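(* Let $M$ be a simply laced spherical Coxeter diagram. The subalgebra of the BMW algebra $\mathrm{B}(M)$ generated by $e_1,\dots,e_n$ together with the identity is isomorphic to the Temperley--Lieb algebra of type $M$ over $R$.
   Context: $M$ has nodes $1,\dots,n$ and is a disjoint union of diagrams $A_k,D_k,E_6,E_7,E_8$. Write $i\sim j$ if $i,j$ are adjacent nodes, and $i\not\sim j$ otherwise (including $i=j$). $R=\mathbb{Z}[\delta,\delta^{-1},l,l^{-1},m]/(m(1-\delta)-(l-l^{-1}))$. The BMW algebra $\mathrm{B}(M)$ is the unital associative $R$-algebra generated by $g_1,\dots,g_n,e_1,\dots,e_n$ with relations: for all $i$: $g_i^2=1-m(g_i-l^{-1}e_i)$, $e_ig_i=l^{-1}e_i$, $g_ie_i=l^{-1}e_i$, $e_i^2=\delta e_i$; for $i\not\sim j$: $g_ig_j=g_jg_i$, $e_ig_j=g_je_i$, $e_ie_j=e_je_i$; for $i\sim j$: $g_ig_jg_i=g_jg_ig_j$, $g_je_ig_j=g_ie_jg_i+m(e_jg_i-e_ig_j+g_ie_j-g_je_i)+m^2(e_j-e_i)$, $g_jg_ie_j=e_ie_j$, $e_ig_jg_i=e_ie_j$, $g_je_ie_j=g_ie_j+m(e_j-e_ie_j)$, $e_ig_je_i=le_i$, $e_je_ig_j=e_jg_i+m(e_j-e_je_i)$, $e_ie_je_i=e_i$. The Temperley--Lieb algebra of type $M$ over $R$ is the unital associative $R$-algebra generated by $e_1,\dots,e_n$ with relations $e_i^2=\delta e_i$ for all $i$; $e_ie_j=e_je_i$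 for $i\not\sim j$; $e_ie_je_i=e_i$ for $i\sim j$. *)

theory Defs
  imports
    "HOL-Algebra.QuotRing"
    "HOL-Algebra.Module"
    "HOL-Library.Poly_Mapping"
    "HOL-Library.Product_Plus"
begin

section \<open>Simply laced spherical Coxeter diagrams\<close>

datatype ade = Type_A nat | Type_D nat | Type_E nat

fun ade_admissible :: "ade \<Rightarrow> bool" where
  "ade_admissible (Type_A k) \<longleftrightarrow> 1 \<le> k"
| "ade_admissible (Type_D k) \<longleftrightarrow> 4 \<le> k"
| "ade_admissible (Type_E k) \<longleftrightarrow> k \<in> {6, 7, 8}"

fun ade_rank :: "ade \<Rightarrow> nat" where
  "ade_rank (Type_A k) = k"
| "ade_rank (Type_D k) = k"
| "ade_rank (Type_E k) = k"

text \<open>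
  The edges of a connected diagram on the nodes \<open>1, \<dots>, ade_rank X\<close> (Bourbaki labelling), each
  listed in one direction only:
  \<open>Type_A k\<close> is the path \<open>1 - 2 - \<dots> - k\<close>;
  \<open>Type_D k\<close> is the path \<open>1 - 2 - \<dots> - (k-1)\<close> with \<open>k\<close> attached to \<open>k-2\<close>;
  \<open>Type_E k\<close> is the path \<open>1 - 3 - 4 - \<dots> - k\<close> with \<open>2\<close> attached to \<open>4\<close>.
  No upper bounds are imposed here; the relation is only used on the nodes.
\<close>

fun ade_edge :: "ade \<Rightarrow> nat \<Rightarrow> nat \<Rightarrow> bool" where
  "ade_edge (Type_A k) i j \<longleftrightarrow> j = i + 1"
| "ade_edge (Type_D k) i j \<longleftrightarrow> (j = i + 1 \<and> j < k) \<or> (i + 2 = k \<and> j = k)"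
| "ade_edge (Type_E k) i j \<longleftrightarrow> (i = 1 \<and> j = 3) \<or> (i = 2 \<and> j = 4) \<or> (3 \<le> i \<and> j = i + 1)"

definition ade_adj :: "ade \<Rightarrow> nat \<Rightarrow> nat \<Rightarrow> bool" where
  "ade_adj X i j \<longleftrightarrow> ade_edge X i j \<or> ade_edge X j i"

text \<open>
  The diagram with node set \<open>{1..n}\<close> and adjacency relation \<open>adj\<close> (whose values outside
  the node set are irrelevant) is isomorphic, via \<open>f\<close>, to the disjoint union of the diagrams
  listed in \<open>Xs\<close>; the node \<open>(c, v)\<close> of the disjoint union is the node \<open>v\<close> of \<open>Xs ! c\<close>.
\<close>

definition simply_laced_spherical :: "nat \<Rightarrow> (nat \<Rightarrow> nat \<Rightarrow> bool) \<Rightarrow> bool" where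
  "simply_laced_spherical n adj \<longleftrightarrow>
    (\<exists>Xs f. (\<forall>X \<in> set Xs. ade_admissible X) \<and>
       bij_betw f (SIGMA c:{..<length Xs}. {1..ade_rank (Xs ! c)}) {1..n} \<and>
       (\<forall>x \<in> (SIGMA c:{..<length Xs}. {1..ade_rank (Xs ! c)}).
        \<forall>y \<in> (SIGMA c:{..<length Xs}. {1..ade_rank (Xs ! c)}).
          adj (f x) (f y) \<longleftrightarrow> fst x = fst y \<and> ade_adj (Xs ! fst x) (snd x) (snd y)))"


section \<open>The coefficient ring\<close>

text \<open>
  \<open>\<int>[\<delta>, \<delta>\<^sup>-\<^sup>1, l, l\<^sup>-\<^sup>1, m]\<close> as a monoid ring: the exponent \<open>(a, b, c)\<close> stands
  for the monomial \<open>\<delta>\<^sup>a l\<^sup>b m\<^sup>c\<close>.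
\<close>

type_synonym laurent = "(int \<times> int \<times> nat) \<Rightarrow>\<^sub>0 int"

definition laurent_monom :: "int \<Rightarrow> int \<Rightarrow> nat \<Rightarrow> laurent" where
  "laurent_monom a b c = Poly_Mapping.single (a, b, c) 1"

definition laurent_rel :: laurent where
  "laurent_rel = laurent_monom 0 0 1 * (1 - laurent_monom 1 0 0)
                 - (laurent_monom 0 1 0 - laurent_monom 0 (-1) 0)"

quotient_type coeff = laurent / "\<lambda>p q. laurent_rel dvd p - q"
proof (rule equivpI)
  show "reflp (\<lambda>p q. laurent_rel dvd p - q)"
    by (simp add: reflp_def)
  show "symp (\<lambda>p q. laurent_rel dvd p - q)"
    by (metis (mono_tags, lifting) sympI dvd_minus_iff minus_diff_eq)
  show "transp (\<lambda>p q. laurent_rel dvd p - q)"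
  proof (rule transpI)
    fix p q r assume "laurent_rel dvd p - q" "laurent_rel dvd q - r"
    then have "laurent_rel dvd (p - q) + (q - r)" by (rule dvd_add)
    then show "laurent_rel dvd p - r" by simp
  qed
qed

text \<open>
  The quotient is not the zero ring: the sum of all coefficients, that is evaluation at
  \<open>\<delta> = l = m = 1\<close>, vanishes on the ideal.
\<close>

abbreviation coeff_sum :: "('a \<Rightarrow>\<^sub>0 int) \<Rightarrow> int" where
  "coeff_sum p \<equiv> Sum_any (Poly_Mapping.lookup p)"

lemma coeff_sum_diff:
  "coeff_sum (p - q) = coeff_sum p - coeff_sum q"
proof -
  have "coeff_sum (p - q + q) = coeff_sum (p - q) + coeff_sum q"
    unfolding lookup_add by (rule Sum_any.distrib) simp_all
  then show ?thesis by simp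
qed

lemma coeff_sum_single: "coeff_sum (Poly_Mapping.single k v) = v"
  by (simp add: lookup_single)

lemma coeff_sum_mult_monom:
  "coeff_sum (p * laurent_monom a b c) = coeff_sum p"
proof (induction p rule: frag_induction[OF subset_UNIV])
  case 1
  show ?case by simp
next
  case (2 x)
  show ?case
    by (simp only: laurent_monom_def mult_single coeff_sum_single mult_1_right)
next
  case (3 p q)
  then show ?case by (simp only: left_diff_distrib coeff_sum_diff)
qed

lemma laurent_rel_not_dvd_1: "\<not> laurent_rel dvd 1"
proof
  assume "laurent_rel dvd 1"
  then obtain p where "1 = laurent_rel * p" ..
  then have "1 = (p * laurent_monom 0 0 1 - p * laurent_monom 1 0 1)
      - (p * laurent_monom 0 1 0 - p * laurent_monom 0 (-1) 0)"
    by (simp add: laurent_rel_def laurent_monom_def mult_single algebra_simps)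
  then have "coeff_sum (1 :: laurent) =
      coeff_sum ((p * laurent_monom 0 0 1 - p * laurent_monom 1 0 1)
        - (p * laurent_monom 0 1 0 - p * laurent_monom 0 (-1) 0))"
    by (rule arg_cong)
  then have "coeff_sum (1 :: laurent) = 0"
    unfolding coeff_sum_diff coeff_sum_mult_monom by simp
  moreover have "coeff_sum (1 :: laurent) = 1"
    using coeff_sum_single[of 0 1] by simp
  ultimately show False by simp
qed

instantiation coeff :: comm_ring_1
begin

lift_definition zero_coeff :: coeff is 0 .
lift_definition one_coeff :: coeff is 1 .

lift_definition plus_coeff :: "coeff \<Rightarrow> coeff \<Rightarrow> coeff" is "(+)"
proof -
  fix p p' q q' :: laurent
  assume "laurent_rel dvd p - p'" "laurent_rel dvd q - q'"
  then have "laurent_rel dvd (p - p') + (q - q')" by (rule dvd_add)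
  then show "laurent_rel dvd p + q - (p' + q')" by (simp add: algebra_simps)
qed

lift_definition uminus_coeff :: "coeff \<Rightarrow> coeff" is uminus
proof -
  fix p p' :: laurent
  assume "laurent_rel dvd p - p'"
  moreover have "- p - - p' = - (p - p')" by simp
  ultimately show "laurent_rel dvd - p - - p'" by (simp only: dvd_minus_iff)
qed

lift_definition minus_coeff :: "coeff \<Rightarrow> coeff \<Rightarrow> coeff" is "(-)"
proof -
  fix p p' q q' :: laurent
  assume "laurent_rel dvd p - p'" "laurent_rel dvd q - q'"
  then have "laurent_rel dvd (p - p') - (q - q')" by (rule dvd_diff)
  then show "laurent_rel dvd p - q - (p' - q')" by (simp add: algebra_simps)
qed

lift_definition times_coeff :: "coeff \<Rightarrow> coeff \<Rightarrow> coeff" is "(*)"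
proof -
  fix p p' q q' :: laurent
  assume "laurent_rel dvd p - p'" "laurent_rel dvd q - q'"
  then have "laurent_rel dvd (p - p') * q + p' * (q - q')" by simp
  then show "laurent_rel dvd p * q - p' * q'" by (simp add: algebra_simps)
qed

instance
proof
  show "(0 :: coeff) \<noteq> 1"
    by transfer (use laurent_rel_not_dvd_1 in simp)
qed (transfer; simp add: algebra_simps)+

end

text \<open>The parameters \<open>\<delta>\<close>, \<open>l\<close>, \<open>l\<^sup>-\<^sup>1\<close> and \<open>m\<close>.\<close>

definition dlt :: coeff where "dlt = abs_coeff (laurent_monom 1 0 0)"
definition ell :: coeff where "ell = abs_coeff (laurent_monom 0 1 0)"
definition ell_inv :: coeff where "ell_inv = abs_coeff (laurent_monom 0 (-1) 0)"
definition emm :: coeff where "emm = abs_coeff (laurent_monom 0 0 1)"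


section \<open>Presentations of associative unital algebras\<close>

text \<open>The free monoid, written additively because this is what monoid rings
  \<open>_ \<Rightarrow>\<^sub>0 _\<close> require of their exponents.\<close>

datatype 'x word = Word (letters: "'x list")

instantiation word :: (type) monoid_add
begin

definition zero_word :: "'a word" where "0 = Word []"
definition plus_word :: "'a word \<Rightarrow> 'a word \<Rightarrow> 'a word" where
  "u + v = Word (letters u @ letters v)"

instance
  by standard (simp_all add: zero_word_def plus_word_def)

end

type_synonym ('r, 'x) ncpoly = "'x word \<Rightarrow>\<^sub>0 'r"

definition gen :: "'x \<Rightarrow> ('r::comm_ring_1, 'x) ncpoly" where
  "gen x = Poly_Mapping.single (Word [x]) 1"

definition scal :: "'r::comm_ring_1 \<Rightarrow> ('r, 'x) ncpoly" where
  "scal r = Poly_Mapping.single 0 r"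

text \<open>The free algebra on the set \<open>X\<close>, over the ring given by the type \<open>'r\<close>.\<close>

definition free_algebra :: "'x set \<Rightarrow> ('r::comm_ring_1, 'x) ncpoly ring" where
  "free_algebra X =
    \<lparr>carrier = {p. \<forall>w \<in> Poly_Mapping.keys p. set (letters w) \<subseteq> X},
     mult = (*), one = 1, zero = 0, add = (+)\<rparr>"

text \<open>
  The algebra generated by \<open>X\<close> subject to the relations \<open>p = q\<close> for \<open>(p, q) \<in> rels\<close>: the
  quotient of the free algebra by the two-sided ideal generated by all \<open>p - q\<close>. A scalar \<open>r\<close>
  acts as multiplication by the class of \<open>r \<cdot> 1\<close>.
\<close>

definition rel_ideal ::
  "'x set \<Rightarrow> (('r::comm_ring_1, 'x) ncpoly \<times> ('r, 'x) ncpoly) set \<Rightarrow> ('r, 'x) ncpoly set" where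
  "rel_ideal X rels = Idl\<^bsub>free_algebra X\<^esub> {p - q | p q. (p, q) \<in> rels}"

definition presented_class ::
  "'x set \<Rightarrow> (('r::comm_ring_1, 'x) ncpoly \<times> ('r, 'x) ncpoly) set
    \<Rightarrow> ('r, 'x) ncpoly \<Rightarrow> ('r, 'x) ncpoly set" where
  "presented_class X rels p = rel_ideal X rels +>\<^bsub>free_algebra X\<^esub> p"

definition presented_algebra ::
  "'x set \<Rightarrow> (('r::comm_ring_1, 'x) ncpoly \<times> ('r, 'x) ncpoly) set
    \<Rightarrow> ('r, ('r, 'x) ncpoly set) module" where
  "presented_algebra X rels =
    (let Q = free_algebra X Quot rel_ideal X rels in
     ring.extend Q (module.fields (\<lambda>r a. presented_class X rels (scal r) \<otimes>\<^bsub>Q\<^esub> a)))"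

text \<open>
  Algebras over the ring given by the type \<open>'r\<close>, not necessarily commutative, are records
  with a scalar multiplication; every element of \<open>'r\<close> is a scalar.
\<close>

inductive_set generated_subalgebra :: "('r, 'a) module \<Rightarrow> 'a set \<Rightarrow> 'a set"
  for B :: "('r, 'a) module" and S :: "'a set" where
  one: "\<one>\<^bsub>B\<^esub> \<in> generated_subalgebra B S"
| incl: "s \<in> S \<Longrightarrow> s \<in> generated_subalgebra B S"
| add: "a \<in> generated_subalgebra B S \<Longrightarrow> b \<in> generated_subalgebra B S
    \<Longrightarrow> a \<oplus>\<^bsub>B\<^esub> b \<in> generated_subalgebra B S"
| mult: "a \<in> generated_subalgebra B S \<Longrightarrow> b \<in> generated_subalgebra B S
    \<Longrightarrow> a \<otimes>\<^bsub>B\<^esub> b \<in> generated_subalgebra B S"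
| smult: "a \<in> generated_subalgebra B S \<Longrightarrow> r \<odot>\<^bsub>B\<^esub> a \<in> generated_subalgebra B S"

definition algebra_isomorphic :: "('r, 'a) module \<Rightarrow> ('r, 'b) module \<Rightarrow> bool" where
  "algebra_isomorphic B C \<longleftrightarrow>
    (\<exists>h \<in> ring_iso B C. \<forall>r. \<forall>a \<in> carrier B. h (r \<odot>\<^bsub>B\<^esub> a) = r \<odot>\<^bsub>C\<^esub> h a)"


section \<open>BMW algebras and Temperley--Lieb algebras\<close>

datatype bmw_gen = GG nat | EE nat

abbreviation g :: "nat \<Rightarrow> (coeff, bmw_gen) ncpoly" where "g i \<equiv> gen (GG i)"
abbreviation e :: "nat \<Rightarrow> (coeff, bmw_gen) ncpoly" where "e i \<equiv> gen (EE i)"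

definition bmw_gens :: "nat \<Rightarrow> bmw_gen set" where
  "bmw_gens n = GG ` {1..n} \<union> EE ` {1..n}"

definition bmw_rels_node ::
  "nat \<Rightarrow> ((coeff, bmw_gen) ncpoly \<times> (coeff, bmw_gen) ncpoly) set" where
  "bmw_rels_node i =
    {(g i ^ 2, 1 - scal emm * (g i - scal ell_inv * e i)),
     (e i * g i, scal ell_inv * e i),
     (g i * e i, scal ell_inv * e i),
     (e i ^ 2, scal dlt * e i)}"

definition bmw_rels_nonadj ::
  "nat \<Rightarrow> nat \<Rightarrow> ((coeff, bmw_gen) ncpoly \<times> (coeff, bmw_gen) ncpoly) set" where
  "bmw_rels_nonadj i j =
    {(g i * g j, g j * g i),
     (e i * g j, g j * e i),
     (e i * e j, e j * e i)}"

definition bmw_rels_adj ::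
  "nat \<Rightarrow> nat \<Rightarrow> ((coeff, bmw_gen) ncpoly \<times> (coeff, bmw_gen) ncpoly) set" where
  "bmw_rels_adj i j =
    {(g i * g j * g i, g j * g i * g j),
     (g j * e i * g j,
        g i * e j * g i + scal emm * (e j * g i - e i * g j + g i * e j - g j * e i)
          + scal emm ^ 2 * (e j - e i)),
     (g j * g i * e j, e i * e j),
     (e i * g j * g i, e i * e j),
     (g j * e i * e j, g i * e j + scal emm * (e j - e i * e j)),
     (e i * g j * e i, scal ell * e i),
     (e j * e i * g j, e j * g i + scal emm * (e j - e j * e i)),
     (e i * e j * e i, e i)}"

definition bmw_rels ::
  "nat \<Rightarrow> (nat \<Rightarrow> nat \<Rightarrow> bool) \<Rightarrow> ((coeff, bmw_gen) ncpoly \<times> (coeff, bmw_gen) ncpoly) set" where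
  "bmw_rels n adj =
    (\<Union>i \<in> {1..n}. bmw_rels_node i) \<union>
    (\<Union>i \<in> {1..n}. \<Union>j \<in> {j \<in> {1..n}. \<not> adj i j}. bmw_rels_nonadj i j) \<union>
    (\<Union>i \<in> {1..n}. \<Union>j \<in> {j \<in> {1..n}. adj i j}. bmw_rels_adj i j)"

definition BMW ::
  "nat \<Rightarrow> (nat \<Rightarrow> nat \<Rightarrow> bool) \<Rightarrow> (coeff, (coeff, bmw_gen) ncpoly set) module" where
  "BMW n adj = presented_algebra (bmw_gens n) (bmw_rels n adj)"

definition BMW_e :: "nat \<Rightarrow> (nat \<Rightarrow> nat \<Rightarrow> bool) \<Rightarrow> nat \<Rightarrow> (coeff, bmw_gen) ncpoly set" where
  "BMW_e n adj i = presented_class (bmw_gens n) (bmw_rels n adj) (e i)"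

text \<open>The subalgebra of the BMW algebra generated by \<open>e\<^sub>1, \<dots>, e\<^sub>n\<close> and the identity.\<close>

definition BMW_e_subalgebra ::
  "nat \<Rightarrow> (nat \<Rightarrow> nat \<Rightarrow> bool) \<Rightarrow> (coeff, (coeff, bmw_gen) ncpoly set) module" where
  "BMW_e_subalgebra n adj =
    (BMW n adj)\<lparr>carrier := generated_subalgebra (BMW n adj) (BMW_e n adj ` {1..n})\<rparr>"

text \<open>The generator \<open>e\<^sub>i\<close> of the Temperley--Lieb algebra is \<open>gen i\<close>.\<close>

definition tl_rels ::
  "nat \<Rightarrow> (nat \<Rightarrow> nat \<Rightarrow> bool) \<Rightarrow> ((coeff, nat) ncpoly \<times> (coeff, nat) ncpoly) set" where
  "tl_rels n adj =
    {(gen i ^ 2, scal dlt * gen i) | i. i \<in> {1..n}} \<union>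
    {(gen i * gen j, gen j * gen i) | i j. i \<in> {1..n} \<and> j \<in> {1..n} \<and> \<not> adj i j} \<union>
    {(gen i * gen j * gen i, gen i) | i j. i \<in> {1..n} \<and> j \<in> {1..n} \<and> adj i j}"

definition Temperley_Lieb ::
  "nat \<Rightarrow> (nat \<Rightarrow> nat \<Rightarrow> bool) \<Rightarrow> (coeff, (coeff, nat) ncpoly set) module" where
  "Temperley_Lieb n adj = presented_algebra {1..n} (tl_rels n adj)"

end

theory Submission
  imports Defs "HOL-Complex_Analysis.Complex_Analysis" "HOL-Library.Function_Algebras"
begin

text \<open>
  The point is that the homomorphism from the Temperley--Lieb algebra to the BMW algebra sending \<open>e\<^sub>i\<close> to
  \<open>e\<^sub>i\<close> is injective. For every even \<open>N > 0\<close> the BMW algebra acts on formal power series in \<open>y\<close> with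
  \<open>l = exp ((2^N - 1) y)\<close>, \<open>m = exp (-y) - exp y\<close> and \<open>\<delta> = 2^N + \<dots>\<close>, by the monodromy of the connection
  \<open>y \<Sum>\<alpha>. (r\<^sub>\<alpha> - e\<^sub>\<alpha>) d log \<alpha> / (2 \<pi> \<i>)\<close> on the complement of the reflection hyperplanes. Here \<open>r\<^sub>\<alpha>\<close> and \<open>e\<^sub>\<alpha>\<close> belong to
  a representation of the Brauer algebra: \<open>e\<^sub>\<alpha>\<close> is the product of \<open>N\<close> commuting copies of a Temperley--Lieb
  generator with \<open>\<delta> = 2\<close>, and \<open>r\<^sub>\<alpha>\<close> is the product of the copies of \<open>1 - e\<^sub>\<alpha>\<close>. Flatness yields the braid
  relations, the local solution near a hyperplane the relations for a single node, and the
  remaining relations for two adjacent nodes follow because they hold for \<open>y = 0\<close>.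

  For \<open>y = 0\<close> reduced words in the \<open>e\<^sub>i\<close> act by linearly independent operators, since each copy acts by
  right multiplication on words. Hence the coefficients of an element of the kernel vanish in all these
  specialisations of the coefficient ring, and only 0 does so.
\<close>

unbundle no vec_syntax
unbundle fps_syntax

section \<open>Consequences of the braid and cubic relations for two strands\<close>

text \<open>A homomorphism onto the subalgebra exists because the relations between the
  \<open>e\<close> are among the defining ones; what has to be excluded is that the \<open>g\<close>
  force further relations. This needs representations of the whole BMW algebra in which words in the
  \<open>e\<close> stay independent. The involutions R have to be made from Temperley--Lieb
  generators: 1 - e is an involution only for \<delta> = 2, so larger values come from several
  copies, and their number is even because each copy contributes a sign to R E = E. On the image of
  E the residue R - E is 1 - 2^N; this gives the exponent of l, and the relation of the coefficient
  ring then dictates \<delta>. One N yields a curve in the two-dimensional space of parameters,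
  hence infinitely many N. That the relations for two adjacent nodes survive the deformation is a
  matter of rigidity. In the corner algebra of one e, two elements differ from their BMW values by
  defects s and v. These satisfy two equations, and eliminating v from the terms of lowest order
  leaves the factor 4 (1 - \<delta>) (\<delta> + 2), which is not 0, in front of s.\<close>

locale alg =
  fixes sm :: "'k::comm_ring_1 \<Rightarrow> 'A::ring_1 \<Rightarrow> 'A" (infixr "\<cdot>" 75)
  assumes sm_add_left: "(a + b) \<cdot> u = a \<cdot> u + b \<cdot> u"
    and sm_add_right: "a \<cdot> (u + v) = a \<cdot> u + a \<cdot> v"
    and sm_sm: "a \<cdot> b \<cdot> u = (a * b) \<cdot> u"
    and sm_one: "1 \<cdot> u = u"
    and sm_mult_left: "(a \<cdot> u) * v = a \<cdot> (u * v)"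
    and sm_mult_right: "u * (a \<cdot> v) = a \<cdot> (u * v)"
begin

lemma sm_zero_left: "0 \<cdot> u = 0" using sm_add_left[of 0 0 u] by simp
lemma sm_zero_right: "a \<cdot> 0 = 0" using sm_add_right[of a 0 0] by simp
lemma sm_minus_left: "(- a) \<cdot> u = - (a \<cdot> u)"
  using sm_add_left[of "- a" a u] by (simp add: sm_zero_left eq_neg_iff_add_eq_0)
lemma sm_minus_right: "a \<cdot> (- u) = - (a \<cdot> u)"
  using sm_add_right[of a "- u" u] by (simp add: sm_zero_right eq_neg_iff_add_eq_0)
lemma sm_diff_left: "(a - b) \<cdot> u = a \<cdot> u - b \<cdot> u"
  using sm_add_left[of a "- b" u] by (simp add: sm_minus_left)
lemma sm_diff_right: "a \<cdot> (u - v) = a \<cdot> u - a \<cdot> v"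
  using sm_add_right[of a u "- v"] by (simp add: sm_minus_right)

lemmas sm_simps = sm_add_left sm_add_right sm_sm sm_one sm_mult_left sm_mult_right
  sm_zero_left sm_zero_right sm_minus_left sm_minus_right sm_diff_left sm_diff_right

lemma sm_sum_right: "a \<cdot> (\<Sum>i\<in>I. u i) = (\<Sum>i\<in>I. a \<cdot> u i)"
  by (induction I rule: infinite_finite_induct) (simp_all add: sm_zero_right sm_add_right)

lemma sm_sum_left: "(\<Sum>i\<in>I. a i) \<cdot> u = (\<Sum>i\<in>I. a i \<cdot> u)"
  by (induction I rule: infinite_finite_induct) (simp_all add: sm_zero_left sm_add_left)

end

text \<open>The relations of each single node and, between the two nodes, only the braid relation:
  this is what the monodromy supplies. \<open>c\<close> plays the role of the inverse of
  \<open>l\<close>. By \<open>torsion\<close> one may divide by \<open>m\<close>, so that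
  \<open>p\<close> is determined by \<open>x\<close> and its inverse.\<close>

locale bmw_pair = alg sm for sm :: "'k::comm_ring_1 \<Rightarrow> 'A::ring_1 \<Rightarrow> 'A" (infixr "\<cdot>" 75) +
  fixes x x' y y' p q :: 'A and c l m D Di :: 'k
  assumes lc: "l * c = 1" and DDi: "D * Di = 1" and mD: "m * D = m - (l - c)"
    and xx': "x * x' = 1" and x'x: "x' * x = 1" and yy': "y * y' = 1" and y'y: "y' * y = 1"
    and braid: "x * y * x = y * x * y"
    and skx: "x - x' = m \<cdot> (p - 1)" and xp: "x * p = c \<cdot> p" and px: "p * x = c \<cdot> p"
    and pp: "p * p = D \<cdot> p"
    and sky: "y - y' = m \<cdot> (q - 1)" and yq: "y * q = c \<cdot> q" and qy: "q * y = c \<cdot> q"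
    and qq: "q * q = D \<cdot> q"
    and torsion: "m \<cdot> u = 0 \<Longrightarrow> u = 0"
begin

lemma cl: "c * l = 1" using lc by (simp add: mult.commute)

lemma x'_eq: "x' = x + m \<cdot> 1 - m \<cdot> p" using skx by (simp add: sm_diff_right algebra_simps)
lemma y'_eq: "y' = y + m \<cdot> 1 - m \<cdot> q" using sky by (simp add: sm_diff_right algebra_simps)

lemma xxK [simp]: "x * (x' * u) = u" "x' * (x * u) = u"
  using xx' x'x by (simp_all add: mult.assoc[symmetric])
lemma yyK [simp]: "y * (y' * u) = u" "y' * (y * u) = u"
  using yy' y'y by (simp_all add: mult.assoc[symmetric])

lemma x'p: "x' * p = l \<cdot> p"
proof -
  have "x' * (x * p) = x' * (c \<cdot> p)" by (simp add: xp)
  then have "p = c \<cdot> (x' * p)" by (simp add: sm_mult_right)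
  then have "l \<cdot> p = l \<cdot> c \<cdot> (x' * p)" by simp
  then show ?thesis by (simp add: sm_sm lc sm_one)
qed

lemma px': "p * x' = l \<cdot> p"
proof -
  have "p * x * x' = (c \<cdot> p) * x'" by (simp add: px)
  then have "p = c \<cdot> (p * x')" by (simp add: sm_mult_left mult.assoc xx')
  then have "l \<cdot> p = l \<cdot> c \<cdot> (p * x')" by simp
  then show ?thesis by (simp add: sm_sm lc sm_one)
qed

lemma conj_xy: "x * y * x' = y' * x * y"
proof -
  have "y' * (x * y * x) * x' = y' * (y * x * y) * x'" by (simp add: braid)
  then show ?thesis by (simp add: mult.assoc xx')
qed

lemma conj_xy': "x * y * x = y * (x * y)" using braid by (simp add: mult.assoc)

text \<open>The braid relation conjugates \<open>x\<close> into \<open>y\<close> by means of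
  \<open>x * y\<close>, hence \<open>x - x'\<close> into \<open>y - y'\<close>. These are multiples
  of \<open>p - 1\<close> and \<open>q - 1\<close> by \<open>m\<close>, which can be
  cancelled.\<close>

lemma xyp: "x * y * p = q * (x * y)"
proof -
  have "m \<cdot> (x * y * p - q * (x * y)) = x * y * (m \<cdot> p) - (m \<cdot> q) * (x * y)"
    by (simp add: sm_simps)
  also have "m \<cdot> p = x - x' + m \<cdot> 1" using skx by (simp add: sm_simps)
  also have "m \<cdot> q = y - y' + m \<cdot> 1" using sky by (simp add: sm_simps)
  also have "x * y * (x - x' + m \<cdot> 1) - (y - y' + m \<cdot> 1) * (x * y) = 0"
    using conj_xy conj_xy' by (simp add: algebra_simps sm_simps)
  finally show ?thesis using torsion by fastforce
qed


lemma xx: "x * x = 1 - m \<cdot> x + (m * c) \<cdot> p"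
proof -
  have "(x - x') * x = m \<cdot> (p * x - x)" by (simp add: skx sm_mult_left left_diff_distrib)
  then have "x * x - 1 = (m * c) \<cdot> p - m \<cdot> x"
    by (simp add: left_diff_distrib x'x px sm_simps)
  then show ?thesis by (simp add: algebra_simps)
qed

text \<open>A Jucys--Murphy element on three strands: \<open>x * N * x\<close> is the full twist
  \<open>(x * y * x)^2\<close>. In the BMW algebra \<open>N * p = p\<close>, and this is one of the
  relations to be recovered.\<close>

definition N where "N = y * (x * (x * y))"
definition Y where "Y = p * y * p"
definition Y' where "Y' = p * y' * p"

lemma br: "x * (y * x) = y * (x * y)" using braid by (simp add: mult.assoc)
lemma br_left: "x * (y * (x * w)) = y * (x * (y * w))"
  using arg_cong[OF br, of "\<lambda>v. v * w"] by (simp add: mult.assoc)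

lemma x_N: "x * N = N * x"
proof -
  have "x * N = y * (x * (y * (x * y)))" by (simp only: N_def br_left)
  also have "\<dots> = N * x" by (simp only: N_def mult.assoc br)
  finally show ?thesis .
qed

lemma x'_N: "x' * N = N * x'"
proof -
  have "x' * (x * N) * x' = x' * (N * x) * x'" by (simp add: x_N)
  then show ?thesis by (simp add: mult.assoc xx')
qed

lemma p_N: "p * N = N * p"
proof -
  have "m \<cdot> (p * N - N * p) = (m \<cdot> (p - 1)) * N - N * (m \<cdot> (p - 1))"
    by (simp add: sm_simps algebra_simps)
  also have "\<dots> = 0" by (simp add: skx[symmetric] algebra_simps x_N x'_N)
  finally show ?thesis using torsion by fastforce
qed

lemma y_z: "y * (x * N * x) = (x * N * x) * y"
proof -
  have z: "x * N * x = (x * (y * x)) * (x * (y * x))" by (simp add: N_def mult.assoc)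
  have 1: "y * (x * (y * x)) = (x * (y * x)) * x" by (simp only: mult.assoc br_left br)
  have 2: "x * (x * (y * x)) = (x * (y * x)) * y" by (simp only: br) (simp only: mult.assoc br_left)
  show ?thesis unfolding z by (metis 1 2 mult.assoc)
qed

lemma z_p: "x * N * x * p = (c * c) \<cdot> (N * p)" "p * (x * N * x) = (c * c) \<cdot> (N * p)"
proof -
  have "x * N * x * p = N * x * (c \<cdot> p)" by (simp add: x_N xp mult.assoc)
  also have "\<dots> = (c * c) \<cdot> (N * p)" by (simp add: sm_simps mult.assoc xp)
  finally show "x * N * x * p = (c * c) \<cdot> (N * p)" .
  have "p * (x * N * x) = c \<cdot> (p * N * x)" by (simp add: px sm_simps mult.assoc[symmetric])
  also have "\<dots> = c \<cdot> (N * (p * x))" by (simp add: p_N mult.assoc)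
  finally show "p * (x * N * x) = (c * c) \<cdot> (N * p)" by (simp add: px sm_simps mult.assoc)
qed

lemma Np_z: "N * p = (l * l) \<cdot> (x * N * x * p)" "N * p = (l * l) \<cdot> (p * (x * N * x))"
proof -
  have "(l * l) * (c * c) = 1" using lc by (metis mult.assoc mult.left_commute mult_1)
  then show "N * p = (l * l) \<cdot> (x * N * x * p)" "N * p = (l * l) \<cdot> (p * (x * N * x))"
    by (simp_all add: z_p sm_simps)
qed

text \<open>The full twist \<open>x * N * x\<close> commutes with \<open>y\<close> as well, and next
  to \<open>p\<close> it differs from \<open>N\<close> only by the scalar
  \<open>c * c\<close>.\<close>

lemma N_Y: "N * Y = Y * N"
proof -
  have "N * Y = (N * p) * y * p" by (simp add: Y_def mult.assoc)
  also have "\<dots> = (l * l) \<cdot> (p * ((x * N * x) * y) * p)" by (simp add: Np_z(2) sm_simps mult.assoc)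
  also have "\<dots> = p * y * ((l * l) \<cdot> (x * N * x * p))"
    by (subst y_z[symmetric]) (simp only: sm_mult_right mult.assoc)
  also have "\<dots> = p * y * (N * p)" by (simp add: Np_z(1)[symmetric])
  also have "\<dots> = Y * N" by (simp add: Y_def p_N mult.assoc)
  finally show ?thesis .
qed

lemma pqp: "m \<cdot> (p * q * p) = (m * D) \<cdot> p + Y - Y'"
proof -
  have "m \<cdot> (p * q * p) = p * (m \<cdot> (q - 1)) * p + m \<cdot> (p * p)"
    by (simp add: sm_simps algebra_simps)
  also have "\<dots> = p * y * p - p * y' * p + m \<cdot> D \<cdot> p"
    by (simp only: sky[symmetric] pp right_diff_distrib left_diff_distrib)
  finally show ?thesis by (simp add: sm_sm Y_def Y'_def)
qed

lemma N_p: "N * p = y * y * p - (m * c) \<cdot> (x * y * p) + (m * c) \<cdot> (y * p * y * p)"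
proof -
  have "N * p = y * (x * x) * y * p" by (simp add: N_def mult.assoc)
  also have "\<dots> = y * y * p - m \<cdot> (y * x * y * p) + (m * c) \<cdot> (y * p * y * p)"
    by (simp add: xx sm_simps algebra_simps)
  also have "y * x * y * p = c \<cdot> (x * y * p)"
    by (simp add: braid[symmetric]) (simp add: mult.assoc xp sm_simps)
  finally show ?thesis by (simp add: sm_simps)
qed

text \<open>The comparison takes place in the corner algebra of the idempotent \<open>u\<close>.
  There \<open>n\<close> is the compression of \<open>N\<close>, and \<open>t\<close>,
  \<open>t'\<close> are multiples of the compressions of \<open>y\<close> and \<open>y'\<close>. In
  the BMW algebra their values are \<open>u\<close> for \<open>n\<close>, \<open>l \<cdot> u\<close>
  for \<open>t\<close> and \<open>c \<cdot> u\<close> for \<open>t'\<close>.\<close>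

definition u where "u = Di \<cdot> p"
definition t where "t = Di \<cdot> Y"
definition t' where "t' = Di \<cdot> Y'"
definition n where "n = Di \<cdot> (N * p)"

lemma DiD: "Di * D = 1" using DDi by (simp add: mult.commute)

lemma DDiK: "D * (Di * a) = a" "Di * (D * a) = a"
  using DDi DiD by (simp_all add: mult.assoc[symmetric])

lemma pY: "p * Y = D \<cdot> Y" "Y * p = D \<cdot> Y" "p * Y' = D \<cdot> Y'" "Y' * p = D \<cdot> Y'"
  by (simp_all add: Y_def Y'_def mult.assoc[symmetric] pp sm_simps)
   (simp_all add: mult.assoc pp sm_simps)

lemma u_simps: "u * u = u" "u * t = t" "t * u = t" "u * t' = t'" "t' * u = t'" "u * n = n" "n * u = n"
proof -
  show "u * u = u" by (simp add: u_def sm_simps pp DDi DiD DDiK mult.assoc)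
  show "u * t = t" "t * u = t" "u * t' = t'" "t' * u = t'"
    by (simp_all add: u_def t_def t'_def sm_simps pY DDi DiD DDiK mult.assoc)
  show "n * u = n" by (simp add: n_def u_def sm_simps mult.assoc pp DDi DiD DDiK)
  have "p * (N * p) = D \<cdot> (N * p)"
    using p_N by (simp add: mult.assoc[symmetric] pp sm_simps) (simp add: mult.assoc pp sm_simps)
  then show "u * n = n" by (simp add: n_def u_def sm_simps DDi DiD DDiK mult.assoc)
qed

lemma t_n: "t * n = n * t"
proof -
  have "Y * (N * p) = N * p * Y"
    using N_Y by (simp add: mult.assoc[symmetric]) (metis N_Y mult.assoc pY)
  then show ?thesis by (simp add: t_def n_def sm_simps mult.commute)
qed

text \<open>Expanding \<open>x * x\<close> inside \<open>N\<close>, and then \<open>y * y\<close>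
  between two factors \<open>p\<close>, by the quadratic relation leaves only \<open>p\<close>,
  \<open>Y\<close>, \<open>Y * Y\<close> and \<open>p * q * p\<close>; the last is expressed through
  \<open>Y\<close> and \<open>Y'\<close> by \<open>pqp\<close>.\<close>

lemma E1: "D \<cdot> n = (D * (1 + c * m)) \<cdot> u + (c - m - m * c * c) \<cdot> t - c \<cdot> t' + (m * c) \<cdot> (t * t)"
proof -
  have a: "p * (N * p) = D \<cdot> (N * p)"
    using p_N by (simp add: mult.assoc[symmetric] pp sm_simps) (simp add: mult.assoc pp sm_simps)
  have yy: "y * y = 1 - m \<cdot> y + (m * c) \<cdot> q"
  proof -
    have "(y - y') * y = m \<cdot> (q * y - y)" by (simp add: sky sm_mult_left left_diff_distrib)
    then have "y * y - 1 = (m * c) \<cdot> q - m \<cdot> y"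
      by (simp add: left_diff_distrib y'y qy sm_simps)
    then show ?thesis by (simp add: algebra_simps)
  qed
  have "D \<cdot> (N * p) = p * (y * y) * p - (m * c) \<cdot> (p * x * y * p) + (m * c) \<cdot> (p * y * p * y * p)"
    by (subst a[symmetric], subst N_p) (simp add: algebra_simps sm_simps)
  also have "p * x * y * p = c \<cdot> Y" by (simp add: px Y_def sm_simps)
  also have "p * y * p * y * p = D \<cdot> (t * t)"
  proof -
    have "p * (p * w) = D \<cdot> (p * w)" for w
      by (simp add: mult.assoc[symmetric] pp sm_simps)
    then have "Y * Y = D \<cdot> (p * y * p * y * p)"
      by (simp add: Y_def mult.assoc sm_simps)
    then show ?thesis by (simp add: t_def sm_simps DDi DiD DDiK mult.assoc)
  qed
  also have "p * (y * y) * p = D \<cdot> p - m \<cdot> Y + c \<cdot> m \<cdot> (p * q * p)"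
    by (simp add: yy sm_simps algebra_simps pp Y_def)
  finally have "Di \<cdot> D \<cdot> (N * p) = Di \<cdot> (D \<cdot> p - m \<cdot> Y + c \<cdot> ((m * D) \<cdot> p + Y - Y')
      - (m * c) \<cdot> c \<cdot> Y + (m * c) \<cdot> D \<cdot> (t * t))"
    by (simp add: pqp)
  moreover have "Di \<cdot> D \<cdot> (N * p) = D \<cdot> n" by (simp add: n_def sm_simps mult.commute)
  moreover have "Di \<cdot> (D \<cdot> p - m \<cdot> Y + c \<cdot> ((m * D) \<cdot> p + Y - Y')
      - (m * c) \<cdot> c \<cdot> Y + (m * c) \<cdot> D \<cdot> (t * t)) =
     (D * (1 + c * m)) \<cdot> u + (c - m - m * c * c) \<cdot> t - c \<cdot> t' + (m * c) \<cdot> (t * t)"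
  proof -
    have 2: "Y = D \<cdot> t" "Y' = D \<cdot> t'" "p = D \<cdot> u"
      by (simp_all add: t_def t'_def u_def sm_simps DDi)
    let ?X = "D \<cdot> u - m \<cdot> t + c \<cdot> ((m * D) \<cdot> u + t - t') - (m * c) \<cdot> c \<cdot> t + (m * c) \<cdot> (t * t)"
    have "D \<cdot> (D \<cdot> u) - m \<cdot> (D \<cdot> t) + c \<cdot> ((m * D) \<cdot> (D \<cdot> u) + D \<cdot> t - D \<cdot> t')
        - (m * c) \<cdot> c \<cdot> (D \<cdot> t) + (m * c) \<cdot> D \<cdot> (t * t) = D \<cdot> ?X"
      by (simp add: sm_add_right sm_diff_right sm_sm mult_ac)
    then have "D \<cdot> p - m \<cdot> Y + c \<cdot> ((m * D) \<cdot> p + Y - Y') - (m * c) \<cdot> c \<cdot> Y + (m * c) \<cdot> D \<cdot> (t * t) = D \<cdot> ?X"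
      unfolding 2[symmetric] .
    moreover have "Di \<cdot> D \<cdot> ?X = ?X" by (simp only: sm_sm DiD sm_one)
    moreover have "?X = (D * (1 + c * m)) \<cdot> u + (c - m - m * c * c) \<cdot> t - c \<cdot> t' + (m * c) \<cdot> (t * t)"
      by (simp add: sm_simps distrib_left mult_ac)
    ultimately show ?thesis by simp
  qed
  ultimately show ?thesis by simp
qed

text \<open>The factor \<open>y'\<close> cancels the first letter of \<open>N\<close>, and
  \<open>x * x\<close> next to \<open>p\<close> is the scalar \<open>c * c\<close>.\<close>

lemma R1: "t' * n = (c * c) \<cdot> t"
proof -
  have "p * y' * (N * p) = p * (x * x) * y * p" by (simp add: N_def mult.assoc)
  also have "\<dots> = (c * c) \<cdot> Y"
    by (simp add: mult.assoc[symmetric] px sm_simps Y_def)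
  finally have *: "p * y' * (N * p) = (c * c) \<cdot> Y" .
  have "Y' * (N * p) = p * y' * (p * N * p)" by (simp add: Y'_def mult.assoc)
  also have "p * N * p = D \<cdot> (N * p)" by (simp add: p_N) (simp add: mult.assoc pp sm_simps)
  finally have "Y' * (N * p) = D \<cdot> (c * c) \<cdot> Y" using * by (simp add: sm_simps)
  then have "t' * n = (Di * (Di * (D * (c * c)))) \<cdot> Y" by (simp add: t'_def n_def sm_simps)
  then show ?thesis by (simp add: t_def sm_simps DDiK mult.commute)
qed

text \<open>This is \<open>E1\<close> multiplied by \<open>n\<close>: \<open>R1\<close> trades
  \<open>t' * n\<close> for a multiple of \<open>t\<close>, so that only the commuting elements
  \<open>t\<close> and \<open>n\<close> remain.\<close>

lemma F1: "(m * c) \<cdot> (t * t * n) + (c - m - m * c * c) \<cdot> (t * n) - (c * c * c) \<cdot> t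
   + (D * (1 + c * m)) \<cdot> n - D \<cdot> (n * n) = 0"
proof -
  have "(D \<cdot> n) * n = ((D * (1 + c * m)) \<cdot> u + (c - m - m * c * c) \<cdot> t - c \<cdot> t' + (m * c) \<cdot> (t * t)) * n"
    by (simp add: E1)
  also have "\<dots> = (D * (1 + c * m)) \<cdot> n + (c - m - m * c * c) \<cdot> (t * n) - (c * c * c) \<cdot> t + (m * c) \<cdot> (t * t * n)"
    by (simp add: distrib_right left_diff_distrib sm_mult_left u_simps R1 sm_sm mult.assoc)
  finally show ?thesis by (simp add: sm_mult_left)
qed


lemma swapped: "bmw_pair sm y y' x x' q p c l m D Di"
  by unfold_locales (use lc DDi mD xx' x'x yy' y'y braid skx xp px pp sky yq qy qq torsion in auto)

end

context bmw_pair
begin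

text \<open>The mirror image of a braid: positive and negative crossings change places. Applied to
  the mirror image, \<open>E1\<close> becomes a second, independent equation, which is the source of
  \<open>F2\<close>.\<close>

lemma inverted: "bmw_pair sm x' x y' y p q l c (- m) D Di"
proof -
  interpret sw: bmw_pair sm y y' x x' q p c l m D Di by (rule swapped)
  have "x' * y' * x' = y' * x' * y'"
  proof -
    have "(x' * y' * x') * (x * y * x) = 1" "(y' * x' * y') * (y * x * y) = 1"
      "(x * y * x) * (x' * y' * x') = 1"
      by (simp_all add: mult.assoc xx' x'x y'y)
    then show ?thesis by (metis braid mult.assoc mult_1 mult_1_right)
  qed
  then show ?thesis
    by unfold_locales (use lc DDi mD xx' x'x yy' y'y skx x'p px' pp sky qq torsion sw.x'p sw.px' in
      \<open>auto simp: sm_minus_left mult.commute algebra_simps\<close>)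
qed

interpretation inv: bmw_pair sm x' x y' y p q l c "- m" D Di by (rule inverted)

text \<open>The mirror image of \<open>E1\<close>, multiplied by \<open>n * n\<close>. The mirror
  image of \<open>n\<close> is inverse to \<open>n\<close> in the corner, and two uses of
  \<open>R1\<close> turn \<open>t' * t'\<close> into a multiple of \<open>t * t\<close>.\<close>

lemma F2: "(c + m * c * c + m) \<cdot> (t * n) - l \<cdot> (t * n * n) - (m * c * c * c) \<cdot> (t * t)
   + (D * (1 - l * m)) \<cdot> (n * n) - D \<cdot> n = 0"
proof -
  have inv_t: "inv.t = t'" "inv.t' = t"
    by (simp_all add: inv.t_def inv.t'_def t_def t'_def inv.Y_def inv.Y'_def Y_def Y'_def)
  have E: "D \<cdot> inv.n = (D * (1 - l * m)) \<cdot> u + (l + m + m * l * l) \<cdot> t' - l \<cdot> t - (m * l) \<cdot> (t' * t')"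
    using inv.E1 unfolding inv_t by (simp add: sm_simps algebra_simps)
  have "(D \<cdot> inv.n) * n * n = ((D * (1 - l * m)) \<cdot> u + (l + m + m * l * l) \<cdot> t' - l \<cdot> t - (m * l) \<cdot> (t' * t')) * n * n"
    by (simp only: E)
  moreover have "inv.n * n = u"
  proof -
    have NN: "inv.N * N = 1" by (simp add: N_def inv.N_def mult.assoc x'x y'y)
    have "inv.N * p * (N * p) = inv.N * N * p * p" by (metis p_N mult.assoc)
    then show ?thesis by (simp add: n_def inv.n_def u_def sm_simps NN pp DiD DDiK mult.assoc)
  qed
  moreover have "t' * t' * n * n = (c * c * c * c) \<cdot> (t * t)"
  proof -
    have "t' * t' * n * n = t' * ((c * c) \<cdot> (t * n))" by (simp add: R1 mult.assoc[symmetric] sm_simps) (simp add: mult.assoc R1 sm_simps)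
    also have "\<dots> = (c * c) \<cdot> (t' * n * t)" by (simp add: sm_simps t_n mult.assoc)
    finally show ?thesis by (simp add: R1 sm_simps mult.assoc)
  qed
  moreover have "t' * n * n = (c * c) \<cdot> (t * n)" by (simp add: R1 sm_simps)
  ultimately have "D \<cdot> n = (D * (1 - l * m)) \<cdot> (n * n) + ((l + m + m * l * l) * (c * c)) \<cdot> (t * n)
     - l \<cdot> (t * n * n) - ((m * l) * (c * c * c * c)) \<cdot> (t * t)"
    by (simp add: distrib_right left_diff_distrib sm_mult_left u_simps sm_sm)
  moreover have "(l + m + m * l * l) * (c * c) = c + m * c * c + m"
    using lc by (simp add: algebra_simps) (metis lc mult.assoc mult.left_commute mult_1 mult_1_right)
  moreover have "(m * l) * (c * c * c * c) = m * c * c * c"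
    using lc by (metis mult.assoc mult_1_right)
  ultimately show ?thesis by simp
qed


text \<open>The defects of \<open>t\<close> and \<open>n\<close> from the values that they have in
  the BMW algebra.\<close>

definition s where "s = t - l \<cdot> u"
definition v where "v = n - u"

lemma t_v: "v * t = t * v"
  by (simp add: v_def left_diff_distrib right_diff_distrib u_simps t_n)

lemma u_s_v: "u * s = s" "s * u = s" "u * v = v" "v * u = v"
  by (simp_all add: s_def v_def left_diff_distrib right_diff_distrib u_simps sm_simps)

lemma mDcc: "m * D * c * c = m * c * c - c + c * c * c"
proof -
  have "m * D * c * c = m * c * c - (l * c) * c + c * c * c"
    unfolding mD by (simp add: algebra_simps)
  then show ?thesis by (simp add: lc)
qed

text \<open>Expansion of \<open>F1\<close> at the BMW values. For n = u the equation is quadratic in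
  \<open>t\<close> with the roots \<open>l\<close> and \<open>D * c\<close>, which explains the
  first summand; everything else is divisible by \<open>v\<close>.\<close>

lemma G1: "(m * c) \<cdot> (s * (t - (D * c) \<cdot> u))
   + v * ((m * c) \<cdot> (t * t) + (c - m - m * c * c) \<cdot> t + (D * (1 + c * m)) \<cdot> u - D \<cdot> u - D \<cdot> u - D \<cdot> v) = 0"
proof -
  have n: "n = v + u" by (simp add: v_def)
  have uu: "u * u = u" "t * u = t" "u * t = t" "v * u = v" "u * v = v" "v * t = t * v"
    "u * (t * w) = t * w" "u * (v * w) = v * w" "v * (t * w) = t * (v * w)" for w
    using u_simps u_s_v t_v by (simp_all add: mult.assoc[symmetric])
  have r: "(m * c) \<cdot> (l \<cdot> t) = m \<cdot> t" "(m * c) \<cdot> l \<cdot> (D * c) \<cdot> u = (m * D * c) \<cdot> u"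
  proof -
    have k: "c * (l * w) = w" for w using cl by (simp add: mult.assoc[symmetric])
    show "(m * c) \<cdot> (l \<cdot> t) = m \<cdot> t" "(m * c) \<cdot> l \<cdot> (D * c) \<cdot> u = (m * D * c) \<cdot> u"
      by (simp_all add: sm_sm mult.assoc k cl)
  qed
  have "(m * c) \<cdot> (s * (t - (D * c) \<cdot> u))
      = (m * c) \<cdot> (t * t) - (m * c) \<cdot> l \<cdot> t - (m * D * c * c) \<cdot> t + (m * c) \<cdot> l \<cdot> (D * c) \<cdot> u"
    by (simp add: s_def left_diff_distrib right_diff_distrib sm_simps uu mult.commute mult.left_commute)
  also have "\<dots> = (m * c) \<cdot> (t * t) - m \<cdot> t - (m * c * c - c + c * c * c) \<cdot> t + (m * D * c) \<cdot> u"
    by (simp only: r mDcc)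
  finally have 1: "(m * c) \<cdot> (s * (t - (D * c) \<cdot> u)) = \<dots>" .
  have "(m * c) \<cdot> (t * t) - m \<cdot> t - (m * c * c - c + c * c * c) \<cdot> t + (m * D * c) \<cdot> u
    + v * ((m * c) \<cdot> (t * t) + (c - m - m * c * c) \<cdot> t + (D * (1 + c * m)) \<cdot> u - D \<cdot> u - D \<cdot> u - D \<cdot> v)
    = (m * c) \<cdot> (t * t * (v + u)) + (c - m - m * c * c) \<cdot> (t * (v + u)) - (c * c * c) \<cdot> t
     + (D * (1 + c * m)) \<cdot> (v + u) - D \<cdot> ((v + u) * (v + u))"
    by (simp add: distrib_left distrib_right right_diff_distrib sm_simps uu mult.assoc algebra_simps)
  then show ?thesis unfolding 1 using F1 unfolding n by simp
qed

definition a3 where "a3 = - l"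
definition a2 where "a2 = c + m * c * c + m"
definition a1 where "a1 = c * c * (c - m - m * c * c)"
definition a0 where "a0 = - (c * c * c * c * c)"
definition b3 where "b3 = D * (1 - l * m)"
definition b2 where "b2 = - D * (1 + c * c)"
definition b1 where "b1 = D * c * c * (1 + c * m)"

text \<open>Adding \<open>c * c\<close> times \<open>F1\<close> to \<open>n\<close> times
  \<open>F2\<close> cancels the terms with \<open>t * t\<close>. The result is linear in
  \<open>t\<close>; the \<open>a\<close> and \<open>b\<close> are the coefficients of the two cubic
  polynomials in \<open>n\<close> that occur in it.\<close>

lemma F3: "t * (a3 \<cdot> (n * n * n) + a2 \<cdot> (n * n) + a1 \<cdot> n + a0 \<cdot> u)
   + (b3 \<cdot> (n * n * n) + b2 \<cdot> (n * n) + b1 \<cdot> n) = 0"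
proof -
  have tn: "n * t = t * n" "n * (t * w) = t * (n * w)" for w
    using t_n by (simp_all add: mult.assoc[symmetric])
  have "0 = (c * c) \<cdot> ((m * c) \<cdot> (t * t * n) + (c - m - m * c * c) \<cdot> (t * n) - (c * c * c) \<cdot> t
   + (D * (1 + c * m)) \<cdot> n - D \<cdot> (n * n)) + n * ((c + m * c * c + m) \<cdot> (t * n) - l \<cdot> (t * n * n) - (m * c * c * c) \<cdot> (t * t)
   + (D * (1 - l * m)) \<cdot> (n * n) - D \<cdot> n)"
    by (simp only: F1 F2 sm_zero_right) simp
  then show ?thesis
    by (simp add: a3_def a2_def a1_def a0_def b3_def b2_def b1_def sm_simps u_simps
        distrib_left right_diff_distrib tn mult.assoc algebra_simps)
qed

text \<open>The BMW values solve \<open>F3\<close>; therefore its expansion at them has no constant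
  term.\<close>

lemma root: "l * (a3 + a2 + a1 + a0) + (b3 + b2 + b1) = 0"
proof -
  have 1: "m * D = m - l + c" using mD by simp
  have k: "c * (l * w) = w" "l * (c * w) = w" for w
    using cl lc by (simp_all add: mult.assoc[symmetric])
  have 2: "l * (a3 + a2 + a1 + a0) = - l * l + 1 + m * c + m * l + c * c - c * m - m * c * c * c - c * c * c * c"
    by (simp add: a3_def a2_def a1_def a0_def algebra_simps cl lc k)
  have 3: "b3 + b2 + b1 = - (m * D) * l + c * c * c * (m * D)"
    by (simp add: b3_def b2_def b1_def algebra_simps)
  show ?thesis unfolding 2 3 1 by (simp add: algebra_simps cl lc k)
qed

lemma A1: "a3 + a2 + a1 + a0 = (1 - c * c * c * c) * (m * D)"
proof -
  have 1: "m * D = m - l + c" using mD by simp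
  have k: "c * (l * w) = w" "l * (c * w) = w" for w
    using cl lc by (simp_all add: mult.assoc[symmetric])
  show ?thesis unfolding 1
    by (simp add: a3_def a2_def a1_def a0_def algebra_simps cl lc k)
qed

text \<open>After substituting \<open>t = s + l \<cdot> u\<close> in \<open>F3\<close>, the cubic
  that multiplies \<open>s\<close> is split into its value \<open>A1\<close> at n = u and a multiple
  of \<open>v\<close>; the remaining cubic vanishes at n = u by \<open>root\<close>, so
  \<open>v\<close> splits off there too.\<close>

lemma G3: "s * (((1 - c * c * c * c) * (m * D)) \<cdot> u
       + v * (a3 \<cdot> (n * n + n + u) + a2 \<cdot> (n + u) + a1 \<cdot> u))
   + v * ((l * a3 + b3) \<cdot> (n * n + n + u) + (l * a2 + b2) \<cdot> (n + u) + (l * a1 + b1) \<cdot> u) = 0"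
proof -
  let ?A = "a3 \<cdot> (n * n * n) + a2 \<cdot> (n * n) + a1 \<cdot> n + a0 \<cdot> u"
  have un: "u * (n * w) = n * w" for w using u_simps by (simp add: mult.assoc[symmetric])
  have A: "((1 - c * c * c * c) * (m * D)) \<cdot> u
       + v * (a3 \<cdot> (n * n + n + u) + a2 \<cdot> (n + u) + a1 \<cdot> u) = ?A"
    unfolding A1[symmetric]
    by (simp add: v_def left_diff_distrib distrib_left sm_simps u_simps un mult.assoc algebra_simps)
  have C: "v * ((l * a3 + b3) \<cdot> (n * n + n + u) + (l * a2 + b2) \<cdot> (n + u) + (l * a1 + b1) \<cdot> u)
      = l \<cdot> ?A + (b3 \<cdot> (n * n * n) + b2 \<cdot> (n * n) + b1 \<cdot> n)"
  proof -
    have "l * a0 = (l * (a3 + a2 + a1 + a0) + (b3 + b2 + b1)) - (l * a3 + b3) - (l * a2 + b2) - (l * a1 + b1)"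
      by (simp add: distrib_left)
    then have e: "l * a0 = - (l * a3 + b3) - (l * a2 + b2) - (l * a1 + b1)"
      unfolding root by simp
    show ?thesis
      by (simp add: v_def left_diff_distrib distrib_left sm_simps u_simps e un mult.assoc
        algebra_simps)
  qed
  have "s * ?A = t * ?A - l \<cdot> ?A"
    by (simp add: s_def left_diff_distrib sm_simps distrib_left u_simps mult.assoc[symmetric])
      (simp add: mult.commute[of l])
  then show ?thesis unfolding A C using F3 by simp
qed


text \<open>The same equation sorted by degree in \<open>s\<close> and \<open>v\<close>, so that
  orders in the deformation parameter can be read off from it.\<close>

lemma G3': "((1 - c * c * c * c) * (m * D)) \<cdot> (s * u)
    + (3 * a3 + 2 * a2 + a1) \<cdot> (s * v) + s * v * v * (a3 \<cdot> (v + u + u + u) + a2 \<cdot> u)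
    + (3 * (l * a3 + b3) + 2 * (l * a2 + b2) + (l * a1 + b1)) \<cdot> v
    + v * v * ((l * a3 + b3) \<cdot> (v + u + u + u) + (l * a2 + b2) \<cdot> u) = 0"
proof -
  have n: "n = v + u" by (simp add: v_def)
  have uu: "u * u = u" "v * u = v" "u * v = v" "u * (v * w) = v * w" for w
    using u_simps u_s_v by (simp_all add: mult.assoc[symmetric])
  have k: "v * (z3 \<cdot> (n * n + n + u) + z2 \<cdot> (n + u) + z1 \<cdot> u)
     = (3 * z3 + 2 * z2 + z1) \<cdot> v + v * v * (z3 \<cdot> (v + u + u + u) + z2 \<cdot> u)" for z1 z2 z3
  proof -
    have "(3 * z3 + 2 * z2 + z1) \<cdot> v = z3 \<cdot> v + z3 \<cdot> v + z3 \<cdot> v + z2 \<cdot> v + z2 \<cdot> v + z1 \<cdot> v"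
      by (simp add: sm_add_left[symmetric] ac_simps)
    then show ?thesis
      unfolding n by (simp add: sm_add_right sm_mult_right distrib_left distrib_right uu mult.assoc algebra_simps)
  qed
  show ?thesis
    using G3 unfolding k by (simp add: distrib_left sm_simps mult.assoc add.assoc)
qed

text \<open>By the first assumption \<open>x * y * p\<close> and \<open>x' * y' * p\<close>
  coincide; comparing the two through the skein relation produces the relations between
  \<open>p\<close> and \<open>q\<close>. The conclusions on \<open>q * x * q\<close>, on
  \<open>q * x' * q\<close> and on \<open>N\<close> put the exchanged pair into the same situation,
  so that the lemma can be applied to it in turn.\<close>

lemma half_relations:
  assumes Np: "N * p = p" and Yp: "p * y * p = l \<cdot> p" and Yp': "p * y' * p = c \<cdot> p"
  shows "x * y * p = q * p" "q * x * y = q * p" "p * q * p = p" "q * x * q = l \<cdot> q" "q * x' * q = c \<cdot> q"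
    "x * q * p = y * p + m \<cdot> (p - q * p)" "q * p * y = q * x + m \<cdot> (q - q * p)"
    "bmw_pair.N y x * q = q"
proof -
  interpret sw: bmw_pair sm y y' x x' q p c l m D Di by (rule swapped)
  have Q: "q * x * y = x * y * p" using xyp by (simp add: mult.assoc)
  have F': "x * y * p = x' * y' * p"
  proof -
    have "x' * (y' * (y * (x * (x * y)) * p)) = x' * (y' * p)" using Np by (simp add: N_def)
    then show ?thesis by (simp add: mult.assoc)
  qed
  have Q': "q * x' * y' = x' * y' * p" using inv.xyp by (simp add: mult.assoc)
  have pqp1: "p * q * p = p"
  proof -
    have "m \<cdot> (p * q * p) = m \<cdot> p"
      using pqp unfolding Y_def Y'_def Yp Yp' mD by (simp add: sm_simps)
    then have "m \<cdot> (p * q * p - p) = 0" by (simp add: sm_simps)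
    then show ?thesis using torsion by fastforce
  qed
  have q_conj: "q = x * y * p * y' * x'" unfolding xyp by (simp add: mult.assoc xx')
  have conj: "y' * x' * x * x * y = x * y * x'" by (simp add: conj_xy) (simp add: mult.assoc)
  have qxq: "q * x * q = l \<cdot> q"
  proof -
    have "q * x * q = x * y * p * (y' * x' * x * x * y) * p * y' * x'"
      unfolding q_conj by (simp only: mult.assoc)
    also have "\<dots> = x * y * (p * x) * y * (x' * p) * y' * x'" by (simp only: conj) (simp only: mult.assoc)
    also have "\<dots> = x * y * (p * y * p) * y' * x'" by (simp add: px x'p sm_simps lc cl mult.assoc)
    also have "\<dots> = l \<cdot> q" unfolding Yp q_conj by (simp add: sm_simps mult.assoc)
    finally show ?thesis .
  qed
  have qx'q: "q * x' * q = c \<cdot> q"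
  proof -
    have c2: "y' * x' * x' * x * y = x * y' * x'"
    proof -
      have "y' * x' * y = x * (x' * (y' * x')) * y" by (simp add: mult.assoc)
      also have "x' * (y' * x') = y' * (x' * y')" by (rule inv.br)
      finally show ?thesis by (simp add: mult.assoc x'x y'y)
    qed
    have "q * x' * q = x * y * p * (y' * x' * x' * x * y) * p * y' * x'"
      unfolding q_conj by (simp only: mult.assoc)
    also have "\<dots> = x * y * (p * x) * y' * (x' * p) * y' * x'" by (simp only: c2) (simp only: mult.assoc)
    also have "\<dots> = x * y * (p * y' * p) * y' * x'" by (simp add: px x'p sm_simps lc cl mult.assoc)
    also have "\<dots> = c \<cdot> q" unfolding Yp' q_conj by (simp add: sm_simps mult.assoc)
    finally show ?thesis .
  qed
  have qpq: "q * p * q = q"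
  proof -
    have "m \<cdot> (q * p * q) = m \<cdot> q"
      using sw.pqp unfolding sw.Y_def sw.Y'_def qxq qx'q mD by (simp add: sm_simps)
    then have "m \<cdot> (q * p * q - q) = 0" by (simp add: sm_simps)
    then show ?thesis using torsion by fastforce
  qed
  have qpy: "q * p * y = q * x'"
  proof -
    have "q * x * y = q * x' * (y + m \<cdot> 1 - m \<cdot> q)"
      using Q Q' F' y'_eq by simp
    then have "q * (x - x') * y = m \<cdot> (q * x') - m \<cdot> (q * x' * q)"
      by (simp add: sm_simps algebra_simps)
    then have "m \<cdot> (q * p * y) - m \<cdot> c \<cdot> q = m \<cdot> (q * x') - m \<cdot> c \<cdot> q"
      by (simp add: skx sm_simps qy qx'q left_diff_distrib right_diff_distrib)
    then have "m \<cdot> (q * p * y - q * x') = 0" by (simp add: sm_simps)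
    then show ?thesis using torsion by fastforce
  qed
  have qp: "q * p = q * x' * y'"
    using arg_cong[OF qpy, of "\<lambda>w. w * y'"] by (simp add: mult.assoc yy')
  show 1: "x * y * p = q * p" using qp Q' F' by simp
  show "q * x * y = q * p" using 1 Q by simp
  show "p * q * p = p" "q * x * q = l \<cdot> q" "q * x' * q = c \<cdot> q" by fact+
  have "x * (q * p) = y' * p" using qp Q' by (simp add: mult.assoc)
  then show "x * q * p = y * p + m \<cdot> (p - q * p)" by (simp add: y'_eq mult.assoc sm_simps algebra_simps)
  show "q * p * y = q * x + m \<cdot> (q - q * p)" unfolding qpy by (simp add: x'_eq sm_simps algebra_simps)
  have "sw.N * q = x * y * (N * p) * y' * x'"
    unfolding sw.N_def N_def by (subst q_conj) (simp add: mult.assoc)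
  then show "sw.N * q = q" unfolding Np by (simp add: q_conj[symmetric])
qed

lemma relations:
  assumes Np: "N * p = p" and Yp: "p * y * p = l \<cdot> p" and Yp': "p * y' * p = c \<cdot> p"
  shows "x * y * p = q * p" "q * x * y = q * p" "p * q * p = p" "p * y * p = l \<cdot> p"
    "x * q * p = y * p + m \<cdot> (p - q * p)" "q * p * y = q * x + m \<cdot> (q - q * p)"
    "x * q * x = y * p * y + m \<cdot> (p * y - q * x + y * p - x * q) + (m * m) \<cdot> (p - q)"
proof -
  interpret sw: bmw_pair sm y y' x x' q p c l m D Di by (rule swapped)
  note h = half_relations[OF Np Yp Yp']
  note sh = sw.half_relations[OF h(8) h(4) h(5)]
  show "x * y * p = q * p" "q * x * y = q * p" "p * q * p = p" "p * y * p = l \<cdot> p"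
    "x * q * p = y * p + m \<cdot> (p - q * p)" "q * p * y = q * x + m \<cdot> (q - q * p)"
    using h Yp by auto
  \<comment> \<open>Conjugating \<open>q\<close> by \<open>x\<close> gives the same element as
    conjugating \<open>p\<close> by the inverse of \<open>y\<close>. Replacing \<open>x'\<close> and
    \<open>y'\<close> by the skein relation turns this into the last of the relations.\<close>
  have "x * q * x' = y' * (y * x * q) * x'" by (simp add: mult.assoc)
  also have "\<dots> = y' * p * y" unfolding sw.xyp by (simp add: mult.assoc xx')
  finally have c1: "x * q * x' = y' * p * y" .
  have "x * q * x = x * q * x' - m \<cdot> (x * q) + m \<cdot> (x * q * p)"
    by (simp add: x'_eq sm_simps algebra_simps)
  also have "\<dots> = y * p * y + m \<cdot> (p * y) - m \<cdot> (q * p * y) - m \<cdot> (x * q) + m \<cdot> (x * q * p)"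
    unfolding c1 by (simp add: y'_eq sm_simps algebra_simps)
  also have "\<dots> = y * p * y + m \<cdot> (p * y - q * x + y * p - x * q) + (m * m) \<cdot> (p - q)"
    unfolding h(6) h(7) by (simp add: sm_simps algebra_simps)
  finally show "x * q * x = y * p * y + m \<cdot> (p * y - q * x + y * p - x * q) + (m * m) \<cdot> (p - q)" .
qed

end

section \<open>Deformation of the rank two relations\<close>

text \<open>Linear functionals take the place of a topology: identities and differential equations with values
  in \<open>'a\<close> are tested by them.\<close>

class calg = ring_1 +
  fixes scC :: "complex \<Rightarrow> 'a \<Rightarrow> 'a"
  assumes scC_add_left: "scC (a + b) u = scC a u + scC b u"
    and scC_add_right: "scC a (u + v) = scC a u + scC a v"
    and scC_scC: "scC a (scC b u) = scC (a * b) u"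
    and scC_one: "scC 1 u = u"
    and scC_mult_left: "scC a u * v = scC a (u * v)"
    and scC_mult_right: "u * scC a v = scC a (u * v)"
    and separated: "(\<And>\<phi> :: 'a \<Rightarrow> complex. (\<And>u v. \<phi> (u + v) = \<phi> u + \<phi> v) \<Longrightarrow>
      (\<And>c u. \<phi> (scC c u) = c * \<phi> u) \<Longrightarrow> \<phi> u = \<phi> v) \<Longrightarrow> u = v"

interpretation scC: alg "scC :: complex \<Rightarrow> 'a \<Rightarrow> 'a::calg"
  by unfold_locales
    (simp_all add: scC_add_left scC_add_right scC_scC scC_one scC_mult_left scC_mult_right)

lemma scC_cancel: "scC a u = scC a v \<Longrightarrow> a \<noteq> 0 \<Longrightarrow> u = v"
  by (drule arg_cong[where f = "scC (1 / a)"]) (simp add: scC_scC scC_one)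

lemma scC_eq_0: "scC a u = 0 \<Longrightarrow> a \<noteq> 0 \<Longrightarrow> u = 0"
  using scC_cancel[of a u 0] by (simp add: scC.sm_zero_right)

definition kap :: "complex fps \<Rightarrow> 'a::calg fps" where
  "kap s = Abs_fps (\<lambda>n. scC (s $ n) 1)"

definition scF :: "complex fps \<Rightarrow> 'a::calg fps \<Rightarrow> 'a fps" where
  "scF s x = kap s * x"

lemma kap_nth [simp]: "kap s $ n = scC (s $ n) 1"
  by (simp add: kap_def)

lemma scF_nth: "scF s x $ n = (\<Sum>i=0..n. scC (s $ i) (x $ (n - i)))"
  by (simp add: scF_def fps_mult_nth scC.sm_mult_left)

lemma kap_add: "kap (a + b) = kap a + kap b"
  by (rule fps_ext) (simp add: scC.sm_add_left)

lemma kap_mult: "kap (a * b) = kap a * kap b"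
  by (rule fps_ext) (simp add: fps_mult_nth scC.sm_sum_left scC.sm_simps mult.commute)

lemma kap_one: "kap 1 = 1"
  by (rule fps_ext) (simp add: scC.sm_simps)

lemma kap_central: "x * kap a = kap a * x"
proof (rule fps_ext)
  fix n
  have "(x * kap a) $ n = (\<Sum>i=0..n. scC (a $ (n - i)) (x $ i))"
    by (simp add: fps_mult_nth scC.sm_simps)
  also have "\<dots> = (\<Sum>i=0..n. scC (a $ i) (x $ (n - i)))"
    by (subst sum.atLeastAtMost_rev) simp
  finally show "(x * kap a) $ n = (kap a * x) $ n"
    by (simp add: fps_mult_nth scC.sm_simps)
qed

lemma scF_alg: "alg scF"
proof
  fix a b :: "complex fps" and x y :: "'a fps"
  show "scF (a + b) x = scF a x + scF b x" by (simp add: scF_def kap_add distrib_right)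
  show "scF a (x + y) = scF a x + scF a y" by (simp add: scF_def distrib_left)
  show "scF a (scF b x) = scF (a * b) x" by (simp add: scF_def kap_mult mult.assoc)
  show "scF 1 x = x" by (simp add: scF_def kap_one)
  show "scF a x * y = scF a (x * y)" by (simp add: scF_def mult.assoc)
  show "x * scF a y = scF a (x * y)" by (simp add: scF_def mult.assoc[symmetric] kap_central)
qed

interpretation scF: alg scF by (rule scF_alg)

lemma scF_nth_0: "scF a x $ 0 = scC (a $ 0) (x $ 0)" by (simp add: scF_nth)

lemma fps_mult_leading:
  fixes x y :: "'a::ring_1 fps"
  assumes "\<And>i. i < p \<Longrightarrow> x $ i = 0" "\<And>i. i < q \<Longrightarrow> y $ i = 0"
  shows "(x * y) $ (p + q) = x $ p * y $ q" "j < p + q \<Longrightarrow> (x * y) $ j = 0"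
proof -
  have "(x * y) $ (p + q) = (\<Sum>i=0..p+q. if i = p then x $ p * y $ q else 0)"
    unfolding fps_mult_nth
  proof (rule sum.cong)
    fix i assume "i \<in> {0..p+q}"
    then show "x $ i * y $ (p + q - i) = (if i = p then x $ p * y $ q else 0)"
      using assms(1)[of i] assms(2)[of "p + q - i"] by (cases "i < p"; cases "i = p") auto
  qed simp
  then show "(x * y) $ (p + q) = x $ p * y $ q" by simp
next
  assume j: "j < p + q"
  show "(x * y) $ j = 0" unfolding fps_mult_nth
  proof (rule sum.neutral, safe)
    fix i assume "i \<in> {0..j}"
    then show "x $ i * y $ (j - i) = 0"
      using j assms(1)[of i] assms(2)[of "j - i"] by (cases "i < p") auto
  qed
qed

lemma scF_leading:
  fixes x :: "'a::calg fps"
  assumes "\<And>i. i < p \<Longrightarrow> a $ i = 0" "\<And>i. i < q \<Longrightarrow> x $ i = 0"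
  shows "scF a x $ (p + q) = scC (a $ p) (x $ q)" "j < p + q \<Longrightarrow> scF a x $ j = 0"
  using fps_mult_leading[of p "kap a" q x] assms by (auto simp: scF_def scC.sm_simps)

text \<open>The cubic relations alone admit further irreducible representations of the three strand
  braid group; they are separated from the wanted ones by the value at \<open>y = 0\<close>.\<close>

lemma bmw_pair_deformation:
  fixes x x' y y' p q :: "'a::calg fps"
  assumes pair: "bmw_pair scF x x' y y' p q c l m D Di"
    and c: "c $ 0 = 1" "c $ 1 = 1 - \<delta>" and m: "m $ 0 = 0" "m $ 1 = - 2" and D: "D $ 0 = \<delta>"
    and \<delta>: "\<delta> \<noteq> 0" "\<delta> \<noteq> 1" "\<delta> \<noteq> - 2"
    and x0: "x $ 0 * x $ 0 = 1" and y0: "y $ 0 * y $ 0 = 1" and pyp: "p $ 0 * y $ 0 * p $ 0 = p $ 0"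
  shows "x * y * p = q * p" "q * x * y = q * p" "p * q * p = p" "p * y * p = scF l p"
    "x * q * p = y * p + scF m (p - q * p)" "q * p * y = q * x + scF m (q - q * p)"
    "x * q * x = y * p * y + scF m (p * y - q * x + y * p - x * q) + scF (m * m) (p - q)"
proof -
  interpret bmw_pair scF x x' y y' p q c l m D Di by (rule pair)
  have l: "l $ 0 = 1" "l $ 1 = \<delta> - 1"
  proof -
    have "(l * c) $ 0 = 1" "(l * c) $ 1 = 0" using lc by simp_all
    then have "l $ 0 = 1" and "l $ 1 = - (c $ 1)"
      using c(1) by (simp_all add: fps_mult_nth_1 eq_neg_iff_add_eq_0 add.commute)
    then show "l $ 0 = 1" "l $ 1 = \<delta> - 1" unfolding c(2) by simp_all
  qed
  have Di: "Di $ 0 = 1 / \<delta>"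
  proof -
    have "(D * Di) $ 0 = 1" using DDi by simp
    then show ?thesis using D \<delta> by (simp add: field_simps)
  qed
  have u0: "u $ 0 = scC (1 / \<delta>) (p $ 0)" by (simp add: u_def scF_nth_0 Di)
  have t0: "t $ 0 = u $ 0" by (simp add: t_def Y_def scF_nth_0 Di pyp u0)
  have "N $ 0 = 1" by (simp add: N_def) (metis x0 y0 mult.assoc mult_1)
  then have n0: "n $ 0 = u $ 0" by (simp add: n_def scF_nth_0 Di u0)
  have s0: "s $ 0 = 0" by (simp add: s_def scF_nth_0 t0 l scC.sm_one)
  have v0: "v $ 0 = 0" by (simp add: v_def n0)
  \<comment> \<open>Both defects vanish at order 0, by the hypotheses on the constant terms. The
    first nonzero coefficient of \<open>s\<close>, of order k, is refuted by comparing
    \<open>G1\<close> at orders up to k + 1 with \<open>G3'\<close> at order k + 2.\<close>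
  have "s = 0"
  proof (rule ccontr)
    assume "s \<noteq> 0"
    then have ex: "\<exists>k. s $ k \<noteq> 0" by (metis fps_ext fps_zero_nth)
    define k where "k = (LEAST k. s $ k \<noteq> 0)"
    have sk: "s $ k \<noteq> 0" and sj: "\<And>j. j < k \<Longrightarrow> s $ j = 0"
      using LeastI_ex[OF ex] not_less_Least unfolding k_def by blast+
    have k1: "k \<ge> 1" using sk s0 by (cases k) auto
    define w where "w = t - scF (D * c) u"
    define V where "V = scF (m * c) (t * t) + scF (c - m - m * c * c) t + scF (D * (1 + c * m)) u
      - scF D u - scF D u - scF D v"
    have w0: "w $ 0 = scC (1 - \<delta>) (u $ 0)" by (simp add: w_def scF_nth_0 t0 D c scC.sm_simps)
    have V0: "V $ 0 = scC (1 - \<delta>) (u $ 0)" by (simp add: V_def scF_nth_0 t0 v0 D c m scC.sm_simps)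
    have mc: "(m * c) $ i = 0" if "i < 1" for i using that m by simp
    have mc1: "(m * c) $ 1 = - 2" using m c by (simp add: fps_mult_nth_1)
    have su: "s $ k * u $ 0 = s $ k"
      using fps_mult_leading(1)[of k s 0 u] sj u_s_v by simp
    have sw: "(s * w) $ k = scC (1 - \<delta>) (s $ k)" "\<And>j. j < k \<Longrightarrow> (s * w) $ j = 0"
      using fps_mult_leading(1)[of k s 0 w] fps_mult_leading(2)[of k s 0 w] sj w0 su
      by (simp_all add: scC_mult_right)
    \<comment> \<open>In \<open>G1\<close> the defect \<open>s\<close> comes with a factor
      \<open>m\<close>, of order 1, whereas the factor of \<open>v\<close> starts with 1 - \<delta>
      times the unit of the corner. So \<open>v\<close> starts one order later than
      \<open>s\<close>, and its first coefficient is twice that of \<open>s\<close>.\<close>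
    have vj: "v $ j = 0" if "j \<le> k" for j
      using that
    proof (induction j rule: less_induct)
      case (less j)
      have "v $ j * u $ 0 = v $ j"
        using fps_mult_leading(1)[of j v 0 u] less u_s_v by simp
      then have "(v * V) $ j = scC (1 - \<delta>) (v $ j)"
        using fps_mult_leading(1)[of j v 0 V] less V0 by (simp add: scC_mult_right)
      moreover have "scF (m * c) (s * w) $ j = 0"
        using scF_leading(2)[of 1 "m * c" k "s * w" j] mc sw less.prems by simp
      moreover have "(scF (m * c) (s * w) + v * V) $ j = 0" unfolding w_def V_def G1 by simp
      ultimately have "scC (1 - \<delta>) (v $ j) = 0" by simp
      then show ?case using \<delta> scC_eq_0[of "1 - \<delta>" "v $ j"] by simp
    qed
    have vk: "v $ (Suc k) = scC 2 (s $ k)"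
    proof -
      have vj': "\<And>j. j < Suc k \<Longrightarrow> v $ j = 0" using vj by simp
      have "v $ Suc k * u $ 0 = v $ Suc k"
        using fps_mult_leading(1)[of "Suc k" v 0 u] vj' u_s_v by simp
      then have "(v * V) $ Suc k = scC (1 - \<delta>) (v $ Suc k)"
        using fps_mult_leading(1)[of "Suc k" v 0 V] vj' V0 by (simp add: scC_mult_right)
      moreover have "scF (m * c) (s * w) $ Suc k = scC (- 2) (scC (1 - \<delta>) (s $ k))"
        using scF_leading(1)[of 1 "m * c" k "s * w"] mc mc1 sw by simp
      moreover have "(scF (m * c) (s * w) + v * V) $ Suc k = 0" unfolding w_def V_def G1 by simp
      ultimately have "scC (- 2) (scC (1 - \<delta>) (s $ k)) + scC (1 - \<delta>) (v $ Suc k) = 0"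
        by simp
      moreover have "scC (- 2) (scC (1 - \<delta>) (s $ k)) = - scC (1 - \<delta>) (scC 2 (s $ k))"
        by (simp only: scC_scC scC.sm_minus_left[symmetric]) (simp add: mult.commute)
      ultimately have "scC (1 - \<delta>) (v $ Suc k) = scC (1 - \<delta>) (scC 2 (s $ k))" by simp
      then show ?thesis using \<delta> scC_cancel[of "1 - \<delta>"] by simp
    qed
    have vj': "\<And>j. j < k + 1 \<Longrightarrow> v $ j = 0" using vj by simp
    have vv: "\<And>j. j < k + 1 + (k + 1) \<Longrightarrow> (v * v) $ j = 0"
      using fps_mult_leading(2)[of "k + 1" v "k + 1" v] vj' by blast
    have sv: "\<And>j. j < k + (k + 1) \<Longrightarrow> (s * v) $ j = 0"
      using fps_mult_leading(2)[of k s "k + 1" v] sj vj' by blast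
    have svv: "\<And>j. j < k + (k + 1) + (k + 1) \<Longrightarrow> (s * v * v) $ j = 0"
      using fps_mult_leading(2)[of "k + (k + 1)" "s * v" "k + 1" v] sv vj' by blast
    have T3: "(s * v * v * (scF a3 (v + u + u + u) + scF a2 u)) $ (k + 2) = 0"
      using fps_mult_leading(2)[of "k + (k + 1) + (k + 1)" "s * v * v" 0] svv k1 by simp
    have T5: "(v * v * (scF (l * a3 + b3) (v + u + u + u) + scF (l * a2 + b2) u)) $ (k + 2) = 0"
      using fps_mult_leading(2)[of "k + 1 + (k + 1)" "v * v" 0] vv k1 by simp
    have a0: "(3 * a3 + 2 * a2 + a1) $ i = 0" if "i < 1" for i
      using that by (simp add: a3_def a2_def a1_def l c m fps_numeral_nth)
    have T2: "scF (3 * a3 + 2 * a2 + a1) (s * v) $ (k + 2) = 0"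
      using scF_leading(2)[of 1 "3 * a3 + 2 * a2 + a1" "k + (k + 1)" "s * v" "k + 2"] a0 sv k1 by simp
    let ?\<kappa> = "3 * (l * a3 + b3) + 2 * (l * a2 + b2) + (l * a1 + b1)"
    have \<kappa>0: "?\<kappa> $ i = 0" if "i < 1" for i
      using that by (simp add: a3_def a2_def a1_def b3_def b2_def b1_def l c m D fps_numeral_nth)
    have \<kappa>1: "?\<kappa> $ 1 = 2 * (1 - \<delta>) * (2 - \<delta>)"
      by (simp add: a3_def a2_def a1_def b3_def b2_def b1_def l c m D l(2)[unfolded One_nat_def] c(2)[unfolded One_nat_def] m(2)[unfolded One_nat_def] fps_numeral_nth fps_mult_nth_1)
         (simp add: algebra_simps)
    have T4: "scF ?\<kappa> v $ (k + 2) = scC (2 * (1 - \<delta>) * (2 - \<delta>)) (scC 2 (s $ k))"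
      using scF_leading(1)[of 1 ?\<kappa> "k + 1" v] \<kappa>0 \<kappa>1 vj' vk by (simp add: numeral_2_eq_2)
    let ?A = "(1 - c * c * c * c) * (m * D)"
    have c4: "(1 - c * c * c * c) $ i = 0" if "i < 1" for i using that c by simp
    have mD0: "(m * D) $ i = 0" if "i < 1" for i using that m by simp
    have A: "?A $ i = 0" if "i < 2" for i
      using fps_mult_leading(2)[of 1 "1 - c * c * c * c" 1 "m * D" i] c4 mD0 that by simp
    have A2: "?A $ 2 = 8 * (1 - \<delta>) * \<delta>"
      using fps_mult_leading(1)[of 1 "1 - c * c * c * c" 1 "m * D"] c4 mD0
      by (simp add: fps_mult_nth_1 c m D c(2)[unfolded One_nat_def] m(2)[unfolded One_nat_def] numeral_2_eq_2) (simp add: algebra_simps)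
    have T1: "scF ?A (s * u) $ (k + 2) = scC (8 * (1 - \<delta>) * \<delta>) (s $ k)"
      using scF_leading(1)[of 2 ?A k s] A A2 sj by (simp add: u_s_v)
    \<comment> \<open>Only the terms linear in \<open>s\<close> and \<open>v\<close> reach order k +
      2 of \<open>G3'\<close>. The coefficient of \<open>s\<close> starts at order 2 and that of
      \<open>v\<close> at order 1; since the first coefficient of \<open>v\<close> is twice that of
      \<open>s\<close>, the contributions add up to
      \<open>4 * (1 - \<delta>) * (\<delta> + 2)\<close> times it, and the zeros 1 and -2 of this
      factor are excluded.\<close>
    have "0 = scC (8 * (1 - \<delta>) * \<delta>) (s $ k) + scC (2 * (1 - \<delta>) * (2 - \<delta>)) (scC 2 (s $ k))"
      using arg_cong[OF G3', of "\<lambda>f. f $ (k + 2)"]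
      unfolding fps_add_nth T1 T2 T3 T4 T5 by simp
    also have "\<dots> = scC (4 * (1 - \<delta>) * (\<delta> + 2)) (s $ k)"
      by (simp add: scC.sm_sm scC.sm_add_left[symmetric] algebra_simps)
    finally have "scC (4 * (1 - \<delta>) * (\<delta> + 2)) (s $ k) = 0" by simp
    moreover have "\<delta> + 2 \<noteq> 0" using \<delta>(3) by (simp add: eq_neg_iff_add_eq_0)
    ultimately show False using sk \<delta> scC_eq_0[of "4 * (1 - \<delta>) * (\<delta> + 2)" "s $ k"] by simp
  qed
  then have tl: "t = scF l u" by (simp add: s_def)
  have "v = 0"
  proof (rule fps_ext)
    define V where "V = scF (m * c) (t * t) + scF (c - m - m * c * c) t + scF (D * (1 + c * m)) u
      - scF D u - scF D u - scF D v"
    have V0: "V $ 0 = scC (1 - \<delta>) (u $ 0)" by (simp add: V_def scF_nth_0 t0 v0 D c m scC.sm_simps)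
    have G: "v * V = 0" using G1 by (simp add: V_def \<open>s = 0\<close> scF.sm_zero_right)
    fix j show "v $ j = 0 $ j"
    proof (induction j rule: less_induct)
      case (less j)
      have "v $ j * u $ 0 = v $ j"
        using fps_mult_leading(1)[of j v 0 u] less u_s_v by simp
      then have "(v * V) $ j = scC (1 - \<delta>) (v $ j)"
        using fps_mult_leading(1)[of j v 0 V] less V0 by (simp add: scC_mult_right)
      then have "scC (1 - \<delta>) (v $ j) = 0" unfolding G by simp
      then show ?case using \<delta> scC_eq_0[of "1 - \<delta>" "v $ j"] by simp
    qed
  qed
  then have nu: "n = u" by (simp add: v_def)
  have sD: "scF D (scF Di w) = w" for w :: "'a fps" by (simp add: scF.sm_sm DDi scF.sm_one)
  have Np: "N * p = p" using nu sD unfolding n_def u_def by metis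
  have dd: "D * (l * Di) = l" "D * (c * Di) = c"
    by (metis DDi mult.left_commute mult_1_right)+
  have Y: "p * y * p = scF l p"
  proof -
    have "scF D t = scF D (scF l u)" by (simp add: tl)
    then show ?thesis by (simp add: t_def u_def sD Y_def) (simp add: scF.sm_sm dd)
  qed
  have Y': "p * y' * p = scF c p"
  proof -
    have "t' = scF (c * c) t" using R1 by (simp add: nu u_simps)
    then have "t' = scF c u" by (simp add: tl scF.sm_sm mult.assoc cl)
    then have "scF D t' = scF D (scF c u)" by simp
    then show ?thesis by (simp add: t'_def u_def sD Y'_def) (simp add: scF.sm_sm dd)
  qed
  show "x * y * p = q * p" "q * x * y = q * p" "p * q * p = p" "p * y * p = scF l p"
    "x * q * p = y * p + scF m (p - q * p)" "q * p * y = q * x + scF m (q - q * p)"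
    "x * q * x = y * p * y + scF m (p * y - q * x + y * p - x * q) + scF (m * m) (p - q)"
    using relations[OF Np Y Y'] by auto
qed

section \<open>A formal Knizhnik--Zamolodchikov connection\<close>

lemma integral_rescale:
  fixes f :: "real \<Rightarrow> complex"
  assumes "continuous_on {0..1} f" "0 \<le> s" "s \<le> 1"
  shows "integral {0..s} f = integral {0..1} (\<lambda>y. complex_of_real s * f (s * y))"
proof -
  have "((\<lambda>x. s *\<^sub>R f (s * x)) has_integral (integral {s * 0..s * 1} f)) {0..1}"
  proof (rule has_integral_substitution[where c = 0 and d = 1 and g' = "\<lambda>_. s"])
    show "(*) s ` {0..1} \<subseteq> {0..1}" using assms by (auto intro: mult_le_one)
    show "((*) s has_real_derivative s) (at x within {0..1})" for x
      by (auto intro!: derivative_eq_intros)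
  qed (use assms in auto)
  from integral_unique[OF this] show ?thesis by (simp add: scaleR_conv_of_real)
qed

text \<open>Rescaling moves the variable upper end into the integrand; continuity of parameter
  integrals over the fixed interval then applies.\<close>

lemma continuous_on_indefinite:
  fixes f :: "real \<Rightarrow> real \<Rightarrow> complex"
  assumes "continuous_on ({0..1} \<times> T) (\<lambda>(x, t). f x t)"
  shows "continuous_on ({0..1} \<times> T) (\<lambda>(s, t). integral {0..s} (\<lambda>x. f x t))"
proof -
  have "continuous_on (({0..1} \<times> T) \<times> cbox 0 1) (\<lambda>q. (\<lambda>(x, t). f x t) (fst (fst q) * snd q, snd (fst q)))"
    by (rule continuous_on_compose2[OF assms]) (auto intro!: continuous_intros simp: mult_le_one)
  then have "continuous_on (({0..1} \<times> T) \<times> cbox 0 1)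
      (\<lambda>(p, y). complex_of_real (fst p) * f (fst p * y) (snd p))"
    by (auto simp: split_beta intro!: continuous_intros)
  from integral_continuous_on_param[OF this]
  have "continuous_on ({0..1} \<times> T) (\<lambda>p. integral (cbox 0 1) (\<lambda>y. complex_of_real (fst p) * f (fst p * y) (snd p)))" .
  moreover have "integral {0..s} (\<lambda>x. f x t) = integral (cbox 0 1) (\<lambda>y. complex_of_real s * f (s * y) t)"
    if "s \<in> {0..1}" "t \<in> T" for s t
    unfolding cbox_interval
  proof (rule integral_rescale)
    show "continuous_on {0..1} (\<lambda>x. f x t)"
    proof -
      have "continuous_on {0..1} (\<lambda>x. (\<lambda>(x, t). f x t) (x, t))"
        by (rule continuous_on_compose2[OF assms]) (use that in \<open>auto intro!: continuous_intros\<close>)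
      then show ?thesis by simp
    qed
  qed (use that in auto)
  ultimately show ?thesis
    by (subst continuous_on_cong[OF refl, of _ _ "\<lambda>p. integral (cbox 0 1) (\<lambda>y. complex_of_real (fst p) * f (fst p * y) (snd p))"])
       (auto simp: split_beta)
qed

lemma vector_derivative_zero_const:
  fixes f :: "real \<Rightarrow> complex"
  assumes "\<And>s. s \<in> {a..b} \<Longrightarrow> (f has_vector_derivative 0) (at s within {a..b})" "t \<in> {a..b}"
  shows "f t = f a"
proof -
  have "a \<in> {a..b}" using assms(2) by auto
  then show ?thesis
    using has_vector_derivative_zero_constant[of "{a..b}" f] assms by (metis convex_real_interval(5))
qed

lemma has_vector_derivative_inverse:
  fixes f :: "real \<Rightarrow> complex"
  assumes "(f has_vector_derivative f') (at x within S)" "f x \<noteq> 0"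
  shows "((\<lambda>t. inverse (f t)) has_vector_derivative - (inverse (f x) * f' * inverse (f x))) (at x within S)"
proof -
  have "(inverse has_field_derivative - (inverse (f x) ^ Suc (Suc 0))) (at (f x) within f ` S)"
    by (rule DERIV_inverse[OF assms(2)])
  from field_vector_diff_chain_within[OF assms(1) this] show ?thesis
    by (simp add: o_def algebra_simps)
qed

section \<open>Linear functionals as a substitute for a topology\<close>

definition clin :: "('a::calg \<Rightarrow> complex) \<Rightarrow> bool" where
  "clin \<phi> \<longleftrightarrow> (\<forall>u v. \<phi> (u + v) = \<phi> u + \<phi> v) \<and> (\<forall>c u. \<phi> (scC c u) = c * \<phi> u)"

lemma clin_add: "clin \<phi> \<Longrightarrow> \<phi> (u + v) = \<phi> u + \<phi> v"
  and clin_scC: "clin \<phi> \<Longrightarrow> \<phi> (scC c u) = c * \<phi> u"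
  by (simp_all add: clin_def)

lemma clin_0: "clin \<phi> \<Longrightarrow> \<phi> 0 = 0" using clin_scC[of \<phi> 0 0] by (simp add: scC.sm_zero_left)

lemma clin_diff: "clin \<phi> \<Longrightarrow> \<phi> (u - v) = \<phi> u - \<phi> v"
  using clin_add[of \<phi> "u - v" v] by simp

lemma clin_sum: "clin \<phi> \<Longrightarrow> \<phi> (\<Sum>i\<in>I. f i) = (\<Sum>i\<in>I. \<phi> (f i))"
  by (induction I rule: infinite_finite_induct) (simp_all add: clin_0 clin_add)

lemma clin_left: "clin \<phi> \<Longrightarrow> clin (\<lambda>u. \<phi> (x * u))"
  by (simp add: clin_def distrib_left scC_mult_right)

lemma clin_right: "clin \<phi> \<Longrightarrow> clin (\<lambda>u. \<phi> (u * x))"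
  by (simp add: clin_def distrib_right scC_mult_left)

lemma clin_eqI: "(\<And>\<phi>. clin \<phi> \<Longrightarrow> \<phi> u = \<phi> v) \<Longrightarrow> u = v"
  by (rule separated) (simp add: clin_def)

text \<open>Chen's iterated integrals of the forms d log \<alpha> along the segment from
  \<open>\<kappa>\<close> to \<open>l\<close>, on which \<alpha> takes the value
  \<open>\<kappa> \<alpha> + x * (l \<alpha> - \<kappa> \<alpha>)\<close> at time x.\<close>

fun ray_integral :: "('r \<Rightarrow> complex) \<Rightarrow> ('r \<Rightarrow> complex) \<Rightarrow> 'r list \<Rightarrow> real \<Rightarrow> complex" where
  "ray_integral \<kappa> l [] s = 1"
| "ray_integral \<kappa> l (\<alpha> # w) s =
     integral {0..s} (\<lambda>x. (l \<alpha> - \<kappa> \<alpha>) / (\<kappa> \<alpha> + of_real x * (l \<alpha> - \<kappa> \<alpha>)) * ray_integral \<kappa> l w x)"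

text \<open>The derivative of \<open>ray_integral\<close> while the end point \<open>l\<close> moves
  with velocity \<open>l'\<close>. The first summand comes from differentiating the form of the
  first letter, the second one from the rest of the word.\<close>

fun ray_derivative :: "('r \<Rightarrow> complex) \<Rightarrow> ('r \<Rightarrow> complex) \<Rightarrow> ('r \<Rightarrow> complex) \<Rightarrow> 'r list \<Rightarrow> real \<Rightarrow> complex" where
  "ray_derivative \<kappa> l l' [] s = 0"
| "ray_derivative \<kappa> l l' (\<alpha> # w) s = integral {0..s} (\<lambda>x.
     l' \<alpha> * \<kappa> \<alpha> / (\<kappa> \<alpha> + of_real x * (l \<alpha> - \<kappa> \<alpha>))\<^sup>2 * ray_integral \<kappa> l w x
     + (l \<alpha> - \<kappa> \<alpha>) / (\<kappa> \<alpha> + of_real x * (l \<alpha> - \<kappa> \<alpha>)) * ray_derivative \<kappa> l l' w x)"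

definition words_of :: "'r set \<Rightarrow> nat \<Rightarrow> 'r list set" where
  "words_of A k = {w. set w \<subseteq> A \<and> length w = k}"

lemma words_of_0 [simp]: "words_of A 0 = {[]}" by (auto simp: words_of_def)

lemma sum_words_of_Suc:
  "(\<Sum>w\<in>words_of A (Suc k). f w) = (\<Sum>a\<in>A. \<Sum>w\<in>words_of A k. f (a # w))" if "finite A"
proof -
  have "words_of A (Suc k) = (\<lambda>(a, w). a # w) ` (A \<times> words_of A k)"
    by (auto simp: words_of_def length_Suc_conv image_iff)
  moreover have "inj_on (\<lambda>(a, w). a # w) (A \<times> words_of A k)" by (auto simp: inj_on_def)
  ultimately show ?thesis
    by (simp add: sum.reindex sum.cartesian_product case_prod_unfold)
qed

text \<open>The connection \<open>\<Sum>\<alpha>. tau \<alpha> d log \<alpha>\<close>; the assumption \<open>flat\<close> is \<open>\<omega> \<and> \<omega> = 0\<close>.\<close>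

locale kz =
  fixes Rt :: "'r::ab_group_add set" and tau :: "'r \<Rightarrow> 'a::calg"
  assumes finite_Rt: "finite Rt"
    and flat: "\<lbrakk>Modules.additive a; Modules.additive b; Modules.additive l; \<And>\<alpha>. \<alpha> \<in> Rt \<Longrightarrow> l \<alpha> \<noteq> 0\<rbrakk> \<Longrightarrow>
      (\<Sum>\<alpha>\<in>Rt. \<Sum>\<beta>\<in>Rt. scC ((a \<alpha> * b \<beta> - b \<alpha> * a \<beta>) / (l \<alpha> * l \<beta>)) (tau \<alpha> * tau \<beta>)) = 0"
begin

definition tau_word :: "'r list \<Rightarrow> 'a" where "tau_word w = prod_list (map tau w)"

definition transport_coeff :: "('r \<Rightarrow> complex) \<Rightarrow> ('r \<Rightarrow> complex) \<Rightarrow> nat \<Rightarrow> 'a" where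
  "transport_coeff \<kappa> l k = (\<Sum>w\<in>words_of Rt k. scC (ray_integral \<kappa> l w 1) (tau_word w))"

text \<open>The exponent of the formal variable y counts the letters. So this is parallel transport
  along the segment for the connection multiplied by y, and each coefficient is a finite
  sum.\<close>

definition transport :: "('r \<Rightarrow> complex) \<Rightarrow> ('r \<Rightarrow> complex) \<Rightarrow> 'a fps" where
  "transport \<kappa> l = Abs_fps (transport_coeff \<kappa> l)"

lemma transport_0: "transport \<kappa> l $ 0 = 1"
  by (simp add: transport_def transport_coeff_def tau_word_def scC_one)

text \<open>The differential equation of parallel transport along a path, with
  \<open>\<Omega> t \<alpha>\<close> for the logarithmic derivative of \<alpha> along it. The formal
  variable y of the connection is the factor \<open>fps_X\<close>.\<close>

definition horizontal :: "real \<Rightarrow> real \<Rightarrow> (real \<Rightarrow> 'r \<Rightarrow> complex) \<Rightarrow> (real \<Rightarrow> 'a fps) \<Rightarrow> bool" where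
  "horizontal a b \<Omega> Y \<longleftrightarrow> (\<forall>\<phi> k. clin \<phi> \<longrightarrow> (\<forall>t\<in>{a..b}.
     ((\<lambda>t. \<phi> (Y t $ k)) has_vector_derivative
       (\<Sum>\<alpha>\<in>Rt. \<Omega> t \<alpha> * \<phi> (tau \<alpha> * (fps_X * Y t) $ k))) (at t within {a..b})))"

lemma horizontalD:
  "horizontal a b \<Omega> Y \<Longrightarrow> clin \<phi> \<Longrightarrow> t \<in> {a..b} \<Longrightarrow>
    ((\<lambda>t. \<phi> (Y t $ k)) has_vector_derivative
       (\<Sum>\<alpha>\<in>Rt. \<Omega> t \<alpha> * \<phi> (tau \<alpha> * (fps_X * Y t) $ k))) (at t within {a..b})"
  by (auto simp: horizontal_def)

text \<open>Because of the factor \<open>fps_X\<close>, the derivative of coefficient k + 1 involves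
  coefficient k only. Induction on k therefore replaces the usual estimates.\<close>

lemma horizontal_unique:
  assumes Y: "horizontal a b \<Omega> Y" and Z: "horizontal a b \<Omega> Z" and ab: "a \<le> b" and init: "Y a = Z a"
    and t: "t \<in> {a..b}"
  shows "Y t = Z t"
proof -
  have "\<forall>t\<in>{a..b}. Y t $ k = Z t $ k" for k
  proof (induction k)
    case 0
    show ?case
    proof (intro ballI clin_eqI)
      fix t \<phi> assume t: "t \<in> {a..b}" and \<phi>: "clin (\<phi> :: 'a \<Rightarrow> complex)"
      have "((\<lambda>t. \<phi> (W t $ 0)) has_vector_derivative 0) (at s within {a..b})"
        if "s \<in> {a..b}" "horizontal a b \<Omega> W" for s W
        using horizontalD[OF that(2) \<phi> that(1), of 0] by (simp add: clin_0[OF \<phi>])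
      then have "\<phi> (W t $ 0) = \<phi> (W a $ 0)" if "horizontal a b \<Omega> W" for W
        using vector_derivative_zero_const[of a b "\<lambda>t. \<phi> (W t $ 0)" t] that t by blast
      from this[OF Y] this[OF Z] show "\<phi> (Y t $ 0) = \<phi> (Z t $ 0)" using init by simp
    qed
  next
    case (Suc k)
    show ?case
    proof (intro ballI clin_eqI)
      fix t \<phi> assume t: "t \<in> {a..b}" and \<phi>: "clin (\<phi> :: 'a \<Rightarrow> complex)"
      have "((\<lambda>t. \<phi> (Y t $ Suc k) - \<phi> (Z t $ Suc k)) has_vector_derivative 0) (at s within {a..b})"
        if "s \<in> {a..b}" for s
        using has_vector_derivative_diff[OF horizontalD[OF Y \<phi> that, of "Suc k"] horizontalD[OF Z \<phi> that, of "Suc k"]]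
          Suc that by simp
      then have "\<phi> (Y t $ Suc k) - \<phi> (Z t $ Suc k) = \<phi> (Y a $ Suc k) - \<phi> (Z a $ Suc k)"
        using vector_derivative_zero_const[of a b "\<lambda>t. \<phi> (Y t $ Suc k) - \<phi> (Z t $ Suc k)" t] t by blast
      then show "\<phi> (Y t $ Suc k) = \<phi> (Z t $ Suc k)" using init by simp
    qed
  qed
  then show ?thesis using t by (simp add: fps_eq_iff)
qed

lemma horizontal_mult_right:
  assumes Y: "horizontal a b \<Omega> Y"
  shows "horizontal a b \<Omega> (\<lambda>t. Y t * C)"
  unfolding horizontal_def
proof (intro allI impI ballI)
  fix \<phi> k t assume \<phi>: "clin (\<phi> :: 'a \<Rightarrow> complex)" and t: "t \<in> {a..b}"
  have "((\<lambda>t. \<Sum>i=0..k. \<phi> (Y t $ i * C $ (k - i))) has_vector_derivative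
      (\<Sum>i=0..k. \<Sum>\<alpha>\<in>Rt. \<Omega> t \<alpha> * \<phi> (tau \<alpha> * (fps_X * Y t) $ i * C $ (k - i)))) (at t within {a..b})"
    by (intro has_vector_derivative_sum horizontalD[OF Y clin_right[OF \<phi>] t])
  moreover have "(\<Sum>i=0..k. \<Sum>\<alpha>\<in>Rt. \<Omega> t \<alpha> * \<phi> (tau \<alpha> * (fps_X * Y t) $ i * C $ (k - i)))
      = (\<Sum>\<alpha>\<in>Rt. \<Omega> t \<alpha> * \<phi> (tau \<alpha> * (fps_X * (Y t * C)) $ k))"
  proof (subst sum.swap, rule sum.cong[OF refl])
    fix \<alpha>
    have "(fps_X * (Y t * C)) $ k = (\<Sum>i=0..k. (fps_X * Y t) $ i * C $ (k - i))"
      by (simp add: mult.assoc[symmetric] fps_mult_nth)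
    then show "(\<Sum>i=0..k. \<Omega> t \<alpha> * \<phi> (tau \<alpha> * (fps_X * Y t) $ i * C $ (k - i)))
        = \<Omega> t \<alpha> * \<phi> (tau \<alpha> * (fps_X * (Y t * C)) $ k)"
      by (simp only: sum_distrib_left clin_sum[OF \<phi>] mult.assoc)
  qed
  ultimately show "((\<lambda>t. \<phi> ((Y t * C) $ k)) has_vector_derivative
       (\<Sum>\<alpha>\<in>Rt. \<Omega> t \<alpha> * \<phi> (tau \<alpha> * (fps_X * (Y t * C)) $ k))) (at t within {a..b})"
    by (simp add: fps_mult_nth[of "Y _" C] clin_sum[OF \<phi>])
qed

text \<open>Equivariance: an element that permutes the residues by conjugation carries the solutions
  over one path to solutions over the path permuted accordingly.\<close>

lemma horizontal_conjugate:
  assumes Y: "horizontal a b \<Omega> Y" and \<sigma>: "bij_betw \<sigma> Rt Rt"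
    and \<rho>: "\<And>\<alpha>. \<alpha> \<in> Rt \<Longrightarrow> \<rho> * tau \<alpha> = tau (\<sigma> \<alpha>) * \<rho>"
    and \<Omega>': "\<And>t \<alpha>. t \<in> {a..b} \<Longrightarrow> \<alpha> \<in> Rt \<Longrightarrow> \<Omega>' t (\<sigma> \<alpha>) = \<Omega> t \<alpha>"
  shows "horizontal a b \<Omega>' (\<lambda>t. fps_const \<rho> * Y t)"
  unfolding horizontal_def
proof (intro allI impI ballI)
  fix \<phi> k t assume \<phi>: "clin (\<phi> :: 'a \<Rightarrow> complex)" and t: "t \<in> {a..b}"
  have XZ: "(fps_X * (fps_const \<rho> * Z)) $ k = \<rho> * (fps_X * Z) $ k" for Z
    by (cases k) simp_all
  have "(\<Sum>\<alpha>\<in>Rt. \<Omega>' t \<alpha> * \<phi> (tau \<alpha> * (fps_X * (fps_const \<rho> * Y t)) $ k))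
      = (\<Sum>\<alpha>\<in>Rt. \<Omega>' t (\<sigma> \<alpha>) * \<phi> (tau (\<sigma> \<alpha>) * (\<rho> * (fps_X * Y t) $ k)))"
    unfolding XZ by (rule sum.reindex_bij_betw[OF \<sigma>, symmetric])
  also have "\<dots> = (\<Sum>\<alpha>\<in>Rt. \<Omega> t \<alpha> * \<phi> (\<rho> * (tau \<alpha> * (fps_X * Y t) $ k)))"
    using t by (intro sum.cong) (simp_all add: \<Omega>' mult.assoc[symmetric] \<rho>)
  finally show "((\<lambda>t. \<phi> ((fps_const \<rho> * Y t) $ k)) has_vector_derivative
       (\<Sum>\<alpha>\<in>Rt. \<Omega>' t \<alpha> * \<phi> (tau \<alpha> * (fps_X * (fps_const \<rho> * Y t)) $ k))) (at t within {a..b})"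
    using horizontalD[OF Y clin_left[OF \<phi>, of \<rho>] t, of k] by simp
qed


text \<open>\<open>transport\<close> only knows straight segments from a fixed centre. Flatness
  makes it solve the equation also when the end point moves along a path, provided that the whole
  triangle between centre and path avoids the hyperplanes.\<close>

lemma transport_horizontal:
  assumes additive: "Modules.additive \<kappa>" "\<And>t. Modules.additive (L t)" "\<And>t. Modules.additive (L' t)"
    and der: "\<And>t \<alpha>. t \<in> {a..b} \<Longrightarrow> ((\<lambda>t. L t \<alpha>) has_vector_derivative L' t \<alpha>) (at t within {a..b})"
    and contL': "\<And>\<alpha>. continuous_on {a..b} (\<lambda>t. L' t \<alpha>)"
    and nz: "\<And>s t \<alpha>. s \<in> {0..1} \<Longrightarrow> t \<in> {a..b} \<Longrightarrow> \<alpha> \<in> Rt \<Longrightarrow>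
      \<kappa> \<alpha> + of_real s * (L t \<alpha> - \<kappa> \<alpha>) \<noteq> 0"
  shows "horizontal a b (\<lambda>t \<alpha>. L' t \<alpha> / L t \<alpha>) (\<lambda>t. transport \<kappa> (L t))"
proof -
  define Z where "Z = (\<lambda>\<alpha> (s::real) t. \<kappa> \<alpha> + of_real s * (L t \<alpha> - \<kappa> \<alpha>))"
  \<comment> \<open>\<open>A\<close> and \<open>B\<close> are the components of d log \<alpha> in
    the directions s and t on the family of segments. As the form is closed, the derivative of
    \<open>A\<close> in t is that of \<open>B\<close> in s; both are \<open>A'\<close>.\<close>
  define A where "A = (\<lambda>\<alpha> s t. (L t \<alpha> - \<kappa> \<alpha>) / Z \<alpha> s t)"
  define A' where "A' = (\<lambda>\<alpha> s t. L' t \<alpha> * \<kappa> \<alpha> / (Z \<alpha> s t)\<^sup>2)"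
  define B where "B = (\<lambda>\<alpha> (s::real) t. of_real s * L' t \<alpha> / Z \<alpha> s t)"
  define J where "J = (\<lambda>w s t. ray_integral \<kappa> (L t) w s)"
  define J' where "J' = (\<lambda>w s t. ray_derivative \<kappa> (L t) (L' t) w s)"
  have J_simps: "J [] s t = 1" "J (\<alpha> # w) s t = integral {0..s} (\<lambda>x. A \<alpha> x t * J w x t)"
    and J'_simps: "J' [] s t = 0"
      "J' (\<alpha> # w) s t = integral {0..s} (\<lambda>x. A' \<alpha> x t * J w x t + A \<alpha> x t * J' w x t)" for \<alpha> w s t
    by (simp_all add: J_def J'_def A_def A'_def Z_def)
  let ?D = "{0..1::real} \<times> {a..b}"
  have Znz: "Z \<alpha> s t \<noteq> 0" if "s \<in> {0..1}" "t \<in> {a..b}" "\<alpha> \<in> Rt" for \<alpha> s t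
    using nz that by (simp add: Z_def)
  have contL: "continuous_on {a..b} (\<lambda>t. L t \<alpha>)" for \<alpha>
    using der has_vector_derivative_continuous by (metis continuous_on_eq_continuous_within)
  have contL2: "continuous_on ?D (\<lambda>p. L (snd p) \<alpha>)" "continuous_on ?D (\<lambda>p. L' (snd p) \<alpha>)" for \<alpha>
    by (rule continuous_on_compose2[OF contL] continuous_on_compose2[OF contL'];
        auto intro!: continuous_intros)+
  have contZ: "continuous_on ?D (\<lambda>p. Z \<alpha> (fst p) (snd p))" for \<alpha>
    unfolding Z_def by (intro continuous_intros contL2)
  have contA: "continuous_on ?D (\<lambda>p. A \<alpha> (fst p) (snd p))"
    and contA': "continuous_on ?D (\<lambda>p. A' \<alpha> (fst p) (snd p))" if "\<alpha> \<in> Rt" for \<alpha>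
    unfolding A_def A'_def by (intro continuous_intros contL2 contZ; use Znz that in auto)+
  have contJ: "continuous_on ?D (\<lambda>(s, t). J w s t)" if "set w \<subseteq> Rt" for w
    using that
  proof (induction w)
    case (Cons \<alpha> w)
    then have "continuous_on ?D (\<lambda>(x, t). A \<alpha> x t * J w x t)"
      using contA[of \<alpha>] by (auto simp: split_beta intro!: continuous_intros)
    from continuous_on_indefinite[OF this] show ?case by (simp add: J_simps)
  qed (simp add: J_simps split_beta)
  have contJ': "continuous_on ?D (\<lambda>(s, t). J' w s t)" if "set w \<subseteq> Rt" for w
    using that
  proof (induction w)
    case (Cons \<alpha> w)
    then have "continuous_on ?D (\<lambda>(x, t). A' \<alpha> x t * J w x t + A \<alpha> x t * J' w x t)"
      using contA[of \<alpha>] contA'[of \<alpha>] contJ[of w] by (auto simp: split_beta intro!: continuous_intros)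
    from continuous_on_indefinite[OF this] show ?case by (simp add: J'_simps)
  qed (simp add: J'_simps split_beta)
  have slice: "continuous_on {0..1} (\<lambda>s. f s t)"
    if "continuous_on ?D (\<lambda>(s, t). f s t)" "t \<in> {a..b}" for f :: "real \<Rightarrow> real \<Rightarrow> complex" and t
  proof -
    have "continuous_on {0..1} (\<lambda>s. (\<lambda>(s, t). f s t) (s, t))"
      by (rule continuous_on_compose2[OF that(1)]) (use that in \<open>auto intro!: continuous_intros\<close>)
    then show ?thesis by simp
  qed
  have A_der: "((\<lambda>t. A \<alpha> s t) has_vector_derivative A' \<alpha> s t) (at t within {a..b})"
    and B_der: "((\<lambda>s. B \<alpha> s t) has_vector_derivative A' \<alpha> s t) (at s within {0..1})"
    if st: "s \<in> {0..1}" "t \<in> {a..b}" "\<alpha> \<in> Rt" for \<alpha> s t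
  proof -
    have quot: "d * (- (inverse z * (r * p) * inverse z)) + p * inverse z = p * k / z\<^sup>2"
      "(r * p) * (- (inverse z * d * inverse z)) + p * inverse z = p * k / z\<^sup>2"
      if "z \<noteq> 0" "z = k + r * d" for z k r d p :: complex
    proof -
      have k: "k = z - r * d" using that by simp
      show "d * (- (inverse z * (r * p) * inverse z)) + p * inverse z = p * k / z\<^sup>2"
        "(r * p) * (- (inverse z * d * inverse z)) + p * inverse z = p * k / z\<^sup>2"
        unfolding k using that(1) by (simp_all add: field_simps power2_eq_square)
    qed
    note quot = quot[OF Znz[OF st], of "\<kappa> \<alpha>" "of_real s" "L t \<alpha> - \<kappa> \<alpha>" "L' t \<alpha>"]
    have "((\<lambda>t. (L t \<alpha> - \<kappa> \<alpha>) * inverse (Z \<alpha> s t)) has_vector_derivative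
        (L t \<alpha> - \<kappa> \<alpha>) * (- (inverse (Z \<alpha> s t) * (of_real s * L' t \<alpha>) * inverse (Z \<alpha> s t)))
        + L' t \<alpha> * inverse (Z \<alpha> s t)) (at t within {a..b})"
    proof (rule has_vector_derivative_mult)
      show "((\<lambda>t. L t \<alpha> - \<kappa> \<alpha>) has_vector_derivative L' t \<alpha>) (at t within {a..b})"
        using has_vector_derivative_diff[OF der[OF st(2)] has_vector_derivative_const] by simp
      have "((\<lambda>t. Z \<alpha> s t) has_vector_derivative of_real s * L' t \<alpha>) (at t within {a..b})"
        unfolding Z_def using der[OF st(2), of \<alpha>]
        by (auto intro!: derivative_eq_intros simp: has_vector_derivative_def scaleR_conv_of_real algebra_simps)
      then show "((\<lambda>t. inverse (Z \<alpha> s t)) has_vector_derivative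
          - (inverse (Z \<alpha> s t) * (of_real s * L' t \<alpha>) * inverse (Z \<alpha> s t))) (at t within {a..b})"
        by (rule has_vector_derivative_inverse) (rule Znz[OF st])
    qed
    then show "((\<lambda>t. A \<alpha> s t) has_vector_derivative A' \<alpha> s t) (at t within {a..b})"
      using quot by (simp add: A_def A'_def Z_def divide_inverse)
    have "((\<lambda>s. (of_real s * L' t \<alpha>) * inverse (Z \<alpha> s t)) has_vector_derivative
        (of_real s * L' t \<alpha>) * (- (inverse (Z \<alpha> s t) * (L t \<alpha> - \<kappa> \<alpha>) * inverse (Z \<alpha> s t)))
        + L' t \<alpha> * inverse (Z \<alpha> s t)) (at s within {0..1})"
    proof (rule has_vector_derivative_mult)
      show "((\<lambda>s. of_real s * L' t \<alpha>) has_vector_derivative L' t \<alpha>) (at s within {0..1})"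
        by (auto intro!: derivative_eq_intros simp: has_vector_derivative_def scaleR_conv_of_real)
      have "((\<lambda>s. Z \<alpha> s t) has_vector_derivative (L t \<alpha> - \<kappa> \<alpha>)) (at s within {0..1})"
        unfolding Z_def
        by (auto intro!: derivative_eq_intros simp: has_vector_derivative_def scaleR_conv_of_real)
      then show "((\<lambda>s. inverse (Z \<alpha> s t)) has_vector_derivative
          - (inverse (Z \<alpha> s t) * (L t \<alpha> - \<kappa> \<alpha>) * inverse (Z \<alpha> s t))) (at s within {0..1})"
        by (rule has_vector_derivative_inverse) (rule Znz[OF st])
    qed
    then show "((\<lambda>s. B \<alpha> s t) has_vector_derivative A' \<alpha> s t) (at s within {0..1})"
      using quot by (simp add: B_def A'_def Z_def divide_inverse)
  qed
  have J_t: "((\<lambda>t. J w s t) has_vector_derivative J' w s t) (at t within {a..b})"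
    if "set w \<subseteq> Rt" "s \<in> {0..1}" "t \<in> {a..b}" for w s t
    using that
  proof (induction w arbitrary: s t)
    case (Cons \<alpha> w)
    have sub: "{0..s} \<subseteq> {0..1}" using Cons.prems by auto
    have "((\<lambda>t. integral (cbox 0 s) (\<lambda>x. A \<alpha> x t * J w x t)) has_vector_derivative
        integral (cbox 0 s) (\<lambda>x. A' \<alpha> x t * J w x t + A \<alpha> x t * J' w x t)) (at t within {a..b})"
    proof (rule leibniz_rule_vector_derivative)
      fix u x assume u: "u \<in> {a..b}" and x: "x \<in> cbox 0 s"
      have x1: "x \<in> {0..1}" using x sub by auto
      have "((\<lambda>t. A \<alpha> x t * J w x t) has_vector_derivative A \<alpha> x u * J' w x u + A' \<alpha> x u * J w x u) (at u within {a..b})"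
        by (rule has_vector_derivative_mult) (use Cons x1 u A_der in auto)
      then show "((\<lambda>t. A \<alpha> x t * J w x t) has_vector_derivative A' \<alpha> x u * J w x u + A \<alpha> x u * J' w x u) (at u within {a..b})"
        by (simp add: add.commute)
    next
      fix u assume u: "u \<in> {a..b}"
      have "continuous_on ?D (\<lambda>(x, t). A \<alpha> x t * J w x t)"
        using contA[of \<alpha>] contJ[of w] Cons.prems by (auto simp: split_beta intro!: continuous_intros)
      from continuous_on_subset[OF slice[OF this u] sub]
      show "(\<lambda>x. A \<alpha> x u * J w x u) integrable_on cbox 0 s"
        by (simp add: integrable_continuous_interval)
    next
      have "continuous_on ?D (\<lambda>(x, t). A' \<alpha> x t * J w x t + A \<alpha> x t * J' w x t)"
        using contA[of \<alpha>] contA'[of \<alpha>] contJ[of w] contJ'[of w] Cons.prems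
        by (auto simp: split_beta intro!: continuous_intros)
      then have "continuous_on ({a..b} \<times> cbox 0 s)
          (\<lambda>p. (\<lambda>(x, t). A' \<alpha> x t * J w x t + A \<alpha> x t * J' w x t) (snd p, fst p))"
        by (rule continuous_on_compose2) (use sub in \<open>auto intro!: continuous_intros\<close>)
      then show "continuous_on ({a..b} \<times> cbox 0 s) (\<lambda>(t, x). A' \<alpha> x t * J w x t + A \<alpha> x t * J' w x t)"
        by (simp add: split_beta)
    qed (use Cons.prems in auto)
    then show ?case by (simp add: J_simps J'_simps)
  next
    case Nil
    have "J [] s = (\<lambda>t. 1)" by (simp add: J_simps fun_eq_iff)
    then show ?case by (simp add: J'_simps)
  qed
  have J_s: "((\<lambda>s. J (\<alpha> # w) s t) has_vector_derivative A \<alpha> s t * J w s t) (at s within {0..1})"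
    and J'_s: "((\<lambda>s. J' (\<alpha> # w) s t) has_vector_derivative A' \<alpha> s t * J w s t + A \<alpha> s t * J' w s t) (at s within {0..1})"
    if "\<alpha> \<in> Rt" "set w \<subseteq> Rt" "s \<in> {0..1}" "t \<in> {a..b}" for \<alpha> w s t
  proof -
    have "continuous_on ?D (\<lambda>(x, t). A \<alpha> x t * J w x t)"
      "continuous_on ?D (\<lambda>(x, t). A' \<alpha> x t * J w x t + A \<alpha> x t * J' w x t)"
      using contA[of \<alpha>] contA'[of \<alpha>] contJ[of w] contJ'[of w] that
      by (auto simp: split_beta intro!: continuous_intros)
    note this = integral_has_vector_derivative[OF slice[OF this(1) that(4)] that(3)]
      integral_has_vector_derivative[OF slice[OF this(2) that(4)] that(3)]
    then show "((\<lambda>s. J (\<alpha> # w) s t) has_vector_derivative A \<alpha> s t * J w s t) (at s within {0..1})"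
      "((\<lambda>s. J' (\<alpha> # w) s t) has_vector_derivative A' \<alpha> s t * J w s t + A \<alpha> s t * J' w s t) (at s within {0..1})"
      unfolding J_simps J'_simps by blast+
  qed
  \<comment> \<open>The functional \<open>\<phi>\<close> applied to the k-th coefficient of the
    transport to the point at time s of the segment with index t.\<close>
  define Q where "Q = (\<lambda>k \<phi> s t. \<Sum>w\<in>words_of Rt k. J w s t * \<phi> (tau_word w))"
  define Q' where "Q' = (\<lambda>k \<phi> s t. \<Sum>w\<in>words_of Rt k. J' w s t * \<phi> (tau_word w))"
  have wsub: "w \<in> words_of Rt k \<Longrightarrow> set w \<subseteq> Rt" for w k by (simp add: words_of_def)
  have tw: "tau_word (\<alpha> # w) = tau \<alpha> * tau_word w" for \<alpha> w by (simp add: tau_word_def)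
  have Q_s: "((\<lambda>s. Q (Suc k) \<phi> s t) has_vector_derivative
      (\<Sum>\<alpha>\<in>Rt. A \<alpha> s t * Q k (\<lambda>u. \<phi> (tau \<alpha> * u)) s t)) (at s within {0..1})"
    if "s \<in> {0..1}" "t \<in> {a..b}" for k s t and \<phi> :: "'a \<Rightarrow> complex"
    unfolding Q_def sum_words_of_Suc[OF finite_Rt] sum_distrib_left tw
    by (intro has_vector_derivative_sum)
       (simp only: mult.assoc[symmetric],
        rule has_vector_derivative_mult_left, rule J_s, use that wsub in auto)
  have Q'_s: "((\<lambda>s. Q' (Suc k) \<phi> s t) has_vector_derivative
      (\<Sum>\<alpha>\<in>Rt. A' \<alpha> s t * Q k (\<lambda>u. \<phi> (tau \<alpha> * u)) s t + A \<alpha> s t * Q' k (\<lambda>u. \<phi> (tau \<alpha> * u)) s t))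
      (at s within {0..1})"
    if "s \<in> {0..1}" "t \<in> {a..b}" for k s t and \<phi> :: "'a \<Rightarrow> complex"
    unfolding Q_def Q'_def sum_words_of_Suc[OF finite_Rt] sum_distrib_left tw sum.distrib[symmetric]
    by (intro has_vector_derivative_sum)
       (simp only: mult.assoc[symmetric] distrib_right[symmetric],
        rule has_vector_derivative_mult_left, rule J'_s, use that wsub in auto)
  have Q_t: "((\<lambda>t. Q k \<phi> s t) has_vector_derivative Q' k \<phi> s t) (at t within {a..b})"
    if "s \<in> {0..1}" "t \<in> {a..b}" for k s t and \<phi> :: "'a \<Rightarrow> complex"
    unfolding Q_def Q'_def
    by (intro has_vector_derivative_sum has_vector_derivative_mult_left J_t) (use that wsub in auto)
  have Q'_0: "Q' 0 \<phi> s t = 0" for \<phi> :: "'a \<Rightarrow> complex" and s t by (simp add: Q'_def J'_simps)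
  have Q_0: "Q 0 \<phi> s t = \<phi> 1" for \<phi> :: "'a \<Rightarrow> complex" and s t by (simp add: Q_def J_simps tau_word_def)
  have wedge: "(\<Sum>\<alpha>\<in>Rt. \<Sum>\<beta>\<in>Rt. (A \<alpha> s t * B \<beta> s t - B \<alpha> s t * A \<beta> s t) * Q k (\<lambda>u. \<phi> (tau \<alpha> * (tau \<beta> * u))) s t) = 0"
    if \<phi>: "clin \<phi>" and st: "s \<in> {0..1}" "t \<in> {a..b}" for k s t and \<phi> :: "'a \<Rightarrow> complex"
  proof -
    have "(\<Sum>\<alpha>\<in>Rt. \<Sum>\<beta>\<in>Rt. scC (((L t \<alpha> - \<kappa> \<alpha>) * (of_real s * L' t \<beta>) - (of_real s * L' t \<alpha>) * (L t \<beta> - \<kappa> \<beta>)) / (Z \<alpha> s t * Z \<beta> s t)) (tau \<alpha> * tau \<beta>)) = 0"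
      by (rule flat) (use additive Znz st in \<open>auto simp: Modules.additive_def Z_def algebra_simps\<close>)
    moreover have "((L t \<alpha> - \<kappa> \<alpha>) * (of_real s * L' t \<beta>) - (of_real s * L' t \<alpha>) * (L t \<beta> - \<kappa> \<beta>)) / (Z \<alpha> s t * Z \<beta> s t)
        = A \<alpha> s t * B \<beta> s t - B \<alpha> s t * A \<beta> s t" for \<alpha> \<beta>
      unfolding A_def B_def times_divide_times_eq by (rule diff_divide_distrib)
    ultimately have F: "(\<Sum>\<alpha>\<in>Rt. \<Sum>\<beta>\<in>Rt. scC (A \<alpha> s t * B \<beta> s t - B \<alpha> s t * A \<beta> s t) (tau \<alpha> * tau \<beta>)) = 0"
      by simp
    have "(\<Sum>\<alpha>\<in>Rt. \<Sum>\<beta>\<in>Rt. (A \<alpha> s t * B \<beta> s t - B \<alpha> s t * A \<beta> s t) * Q k (\<lambda>u. \<phi> (tau \<alpha> * (tau \<beta> * u))) s t)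
       = (\<Sum>\<alpha>\<in>Rt. \<Sum>\<beta>\<in>Rt. \<Sum>w\<in>words_of Rt k. J w s t * \<phi> (scC (A \<alpha> s t * B \<beta> s t - B \<alpha> s t * A \<beta> s t) (tau \<alpha> * tau \<beta>) * tau_word w))"
      unfolding Q_def sum_distrib_left scC_mult_left clin_scC[OF \<phi>] by (simp add: mult.assoc mult.left_commute)
    also have "\<dots> = (\<Sum>w\<in>words_of Rt k. J w s t * \<phi> ((\<Sum>\<alpha>\<in>Rt. \<Sum>\<beta>\<in>Rt. scC (A \<alpha> s t * B \<beta> s t - B \<alpha> s t * A \<beta> s t) (tau \<alpha> * tau \<beta>)) * tau_word w))"
      unfolding sum_distrib_right clin_sum[OF \<phi>] sum_distrib_left
      by (rule trans[OF _ sum.swap], rule sum.cong[OF refl], rule sum.swap)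
    also have "\<dots> = 0" unfolding F by (simp add: clin_0[OF \<phi>])
    finally show ?thesis .
  qed
  \<comment> \<open>The difference of the two sides vanishes at s = 0. Its derivative in s is 0: for
    longer words this is the curvature term \<open>wedge\<close>. At s = 1 the identity is the
    equation of a horizontal section.\<close>
  have key: "Q' (Suc k) \<phi> s t = (\<Sum>\<alpha>\<in>Rt. B \<alpha> s t * Q k (\<lambda>u. \<phi> (tau \<alpha> * u)) s t)"
    if "clin \<phi>" "s \<in> {0..1}" "t \<in> {a..b}" for k s t and \<phi> :: "'a \<Rightarrow> complex"
    using that
  proof (induction k arbitrary: \<phi> s t)
    case 0
    let ?E = "\<lambda>s. Q' (Suc 0) \<phi> s t - (\<Sum>\<alpha>\<in>Rt. B \<alpha> s t * \<phi> (tau \<alpha>))"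
    have "(?E has_vector_derivative 0) (at s within {0..1})" if s: "s \<in> {0..1}" for s
    proof -
      have "(?E has_vector_derivative (\<Sum>\<alpha>\<in>Rt. A' \<alpha> s t * \<phi> (tau \<alpha>)) - (\<Sum>\<alpha>\<in>Rt. A' \<alpha> s t * \<phi> (tau \<alpha>))) (at s within {0..1})"
      proof (rule has_vector_derivative_diff)
        show "((\<lambda>s. Q' (Suc 0) \<phi> s t) has_vector_derivative (\<Sum>\<alpha>\<in>Rt. A' \<alpha> s t * \<phi> (tau \<alpha>))) (at s within {0..1})"
          using Q'_s[OF s 0(3), of 0 \<phi>] by (simp add: Q'_0 Q_0)
        show "((\<lambda>s. \<Sum>\<alpha>\<in>Rt. B \<alpha> s t * \<phi> (tau \<alpha>)) has_vector_derivative (\<Sum>\<alpha>\<in>Rt. A' \<alpha> s t * \<phi> (tau \<alpha>))) (at s within {0..1})"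
          by (intro has_vector_derivative_sum has_vector_derivative_mult_left B_der) (use s 0 in auto)
      qed
      then show ?thesis by simp
    qed
    from vector_derivative_zero_const[OF this 0(2)] have "?E s = ?E 0" .
    also have "?E 0 = 0" by (simp add: Q'_def sum_words_of_Suc[OF finite_Rt] J'_simps B_def)
    finally show ?case by (simp add: Q_0)
  next
    case (Suc k)
    let ?E = "\<lambda>s. Q' (Suc (Suc k)) \<phi> s t - (\<Sum>\<alpha>\<in>Rt. B \<alpha> s t * Q (Suc k) (\<lambda>u. \<phi> (tau \<alpha> * u)) s t)"
    have "(?E has_vector_derivative 0) (at s within {0..1})" if s: "s \<in> {0..1}" for s
    proof -
      let ?q = "\<lambda>\<alpha> \<beta>. Q k (\<lambda>u. \<phi> (tau \<alpha> * (tau \<beta> * u))) s t"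
      have "(?E has_vector_derivative
          (\<Sum>\<alpha>\<in>Rt. A' \<alpha> s t * Q (Suc k) (\<lambda>u. \<phi> (tau \<alpha> * u)) s t + A \<alpha> s t * Q' (Suc k) (\<lambda>u. \<phi> (tau \<alpha> * u)) s t)
          - (\<Sum>\<alpha>\<in>Rt. B \<alpha> s t * (\<Sum>\<beta>\<in>Rt. A \<beta> s t * ?q \<alpha> \<beta>) + A' \<alpha> s t * Q (Suc k) (\<lambda>u. \<phi> (tau \<alpha> * u)) s t))
          (at s within {0..1})"
        by (intro has_vector_derivative_diff Q'_s has_vector_derivative_sum has_vector_derivative_mult Q_s B_der)
           (use s Suc.prems in auto)
      also have "(\<Sum>\<alpha>\<in>Rt. A' \<alpha> s t * Q (Suc k) (\<lambda>u. \<phi> (tau \<alpha> * u)) s t + A \<alpha> s t * Q' (Suc k) (\<lambda>u. \<phi> (tau \<alpha> * u)) s t)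
          - (\<Sum>\<alpha>\<in>Rt. B \<alpha> s t * (\<Sum>\<beta>\<in>Rt. A \<beta> s t * ?q \<alpha> \<beta>) + A' \<alpha> s t * Q (Suc k) (\<lambda>u. \<phi> (tau \<alpha> * u)) s t)
          = (\<Sum>\<alpha>\<in>Rt. A \<alpha> s t * (\<Sum>\<beta>\<in>Rt. B \<beta> s t * ?q \<alpha> \<beta>)) - (\<Sum>\<alpha>\<in>Rt. B \<alpha> s t * (\<Sum>\<beta>\<in>Rt. A \<beta> s t * ?q \<alpha> \<beta>))"
        using Suc.IH[OF clin_left[OF Suc.prems(1)] s Suc.prems(3)] by (simp add: sum.distrib)
      also have "\<dots> = (\<Sum>\<alpha>\<in>Rt. \<Sum>\<beta>\<in>Rt. (A \<alpha> s t * B \<beta> s t - B \<alpha> s t * A \<beta> s t) * ?q \<alpha> \<beta>)"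
        by (simp add: sum_distrib_left sum_subtractf left_diff_distrib mult.assoc)
      also have "\<dots> = 0" by (rule wedge[OF Suc.prems(1) s Suc.prems(3)])
      finally show ?thesis .
    qed
    from vector_derivative_zero_const[OF this Suc.prems(2)] have "?E s = ?E 0" .
    also have "?E 0 = 0" by (simp add: Q'_def sum_words_of_Suc[OF finite_Rt] J'_simps B_def)
    finally show ?case by simp
  qed
  have one: "(1::real) \<in> {0..1}" by simp
  have PQ: "\<phi> (transport \<kappa> (L t) $ k) = Q k \<phi> 1 t" if "clin \<phi>" for \<phi> :: "'a \<Rightarrow> complex" and k t
    by (simp add: transport_def transport_coeff_def Q_def J_def clin_sum[OF that] clin_scC[OF that])
  show ?thesis
    unfolding horizontal_def
  proof (intro allI impI ballI)
    fix \<phi> k t assume \<phi>: "clin (\<phi> :: 'a \<Rightarrow> complex)" and t: "t \<in> {a..b}"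
    have "Q' k \<phi> 1 t = (\<Sum>\<alpha>\<in>Rt. L' t \<alpha> / L t \<alpha> * \<phi> (tau \<alpha> * (fps_X * transport \<kappa> (L t)) $ k))"
    proof (cases k)
      case 0
      then show ?thesis by (simp add: Q'_0 clin_0[OF \<phi>])
    next
      case (Suc j)
      then show ?thesis
        using PQ[OF clin_left[OF \<phi>]] by (simp add: key[OF \<phi> one t] B_def Z_def)
    qed
    then show "((\<lambda>t. \<phi> (transport \<kappa> (L t) $ k)) has_vector_derivative
       (\<Sum>\<alpha>\<in>Rt. L' t \<alpha> / L t \<alpha> * \<phi> (tau \<alpha> * (fps_X * transport \<kappa> (L t)) $ k))) (at t within {a..b})"
      using Q_t[OF one t, of k \<phi>] by (simp add: PQ[OF \<phi>])
  qed
qed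

end

section \<open>Simply laced root systems\<close>

text \<open>Entries off the diagonal occur in equal pairs.\<close>

lemma even_symmetric_sum:
  fixes f :: "'i \<Rightarrow> 'i \<Rightarrow> int"
  assumes "finite I" "\<And>i j. f i j = f j i" "\<And>i. even (f i i)"
  shows "even (\<Sum>i\<in>I. \<Sum>j\<in>I. f i j)"
  using assms(1)
proof (induction I)
  case (insert x I)
  have "(\<Sum>i\<in>insert x I. \<Sum>j\<in>insert x I. f i j)
      = f x x + (\<Sum>j\<in>I. f x j) + ((\<Sum>i\<in>I. f i x) + (\<Sum>i\<in>I. \<Sum>j\<in>I. f i j))"
    using insert by (simp add: sum.distrib)
  also have "(\<Sum>i\<in>I. f i x) = (\<Sum>j\<in>I. f x j)" by (simp add: assms(2))
  finally show ?case using insert assms(3) by simp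
qed simp

text \<open>All that is used of the classification: the diagram is a simple graph with positive
  definite Tits form.\<close>

locale tits =
  fixes n :: nat and adj :: "nat \<Rightarrow> nat \<Rightarrow> bool"
  assumes adj_sym: "i \<in> {1..n} \<Longrightarrow> j \<in> {1..n} \<Longrightarrow> adj i j \<Longrightarrow> adj j i"
    and adj_irrefl: "i \<in> {1..n} \<Longrightarrow> \<not> adj i i"
    and positive: "v \<noteq> (\<lambda>_. 0) \<Longrightarrow> (\<And>i. i \<notin> {1..n} \<Longrightarrow> v i = 0) \<Longrightarrow>
      (\<Sum>i=1..n. \<Sum>j=1..n. (if i = j then 2 else if adj i j then - 1 else 0) * v i * v j) > (0::int)"
begin

definition cartan :: "nat \<Rightarrow> nat \<Rightarrow> int" where
  "cartan i j = (if i = j then 2 else if adj i j then - 1 else 0)"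

definition bil :: "(nat \<Rightarrow> int) \<Rightarrow> (nat \<Rightarrow> int) \<Rightarrow> int" where
  "bil v w = (\<Sum>i=1..n. \<Sum>j=1..n. cartan i j * v i * w j)"

definition lat :: "(nat \<Rightarrow> int) set" where "lat = {v. \<forall>i. i \<notin> {1..n} \<longrightarrow> v i = 0}"

definition simple :: "nat \<Rightarrow> nat \<Rightarrow> int" where "simple i = (\<lambda>j. if j = i then 1 else 0)"

definition roots :: "(nat \<Rightarrow> int) set" where "roots = {v \<in> lat. bil v v = 2}"

definition pos :: "(nat \<Rightarrow> int) set" where "pos = {v \<in> roots. \<forall>i. v i \<ge> 0}"

definition ht :: "(nat \<Rightarrow> int) \<Rightarrow> int" where "ht v = (\<Sum>i=1..n. v i)"

definition sc :: "int \<Rightarrow> (nat \<Rightarrow> int) \<Rightarrow> nat \<Rightarrow> int" where "sc c v = (\<lambda>i. c * v i)"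

definition refl :: "(nat \<Rightarrow> int) \<Rightarrow> (nat \<Rightarrow> int) \<Rightarrow> nat \<Rightarrow> int" where
  "refl \<alpha> \<beta> = \<beta> - sc (bil \<beta> \<alpha>) \<alpha>"

lemma cartan_sym: "i \<in> {1..n} \<Longrightarrow> j \<in> {1..n} \<Longrightarrow> cartan i j = cartan j i"
  using adj_sym by (auto simp: cartan_def)

lemma bil_add: "bil (u + v) w = bil u w + bil v w" "bil w (u + v) = bil w u + bil w v"
  by (simp_all add: bil_def sum.distrib algebra_simps)

lemma bil_sc: "bil (sc c u) w = c * bil u w" "bil w (sc c u) = c * bil w u"
  by (simp_all add: bil_def sc_def sum_distrib_left algebra_simps)

lemma bil_minus: "bil (- u) w = - bil u w" "bil w (- u) = - bil w u"
  by (simp_all add: bil_def sum_negf)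

lemma bil_diff: "bil (u - v) w = bil u w - bil v w" "bil w (u - v) = bil w u - bil w v"
  by (simp_all add: bil_def sum_subtractf algebra_simps)

lemma bil_sym: "bil u v = bil v u"
  unfolding bil_def
  by (subst sum.swap, intro sum.cong refl) (simp add: cartan_sym algebra_simps)

lemmas bil_simps = bil_add bil_sc bil_minus bil_diff

lemma bil_simple: "i \<in> {1..n} \<Longrightarrow> bil v (simple i) = (\<Sum>j=1..n. cartan j i * v j)"
  by (simp add: bil_def simple_def if_distrib cong: if_cong)

lemma bil_simple_simple: "i \<in> {1..n} \<Longrightarrow> j \<in> {1..n} \<Longrightarrow> bil (simple i) (simple j) = cartan i j"
  by (simp add: bil_simple) (simp add: simple_def if_distrib cong: if_cong)

lemma bil_expand: "bil u v = (\<Sum>i=1..n. v i * bil u (simple i))"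
proof -
  have "(\<Sum>i=1..n. v i * bil u (simple i)) = (\<Sum>i=1..n. \<Sum>j=1..n. cartan j i * u j * v i)"
    by (intro sum.cong refl) (simp add: bil_simple sum_distrib_left algebra_simps)
  then show ?thesis unfolding bil_def by (subst (asm) sum.swap) simp
qed

lemma bil_pos: "v \<in> lat \<Longrightarrow> v \<noteq> 0 \<Longrightarrow> bil v v > 0"
  using positive[of v] by (auto simp: lat_def bil_def cartan_def zero_fun_def)

lemma bil_even: "even (bil v v)"
proof -
  \<comment> \<open>Symmetry and evenness are required at all indices, so the Cartan matrix is
    continued by 2 outside the diagram.\<close>
  have "bil v v = (\<Sum>i\<in>{1..n}. \<Sum>j\<in>{1..n}. (if i \<in> {1..n} \<and> j \<in> {1..n} then cartan i j else 2) * v i * v j)"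
    unfolding bil_def by (intro sum.cong) auto
  also have "even \<dots>"
  proof (rule even_symmetric_sum)
    fix i j
    show "(if i \<in> {1..n} \<and> j \<in> {1..n} then cartan i j else 2) * v i * v j =
        (if j \<in> {1..n} \<and> i \<in> {1..n} then cartan j i else 2) * v j * v i"
      using cartan_sym[of i j] by (auto simp: mult_ac)
  qed (auto simp: cartan_def)
  finally show ?thesis .
qed

lemma bil_ge_2: "v \<in> lat \<Longrightarrow> v \<noteq> 0 \<Longrightarrow> bil v v \<ge> 2"
  using bil_pos[of v] bil_even[of v] by (cases "bil v v = 1") auto

lemma lat_closed: "u \<in> lat \<Longrightarrow> v \<in> lat \<Longrightarrow> u + v \<in> lat" "u \<in> lat \<Longrightarrow> v \<in> lat \<Longrightarrow> u - v \<in> lat"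
  "u \<in> lat \<Longrightarrow> - u \<in> lat" "u \<in> lat \<Longrightarrow> sc c u \<in> lat" "i \<in> {1..n} \<Longrightarrow> simple i \<in> lat"
  by (auto simp: lat_def sc_def simple_def)

lemma simple_root: "i \<in> {1..n} \<Longrightarrow> simple i \<in> roots"
  by (simp add: roots_def lat_closed bil_simple_simple cartan_def)

lemma simple_pos: "i \<in> {1..n} \<Longrightarrow> simple i \<in> pos"
  by (simp add: pos_def simple_root) (simp add: simple_def)

lemma minus_root: "\<alpha> \<in> roots \<Longrightarrow> - \<alpha> \<in> roots"
  by (simp add: roots_def lat_closed bil_simps)

lemma root_nonzero: "\<alpha> \<in> roots \<Longrightarrow> \<alpha> \<noteq> 0"
  by (auto simp: roots_def bil_def)

lemma bil_root: "\<alpha> \<in> roots \<Longrightarrow> bil \<alpha> \<alpha> = 2" by (simp add: roots_def)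

lemma bil_roots:
  assumes "\<alpha> \<in> roots" "\<beta> \<in> roots"
  shows "bil \<alpha> \<beta> \<in> {-2, -1, 0, 1, 2}" "bil \<alpha> \<beta> = 2 \<longleftrightarrow> \<alpha> = \<beta>" "bil \<alpha> \<beta> = -2 \<longleftrightarrow> \<alpha> = - \<beta>"
proof -
  have p: "bil (\<alpha> + \<beta>) (\<alpha> + \<beta>) = 4 + 2 * bil \<alpha> \<beta>" and m: "bil (\<alpha> - \<beta>) (\<alpha> - \<beta>) = 4 - 2 * bil \<alpha> \<beta>"
    using assms bil_sym[of \<beta> \<alpha>] by (simp_all add: bil_simps bil_root)
  have lat: "\<alpha> \<in> lat" "\<beta> \<in> lat" using assms by (auto simp: roots_def)
  have m1: "\<alpha> \<noteq> \<beta> \<Longrightarrow> bil \<alpha> \<beta> < 2"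
    using bil_pos[of "\<alpha> - \<beta>"] m lat_closed lat by (auto simp: bil_def)
  have p1: "\<alpha> \<noteq> - \<beta> \<Longrightarrow> bil \<alpha> \<beta> > -2"
    using bil_pos[of "\<alpha> + \<beta>"] p lat_closed lat by (auto simp: eq_neg_iff_add_eq_0)
  have "bil \<alpha> \<beta> = 2" if "\<alpha> = \<beta>" using that assms by (simp add: bil_root)
  moreover have "bil \<alpha> \<beta> = -2" if "\<alpha> = - \<beta>" using that assms by (simp add: bil_root bil_simps)
  ultimately show "bil \<alpha> \<beta> \<in> {-2, -1, 0, 1, 2}" "bil \<alpha> \<beta> = 2 \<longleftrightarrow> \<alpha> = \<beta>" "bil \<alpha> \<beta> = -2 \<longleftrightarrow> \<alpha> = - \<beta>"
    using m1 p1 by (cases "\<alpha> = \<beta>"; cases "\<alpha> = - \<beta>"; auto)+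
qed

lemma sc_simps: "sc 0 v = 0" "sc 1 v = v" "sc (- c) v = - sc c v" "sc 2 v = v + v" "sc c 0 = 0"
  "sc c (u + v) = sc c u + sc c v" "sc c (u - v) = sc c u - sc c v" "sc c (- v) = - sc c v"
  "sc (c + d) v = sc c v + sc d v" "sc (c - d) v = sc c v - sc d v" "sc c (sc d v) = sc (c * d) v"
  by (auto simp: sc_def fun_eq_iff algebra_simps)

lemma refl_bil: "\<alpha> \<in> roots \<Longrightarrow> bil (refl \<alpha> u) (refl \<alpha> v) = bil u v"
  using bil_sym[of \<alpha> v] by (simp add: refl_def bil_simps bil_root algebra_simps)

lemma refl_root: "\<alpha> \<in> roots \<Longrightarrow> \<beta> \<in> roots \<Longrightarrow> refl \<alpha> \<beta> \<in> roots"
  using refl_bil[of \<alpha> \<beta> \<beta>] by (auto simp: roots_def refl_def intro!: lat_closed)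

lemma refl_refl: "\<alpha> \<in> roots \<Longrightarrow> refl \<alpha> (refl \<alpha> \<beta>) = \<beta>"
  by (simp add: refl_def bil_simps bil_root sc_simps)

lemma refl_add: "refl \<alpha> (u + v) = refl \<alpha> u + refl \<alpha> v" "refl \<alpha> (- u) = - refl \<alpha> u"
  "refl \<alpha> (u - v) = refl \<alpha> u - refl \<alpha> v" "refl \<alpha> (sc c u) = sc c (refl \<alpha> u)" "refl (- \<alpha>) u = refl \<alpha> u"
  by (simp_all add: refl_def bil_simps sc_simps)

lemma refl_self: "\<alpha> \<in> roots \<Longrightarrow> refl \<alpha> \<alpha> = - \<alpha>"
  by (simp add: refl_def bil_root sc_simps)

lemma refl_conj: "\<alpha> \<in> roots \<Longrightarrow> refl (refl \<alpha> \<beta>) v = refl \<alpha> (refl \<beta> (refl \<alpha> v))"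
proof -
  assume a: "\<alpha> \<in> roots"
  have "bil v (refl \<alpha> \<beta>) = bil (refl \<alpha> v) \<beta>"
    using bil_sym[of \<beta> \<alpha>] by (simp add: refl_def bil_simps)
  then show ?thesis
    by (simp add: refl_def[of "refl \<alpha> \<beta>"] refl_def[of \<beta> "refl \<alpha> v"] refl_add refl_refl[OF a])
qed

lemma ht_add: "ht (u + v) = ht u + ht v" "ht (- u) = - ht u" "ht (u - v) = ht u - ht v" "ht (sc c u) = c * ht u"
  by (simp_all add: ht_def sum.distrib sum_negf sum_subtractf sc_def sum_distrib_left)

lemma ht_simple: "i \<in> {1..n} \<Longrightarrow> ht (simple i) = 1"
  by (simp add: ht_def simple_def)

lemma pos_ht: "\<alpha> \<in> pos \<Longrightarrow> ht \<alpha> \<ge> 1"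
proof -
  assume a: "\<alpha> \<in> pos"
  then have "\<alpha> \<noteq> 0" using root_nonzero by (auto simp: pos_def)
  then obtain i where i: "\<alpha> i \<noteq> 0" by (auto simp: fun_eq_iff)
  have "i \<in> {1..n}" using a i by (auto simp: pos_def roots_def lat_def)
  moreover have "\<alpha> i \<ge> 1" using a i by (auto simp: pos_def dest!: spec[of _ i])
  moreover have "\<alpha> i \<le> ht \<alpha>" unfolding ht_def
    by (rule member_le_sum) (use a calculation in \<open>auto simp: pos_def\<close>)
  ultimately show ?thesis by simp
qed

text \<open>The positive part p and the negative part q have disjoint supports, hence a product at
  most 0. So the norms of p and q add up to at most 2, while every nonzero lattice vector has norm
  at least 2.\<close>

lemma pos_or_neg:
  assumes "\<alpha> \<in> roots" shows "\<alpha> \<in> pos \<or> - \<alpha> \<in> pos"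
proof -
  define p where "p = (\<lambda>i. max (\<alpha> i) 0)"
  define q where "q = (\<lambda>i. max (- \<alpha> i) 0)"
  have \<alpha>: "\<alpha> = p - q" by (auto simp: p_def q_def fun_eq_iff)
  have lat: "p \<in> lat" "q \<in> lat" using assms by (auto simp: roots_def lat_def p_def q_def)
  have "cartan i j * p i * q j \<le> 0" for i j
  proof (cases "i = j")
    case True
    then show ?thesis by (auto simp: p_def q_def max_def)
  next
    case False
    then have "cartan i j \<le> 0" "p i * q j \<ge> 0" by (simp_all add: cartan_def p_def q_def)
    then show ?thesis by (simp add: mult.assoc mult_nonpos_nonneg)
  qed
  then have "bil p q \<le> 0" unfolding bil_def by (intro sum_nonpos)
  moreover have "bil \<alpha> \<alpha> = bil p p + bil q q - 2 * bil p q"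
    unfolding \<alpha> using bil_sym[of q p] by (simp add: bil_simps)
  ultimately have "bil p p + bil q q \<le> 2" using assms by (simp add: bil_root)
  then have "p = 0 \<or> q = 0" using bil_ge_2[OF lat(1)] bil_ge_2[OF lat(2)] by linarith
  then have "(\<forall>i. \<alpha> i \<ge> 0) \<or> (\<forall>i. \<alpha> i \<le> 0)"
  proof
    assume "p = 0"
    then have "max (\<alpha> i) 0 = 0" for i by (metis p_def zero_fun_apply)
    then show ?thesis by (metis max.cobounded1)
  next
    assume "q = 0"
    then have "max (- \<alpha> i) 0 = 0" for i by (metis q_def zero_fun_apply)
    then show ?thesis by (metis max.cobounded1 neg_le_0_iff_le)
  qed
  then show ?thesis using assms minus_root[OF assms] by (auto simp: pos_def)
qed

lemma not_both: "\<alpha> \<in> pos \<Longrightarrow> - \<alpha> \<notin> pos"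
  using pos_ht[of \<alpha>] pos_ht[of "- \<alpha>"] by (auto simp: ht_add)

lemma pos_root: "\<alpha> \<in> pos \<Longrightarrow> \<alpha> \<in> roots" by (simp add: pos_def)

lemma pos_eq_simple:
  assumes "\<alpha> \<in> pos" "i \<in> {1..n}" "\<And>j. j \<noteq> i \<Longrightarrow> \<alpha> j = 0"
  shows "\<alpha> = simple i"
proof -
  have *: "\<alpha> = sc (\<alpha> i) (simple i)" using assms(3) by (auto simp: sc_def simple_def fun_eq_iff)
  then have "bil \<alpha> \<alpha> = (\<alpha> i * \<alpha> i) * 2"
    using assms(2) by (metis bil_root bil_sc mult.assoc simple_root)
  then have "\<alpha> i * \<alpha> i = 1" using assms(1) by (simp add: pos_def roots_def)
  moreover have "\<alpha> i \<ge> 0" using assms(1) by (simp add: pos_def)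
  ultimately have "\<alpha> i = 1" by (auto simp: zmult_eq_1_iff)
  then show ?thesis using * by (simp add: sc_simps)
qed

text \<open>A simple reflection changes one coefficient only. Some other coefficient is positive,
  and it decides the sign of the image.\<close>

lemma refl_pos:
  assumes "\<alpha> \<in> pos" "i \<in> {1..n}" "\<alpha> \<noteq> simple i"
  shows "refl (simple i) \<alpha> \<in> pos"
proof -
  obtain j where j: "j \<noteq> i" "\<alpha> j \<noteq> 0" using pos_eq_simple[OF assms(1,2)] assms(3) by blast
  then have "\<alpha> j > 0" using assms(1) by (auto simp: pos_def dest!: spec[of _ j])
  moreover have "refl (simple i) \<alpha> j = \<alpha> j" using j by (simp add: refl_def sc_def simple_def)
  ultimately have "- refl (simple i) \<alpha> \<notin> pos" by (auto simp: pos_def intro!: exI[of _ j])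
  then show ?thesis
    using pos_or_neg[OF refl_root[OF simple_root[OF assms(2)] pos_root[OF assms(1)]]] by blast
qed

lemma pos_descent:
  assumes "\<alpha> \<in> pos"
  shows "(\<exists>i\<in>{1..n}. \<alpha> = simple i) \<or> (\<exists>i\<in>{1..n}. bil \<alpha> (simple i) = 1)"
proof -
  have "0 < (\<Sum>i=1..n. \<alpha> i * bil \<alpha> (simple i))"
    using bil_expand[of \<alpha> \<alpha>] assms by (simp add: pos_def roots_def)
  then obtain i where i: "i \<in> {1..n}" "\<alpha> i * bil \<alpha> (simple i) > 0"
    by (meson sum_nonpos not_le)
  moreover have "\<alpha> i \<ge> 0" using assms by (simp add: pos_def)
  ultimately have "bil \<alpha> (simple i) > 0" by (simp add: zero_less_mult_iff)
  then show ?thesis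
    using bil_roots[OF pos_root[OF assms] simple_root[OF i(1)]] i by auto
qed

text \<open>Roots that agree modulo 2 are equal up to sign, for otherwise half of their difference
  would be a nonzero lattice vector of norm less than 2. The number of classes modulo 2 is
  finite.\<close>

lemma finite_roots: "finite roots"
proof -
  let ?par = "\<lambda>v::nat\<Rightarrow>int. {i \<in> {1..n}. odd (v i)}"
  have "\<beta> = \<alpha> \<or> \<beta> = - \<alpha>" if ab: "\<alpha> \<in> roots" "\<beta> \<in> roots" and par: "?par \<alpha> = ?par \<beta>" for \<alpha> \<beta>
  proof (rule ccontr)
    assume ne: "\<not> (\<beta> = \<alpha> \<or> \<beta> = - \<alpha>)"
    define \<gamma> where "\<gamma> = (\<lambda>i. (\<alpha> i - \<beta> i) div 2)"
    have lat: "\<alpha> \<in> lat" "\<beta> \<in> lat" using ab by (auto simp: roots_def)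
    have ev: "even (\<alpha> i - \<beta> i)" for i
      using lat par by (cases "i \<in> {1..n}") (auto simp: lat_def set_eq_iff)
    have *: "sc 2 \<gamma> = \<alpha> - \<beta>" using ev by (auto simp: sc_def \<gamma>_def fun_eq_iff)
    have "\<gamma> \<in> lat" using lat by (auto simp: lat_def \<gamma>_def)
    moreover have "\<gamma> \<noteq> 0" using * ne by (auto simp: sc_simps)
    ultimately have "bil \<gamma> \<gamma> \<ge> 2" by (rule bil_ge_2)
    moreover have "4 * bil \<gamma> \<gamma> = bil (\<alpha> - \<beta>) (\<alpha> - \<beta>)" unfolding *[symmetric] by (simp add: bil_simps)
    moreover have "bil (\<alpha> - \<beta>) (\<alpha> - \<beta>) = 4 - 2 * bil \<alpha> \<beta>"
      using ab bil_sym[of \<beta> \<alpha>] by (simp add: bil_simps bil_root)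
    ultimately show False using bil_roots[OF ab] ne by auto
  qed
  then have "finite (?par -` {P} \<inter> roots)" for P
  proof (cases "?par -` {P} \<inter> roots = {}")
    case False
    then obtain \<alpha> where "\<alpha> \<in> roots" "?par \<alpha> = P" by auto
    then have "?par -` {P} \<inter> roots \<subseteq> {\<alpha>, - \<alpha>}"
      using \<open>\<And>\<beta> \<alpha>. \<lbrakk>\<alpha> \<in> roots; \<beta> \<in> roots; ?par \<alpha> = ?par \<beta>\<rbrakk> \<Longrightarrow> \<beta> = \<alpha> \<or> \<beta> = - \<alpha>\<close>
      by blast
    then show ?thesis by (rule finite_subset) simp
  qed simp
  moreover have "finite (?par ` roots)" by (rule finite_subset[of _ "Pow {1..n}"]) auto
  ultimately have "finite (?par -` (?par ` roots) \<inter> roots)" using finite_finite_vimage_IntI by blast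
  moreover have "?par -` (?par ` roots) \<inter> roots = roots" by blast
  ultimately show ?thesis by simp
qed


lemma pos_sub_simple:
  assumes "\<alpha> \<in> pos" "i \<in> {1..n}" "bil \<alpha> (simple i) = 1"
  shows "\<alpha> - simple i \<in> pos" "\<alpha> - simple i = refl (simple i) \<alpha>" "ht (\<alpha> - simple i) = ht \<alpha> - 1"
proof -
  show *: "\<alpha> - simple i = refl (simple i) \<alpha>" using assms by (simp add: refl_def sc_simps)
  have "\<alpha> \<noteq> simple i" using assms bil_simple_simple[of i i] by (auto simp: cartan_def)
  then show "\<alpha> - simple i \<in> pos" unfolding * using refl_pos assms by blast
  show "ht (\<alpha> - simple i) = ht \<alpha> - 1" using assms by (simp add: ht_add ht_simple)
qed

lemma simple_inj: "simple i = simple j \<Longrightarrow> i = j"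
  by (metis simple_def zero_neq_one)

end

declare uminus_apply [simp del] minus_apply [simp del]

text \<open>The images of all reflections are found by recursion on the height of the root.\<close>

locale coxeter_rep = tits +
  fixes r :: "nat \<Rightarrow> 'a::ring_1"
  assumes r_sq: "i \<in> {1..n} \<Longrightarrow> r i * r i = 1"
    and r_comm: "i \<in> {1..n} \<Longrightarrow> j \<in> {1..n} \<Longrightarrow> \<not> adj i j \<Longrightarrow> r i * r j = r j * r i"
    and r_braid: "i \<in> {1..n} \<Longrightarrow> j \<in> {1..n} \<Longrightarrow> adj i j \<Longrightarrow> r i * r j * r i = r j * r i * r j"
begin

fun rho_ht :: "nat \<Rightarrow> (nat \<Rightarrow> int) \<Rightarrow> 'a" where
  "rho_ht 0 \<alpha> = 0"
| "rho_ht (Suc h) \<alpha> = (if \<exists>i\<in>{1..n}. \<alpha> = simple i then r (THE i. \<alpha> = simple i)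
     else let j = (SOME j. j \<in> {1..n} \<and> bil \<alpha> (simple j) = 1) in r j * rho_ht h (\<alpha> - simple j) * r j)"

definition rho :: "(nat \<Rightarrow> int) \<Rightarrow> 'a" where
  "rho \<alpha> = (if \<alpha> \<in> pos then rho_ht (nat (ht \<alpha>)) \<alpha> else rho_ht (nat (ht (- \<alpha>))) (- \<alpha>))"

lemma rho_minus: "\<alpha> \<in> roots \<Longrightarrow> rho (- \<alpha>) = rho \<alpha>"
  using pos_or_neg[of \<alpha>] not_both[of \<alpha>] by (auto simp: rho_def)

lemma rho_simple: "i \<in> {1..n} \<Longrightarrow> rho (simple i) = r i"
proof -
  assume i: "i \<in> {1..n}"
  have "(THE j. simple i = simple j) = i" using simple_inj by blast
  then show ?thesis using i by (auto simp: rho_def simple_pos ht_simple)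
qed

lemma rho_rec:
  assumes "\<alpha> \<in> pos" "\<not> (\<exists>i\<in>{1..n}. \<alpha> = simple i)"
  obtains j where "j \<in> {1..n}" "bil \<alpha> (simple j) = 1" "rho \<alpha> = r j * rho (\<alpha> - simple j) * r j"
proof -
  define j where "j = (SOME j. j \<in> {1..n} \<and> bil \<alpha> (simple j) = 1)"
  have j: "j \<in> {1..n}" "bil \<alpha> (simple j) = 1"
  proof -
    have "\<exists>j. j \<in> {1..n} \<and> bil \<alpha> (simple j) = 1" using pos_descent[OF assms(1)] assms(2) by blast
    then show "j \<in> {1..n}" "bil \<alpha> (simple j) = 1" unfolding j_def by (rule someI2_ex, blast)+
  qed
  obtain h where h: "nat (ht \<alpha>) = Suc h" using pos_ht[OF assms(1)] by (cases "nat (ht \<alpha>)") auto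
  have "nat (ht (\<alpha> - simple j)) = h"
    using pos_sub_simple[OF assms(1) j] pos_ht[OF assms(1)] h by simp
  then have "rho \<alpha> = r j * rho (\<alpha> - simple j) * r j"
    using assms h pos_sub_simple[OF assms(1) j] unfolding rho_def by (simp only: rho_ht.simps j_def[symmetric] Let_def if_False if_True)
  then show ?thesis using that j by blast
qed

lemma rrK: "i \<in> {1..n} \<Longrightarrow> r i * (r i * x) = x"
  using r_sq[of i] by (simp add: mult.assoc[symmetric])

lemma r_braid': "i \<in> {1..n} \<Longrightarrow> j \<in> {1..n} \<Longrightarrow> adj i j \<Longrightarrow> r i * (r j * (r i * x)) = r j * (r i * (r j * x))"
  using arg_cong[OF r_braid[of i j], of "\<lambda>y. y * x"] by (simp add: mult.assoc)

lemma r_comm': "i \<in> {1..n} \<Longrightarrow> j \<in> {1..n} \<Longrightarrow> \<not> adj i j \<Longrightarrow> r i * (r j * x) = r j * (r i * x)"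
  using arg_cong[OF r_comm[of i j], of "\<lambda>y. y * x"] by (simp add: mult.assoc)

text \<open>The recursion for \<open>rho\<close> picks an arbitrary descent, so its independence of
  the choice has to be shown. The commutation with \<open>r i\<close> for an orthogonal simple root
  is proved along with it, since it uses the independence at smaller height.\<close>

lemma rho_step:
  assumes "\<alpha> \<in> pos"
  shows "\<forall>i\<in>{1..n}. (bil \<alpha> (simple i) = 1 \<longrightarrow> rho \<alpha> = r i * rho (\<alpha> - simple i) * r i)
     \<and> (bil \<alpha> (simple i) = 0 \<longrightarrow> r i * rho \<alpha> = rho \<alpha> * r i)"
  using assms
proof (induction "nat (ht \<alpha>)" arbitrary: \<alpha> rule: less_induct)
  case less
  note IH = less.hyps and \<alpha> = \<open>\<alpha> \<in> pos\<close>
  show ?case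
  proof (cases "\<exists>k\<in>{1..n}. \<alpha> = simple k")
    case True
    then obtain k where k: "k \<in> {1..n}" "\<alpha> = simple k" by blast
    show ?thesis
    proof (intro ballI conjI impI)
      fix i assume i: "i \<in> {1..n}"
      show "rho \<alpha> = r i * rho (\<alpha> - simple i) * r i" if "bil \<alpha> (simple i) = 1"
        using that i k by (auto simp: bil_simple_simple cartan_def split: if_splits)
      show "r i * rho \<alpha> = rho \<alpha> * r i" if "bil \<alpha> (simple i) = 0"
      proof -
        have "\<not> adj k i" using that i k by (auto simp: bil_simple_simple cartan_def split: if_splits)
        then show ?thesis using i k by (simp add: rho_simple r_comm)
      qed
    qed
  next
    case False
    then obtain j where j: "j \<in> {1..n}" "bil \<alpha> (simple j) = 1" and rj: "rho \<alpha> = r j * rho (\<alpha> - simple j) * r j"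
      using rho_rec[OF \<alpha>] by metis
    let ?b = "\<alpha> - simple j"
    note b = pos_sub_simple[OF \<alpha> j]
    have lt: "nat (ht ?b) < nat (ht \<alpha>)" using b(3) pos_ht[OF \<alpha>] by simp
    note IHb = IH[OF lt b(1)]
    have bb: "bil ?b v = bil \<alpha> v - bil (simple j) v" for v by (simp add: bil_simps)
    show ?thesis
    proof (intro ballI conjI impI)
      fix i assume i: "i \<in> {1..n}"
      have js: "bil (simple j) (simple i) = (if i = j then 2 else if adj j i then -1 else 0)"
        using i j by (auto simp: bil_simple_simple cartan_def)
      have adj_iff: "adj i j \<longleftrightarrow> adj j i" using i j adj_sym by blast
      show "rho \<alpha> = r i * rho (\<alpha> - simple i) * r i" if bi: "bil \<alpha> (simple i) = 1"
      proof -
        consider "i = j" | "i \<noteq> j" "adj j i" | "i \<noteq> j" "\<not> adj j i" by blast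
        then show ?thesis
        proof cases
          \<comment> \<open>Both adjacent simple roots have product 1 with \<alpha>, so \<alpha> has
            product 2 with their sum, which is a root, and equals it. Here the braid relation is
            what is needed.\<close>
          case 2
          have sp: "simple j + simple i \<in> roots"
            using 2 i j by (simp add: roots_def lat_closed bil_simps bil_simple_simple cartan_def adj_iff)
          have "bil \<alpha> (simple j + simple i) = 2" using bi j by (simp add: bil_simps)
          then have "\<alpha> = simple j + simple i" using bil_roots(2)[OF pos_root[OF \<alpha>] sp] by blast
          then have "\<alpha> - simple j = simple i" "\<alpha> - simple i = simple j" by simp_all
          then show ?thesis using rj i j 2 r_braid[of i j] by (simp add: rho_simple adj_iff)
        next
          case 3
          let ?c = "\<alpha> - simple i"
          note c = pos_sub_simple[OF \<alpha> i bi]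
          have ltc: "nat (ht ?c) < nat (ht \<alpha>)" using c(3) pos_ht[OF \<alpha>] by simp
          have "bil ?b (simple i) = 1" "bil ?c (simple j) = 1"
            using js 3 bi j bil_sym[of "simple i" "simple j"] by (simp_all add: bil_simps)
          then have "rho ?b = r i * rho (?b - simple i) * r i" "rho ?c = r j * rho (?c - simple j) * r j"
            using IHb IH[OF ltc c(1)] i j by auto
          moreover have "?b - simple i = ?c - simple j" by (simp add: algebra_simps)
          ultimately show ?thesis
            using rj 3 i j by (simp add: mult.assoc r_comm[of i j] r_comm'[of i j] adj_iff)
        qed (use rj in simp)
      qed
      show "r i * rho \<alpha> = rho \<alpha> * r i" if bi: "bil \<alpha> (simple i) = 0"
      proof -
        have ne: "i \<noteq> j" using bi j by auto
        show ?thesis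
        proof (cases "adj j i")
          case True
          let ?c = "?b - simple i"
          have "bil ?b (simple i) = 1" using js True ne bi by (simp add: bb)
          then have rb: "rho ?b = r i * rho ?c * r i" and c: "?c \<in> pos" "ht ?c = ht ?b - 1"
            using IHb i pos_sub_simple[OF b(1) i] by auto
          have "nat (ht ?c) < nat (ht \<alpha>)" using c(2) b(3) pos_ht[OF \<alpha>] by simp
          moreover have "bil ?c (simple j) = 0"
            using bi j js True ne bil_sym[of "simple i" "simple j"] bil_simple_simple[of j j]
            by (simp add: bil_simps cartan_def)
          ultimately have cj: "r j * rho ?c = rho ?c * r j" using IH[OF _ c(1)] j by blast
          have "r i * rho \<alpha> = r i * (r j * (r i * (rho ?c * (r i * r j))))"
            by (simp add: rj rb mult.assoc)
          also have "\<dots> = r j * (r i * ((r j * rho ?c) * (r i * r j)))"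
            using True i j by (simp add: r_braid' adj_iff mult.assoc)
          also have "\<dots> = r j * (r i * (rho ?c * (r j * r i * r j)))" by (simp add: cj mult.assoc)
          also have "r j * r i * r j = r i * r j * r i" using True i j r_braid[of i j] adj_iff by simp
          finally show ?thesis by (simp add: rj rb mult.assoc)
        next
          case False
          then have "bil ?b (simple i) = 0" using js ne bi by (simp add: bb)
          then have ib: "r i * rho ?b = rho ?b * r i" using IHb i by blast
          have ij: "r i * r j = r j * r i" using r_comm[of i j] False i j adj_iff by blast
          have "r i * rho \<alpha> = (r i * r j) * rho ?b * r j" by (simp only: rj mult.assoc)
          also have "\<dots> = r j * (r i * rho ?b) * r j" by (simp only: ij mult.assoc)
          also have "\<dots> = r j * rho ?b * (r i * r j)" by (simp only: ib mult.assoc)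
          finally show ?thesis by (simp only: ij rj mult.assoc)
        qed
      qed
    qed
  qed
qed

lemma rho_refl_simple:
  assumes "\<alpha> \<in> roots" "i \<in> {1..n}"
  shows "r i * rho \<alpha> * r i = rho (refl (simple i) \<alpha>)"
proof -
  have pos: "r i * rho \<alpha> * r i = rho (refl (simple i) \<alpha>)" if \<alpha>: "\<alpha> \<in> pos" for \<alpha>
  proof -
    have "bil \<alpha> (simple i) \<in> {-2, -1, 0, 1, 2}"
      using bil_roots(1)[OF pos_root[OF \<alpha>] simple_root[OF assms(2)]] .
    then consider "bil \<alpha> (simple i) = -2" | "bil \<alpha> (simple i) = -1" | "bil \<alpha> (simple i) = 0"
      | "bil \<alpha> (simple i) = 1" | "bil \<alpha> (simple i) = 2" by auto
    then show ?thesis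
    proof cases
      case 1
      then have "\<alpha> = - simple i" using bil_roots(3)[OF pos_root[OF \<alpha>] simple_root[OF assms(2)]] by simp
      then have "- \<alpha> \<in> pos" using simple_pos[OF assms(2)] by simp
      then show ?thesis using not_both[OF \<alpha>] by simp
    next
      case 2
      let ?b = "refl (simple i) \<alpha>"
      have "\<alpha> \<noteq> simple i" using 2 bil_simple_simple[of i i] assms(2) by (auto simp: cartan_def)
      then have b: "?b \<in> pos" using refl_pos[OF \<alpha> assms(2)] by blast
      have eq: "?b = \<alpha> + simple i" using 2 by (simp add: refl_def sc_simps)
      have "bil ?b (simple i) = 1"
        unfolding eq using 2 assms(2) bil_simple_simple[of i i] by (simp add: bil_simps cartan_def)
      then have "rho ?b = r i * rho (?b - simple i) * r i" using rho_step[OF b] assms(2) by blast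
      then show ?thesis by (simp add: eq)
    next
      case 3
      then have "r i * rho \<alpha> = rho \<alpha> * r i" using rho_step[OF \<alpha>] assms(2) by blast
      then show ?thesis using 3 assms(2) by (simp add: refl_def sc_simps mult.assoc r_sq)
    next
      case 4
      then have "rho \<alpha> = r i * rho (\<alpha> - simple i) * r i" using rho_step[OF \<alpha>] assms(2) by blast
      then show ?thesis
        using pos_sub_simple(2)[OF \<alpha> assms(2) 4] assms(2) by (simp add: mult.assoc r_sq rrK)
    next
      case 5
      then have "\<alpha> = simple i" using bil_roots(2)[OF pos_root[OF \<alpha>] simple_root[OF assms(2)]] by simp
      then show ?thesis using assms(2)
        by (simp add: refl_self simple_root rho_minus[OF simple_root[OF assms(2)]] rho_simple mult.assoc r_sq)
    qed
  qed
  show ?thesis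
  proof (cases "\<alpha> \<in> pos")
    case False
    then have "- \<alpha> \<in> pos" using pos_or_neg[OF assms(1)] by blast
    from pos[OF this] show ?thesis
      unfolding refl_add rho_minus[OF assms(1)] rho_minus[OF refl_root[OF simple_root[OF assms(2)] assms(1)]] .
  qed (use pos in blast)
qed

lemma roots_induct [consumes 1, case_names minus simple refl]:
  assumes "\<alpha> \<in> roots" and minus: "\<And>\<alpha>. \<alpha> \<in> roots \<Longrightarrow> P (- \<alpha>) \<Longrightarrow> P \<alpha>"
    and simple: "\<And>i. i \<in> {1..n} \<Longrightarrow> P (simple i)"
    and step: "\<And>\<alpha> i. \<alpha> \<in> roots \<Longrightarrow> i \<in> {1..n} \<Longrightarrow> P (refl (simple i) \<alpha>) \<Longrightarrow> P \<alpha>"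
  shows "P \<alpha>"
proof -
  have pos: "P \<alpha>" if "\<alpha> \<in> pos" for \<alpha>
    using that
  proof (induction "nat (ht \<alpha>)" arbitrary: \<alpha> rule: less_induct)
    case less
    show ?case
    proof (cases "\<exists>i\<in>{1..n}. \<alpha> = simple i")
      case False
      then obtain i where i: "i \<in> {1..n}" "bil \<alpha> (simple i) = 1" using pos_descent[OF less.prems] by blast
      note b = pos_sub_simple[OF less.prems i]
      have "P (\<alpha> - simple i)" by (rule less.hyps[OF _ b(1)]) (use b(3) pos_ht[OF less.prems] in simp)
      then show ?thesis using step[OF pos_root[OF less.prems] i(1)] b(2) by simp
    qed (use simple in blast)
  qed
  show ?thesis using pos_or_neg[OF assms(1)] pos minus[OF assms(1)] by blast
qed

lemma rho_sq: "\<alpha> \<in> roots \<Longrightarrow> rho \<alpha> * rho \<alpha> = 1"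
proof (induction rule: roots_induct)
  case (refl \<alpha> i)
  have "rho \<alpha> = r i * rho (local.refl (simple i) \<alpha>) * r i"
    using rho_refl_simple[of "local.refl (simple i) \<alpha>" i] refl
    by (simp add: refl_refl refl_root simple_root)
  moreover have "rho (local.refl (simple i) \<alpha>) * (rho (local.refl (simple i) \<alpha>) * x) = x" for x
    using refl(3) by (simp add: mult.assoc[symmetric])
  ultimately show ?case using refl by (simp add: mult.assoc rrK r_sq)
next
  case (minus \<alpha>)
  then show ?case unfolding rho_minus[OF minus(1)] by blast
next
  case (simple i)
  then show ?case by (simp only: rho_simple r_sq)
qed

lemma rho_conj: "\<alpha> \<in> roots \<Longrightarrow> \<beta> \<in> roots \<Longrightarrow> rho \<alpha> * rho \<beta> * rho \<alpha> = rho (refl \<alpha> \<beta>)"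
proof (induction arbitrary: \<beta> rule: roots_induct)
  case (minus \<alpha>)
  from minus(2)[OF minus(3)] show ?case unfolding rho_minus[OF minus(1)] refl_add .
next
  case (simple i)
  then show ?case by (simp add: rho_simple rho_refl_simple)
next
  case (refl \<alpha> i)
  let ?a = "local.refl (simple i) \<alpha>"
  have a: "rho \<alpha> = r i * rho ?a * r i"
    using rho_refl_simple[of ?a i] refl by (simp add: refl_refl refl_root simple_root)
  have "rho \<alpha> * rho \<beta> * rho \<alpha> = r i * (rho ?a * (r i * rho \<beta> * r i) * rho ?a) * r i"
    by (simp add: a mult.assoc)
  also have "\<dots> = rho (local.refl (simple i) (local.refl ?a (local.refl (simple i) \<beta>)))"
    using refl by (simp add: rho_refl_simple refl_root simple_root)
  also have "local.refl (simple i) (local.refl ?a (local.refl (simple i) \<beta>)) = local.refl \<alpha> \<beta>"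
    using refl_conj[of "simple i" ?a \<beta>] refl by (simp add: refl_refl simple_root)
  finally show ?case .
qed

end

section \<open>Representations of the Brauer algebra\<close>

text \<open>For e = 1 - r, the equation r r = 1 says that e e = 2 e. So this is a Temperley--Lieb
  representation with \<delta> = 2, written in terms of the reflections.\<close>

locale tl_rep = coxeter_rep +
  assumes tl: "i \<in> {1..n} \<Longrightarrow> j \<in> {1..n} \<Longrightarrow> adj i j \<Longrightarrow> (1 - r i) * (1 - r j) * (1 - r i) = 1 - r i"
begin

definition eps :: "(nat \<Rightarrow> int) \<Rightarrow> 'a" where "eps \<alpha> = 1 - rho \<alpha>"

lemma eps_minus: "\<alpha> \<in> roots \<Longrightarrow> eps (- \<alpha>) = eps \<alpha>"
  unfolding eps_def by (simp only: rho_minus)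

lemma rho_rhoK: "\<alpha> \<in> roots \<Longrightarrow> rho \<alpha> * (rho \<alpha> * x) = x"
  using rho_sq[of \<alpha>] by (simp add: mult.assoc[symmetric])

lemma rho_eps_conj: "\<alpha> \<in> roots \<Longrightarrow> \<beta> \<in> roots \<Longrightarrow> rho \<alpha> * eps \<beta> * rho \<alpha> = eps (refl \<alpha> \<beta>)"
  using rho_conj[of \<alpha> \<beta>] rho_sq[of \<alpha>] by (simp add: eps_def algebra_simps)

lemma rho_eps: "\<alpha> \<in> roots \<Longrightarrow> rho \<alpha> * eps \<alpha> = - eps \<alpha>" "\<alpha> \<in> roots \<Longrightarrow> eps \<alpha> * rho \<alpha> = - eps \<alpha>"
  by (simp_all add: eps_def algebra_simps rho_sq)

lemma eps_eps: "\<alpha> \<in> roots \<Longrightarrow> eps \<alpha> * eps \<alpha> = 2 * eps \<alpha>"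
  by (simp add: eps_def algebra_simps rho_sq mult_2)

lemma eps_tl_conj:
  assumes "\<alpha> \<in> roots" "\<beta> \<in> roots" "\<gamma> \<in> roots" "eps \<alpha> * eps \<beta> * eps \<alpha> = eps \<alpha>"
  shows "eps (refl \<gamma> \<alpha>) * eps (refl \<gamma> \<beta>) * eps (refl \<gamma> \<alpha>) = eps (refl \<gamma> \<alpha>)"
proof -
  have "eps (refl \<gamma> \<alpha>) * eps (refl \<gamma> \<beta>) * eps (refl \<gamma> \<alpha>)
      = rho \<gamma> * (eps \<alpha> * eps \<beta> * eps \<alpha>) * rho \<gamma>"
    using assms(1-3) by (simp add: rho_eps_conj[symmetric] mult.assoc rho_rhoK)
  then show ?thesis using assms by (simp add: rho_eps_conj)
qed

lemma eps_refl_left: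
  assumes "\<alpha> \<in> roots" "\<beta> \<in> roots"
  shows "eps \<alpha> * eps (refl \<alpha> \<beta>) * eps \<alpha> = eps \<alpha> * eps \<beta> * eps \<alpha>"
proof -
  have "eps \<alpha> * eps (refl \<alpha> \<beta>) * eps \<alpha> = (eps \<alpha> * rho \<alpha>) * eps \<beta> * (rho \<alpha> * eps \<alpha>)"
    using assms by (simp add: rho_eps_conj[symmetric] mult.assoc)
  then show ?thesis using assms by (simp add: rho_eps)
qed

text \<open>Induction on the height, where reflections carry the identity from lower to higher
  roots. If \<beta> has product 1 with the simple root of node i, that reflection lowers \<beta> and
  the signs in \<open>rho_eps\<close> cancel. Otherwise \<beta> descends at another node j; for j
  adjacent to i, the identity is used for j, and the reflections of i and then j carry the simple
  root of j to that of i.\<close>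

lemma eps_tl_simple:
  assumes "\<beta> \<in> pos" "i \<in> {1..n}" "bil \<beta> (simple i) = 1 \<or> bil \<beta> (simple i) = -1"
  shows "eps (simple i) * eps \<beta> * eps (simple i) = eps (simple i)"
  using assms
proof (induction "nat (ht \<beta>)" arbitrary: \<beta> i rule: less_induct)
  case less
  note i = less.prems(2) and \<beta> = pos_root[OF less.prems(1)]
  note si = simple_root[OF i]
  show ?case
  proof (cases "bil \<beta> (simple i) = 1")
    case True
    note b = pos_sub_simple[OF less.prems(1) i True]
    have "bil (\<beta> - simple i) (simple i) = -1"
      using True i bil_simple_simple[of i i] by (simp add: bil_simps cartan_def)
    then have "eps (simple i) * eps (\<beta> - simple i) * eps (simple i) = eps (simple i)"
      using less.hyps[OF _ b(1) i] b(3) pos_ht[OF less.prems(1)] by simp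
    then show ?thesis unfolding b(2) eps_refl_left[OF si \<beta>] .
  next
    case False
    then have bi: "bil \<beta> (simple i) = -1" using less.prems by simp
    show ?thesis
    proof (cases "\<exists>j\<in>{1..n}. \<beta> = simple j")
      case True
      then obtain j where j: "j \<in> {1..n}" "\<beta> = simple j" by blast
      then have "adj j i" using bi i by (simp add: bil_simple_simple cartan_def split: if_splits)
      then have "adj i j" using adj_sym i j by blast
      then show ?thesis using tl[of i j] i j by (simp add: eps_def rho_simple)
    next
      case False
      then obtain j where j: "j \<in> {1..n}" "bil \<beta> (simple j) = 1" using pos_descent[OF less.prems(1)] by blast
      note sj = simple_root[OF j(1)]
      note b = pos_sub_simple[OF less.prems(1) j]
      have lt: "nat (ht (\<beta> - simple j)) < nat (ht \<beta>)" using b(3) pos_ht[OF less.prems(1)] by simp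
      have bb: "refl (simple j) (\<beta> - simple j) = \<beta>" unfolding b(2) by (rule refl_refl[OF sj])
      have ne: "i \<noteq> j" using bi j by auto
      have ij: "bil (simple i) (simple j) = cartan i j" using i j by (simp add: bil_simple_simple)
      show ?thesis
      proof (cases "adj i j")
        case False
        then have c0: "cartan i j = 0" using ne by (simp add: cartan_def)
        have "bil (\<beta> - simple j) (simple i) = -1"
          using bi ij c0 bil_sym[of "simple j" "simple i"] by (simp add: bil_simps)
        from less.hyps[OF lt b(1) i disjI2[OF this]]
        have "eps (refl (simple j) (simple i)) * eps \<beta> * eps (refl (simple j) (simple i)) = eps (refl (simple j) (simple i))"
          using eps_tl_conj[OF si pos_root[OF b(1)] sj] bb by simp
        moreover have "refl (simple j) (simple i) = simple i"
          using ij c0 by (simp add: refl_def sc_simps)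
        ultimately show ?thesis by simp
      next
        case True
        then have c1: "cartan i j = -1" using ne by (simp add: cartan_def)
        let ?b = "\<beta> - simple j"
        have bj: "bil ?b (simple j) = -1" and b0: "bil ?b (simple i) = 0"
          using j bi ij c1 bil_sym[of "simple j" "simple i"] bil_simple_simple[of j j] j(1)
          by (simp_all add: bil_simps cartan_def)
        from less.hyps[OF lt b(1) j(1) disjI2[OF bj]]
        have "eps (refl (simple i) (simple j)) * eps (refl (simple i) ?b) * eps (refl (simple i) (simple j)) = eps (refl (simple i) (simple j))"
          using eps_tl_conj[OF sj pos_root[OF b(1)] si] by simp
        moreover have "refl (simple i) ?b = ?b" using b0 by (simp add: refl_def sc_simps)
        moreover have sij: "refl (simple i) (simple j) = simple j + simple i"
          using ij c1 bil_sym[of "simple j" "simple i"] by (simp add: refl_def sc_simps)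
        ultimately have "eps (simple j + simple i) * eps ?b * eps (simple j + simple i) = eps (simple j + simple i)"
          by simp
        moreover have "simple j + simple i \<in> roots" using refl_root[OF si sj] sij by simp
        ultimately have "eps (refl (simple j) (simple j + simple i)) * eps \<beta> * eps (refl (simple j) (simple j + simple i))
            = eps (refl (simple j) (simple j + simple i))"
          using eps_tl_conj[OF _ pos_root[OF b(1)] sj] bb by simp
        moreover have "refl (simple j) (simple j + simple i) = simple i"
          using ij c1 j(1) by (simp add: refl_def bil_simps sc_simps bil_simple_simple[of j j] cartan_def)
        ultimately show ?thesis by simp
      qed
    qed
  qed
qed

lemma eps_tl:
  assumes "\<alpha> \<in> roots" "\<beta> \<in> roots" "bil \<alpha> \<beta> = 1 \<or> bil \<alpha> \<beta> = -1"
  shows "eps \<alpha> * eps \<beta> * eps \<alpha> = eps \<alpha>"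
  using assms
proof (induction arbitrary: \<beta> rule: roots_induct)
  case (minus \<alpha>)
  then have "eps (- \<alpha>) * eps \<beta> * eps (- \<alpha>) = eps (- \<alpha>)" by (auto simp: bil_simps)
  then show ?case unfolding eps_minus[OF minus(1)] .
next
  case (simple i)
  show ?case
  proof (cases "\<beta> \<in> pos")
    case True
    then show ?thesis using eps_tl_simple[OF True simple(1)] simple bil_sym[of \<beta> "simple i"] by auto
  next
    case False
    then have "- \<beta> \<in> pos" using pos_or_neg simple by blast
    then have "eps (simple i) * eps (- \<beta>) * eps (simple i) = eps (simple i)"
      using eps_tl_simple[of "- \<beta>" i] simple bil_sym[of \<beta> "simple i"] by (auto simp: bil_simps)
    then show ?thesis unfolding eps_minus[OF simple(2)] .
  qed
next
  case (refl \<alpha> i)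
  let ?s = "local.refl (simple i)"
  note si = simple_root[OF refl(2)]
  have "eps (?s \<alpha>) * eps (?s \<beta>) * eps (?s \<alpha>) = eps (?s \<alpha>)"
    using refl(3)[OF refl_root[OF si refl(4)]] refl(5) refl_bil[OF si] by simp
  from eps_tl_conj[OF refl_root[OF si refl(1)] refl_root[OF si refl(4)] si this]
  show ?case unfolding refl_refl[OF si] .
qed

lemma eps_rho:
  assumes "\<alpha> \<in> roots" "\<beta> \<in> roots" "bil \<alpha> \<beta> = 1 \<or> bil \<alpha> \<beta> = -1"
  shows "eps \<alpha> * rho \<beta> = eps \<alpha> * eps (refl \<alpha> \<beta>)" "rho \<beta> * eps \<alpha> = eps (refl \<alpha> \<beta>) * eps \<alpha>"
proof -
  have r: "rho \<beta> = 1 - eps \<beta>" by (simp add: eps_def)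
  have "eps \<alpha> * eps (refl \<alpha> \<beta>) = (eps \<alpha> * rho \<alpha>) * eps \<beta> * rho \<alpha>"
    using assms by (simp add: rho_eps_conj[symmetric] mult.assoc)
  also have "\<dots> = - (eps \<alpha> * eps \<beta>) + eps \<alpha> * eps \<beta> * eps \<alpha>"
    using assms by (simp add: rho_eps) (simp add: eps_def algebra_simps)
  finally show "eps \<alpha> * rho \<beta> = eps \<alpha> * eps (refl \<alpha> \<beta>)"
    unfolding eps_tl[OF assms] r by (simp add: algebra_simps)
  have "eps (refl \<alpha> \<beta>) * eps \<alpha> = rho \<alpha> * eps \<beta> * (rho \<alpha> * eps \<alpha>)"
    using assms by (simp add: rho_eps_conj[symmetric] mult.assoc)
  also have "\<dots> = - (eps \<beta> * eps \<alpha>) + eps \<alpha> * eps \<beta> * eps \<alpha>"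
    using assms by (simp add: rho_eps) (simp add: eps_def algebra_simps)
  finally show "rho \<beta> * eps \<alpha> = eps (refl \<alpha> \<beta>) * eps \<alpha>"
    unfolding eps_tl[OF assms] r by (simp add: algebra_simps)
qed

lemma commutes_rho:
  assumes "\<And>i. i \<in> {1..n} \<Longrightarrow> x * r i = r i * x" and "\<alpha> \<in> roots"
  shows "x * rho \<alpha> = rho \<alpha> * x"
  using assms(2)
proof (induction rule: roots_induct)
  case (minus \<alpha>)
  then show ?case unfolding rho_minus[OF minus(1)] by blast
next
  case (simple i)
  then show ?case by (simp add: rho_simple assms)
next
  case (refl \<alpha> i)
  let ?a = "local.refl (simple i) \<alpha>"
  note si = simple_root[OF refl(2)]
  have a: "rho \<alpha> = r i * rho ?a * r i"
    using rho_refl_simple[OF refl_root[OF si refl(1)] refl(2)] by (simp add: refl_refl[OF si])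
  have "x * rho \<alpha> = (x * r i) * rho ?a * r i" unfolding a by (simp only: mult.assoc)
  also have "\<dots> = r i * (x * rho ?a) * r i" by (simp only: assms(1)[OF refl(2)] mult.assoc)
  also have "\<dots> = r i * rho ?a * (x * r i)" by (simp only: refl(3) mult.assoc)
  finally show ?case unfolding assms(1)[OF refl(2)] by (simp only: a mult.assoc)
qed

end

lemma prod_list_commute:
  fixes f h :: "nat \<Rightarrow> 'a::monoid_mult"
  assumes "\<And>b. b < N \<Longrightarrow> x * h b = h b * x"
  shows "x * prod_list (map h [0..<N]) = prod_list (map h [0..<N]) * x"
  using assms
proof (induction N)
  case (Suc N)
  then have "x * prod_list (map h [0..<N]) = prod_list (map h [0..<N]) * x" by simp
  moreover have "x * h N = h N * x" using Suc by simp
  ultimately show ?case by (simp add: mult.assoc) (metis mult.assoc)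
qed simp

lemma prod_list_mult:
  fixes f h :: "nat \<Rightarrow> 'a::monoid_mult"
  assumes "\<And>a b. a < N \<Longrightarrow> b < N \<Longrightarrow> a \<noteq> b \<Longrightarrow> f a * h b = h b * f a"
  shows "prod_list (map f [0..<N]) * prod_list (map h [0..<N]) = prod_list (map (\<lambda>a. f a * h a) [0..<N])"
  using assms
proof (induction N)
  case (Suc N)
  let ?f = "prod_list (map f [0..<N])" and ?h = "prod_list (map h [0..<N])"
  have "f N * ?h = ?h * f N" by (rule prod_list_commute) (use Suc in auto)
  then have "(?f * f N) * (?h * h N) = (?f * ?h) * (f N * h N)" by (metis mult.assoc)
  moreover have "?f * ?h = prod_list (map (\<lambda>a. f a * h a) [0..<N])" using Suc by simp
  ultimately show ?case by simp
qed simp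

text \<open>The relations that hold in the Brauer algebra of the diagram for the elements attached to all
  reflections.\<close>

locale brauer_rep = tits +
  fixes R E :: "(nat \<Rightarrow> int) \<Rightarrow> 'a::ring_1" and \<delta> :: nat
  assumes R_sq: "\<alpha> \<in> roots \<Longrightarrow> R \<alpha> * R \<alpha> = 1"
    and R_minus: "\<alpha> \<in> roots \<Longrightarrow> R (- \<alpha>) = R \<alpha>" and E_minus: "\<alpha> \<in> roots \<Longrightarrow> E (- \<alpha>) = E \<alpha>"
    and R_R: "\<alpha> \<in> roots \<Longrightarrow> \<beta> \<in> roots \<Longrightarrow> R \<alpha> * R \<beta> = R (refl \<alpha> \<beta>) * R \<alpha>"
    and R_E: "\<alpha> \<in> roots \<Longrightarrow> \<beta> \<in> roots \<Longrightarrow> R \<alpha> * E \<beta> = E (refl \<alpha> \<beta>) * R \<alpha>"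
    and RE: "\<alpha> \<in> roots \<Longrightarrow> R \<alpha> * E \<alpha> = E \<alpha>" and ER: "\<alpha> \<in> roots \<Longrightarrow> E \<alpha> * R \<alpha> = E \<alpha>"
    and EE: "\<alpha> \<in> roots \<Longrightarrow> E \<alpha> * E \<alpha> = of_nat \<delta> * E \<alpha>"
    and E_comm: "\<alpha> \<in> roots \<Longrightarrow> \<beta> \<in> roots \<Longrightarrow> bil \<alpha> \<beta> = 0 \<Longrightarrow> E \<alpha> * E \<beta> = E \<beta> * E \<alpha>"
    and E_R: "\<alpha> \<in> roots \<Longrightarrow> \<beta> \<in> roots \<Longrightarrow> bil \<alpha> \<beta> = 1 \<or> bil \<alpha> \<beta> = -1 \<Longrightarrow> E \<alpha> * R \<beta> = E \<alpha> * E (refl \<alpha> \<beta>)"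
    and R_E': "\<alpha> \<in> roots \<Longrightarrow> \<beta> \<in> roots \<Longrightarrow> bil \<alpha> \<beta> = 1 \<or> bil \<alpha> \<beta> = -1 \<Longrightarrow> R \<beta> * E \<alpha> = E (refl \<alpha> \<beta>) * E \<alpha>"
    and EEE: "\<alpha> \<in> roots \<Longrightarrow> \<beta> \<in> roots \<Longrightarrow> bil \<alpha> \<beta> = 1 \<or> bil \<alpha> \<beta> = -1 \<Longrightarrow> E \<alpha> * E \<beta> * E \<alpha> = E \<alpha>"

text \<open>The tensor power of Temperley--Lieb representations with \<open>\<delta> = 2\<close>; for an even number of
  factors the signs in \<open>rho * eps = - eps\<close> cancel.\<close>

lemma brauer_rep_tensor:
  fixes r :: "nat \<Rightarrow> nat \<Rightarrow> 'a::ring_1"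
  assumes tl_rep: "\<And>a. a < N \<Longrightarrow> tl_rep n adj (r a)" and tits: "tits n adj"
    and comm: "\<And>a b i j. a < N \<Longrightarrow> b < N \<Longrightarrow> a \<noteq> b \<Longrightarrow> i \<in> {1..n} \<Longrightarrow> j \<in> {1..n} \<Longrightarrow> r a i * r b j = r b j * r a i"
    and N: "even N"
  shows "\<exists>R E. brauer_rep n adj R E (2 ^ N) \<and>
    (\<forall>i\<in>{1..n}. R (tits.simple i) = prod_list (map (\<lambda>a. r a i) [0..<N]) \<and>
      E (tits.simple i) = prod_list (map (\<lambda>a. 1 - r a i) [0..<N]))"
proof -
  interpret tits n adj by (rule tits)
  define \<rho> where "\<rho> a = coxeter_rep.rho n adj (r a)" for a
  define \<eta> where "\<eta> a \<alpha> = 1 - \<rho> a \<alpha>" for a \<alpha>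
  have cox: "coxeter_rep n adj (r a)" if "a < N" for a using tl_rep[OF that] by (simp add: tl_rep_def)
  have \<eta>: "\<eta> a \<alpha> = tl_rep.eps n adj (r a) \<alpha>" if "a < N" for a \<alpha>
    using tl_rep.eps_def[OF tl_rep[OF that]] by (simp add: \<eta>_def \<rho>_def)
  have comm1: "r a i * \<rho> b \<beta> = \<rho> b \<beta> * r a i"
    if "a < N" "b < N" "a \<noteq> b" "i \<in> {1..n}" "\<beta> \<in> roots" for a b i \<beta>
    unfolding \<rho>_def using tl_rep.commutes_rho[OF tl_rep[OF that(2)], of "r a i" \<beta>] comm that by simp
  have comm2: "\<rho> a \<alpha> * \<rho> b \<beta> = \<rho> b \<beta> * \<rho> a \<alpha>"
    if "a < N" "b < N" "a \<noteq> b" "\<alpha> \<in> roots" "\<beta> \<in> roots" for a b \<alpha> \<beta>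
    using tl_rep.commutes_rho[OF tl_rep[OF that(1)], of "\<rho> b \<beta>" \<alpha>] comm1[OF that(1,2,3) _ that(5)] that
    by (simp add: \<rho>_def)
  have comm3: "\<rho> a \<alpha> * \<eta> b \<beta> = \<eta> b \<beta> * \<rho> a \<alpha>" "\<eta> a \<alpha> * \<rho> b \<beta> = \<rho> b \<beta> * \<eta> a \<alpha>"
    "\<eta> a \<alpha> * \<eta> b \<beta> = \<eta> b \<beta> * \<eta> a \<alpha>"
    if "a < N" "b < N" "a \<noteq> b" "\<alpha> \<in> roots" "\<beta> \<in> roots" for a b \<alpha> \<beta>
    using comm2[OF that] by (simp_all add: \<eta>_def algebra_simps)
  define P where "P f = prod_list (map f [0..<N])" for f :: "nat \<Rightarrow> 'a"
  have P_cong: "P f = P h" if "\<And>a. a < N \<Longrightarrow> f a = h a" for f h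
    unfolding P_def by (rule arg_cong[where f = prod_list]) (use that in auto)
  have P_mult: "P f * P h = P (\<lambda>a. f a * h a)" if "\<And>a b. a < N \<Longrightarrow> b < N \<Longrightarrow> a \<noteq> b \<Longrightarrow> f a * h b = h b * f a" for f h
    unfolding P_def using that by (rule prod_list_mult)
  have P_one: "P (\<lambda>a. 1) = 1" unfolding P_def by (induction N) auto
  \<comment> \<open>Here the parity of the number of copies enters.\<close>
  have P_minus: "P (\<lambda>a. - f a) = P f" for f
  proof -
    have "prod_list (map (\<lambda>a. - f a) [0..<M]) = (- 1) ^ M * prod_list (map f [0..<M])" for M
      by (induction M) (auto simp: mult.assoc)
    then show ?thesis using N by (simp add: P_def)
  qed
  have P_two: "P (\<lambda>a. 2 * f a) = of_nat (2 ^ N) * P f" for f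
  proof -
    have "prod_list (map (\<lambda>a. 2 * f a) [0..<M]) = of_nat (2 ^ M) * prod_list (map f [0..<M])" for M
    proof (induction M)
      case (Suc M)
      have "of_nat (2 ^ M) * x * (2 * y) = of_nat (2 ^ Suc M) * (x * y)" for x y :: 'a
        by (simp add: mult.assoc) (metis mult.assoc mult_2 mult_2_right)
      then show ?case using Suc by simp
    qed simp
    then show ?thesis by (simp add: P_def)
  qed
  define R where "R \<alpha> = P (\<lambda>a. \<rho> a \<alpha>)" for \<alpha>
  define E where "E \<alpha> = P (\<lambda>a. \<eta> a \<alpha>)" for \<alpha>
  have "brauer_rep n adj R E (2 ^ N)"
  proof
    fix \<alpha> assume \<alpha>: "\<alpha> \<in> roots"
    show "R \<alpha> * R \<alpha> = 1"
    proof -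
      have "R \<alpha> * R \<alpha> = P (\<lambda>a. \<rho> a \<alpha> * \<rho> a \<alpha>)" unfolding R_def by (rule P_mult) (use comm2 \<alpha> in blast)
      also have "\<dots> = P (\<lambda>a. 1)" by (rule P_cong) (simp add: \<rho>_def coxeter_rep.rho_sq[OF cox] \<alpha>)
      finally show ?thesis by (simp add: P_one)
    qed
    show "R (- \<alpha>) = R \<alpha>" unfolding R_def
      by (rule P_cong) (simp only: \<rho>_def coxeter_rep.rho_minus[OF cox \<alpha>])
    show "E (- \<alpha>) = E \<alpha>" unfolding E_def
      by (rule P_cong) (simp only: \<eta>_def \<rho>_def coxeter_rep.rho_minus[OF cox \<alpha>])
    show "R \<alpha> * E \<alpha> = E \<alpha>"
    proof -
      have "R \<alpha> * E \<alpha> = P (\<lambda>a. \<rho> a \<alpha> * \<eta> a \<alpha>)" unfolding R_def E_def by (rule P_mult) (use comm3 \<alpha> in blast)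
      also have "\<dots> = P (\<lambda>a. - \<eta> a \<alpha>)"
        by (rule P_cong) (simp add: \<eta> \<rho>_def tl_rep.rho_eps[OF tl_rep] \<alpha>)
      finally show ?thesis by (simp add: P_minus E_def)
    qed
    show "E \<alpha> * R \<alpha> = E \<alpha>"
    proof -
      have "E \<alpha> * R \<alpha> = P (\<lambda>a. \<eta> a \<alpha> * \<rho> a \<alpha>)" unfolding R_def E_def by (rule P_mult) (use comm3 \<alpha> in blast)
      also have "\<dots> = P (\<lambda>a. - \<eta> a \<alpha>)"
        by (rule P_cong) (simp add: \<eta> \<rho>_def tl_rep.rho_eps[OF tl_rep] \<alpha>)
      finally show ?thesis by (simp add: P_minus E_def)
    qed
    show "E \<alpha> * E \<alpha> = of_nat (2 ^ N) * E \<alpha>"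
    proof -
      have "E \<alpha> * E \<alpha> = P (\<lambda>a. \<eta> a \<alpha> * \<eta> a \<alpha>)" unfolding E_def by (rule P_mult) (use comm3 \<alpha> in blast)
      also have "\<dots> = P (\<lambda>a. 2 * \<eta> a \<alpha>)"
        by (rule P_cong) (simp add: \<eta> tl_rep.eps_eps[OF tl_rep] \<alpha>)
      finally show ?thesis by (simp only: P_two E_def)
    qed
    fix \<beta> assume \<beta>: "\<beta> \<in> roots"
    have f: "\<rho> a \<alpha> * \<rho> a \<beta> = \<rho> a (refl \<alpha> \<beta>) * \<rho> a \<alpha>" if a: "a < N" for a
      using coxeter_rep.rho_conj[OF cox[OF a] \<alpha> \<beta>, symmetric] coxeter_rep.rho_sq[OF cox[OF a] \<alpha>]
      by (simp add: \<rho>_def mult.assoc)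
    note \<alpha>\<beta> = refl_root[OF \<alpha> \<beta>]
    show "R \<alpha> * R \<beta> = R (refl \<alpha> \<beta>) * R \<alpha>"
    proof -
      have "R \<alpha> * R \<beta> = P (\<lambda>a. \<rho> a \<alpha> * \<rho> a \<beta>)" unfolding R_def by (rule P_mult) (use comm2 \<alpha> \<beta> in blast)
      also have "\<dots> = P (\<lambda>a. \<rho> a (refl \<alpha> \<beta>) * \<rho> a \<alpha>)" by (rule P_cong) (rule f)
      also have "\<dots> = R (refl \<alpha> \<beta>) * R \<alpha>" unfolding R_def by (rule P_mult[symmetric]) (use comm2 \<alpha> \<alpha>\<beta> in blast)
      finally show ?thesis .
    qed
    show "R \<alpha> * E \<beta> = E (refl \<alpha> \<beta>) * R \<alpha>"
    proof -
      have "R \<alpha> * E \<beta> = P (\<lambda>a. \<rho> a \<alpha> * \<eta> a \<beta>)" unfolding R_def E_def by (rule P_mult) (use comm3 \<alpha> \<beta> in blast)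
      also have "\<dots> = P (\<lambda>a. \<eta> a (refl \<alpha> \<beta>) * \<rho> a \<alpha>)" by (rule P_cong) (simp add: \<eta>_def f algebra_simps)
      also have "\<dots> = E (refl \<alpha> \<beta>) * R \<alpha>" unfolding R_def E_def by (rule P_mult[symmetric]) (use comm3 \<alpha> \<alpha>\<beta> in blast)
      finally show ?thesis .
    qed
    show "E \<alpha> * E \<beta> = E \<beta> * E \<alpha>" if "bil \<alpha> \<beta> = 0"
    proof -
      have "refl \<alpha> \<beta> = \<beta>" using that bil_sym[of \<beta> \<alpha>] by (simp add: refl_def sc_simps)
      then have "\<rho> a \<alpha> * \<rho> a \<beta> = \<rho> a \<beta> * \<rho> a \<alpha>" if "a < N" for a using f[OF that] by simp
      then have "P (\<lambda>a. \<eta> a \<alpha> * \<eta> a \<beta>) = P (\<lambda>a. \<eta> a \<beta> * \<eta> a \<alpha>)"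
        by (intro P_cong) (simp add: \<eta>_def algebra_simps)
      moreover have "E \<alpha> * E \<beta> = P (\<lambda>a. \<eta> a \<alpha> * \<eta> a \<beta>)" "E \<beta> * E \<alpha> = P (\<lambda>a. \<eta> a \<beta> * \<eta> a \<alpha>)"
        unfolding E_def by (rule P_mult, use comm3 \<alpha> \<beta> in blast)+
      ultimately show ?thesis by simp
    qed
    assume ab: "bil \<alpha> \<beta> = 1 \<or> bil \<alpha> \<beta> = -1"
    show "E \<alpha> * R \<beta> = E \<alpha> * E (refl \<alpha> \<beta>)"
    proof -
      have "E \<alpha> * R \<beta> = P (\<lambda>a. \<eta> a \<alpha> * \<rho> a \<beta>)" unfolding R_def E_def by (rule P_mult) (use comm3 \<alpha> \<beta> in blast)
      also have "\<dots> = P (\<lambda>a. \<eta> a \<alpha> * \<eta> a (refl \<alpha> \<beta>))"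
        by (rule P_cong) (simp add: \<eta> \<rho>_def tl_rep.eps_rho[OF tl_rep \<alpha> \<beta> ab])
      also have "\<dots> = E \<alpha> * E (refl \<alpha> \<beta>)" unfolding E_def by (rule P_mult[symmetric]) (use comm3 \<alpha> \<alpha>\<beta> in blast)
      finally show ?thesis .
    qed
    show "R \<beta> * E \<alpha> = E (refl \<alpha> \<beta>) * E \<alpha>"
    proof -
      have "R \<beta> * E \<alpha> = P (\<lambda>a. \<rho> a \<beta> * \<eta> a \<alpha>)" unfolding R_def E_def by (rule P_mult) (use comm3 \<alpha> \<beta> in blast)
      also have "\<dots> = P (\<lambda>a. \<eta> a (refl \<alpha> \<beta>) * \<eta> a \<alpha>)"
        by (rule P_cong) (simp add: \<eta> \<rho>_def tl_rep.eps_rho[OF tl_rep \<alpha> \<beta> ab])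
      also have "\<dots> = E (refl \<alpha> \<beta>) * E \<alpha>" unfolding E_def by (rule P_mult[symmetric]) (use comm3 \<alpha> \<alpha>\<beta> in blast)
      finally show ?thesis .
    qed
    show "E \<alpha> * E \<beta> * E \<alpha> = E \<alpha>"
    proof -
      have 1: "E \<alpha> * E \<beta> = P (\<lambda>a. \<eta> a \<alpha> * \<eta> a \<beta>)" unfolding E_def by (rule P_mult) (use comm3 \<alpha> \<beta> in blast)
      have "E \<alpha> * E \<beta> * E \<alpha> = P (\<lambda>a. \<eta> a \<alpha> * \<eta> a \<beta> * \<eta> a \<alpha>)"
        unfolding 1 unfolding E_def
      proof (rule P_mult)
        fix a b assume "a < N" "b < N" "a \<noteq> b"
        then have "\<eta> a \<beta> * \<eta> b \<alpha> = \<eta> b \<alpha> * \<eta> a \<beta>" "\<eta> a \<alpha> * \<eta> b \<alpha> = \<eta> b \<alpha> * \<eta> a \<alpha>"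
          using comm3 \<alpha> \<beta> by blast+
        then show "\<eta> a \<alpha> * \<eta> a \<beta> * \<eta> b \<alpha> = \<eta> b \<alpha> * (\<eta> a \<alpha> * \<eta> a \<beta>)" by (metis mult.assoc)
      qed
      also have "\<dots> = E \<alpha>" unfolding E_def
        by (rule P_cong) (simp add: \<eta> tl_rep.eps_tl[OF tl_rep \<alpha> \<beta> ab])
      finally show ?thesis .
    qed
  qed
  moreover have "R (simple i) = prod_list (map (\<lambda>a. r a i) [0..<N])" "E (simple i) = prod_list (map (\<lambda>a. 1 - r a i) [0..<N])"
    if "i \<in> {1..n}" for i
    using that unfolding R_def E_def P_def[symmetric]
    by (auto intro!: P_cong simp: \<eta>_def \<rho>_def coxeter_rep.rho_simple[OF cox])
  ultimately show ?thesis by blast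
qed

section \<open>Monodromy and the braid relations\<close>

definition finv :: "'a::ring_1 fps \<Rightarrow> 'a fps" where "finv f = fps_left_inverse f 1"

lemma finv:
  assumes "f $ 0 = 1"
  shows "finv f * f = 1" "f * finv f = 1" "finv f $ 0 = 1"
proof -
  show l: "finv f * f = 1" unfolding finv_def by (rule fps_left_inverse) (simp add: assms)
  have r: "f * fps_right_inverse f 1 = 1" by (rule fps_right_inverse) (simp add: assms)
  have "finv f = finv f * (f * fps_right_inverse f 1)" by (simp add: r)
  also have "\<dots> = fps_right_inverse f 1" by (simp add: mult.assoc[symmetric] l)
  finally show "f * finv f = 1" using r by simp
  show "finv f $ 0 = 1" by (simp add: finv_def)
qed

section \<open>Flatness of the connection\<close>

locale brauer_kz = brauer_rep n adj R E \<delta> for n adj and R E :: "(nat \<Rightarrow> int) \<Rightarrow> 'a::calg" and \<delta>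
begin

definition tt :: "(nat \<Rightarrow> int) \<Rightarrow> 'a" where "tt \<alpha> = R \<alpha> - E \<alpha>"

text \<open>Every hyperplane is counted twice, once for each of its two roots.\<close>

definition tau :: "(nat \<Rightarrow> int) \<Rightarrow> 'a" where "tau \<alpha> = scC (1 / (2 * pi * \<i>)) (tt \<alpha>)"

definition cc :: "(nat \<Rightarrow> int) \<Rightarrow> (nat \<Rightarrow> int) \<Rightarrow> 'a" where "cc \<alpha> \<beta> = tt \<alpha> * tt \<beta> - tt \<beta> * tt \<alpha>"

lemma tt_minus: "\<alpha> \<in> roots \<Longrightarrow> tt (- \<alpha>) = tt \<alpha>"
  unfolding tt_def by (simp only: R_minus E_minus)

lemma R_tt: "\<alpha> \<in> roots \<Longrightarrow> \<beta> \<in> roots \<Longrightarrow> R \<alpha> * tt \<beta> = tt (refl \<alpha> \<beta>) * R \<alpha>"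
  by (simp add: tt_def algebra_simps R_R R_E)

lemma cc_0: "\<alpha> \<in> roots \<Longrightarrow> \<beta> \<in> roots \<Longrightarrow> bil \<alpha> \<beta> = 0 \<Longrightarrow> cc \<alpha> \<beta> = 0"
  using R_tt[of \<alpha> \<beta>] R_E[of \<beta> \<alpha>] E_comm[of \<alpha> \<beta>] bil_sym[of \<beta> \<alpha>]
  by (simp add: cc_def refl_def sc_simps) (simp add: tt_def algebra_simps)

lemma third_root:
  assumes "\<alpha> \<in> roots" "\<beta> \<in> roots" "bil \<alpha> \<beta> = -1"
  shows "- \<alpha> - \<beta> \<in> roots" "refl \<alpha> \<beta> = - (- \<alpha> - \<beta>)" "bil \<beta> (- \<alpha> - \<beta>) = -1"
    "refl \<alpha> (- \<alpha> - \<beta>) = - \<beta>" "bil \<alpha> (- \<alpha> - \<beta>) = -1"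
proof -
  show r: "refl \<alpha> \<beta> = - (- \<alpha> - \<beta>)" using assms bil_sym[of \<beta> \<alpha>] by (simp add: refl_def sc_simps)
  show "- \<alpha> - \<beta> \<in> roots" using minus_root[OF refl_root[OF assms(1,2)]] unfolding r minus_minus .
  show "bil \<beta> (- \<alpha> - \<beta>) = -1" "bil \<alpha> (- \<alpha> - \<beta>) = -1"
    using assms bil_sym[of \<beta> \<alpha>] by (simp_all add: bil_simps bil_root)
  have "refl \<alpha> (- \<alpha> - \<beta>) = - (refl \<alpha> (refl \<alpha> \<beta>))" using r by (simp add: refl_add)
  then show "refl \<alpha> (- \<alpha> - \<beta>) = - \<beta>" using refl_refl[OF assms(1)] by simp
qed

text \<open>The infinitesimal braid relation in a subsystem of type A2. \<open>R \<alpha>\<close>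
  exchanges the other two roots up to sign, so it commutes with the sum; \<open>E \<alpha>\<close>
  annihilates the sum on both sides, because each of its products with a reflection equals the
  product with the \<open>E\<close> of the other root.\<close>

lemma tt_comm_sum:
  assumes a: "\<alpha> \<in> roots" "\<beta> \<in> roots" "bil \<alpha> \<beta> = -1"
  shows "tt \<alpha> * (tt \<beta> + tt (- \<alpha> - \<beta>)) = (tt \<beta> + tt (- \<alpha> - \<beta>)) * tt \<alpha>"
proof -
  let ?g = "- \<alpha> - \<beta>"
  note g = third_root[OF a]
  have R1: "R \<alpha> * tt \<beta> = tt ?g * R \<alpha>" "R \<alpha> * tt ?g = tt \<beta> * R \<alpha>"
    using R_tt[OF a(1,2)] R_tt[OF a(1) g(1)] unfolding g(2) g(4) tt_minus[OF g(1)] tt_minus[OF a(2)] .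
  have "E \<alpha> * R \<beta> = E \<alpha> * E ?g" "E \<alpha> * R ?g = E \<alpha> * E \<beta>"
    using E_R[OF a(1,2)] E_R[OF a(1) g(1)] a(3) g(5)
    unfolding g(2) g(4) E_minus[OF g(1)] E_minus[OF a(2)] by auto
  then have E1: "E \<alpha> * (tt \<beta> + tt ?g) = 0" by (simp add: tt_def algebra_simps)
  have "R \<beta> * E \<alpha> = E ?g * E \<alpha>" "R ?g * E \<alpha> = E \<beta> * E \<alpha>"
    using R_E'[OF a(1,2)] R_E'[OF a(1) g(1)] a(3) g(5)
    unfolding g(2) g(4) E_minus[OF g(1)] E_minus[OF a(2)] by auto
  then have E2: "(tt \<beta> + tt ?g) * E \<alpha> = 0" by (simp add: tt_def algebra_simps)
  have "tt \<alpha> * (tt \<beta> + tt ?g) = R \<alpha> * tt \<beta> + R \<alpha> * tt ?g - E \<alpha> * (tt \<beta> + tt ?g)"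
    by (simp only: tt_def[of \<alpha>] left_diff_distrib) (simp only: distrib_left)
  also have "\<dots> = (tt \<beta> + tt ?g) * R \<alpha> - (tt \<beta> + tt ?g) * E \<alpha>" unfolding E1 E2 R1 by (simp add: distrib_right)
  also have "\<dots> = (tt \<beta> + tt ?g) * tt \<alpha>" by (simp only: tt_def[of \<alpha>] right_diff_distrib)
  finally show ?thesis .
qed

lemma cc_cycle:
  assumes "\<alpha> \<in> roots" "\<beta> \<in> roots" "bil \<alpha> \<beta> = -1"
  shows "cc \<beta> (- \<alpha> - \<beta>) = cc \<alpha> \<beta>"
proof -
  have "tt \<beta> * (tt \<alpha> + tt (- \<beta> - \<alpha>)) = (tt \<alpha> + tt (- \<beta> - \<alpha>)) * tt \<beta>"
    using tt_comm_sum[OF assms(2,1)] assms(3) bil_sym[of \<beta> \<alpha>] by simp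
  moreover have "- \<beta> - \<alpha> = - \<alpha> - \<beta>" by simp
  ultimately show ?thesis by (simp add: cc_def algebra_simps)
qed

text \<open>The coefficients are antisymmetric, so only commutators matter, and these vanish unless
  the two roots span a system of type A2. Pairs with product -1 form cycles (\<alpha>, \<beta>),
  (\<beta>, \<gamma>), (\<gamma>, \<alpha>) with \<alpha> + \<beta> + \<gamma> = 0. The commutator
  and the numerator are constant on such a cycle, and the reciprocal denominators add up to 0, which
  is Arnold's relation. A change of sign of \<beta> reduces product 1 to product -1.\<close>

lemma flat_tt:
  fixes a b l :: "(nat \<Rightarrow> int) \<Rightarrow> complex"
  assumes add: "Modules.additive a" "Modules.additive b" "Modules.additive l"
    and nz: "\<And>\<alpha>. \<alpha> \<in> roots \<Longrightarrow> l \<alpha> \<noteq> 0"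
  shows "(\<Sum>\<alpha>\<in>roots. \<Sum>\<beta>\<in>roots. scC ((a \<alpha> * b \<beta> - b \<alpha> * a \<beta>) / (l \<alpha> * l \<beta>)) (tt \<alpha> * tt \<beta>)) = 0"
proof -
  define K where "K \<alpha> \<beta> = (a \<alpha> * b \<beta> - b \<alpha> * a \<beta>) / (l \<alpha> * l \<beta>)" for \<alpha> \<beta>
  define F where "F = (\<lambda>(\<alpha>, \<beta>). scC (K \<alpha> \<beta>) (cc \<alpha> \<beta>))"
  let ?P = "\<lambda>c. {(\<alpha>, \<beta>) \<in> roots \<times> roots. bil \<alpha> \<beta> = c}"
  have ng: "a (- \<alpha>) = - a \<alpha>" "b (- \<alpha>) = - b \<alpha>" "l (- \<alpha>) = - l \<alpha>" for \<alpha>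
    using add by (simp_all add: additive.minus)
  have fin: "finite (?P c)" for c
    by (rule finite_subset[of _ "roots \<times> roots"]) (auto simp: finite_roots)
  have K_anti: "K \<beta> \<alpha> = - K \<alpha> \<beta>" for \<alpha> \<beta>
    by (simp add: K_def mult.commute minus_divide_left)
  have "(\<Sum>\<alpha>\<in>roots. \<Sum>\<beta>\<in>roots. scC (K \<alpha> \<beta>) (tt \<beta> * tt \<alpha>))
      = (\<Sum>\<alpha>\<in>roots. \<Sum>\<beta>\<in>roots. scC (K \<beta> \<alpha>) (tt \<alpha> * tt \<beta>))" by (rule sum.swap)
  also have "\<dots> = (\<Sum>\<alpha>\<in>roots. \<Sum>\<beta>\<in>roots. - scC (K \<alpha> \<beta>) (tt \<alpha> * tt \<beta>))"
    by (intro sum.cong refl, subst K_anti) (simp only: scC.sm_minus_left)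
  finally have swap: "(\<Sum>\<alpha>\<in>roots. \<Sum>\<beta>\<in>roots. scC (K \<alpha> \<beta>) (tt \<beta> * tt \<alpha>))
      = - (\<Sum>\<alpha>\<in>roots. \<Sum>\<beta>\<in>roots. scC (K \<alpha> \<beta>) (tt \<alpha> * tt \<beta>))"
    by (simp only: sum_negf)
  have zero: "(\<Sum>p\<in>?P (-1). F p) = 0"
  proof -
    define \<tau> :: "(nat \<Rightarrow> int) \<times> (nat \<Rightarrow> int) \<Rightarrow> (nat \<Rightarrow> int) \<times> (nat \<Rightarrow> int)"
      where "\<tau> p = (snd p, - fst p - snd p)" for p
    have cyc: "\<tau> (\<tau> (\<tau> p)) = p" for p by (cases p) (simp add: \<tau>_def algebra_simps)
    have mem: "\<tau> p \<in> ?P (-1)" if "p \<in> ?P (-1)" for p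
      using that third_root by (auto simp: \<tau>_def)
    have bij: "bij_betw \<tau> (?P (-1)) (?P (-1))"
    proof (rule bij_betw_byWitness[where f' = "\<lambda>p. \<tau> (\<tau> p)"])
      show "\<tau> ` ?P (-1) \<subseteq> ?P (-1)" "(\<lambda>p. \<tau> (\<tau> p)) ` ?P (-1) \<subseteq> ?P (-1)"
        by (intro image_subsetI mem, assumption)+
    qed (simp_all only: cyc, simp_all)
    have pt: "F p + F (\<tau> p) + F (\<tau> (\<tau> p)) = 0" if pP: "p \<in> ?P (-1)" for p
    proof -
      obtain \<alpha> \<beta> where p: "p = (\<alpha>, \<beta>)" "\<alpha> \<in> roots" "\<beta> \<in> roots" "bil \<alpha> \<beta> = -1" using pP by auto
      let ?g = "- \<alpha> - \<beta>"
      note g = third_root[OF p(2-4)]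
      have t2: "- \<beta> - ?g = \<alpha>" by simp
      have c: "cc \<beta> ?g = cc \<alpha> \<beta>" "cc ?g \<alpha> = cc \<alpha> \<beta>"
        using cc_cycle[OF p(2-4)] cc_cycle[OF p(3) g(1) g(3)] unfolding t2 by simp_all
      have f: "f ?g = - f \<alpha> - f \<beta>" if "Modules.additive f" for f :: "(nat \<Rightarrow> int) \<Rightarrow> complex"
        using that by (simp add: additive.diff additive.minus)
      have fg: "a ?g = - a \<alpha> - a \<beta>" "b ?g = - b \<alpha> - b \<beta>" "l ?g = - l \<alpha> - l \<beta>"
        using f add by blast+
      have l0: "l \<alpha> \<noteq> 0" "l \<beta> \<noteq> 0" "- l \<alpha> - l \<beta> \<noteq> 0"
        using nz[OF p(2)] nz[OF p(3)] nz[OF g(1)] fg by auto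
      have arnold: "w / (x * y) + w / (y * z) + w / (z * x) = 0"
        if "x \<noteq> 0" "y \<noteq> 0" "z \<noteq> 0" "x + y + z = 0" for w x y z :: complex
      proof -
        have "w / (x * y) + w / (y * z) + w / (z * x) = w * (x + y + z) / (x * y * z)"
          using that(1-3) by (simp add: field_simps)
        then show ?thesis by (simp add: that(4))
      qed
      have "K \<alpha> \<beta> + K \<beta> ?g + K ?g \<alpha> = 0"
      proof -
        have "b \<beta> * a \<alpha> - a \<beta> * b \<alpha> = a \<alpha> * b \<beta> - b \<alpha> * a \<beta>" by simp
        moreover have "a \<beta> * (- b \<alpha> - b \<beta>) - b \<beta> * (- a \<alpha> - a \<beta>) = a \<alpha> * b \<beta> - b \<alpha> * a \<beta>"
          "(- a \<alpha> - a \<beta>) * b \<alpha> - (- b \<alpha> - b \<beta>) * a \<alpha> = a \<alpha> * b \<beta> - b \<alpha> * a \<beta>"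
          by (simp_all add: algebra_simps)
        ultimately show ?thesis unfolding K_def fg using arnold[OF l0] by simp
      qed
      then have "scC (K \<alpha> \<beta>) (cc \<alpha> \<beta>) + scC (K \<beta> ?g) (cc \<alpha> \<beta>) + scC (K ?g \<alpha>) (cc \<alpha> \<beta>) = 0"
        by (simp add: scC_add_left[symmetric] scC.sm_zero_left)
      then show ?thesis by (simp add: p(1) F_def c \<tau>_def)
    qed
    have s1: "(\<Sum>p\<in>?P (-1). F (\<tau> p)) = (\<Sum>p\<in>?P (-1). F p)"
      by (rule sum.reindex_bij_betw[OF bij])
    have s2: "(\<Sum>p\<in>?P (-1). F (\<tau> (\<tau> p))) = (\<Sum>p\<in>?P (-1). F (\<tau> p))"
      by (rule sum.reindex_bij_betw[OF bij, of "\<lambda>p. F (\<tau> p)"])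
    have "(\<Sum>p\<in>?P (-1). F p + F (\<tau> p) + F (\<tau> (\<tau> p))) = 0"
      by (rule sum.neutral) (use pt in blast)
    then have "(\<Sum>p\<in>?P (-1). F p) + (\<Sum>p\<in>?P (-1). F p) + (\<Sum>p\<in>?P (-1). F p) = 0"
      by (simp only: sum.distrib s1 s2)
    then have "scC 3 (\<Sum>p\<in>?P (-1). F p) = 0"
      using scC_add_left[of 1 1 "\<Sum>p\<in>?P (-1). F p"] scC_add_left[of 2 1 "\<Sum>p\<in>?P (-1). F p"] by (simp add: scC_one)
    then show ?thesis by (rule scC_eq_0) simp
  qed
  have "(\<Sum>p\<in>?P 1. F p) = (\<Sum>p\<in>?P (-1). F p)"
  proof (rule sum.reindex_bij_witness[of _ "\<lambda>(\<alpha>, \<beta>). (\<alpha>, - \<beta>)" "\<lambda>(\<alpha>, \<beta>). (\<alpha>, - \<beta>)"])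
    fix p assume "p \<in> ?P 1"
    then obtain \<alpha> \<beta> where p: "p = (\<alpha>, \<beta>)" "\<beta> \<in> roots" by auto
    have "cc \<alpha> (- \<beta>) = cc \<alpha> \<beta>" unfolding cc_def tt_minus[OF p(2)] ..
    moreover have "K \<alpha> (- \<beta>) = K \<alpha> \<beta>" unfolding K_def ng by (simp add: divide_simps)
    ultimately show "F (case p of (\<alpha>, \<beta>) \<Rightarrow> (\<alpha>, - \<beta>)) = F p" by (simp add: p(1) F_def)
  qed (auto simp: minus_root bil_simps)
  with zero have one: "(\<Sum>p\<in>?P 1. F p) = 0" by simp
  have "(\<Sum>p\<in>roots \<times> roots. F p) = (\<Sum>p\<in>?P (-1) \<union> ?P 1. F p)"
  proof (rule sum.mono_neutral_right)
    show "\<forall>p\<in>roots \<times> roots - (?P (-1) \<union> ?P 1). F p = 0"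
    proof
      fix p assume p: "p \<in> roots \<times> roots - (?P (-1) \<union> ?P 1)"
      then obtain \<alpha> \<beta> where ab: "p = (\<alpha>, \<beta>)" "\<alpha> \<in> roots" "\<beta> \<in> roots" "bil \<alpha> \<beta> \<noteq> -1" "bil \<alpha> \<beta> \<noteq> 1" by auto
      then consider "bil \<alpha> \<beta> = 0" | "\<alpha> = \<beta>" | "\<alpha> = - \<beta>" using bil_roots[OF ab(2,3)] by auto
      then have "cc \<alpha> \<beta> = 0"
      proof cases
        case 3
        show ?thesis unfolding 3 cc_def tt_minus[OF ab(3)] by simp
      qed (use cc_0 ab in \<open>auto simp: cc_def\<close>)
      then show "F p = 0" by (simp add: ab F_def scC.sm_zero_right)
    qed
  qed (auto simp: finite_roots)
  also have "\<dots> = (\<Sum>p\<in>?P (-1). F p) + (\<Sum>p\<in>?P 1. F p)" by (rule sum.union_disjoint) (use fin in auto)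
  finally have "(\<Sum>p\<in>roots \<times> roots. F p) = 0" unfolding zero one by simp
  then have "(\<Sum>\<alpha>\<in>roots. \<Sum>\<beta>\<in>roots. F (\<alpha>, \<beta>)) = 0"
    by (simp add: sum.cartesian_product)
  then have "(\<Sum>\<alpha>\<in>roots. \<Sum>\<beta>\<in>roots. scC (K \<alpha> \<beta>) (tt \<alpha> * tt \<beta>))
     - (\<Sum>\<alpha>\<in>roots. \<Sum>\<beta>\<in>roots. scC (K \<alpha> \<beta>) (tt \<beta> * tt \<alpha>)) = 0"
    by (simp add: F_def cc_def scC.sm_diff_right sum_subtractf)
  then have "scC 2 (\<Sum>\<alpha>\<in>roots. \<Sum>\<beta>\<in>roots. scC (K \<alpha> \<beta>) (tt \<alpha> * tt \<beta>)) = 0"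
    unfolding swap using scC_add_left[of 1 1 "\<Sum>\<alpha>\<in>roots. \<Sum>\<beta>\<in>roots. scC (K \<alpha> \<beta>) (tt \<alpha> * tt \<beta>)"]
    by (simp add: scC_one)
  then show ?thesis unfolding K_def by (rule scC_eq_0) simp
qed

end

sublocale brauer_kz \<subseteq> kz roots tau
proof
  fix a b l :: "(nat \<Rightarrow> int) \<Rightarrow> complex"
  assume *: "Modules.additive a" "Modules.additive b" "Modules.additive l" "\<And>\<alpha>. \<alpha> \<in> roots \<Longrightarrow> l \<alpha> \<noteq> 0"
  let ?z = "1 / (2 * pi * \<i>)"
  have "scC x (tau \<alpha> * tau \<beta>) = scC (?z * ?z) (scC x (tt \<alpha> * tt \<beta>))" for x \<alpha> \<beta>
    by (simp add: tau_def scC_mult_left scC_mult_right scC_scC mult_ac)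
  then show "(\<Sum>\<alpha>\<in>roots. \<Sum>\<beta>\<in>roots. scC ((a \<alpha> * b \<beta> - b \<alpha> * a \<beta>) / (l \<alpha> * l \<beta>)) (tau \<alpha> * tau \<beta>)) = 0"
    using flat_tt[OF *] by (simp only: scC.sm_sum_right[symmetric] scC.sm_zero_right)
qed (rule finite_roots)

section \<open>The Weyl group action and monodromy between its base points\<close>

context brauer_kz
begin

fun act :: "nat list \<Rightarrow> (nat \<Rightarrow> int) \<Rightarrow> nat \<Rightarrow> int" where
  "act [] \<alpha> = \<alpha>"
| "act (i # w) \<alpha> = refl (simple i) (act w \<alpha>)"

fun act_inv :: "nat list \<Rightarrow> (nat \<Rightarrow> int) \<Rightarrow> nat \<Rightarrow> int" where
  "act_inv [] \<alpha> = \<alpha>"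
| "act_inv (i # w) \<alpha> = act_inv w (refl (simple i) \<alpha>)"

definition ring_word :: "nat list \<Rightarrow> 'a" where "ring_word w = prod_list (map (\<lambda>i. R (simple i)) w)"
definition ring_inv :: "nat list \<Rightarrow> 'a" where "ring_inv w = prod_list (map (\<lambda>i. R (simple i)) (rev w))"

lemma act_root: "set w \<subseteq> {1..n} \<Longrightarrow> \<alpha> \<in> roots \<Longrightarrow> act w \<alpha> \<in> roots"
  "set w \<subseteq> {1..n} \<Longrightarrow> \<alpha> \<in> roots \<Longrightarrow> act_inv w \<alpha> \<in> roots"
  by (induction w arbitrary: \<alpha>) (auto simp: refl_root simple_root)

lemma act_act_inv: "set w \<subseteq> {1..n} \<Longrightarrow> act w (act_inv w \<alpha>) = \<alpha>" "set w \<subseteq> {1..n} \<Longrightarrow> act_inv w (act w \<alpha>) = \<alpha>"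
  by (induction w arbitrary: \<alpha>) (simp_all add: refl_refl simple_root)

lemma act_append: "act (u @ w) \<alpha> = act u (act w \<alpha>)" "act_inv (u @ w) \<alpha> = act_inv w (act_inv u \<alpha>)"
  by (induction u arbitrary: \<alpha>) simp_all

lemma act_linear: "act w (\<alpha> + \<beta>) = act w \<alpha> + act w \<beta>" "act w (- \<alpha>) = - act w \<alpha>"
  "act_inv w (\<alpha> + \<beta>) = act_inv w \<alpha> + act_inv w \<beta>" "act_inv w (- \<alpha>) = - act_inv w \<alpha>"
  by (induction w arbitrary: \<alpha> \<beta>) (simp_all add: refl_add)

lemma act_bij: "set w \<subseteq> {1..n} \<Longrightarrow> bij_betw (act w) roots roots"
  by (rule bij_betw_byWitness[where f' = "act_inv w"]) (auto simp: act_act_inv act_root)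

lemma ring_word_inv_both:
  "set w \<subseteq> {1..n} \<Longrightarrow> ring_word w * ring_inv w = 1 \<and> ring_inv w * ring_word w = 1"
proof (induction w)
  case (Cons i w)
  have i: "i \<in> {1..n}" using Cons.prems by simp
  have r: "R (simple i) * R (simple i) = 1" by (rule R_sq[OF simple_root[OF i]])
  have IH: "ring_word w * ring_inv w = 1" "ring_inv w * ring_word w = 1" using Cons by auto
  have 1: "ring_word (i # w) = R (simple i) * ring_word w" "ring_inv (i # w) = ring_inv w * R (simple i)"
    by (simp_all add: ring_word_def ring_inv_def)
  have "ring_word (i # w) * ring_inv (i # w) = R (simple i) * (ring_word w * ring_inv w) * R (simple i)"
    "ring_inv (i # w) * ring_word (i # w) = ring_inv w * (R (simple i) * R (simple i)) * ring_word w"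
    unfolding 1 by (simp_all only: mult.assoc)
  then show ?case using IH r by simp
qed (simp add: ring_word_def ring_inv_def)

lemmas ring_word_inv = ring_word_inv_both[THEN conjunct1] ring_word_inv_both[THEN conjunct2]

lemma ring_word_tau: "set w \<subseteq> {1..n} \<Longrightarrow> \<alpha> \<in> roots \<Longrightarrow> ring_word w * tau \<alpha> = tau (act w \<alpha>) * ring_word w"
proof (induction w)
  case (Cons i w)
  have "ring_word (i # w) * tau \<alpha> = R (simple i) * (ring_word w * tau \<alpha>)"
    by (simp add: ring_word_def mult.assoc)
  also have "\<dots> = (R (simple i) * tau (act w \<alpha>)) * ring_word w" using Cons by (simp add: mult.assoc)
  also have "R (simple i) * tau (act w \<alpha>) = tau (act (i # w) \<alpha>) * R (simple i)"
    using R_tt[of "simple i" "act w \<alpha>"] Cons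
    by (simp add: tau_def simple_root act_root scC_mult_left scC_mult_right)
  finally show ?case by (simp add: ring_word_def mult.assoc)
qed (simp add: ring_word_def)

definition base :: "(nat \<Rightarrow> int) \<Rightarrow> complex" where "base \<alpha> = of_int (ht \<alpha>)"
text \<open>Here all simple roots take the value \<i>. The base points \<open>point w\<close> are
  real, so the segments from this one centre to all of them avoid the hyperplanes.\<close>

definition center :: "(nat \<Rightarrow> int) \<Rightarrow> complex" where "center \<alpha> = \<i> * of_int (ht \<alpha>)"

text \<open>The affine line through the base point in the direction of the \<open>i\<close>-th coroot, with the value
  \<open>u\<close> of the \<open>i\<close>-th simple root as coordinate. The half circle \<open>u = exp (\<i>\<theta>)\<close> leads from the base
  point to its mirror image.\<close>

definition coline :: "nat \<Rightarrow> complex \<Rightarrow> (nat \<Rightarrow> int) \<Rightarrow> complex" where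
  "coline i u \<alpha> = of_int (ht \<alpha>) - of_int (bil \<alpha> (simple i)) * (1 - u) / 2"

definition P :: "((nat \<Rightarrow> int) \<Rightarrow> complex) \<Rightarrow> 'a fps" where "P = transport center"

lemma P_0: "P l $ 0 = 1" by (simp add: P_def transport_0)

text \<open>The image under \<open>w\<close> of the base point, at which all simple roots take the
  value 1.\<close>

definition point :: "nat list \<Rightarrow> (nat \<Rightarrow> int) \<Rightarrow> complex" where
  "point w \<alpha> = of_int (ht (act_inv w \<alpha>))"

text \<open>The logarithmic derivative of \<alpha> in \<theta> along the half circle of node
  \<open>i\<close>, moved by \<open>w\<close>.\<close>

definition \<Omega> :: "nat \<Rightarrow> nat list \<Rightarrow> real \<Rightarrow> (nat \<Rightarrow> int) \<Rightarrow> complex" where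
  "\<Omega> i w \<theta> \<alpha> = (of_int (bil (act_inv w \<alpha>) (simple i)) / 2 * (\<i> * exp (\<i> * \<theta>))) / coline i (exp (\<i> * \<theta>)) (act_inv w \<alpha>)"

lemma additive_coline: "Modules.additive (\<lambda>\<alpha>. coline i u (act_inv w \<alpha>))"
  by (simp add: Modules.additive_def coline_def act_linear ht_add bil_add algebra_simps add_divide_distrib diff_divide_distrib)

lemma coline_ends: "i \<in> {1..n} \<Longrightarrow> coline i 1 (act_inv w \<alpha>) = point w \<alpha>"
  "i \<in> {1..n} \<Longrightarrow> coline i (- 1) (act_inv w \<alpha>) = point (w @ [i]) \<alpha>"
  by (simp_all add: coline_def point_def act_append refl_def ht_add ht_simple)

text \<open>At u = 1 and u = -1 the value is the height of \<beta> and of its reflection, both of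
  which are positive roots. In between, the real part is an affine function of Re u.\<close>

lemma coline_Re:
  assumes "\<beta> \<in> pos" "i \<in> {1..n}" "\<beta> \<noteq> simple i" "cmod u \<le> 1"
  shows "Re (coline i u \<beta>) > 0"
proof -
  have b: "bil \<beta> (simple i) \<in> {-2, -1, 0, 1, 2}" "bil \<beta> (simple i) \<noteq> 2"
    using bil_roots[OF pos_root[OF assms(1)] simple_root[OF assms(2)]] assms(3) by auto
  have "\<beta> \<noteq> - simple i" using not_both[OF assms(1)] simple_pos[OF assms(2)] by (metis minus_minus)
  then have b2: "bil \<beta> (simple i) \<noteq> -2"
    using bil_roots(3)[OF pos_root[OF assms(1)] simple_root[OF assms(2)]] by auto
  have u: "Re u \<le> 1" "Re u \<ge> -1" using abs_Re_le_cmod[of u] assms(4) by linarith+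
  have Re: "Re (coline i u \<beta>) = of_int (ht \<beta>) - of_int (bil \<beta> (simple i)) * (1 - Re u) / 2"
    by (simp add: coline_def)
  show ?thesis
  proof (cases "bil \<beta> (simple i) = 1")
    case True
    have "ht (\<beta> - simple i) \<ge> 1" using pos_ht pos_sub_simple(1)[OF assms(1,2) True] by blast
    then have "ht \<beta> \<ge> 2" using pos_sub_simple(3)[OF assms(1,2) True] by simp
    then have "real_of_int (ht \<beta>) \<ge> 2" by linarith
    then show ?thesis unfolding Re True using u by simp
  next
    case False
    then have "bil \<beta> (simple i) = 0 \<or> bil \<beta> (simple i) = -1" using b b2 by auto
    moreover have "real_of_int (ht \<beta>) \<ge> 1" using pos_ht[OF assms(1)] by linarith
    ultimately show ?thesis unfolding Re using u by auto
  qed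
qed

lemma coline_simple: "i \<in> {1..n} \<Longrightarrow> coline i u (simple i) = u"
  by (simp add: coline_def ht_simple bil_simple_simple cartan_def diff_divide_distrib)

lemma coline_minus: "coline i u (- \<alpha>) = - coline i u \<alpha>"
  by (simp add: coline_def ht_add bil_minus)

text \<open>The segment from \<open>center\<close> avoids the hyperplanes as long as no positive root takes a value in
  \<open>-\<i>[0, \<infinity>)\<close>.\<close>

lemma segment_avoids:
  assumes w: "set w \<subseteq> {1..n}" "act w (simple i) \<in> pos" and i: "i \<in> {1..n}"
    and \<theta>: "\<theta> \<in> {0..pi}" and s: "s \<in> {0..1}" and \<alpha>: "\<alpha> \<in> pos"
  shows "center \<alpha> + of_real s * (coline i (exp (\<i> * \<theta>)) (act_inv w \<alpha>) - center \<alpha>) \<noteq> 0"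
proof
  assume eq: "center \<alpha> + of_real s * (coline i (exp (\<i> * \<theta>)) (act_inv w \<alpha>) - center \<alpha>) = 0"
  let ?\<beta> = "act_inv w \<alpha>"
  let ?c = "coline i (exp (\<i> * \<theta>)) ?\<beta>"
  have h: "real_of_int (ht \<alpha>) \<ge> 1" using pos_ht[OF \<alpha>] by linarith
  have Re: "s * Re ?c = 0" using arg_cong[OF eq, of Re] by (simp add: center_def)
  have Im: "(1 - s) * ht \<alpha> + s * Im ?c = 0" using arg_cong[OF eq, of Im] by (simp add: center_def algebra_simps)
  have s0: "s > 0" using Im h s by (cases "s = 0") auto
  then have Re0: "Re ?c = 0" using Re by simp
  have \<beta>: "?\<beta> \<in> roots" using act_root(2)[OF w(1) pos_root[OF \<alpha>]] .
  have n1: "cmod (exp (\<i> * \<theta>)) \<le> 1" by simp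
  \<comment> \<open>By \<open>coline_Re\<close>, only the root of the moved half circle itself can
    have real part 0. Its value exp (\<i> \<theta>) lies in the closed upper half plane and cannot
    cancel the contribution of the centre.\<close>
  have "?\<beta> = simple i"
  proof (rule ccontr)
    assume ne: "?\<beta> \<noteq> simple i"
    show False
    proof (cases "?\<beta> \<in> pos")
      case True
      then show False using coline_Re[OF True i ne n1] Re0 by simp
    next
      case False
      then have p: "- ?\<beta> \<in> pos" using pos_or_neg[OF \<beta>] by blast
      have "- ?\<beta> \<noteq> simple i"
      proof
        assume "- ?\<beta> = simple i"
        then have "act w (simple i) = - \<alpha>"
          using act_act_inv(1)[OF w(1), of \<alpha>] act_linear(2)[of w ?\<beta>] by simp
        then show False using w(2) not_both[OF \<alpha>] by simp
      qed
      then show False using coline_Re[OF p i _ n1] Re0 by (simp add: coline_minus)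
    qed
  qed
  then have c: "?c = exp (\<i> * \<theta>)" using coline_simple[OF i] by simp
  have "Im ?c \<ge> 0" unfolding c using \<theta> by (simp add: Im_exp sin_ge_zero)
  moreover have "Re ?c \<noteq> 0 \<or> Im ?c \<noteq> 0" unfolding c by (metis complex_eq_0 exp_not_eq_zero complex_eqI zero_complex.sel)
  ultimately have "Im ?c > 0" using Re0 by auto
  then have "(1 - s) * ht \<alpha> + s * Im ?c > 0" using h s s0 by (simp add: add_nonneg_pos)
  then show False using Im by simp
qed

lemma P_horizontal:
  assumes w: "set w \<subseteq> {1..n}" "act w (simple i) \<in> pos" and i: "i \<in> {1..n}"
  shows "horizontal 0 pi (\<Omega> i w) (\<lambda>\<theta>. P (\<lambda>\<alpha>. coline i (exp (\<i> * \<theta>)) (act_inv w \<alpha>)))"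
proof -
  have "horizontal 0 pi (\<lambda>\<theta> \<alpha>. (of_int (bil (act_inv w \<alpha>) (simple i)) / 2 * (\<i> * exp (\<i> * \<theta>)))
        / coline i (exp (\<i> * \<theta>)) (act_inv w \<alpha>))
      (\<lambda>\<theta>. transport center (\<lambda>\<alpha>. coline i (exp (\<i> * \<theta>)) (act_inv w \<alpha>)))"
  proof (rule transport_horizontal)
    show "Modules.additive center" by (simp add: Modules.additive_def center_def ht_add algebra_simps)
    show "Modules.additive (\<lambda>\<alpha>. coline i (exp (\<i> * \<theta>)) (act_inv w \<alpha>))" for \<theta> by (rule additive_coline)
    show "Modules.additive (\<lambda>\<alpha>. of_int (bil (act_inv w \<alpha>) (simple i)) / 2 * (\<i> * exp (\<i> * complex_of_real \<theta>)))" for \<theta>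
      by (simp add: Modules.additive_def act_linear bil_add algebra_simps add_divide_distrib)
    show "((\<lambda>\<theta>. coline i (exp (\<i> * \<theta>)) (act_inv w \<alpha>)) has_vector_derivative
        of_int (bil (act_inv w \<alpha>) (simple i)) / 2 * (\<i> * exp (\<i> * \<theta>))) (at \<theta> within {0..pi})" for \<theta> \<alpha>
    proof -
      have "((\<lambda>z. coline i (exp (\<i> * z)) (act_inv w \<alpha>)) has_field_derivative
          of_int (bil (act_inv w \<alpha>) (simple i)) / 2 * (\<i> * exp (\<i> * \<theta>))) (at (of_real \<theta>))"
        unfolding coline_def by (auto intro!: derivative_eq_intros)
      then show ?thesis by (rule has_vector_derivative_real_field[THEN has_vector_derivative_at_within])
    qed
    show "continuous_on {0..pi} (\<lambda>\<theta>. of_int (bil (act_inv w \<alpha>) (simple i)) / 2 * (\<i> * exp (\<i> * complex_of_real \<theta>)))" for \<alpha>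
      by (intro continuous_intros)
    fix s \<theta> \<alpha> assume s: "s \<in> {0..1::real}" "\<theta> \<in> {0..pi}" and \<alpha>: "\<alpha> \<in> roots"
    show "center \<alpha> + of_real s * (coline i (exp (\<i> * \<theta>)) (act_inv w \<alpha>) - center \<alpha>) \<noteq> 0"
    proof (cases "\<alpha> \<in> pos")
      case False
      then have "- \<alpha> \<in> pos" using pos_or_neg[OF \<alpha>] by blast
      from segment_avoids[OF w i s(2,1) this] show ?thesis
        by (simp add: act_linear coline_minus center_def ht_add algebra_simps neg_eq_iff_add_eq_0)
    qed (use segment_avoids[OF w i s(2,1)] in blast)
  qed
  then show ?thesis unfolding \<Omega>_def[abs_def] P_def .
qed


lemma fps_const_mult_assoc: "fps_const a * (fps_const b * f) = fps_const (a * b) * (f :: 'b::ring_1 fps)"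
  by (simp add: mult.assoc[symmetric])

text \<open>Two solutions over the same moved half circle, equal at its start: one is the transport
  from the centre, the other is the transport over the original half circle, carried along by
  \<open>w\<close>. Hence they agree at its end.\<close>

lemma transport_translate:
  assumes w: "set w \<subseteq> {1..n}" "act w (simple i) \<in> pos" and i: "i \<in> {1..n}"
  shows "P (point (w @ [i])) * finv (P (point w))
     = fps_const (ring_word w) * (P (point [i]) * finv (P (point []))) * fps_const (ring_inv w)"
proof -
  let ?L = "\<lambda>w \<theta>. (\<lambda>\<alpha>. coline i (exp (\<i> * complex_of_real \<theta>)) (act_inv w \<alpha>))"
  let ?Y = "\<lambda>\<theta>. P (?L w \<theta>) * finv (P (point w))"
  let ?Z = "\<lambda>\<theta>. (fps_const (ring_word w) * P (?L [] \<theta>)) * (finv (P (point [])) * fps_const (ring_inv w))"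
  have hor: "horizontal 0 pi (\<Omega> i w) ?Y" by (rule horizontal_mult_right[OF P_horizontal[OF w i]])
  have "horizontal 0 pi (\<Omega> i w) (\<lambda>\<theta>. fps_const (ring_word w) * P (?L [] \<theta>))"
  proof (rule horizontal_conjugate)
    show "horizontal 0 pi (\<Omega> i []) (\<lambda>\<theta>. P (?L [] \<theta>))"
      by (rule P_horizontal) (use i simple_pos in auto)
    show "bij_betw (act w) roots roots" by (rule act_bij[OF w(1)])
    show "\<alpha> \<in> roots \<Longrightarrow> ring_word w * tau \<alpha> = tau (act w \<alpha>) * ring_word w" for \<alpha>
      by (rule ring_word_tau[OF w(1)])
    show "\<Omega> i w \<theta> (act w \<alpha>) = \<Omega> i [] \<theta> \<alpha>" for \<theta> \<alpha> by (simp add: \<Omega>_def act_act_inv[OF w(1)])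
  qed
  then have hor': "horizontal 0 pi (\<Omega> i w) ?Z" by (rule horizontal_mult_right)
  have L0: "?L v 0 = point v" "?L v pi = point (v @ [i])" for v
    using coline_ends[OF i, of v] by (simp_all add: fun_eq_iff)
  have "?Y 0 = 1" by (simp only: L0 finv[OF P_0])
  moreover have "?Z 0 = 1"
  proof -
    have "?Z 0 = fps_const (ring_word w) * (P (point []) * finv (P (point []))) * fps_const (ring_inv w)"
      unfolding L0 by (simp only: mult.assoc)
    then show ?thesis by (simp add: finv[OF P_0] ring_word_inv[OF w(1)])
  qed
  ultimately have init: "?Y 0 = ?Z 0" by (rule trans[OF _ sym])
  have "pi \<in> {0..pi}" by simp
  from horizontal_unique[OF hor hor' pi_ge_zero init this] have "?Y pi = ?Z pi" .
  then show ?thesis unfolding L0 by (simp add: mult.assoc)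
qed

text \<open>The image of a braid generator: the half circle from the base point to its mirror image,
  followed by the reflection that leads back.\<close>

definition gg :: "nat \<Rightarrow> 'a fps" where
  "gg i = fps_const (R (simple i)) * P (point [i]) * finv (P (point []))"

text \<open>The positive lift of a Weyl group element to the braid group. It is made of data that
  depend on the group element only; on the other hand \<open>GG_snoc\<close> writes it as a product
  of the \<open>gg\<close> along a reduced word. Comparing two reduced words of one element yields
  the braid relations.\<close>

definition GG :: "nat list \<Rightarrow> 'a fps" where
  "GG w = fps_const (ring_inv w) * P (point w) * finv (P (point []))"

lemma GG_Nil: "GG [] = 1" by (simp add: GG_def ring_inv_def finv P_0)

text \<open>That \<open>act w (simple i)\<close> is positive means that appending \<open>i\<close>
  makes the word longer in the Weyl group. The half circle is then traversed on the side that can be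
  seen from the centre.\<close>

lemma GG_snoc:
  assumes "set w \<subseteq> {1..n}" "act w (simple i) \<in> pos" "i \<in> {1..n}"
  shows "GG (w @ [i]) = gg i * GG w"
proof -
  have "GG (w @ [i]) = fps_const (ring_inv (w @ [i])) * (P (point (w @ [i])) * (finv (P (point w)) * P (point w))) * finv (P (point []))"
    by (simp add: GG_def finv P_0)
  also have "\<dots> = fps_const (ring_inv (w @ [i])) * (P (point (w @ [i])) * finv (P (point w))) * (P (point w) * finv (P (point [])))"
    by (simp only: mult.assoc)
  also have "\<dots> = fps_const (ring_inv (w @ [i]) * ring_word w) * (P (point [i]) * finv (P (point []))) * GG w"
    unfolding transport_translate[OF assms] by (simp add: GG_def mult.assoc fps_const_mult_assoc)
  also have "ring_inv (w @ [i]) * ring_word w = R (simple i)"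
  proof -
    have "ring_inv (w @ [i]) * ring_word w = R (simple i) * (ring_inv w * ring_word w)"
      by (simp add: ring_inv_def mult.assoc)
    then show ?thesis by (simp add: ring_word_inv[OF assms(1)])
  qed
  finally show ?thesis by (simp add: gg_def mult.assoc)
qed

lemma gg_0: "gg i $ 0 = R (simple i)"
  by (simp add: gg_def P_0 finv)

lemma gg_braid:
  assumes ij: "i \<in> {1..n}" "j \<in> {1..n}" "adj i j"
  shows "gg i * gg j * gg i = gg j * gg i * gg j"
proof -
  have ne: "i \<noteq> j" using ij adj_irrefl by auto
  have ji: "adj j i" using adj_sym ij by blast
  have refl_ij: "refl (simple k) (simple m) = simple k + simple m"
    and refl_refl_ij: "refl (simple k) (refl (simple m) (simple k)) = simple m"
    if "k \<in> {1..n}" "m \<in> {1..n}" "adj k m" "adj m k" "k \<noteq> m" for k m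
    using that by (simp_all add: refl_def bil_simps bil_simple_simple cartan_def sc_simps)
  have three: "GG [k, m, k] = gg k * gg m * gg k"
    if km: "k \<in> {1..n}" "m \<in> {1..n}" "adj k m" "adj m k" "k \<noteq> m" for k m
  proof -
    have "refl (simple k) (simple m) \<in> pos" by (rule refl_pos) (use km simple_pos simple_inj in auto)
    then have 2: "GG [k, m] = gg m * GG [k]" using GG_snoc[of "[k]" m] km by simp
    have 1: "GG [k] = gg k" using GG_snoc[of "[]" k] km simple_pos by (simp add: GG_Nil)
    have "act [k, m] (simple k) \<in> pos" using refl_refl_ij[OF km] simple_pos km by simp
    then have "GG [k, m, k] = gg k * GG [k, m]" using GG_snoc[of "[k, m]" k] km by simp
    then show ?thesis using 1 2 by (simp add: mult.assoc)
  qed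
  have "act_inv [i, j, i] \<alpha> = act_inv [j, i, j] \<alpha>" for \<alpha>
    using ij ji ne bil_sym[of "simple j" "simple i"]
    by (simp add: refl_def bil_simps sc_simps bil_simple_simple cartan_def algebra_simps)
  then have "point [i, j, i] = point [j, i, j]" by (intro ext) (simp only: point_def)
  moreover have "ring_inv [i, j, i] = ring_inv [j, i, j]"
  proof -
    note s = simple_root[OF ij(1)] simple_root[OF ij(2)]
    have "R (simple i) * R (simple j) * R (simple i) = R (refl (simple i) (simple j))"
      using R_R[OF s] R_sq[OF s(1)] by (simp add: mult.assoc)
    moreover have "R (simple j) * R (simple i) * R (simple j) = R (refl (simple j) (simple i))"
      using R_R[OF s(2,1)] R_sq[OF s(2)] by (simp add: mult.assoc)
    moreover have "refl (simple i) (simple j) = refl (simple j) (simple i)"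
      using refl_ij ij ji ne by (simp add: add.commute)
    ultimately show ?thesis by (simp add: ring_inv_def mult.assoc)
  qed
  ultimately have "GG [i, j, i] = GG [j, i, j]" by (simp only: GG_def)
  then show ?thesis using three ij ji ne by metis
qed

lemma gg_comm:
  assumes ij: "i \<in> {1..n}" "j \<in> {1..n}" "\<not> adj i j"
  shows "gg i * gg j = gg j * gg i"
proof (cases "i = j")
  case False
  have ji: "\<not> adj j i" using adj_sym ij by blast
  have two: "GG [k, m] = gg m * gg k" if km: "k \<in> {1..n}" "m \<in> {1..n}" "k \<noteq> m" for k m
  proof -
    have "refl (simple k) (simple m) \<in> pos" by (rule refl_pos) (use km simple_pos simple_inj in auto)
    then have 2: "GG [k, m] = gg m * GG [k]" using GG_snoc[of "[k]" m] km by simp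
    have 1: "GG [k] = gg k" using GG_snoc[of "[]" k] km simple_pos by (simp add: GG_Nil)
    show ?thesis using 1 2 by simp
  qed
  have "act_inv [i, j] \<alpha> = act_inv [j, i] \<alpha>" for \<alpha>
    using ij ji False
    by (simp add: refl_def bil_simps sc_simps bil_simple_simple cartan_def algebra_simps)
  then have "point [i, j] = point [j, i]" by (intro ext) (simp only: point_def)
  moreover have "ring_inv [i, j] = ring_inv [j, i]"
  proof -
    have "refl (simple i) (simple j) = simple j"
      using ij ji False by (simp add: refl_def bil_simple_simple cartan_def sc_simps)
    then show ?thesis
      using R_R[OF simple_root[OF ij(1)] simple_root[OF ij(2)]] by (simp add: ring_inv_def)
  qed
  ultimately have "GG [i, j] = GG [j, i]" by (simp only: GG_def)
  then show ?thesis using two ij False by metis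
qed simp

end

section \<open>Local monodromy around a hyperplane\<close>

text \<open>The radius 3 is dictated by \<open>coline_nonzero\<close>: within it, u = 0 is the only
  value of the coordinate at which a root vanishes on \<open>coline i\<close>. The half circle has
  radius 1.\<close>

definition prim :: "(complex \<Rightarrow> complex) \<Rightarrow> complex \<Rightarrow> complex" where
  "prim f = (SOME F. F 0 = 0 \<and> (\<forall>u\<in>ball 0 3. (F has_field_derivative f u) (at u)))"

lemma prim:
  assumes "f holomorphic_on ball 0 3"
  shows "prim f 0 = 0" "u \<in> ball 0 3 \<Longrightarrow> (prim f has_field_derivative f u) (at u)"
    "prim f holomorphic_on ball 0 3"
proof -
  obtain F where F: "\<And>x. x \<in> ball 0 3 \<Longrightarrow> (F has_field_derivative f x) (at x within ball 0 3)"
    using holomorphic_convex_primitive'[OF convex_ball open_ball assms] by blast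
  have "((\<lambda>x. F x - F 0) has_field_derivative f x) (at x)" if "x \<in> ball 0 3" for x
    using F[OF that] that by (auto intro!: derivative_eq_intros simp: at_within_open[OF _ open_ball])
  then have "\<exists>F. F 0 = 0 \<and> (\<forall>u\<in>ball 0 3. (F has_field_derivative f u) (at u))"
    by (intro exI[of _ "\<lambda>x. F x - F 0"]) auto
  then have *: "prim f 0 = 0 \<and> (\<forall>u\<in>ball 0 3. (prim f has_field_derivative f u) (at u))"
    unfolding prim_def by (rule someI_ex)
  then show "prim f 0 = 0" "u \<in> ball 0 3 \<Longrightarrow> (prim f has_field_derivative f u) (at u)" by auto
  show "prim f holomorphic_on ball 0 3"
    using * unfolding holomorphic_on_def field_differentiable_def by (metis has_field_derivative_at_within)
qed

text \<open>Division by the coordinate with the removable singularity at 0 filled in; it keeps the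
  equation with its simple pole within holomorphic functions.\<close>

definition quot :: "(complex \<Rightarrow> complex) \<Rightarrow> complex \<Rightarrow> complex" where
  "quot f v = (if v = 0 then deriv f 0 else (f v - f 0) / (v - 0))"

lemma quot_holomorphic: "f holomorphic_on ball 0 3 \<Longrightarrow> quot f holomorphic_on ball 0 3"
  unfolding quot_def[abs_def] by (rule pole_lemma_open) auto

section \<open>The holomorphic factor of the local solution\<close>

context brauer_kz
begin

text \<open>The residue at u = 0, to which both roots of node \<open>i\<close> contribute
  equally.\<close>

definition bb :: "nat \<Rightarrow> 'a" where "bb i = scC 2 (tau (simple i))"
definition aa :: "nat \<Rightarrow> (nat \<Rightarrow> int) \<Rightarrow> complex \<Rightarrow> complex" where
  "aa i \<alpha> u = of_int (bil \<alpha> (simple i)) / 2 / coline i u \<alpha>"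
definition others :: "nat \<Rightarrow> (nat \<Rightarrow> int) set" where "others i = roots - {simple i, - simple i}"

text \<open>The fundamental solution along \<open>coline i\<close> has the form \<open>H(u) u\<^bsup>b\<^esup>\<close> with \<open>H\<close> holomorphic and
  \<open>H(0) = 1\<close>, where \<open>u H' = [b, H] + u A H\<close>. The letter \<open>None\<close> of a word stands for the commutator
  with \<open>b\<close>, the letter \<open>Some \<alpha>\<close> for the summand \<open>\<alpha>\<close> of \<open>A\<close>.\<close>

fun JJ :: "nat \<Rightarrow> (nat \<Rightarrow> int) option list \<Rightarrow> complex \<Rightarrow> complex" where
  "JJ i [] = (\<lambda>_. 1)"
| "JJ i (None # w) = prim (quot (JJ i w))"
| "JJ i (Some \<alpha> # w) = prim (\<lambda>v. aa i \<alpha> v * JJ i w v)"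

fun MM :: "nat \<Rightarrow> (nat \<Rightarrow> int) option list \<Rightarrow> 'a" where
  "MM i [] = 1"
| "MM i (None # w) = bb i * MM i w - MM i w * bb i"
| "MM i (Some \<alpha> # w) = tau \<alpha> * MM i w"

definition HH :: "nat \<Rightarrow> nat \<Rightarrow> complex \<Rightarrow> 'a" where
  "HH i k u = (\<Sum>w\<in>words_of (insert None (Some ` others i)) k. scC (JJ i w u) (MM i w))"

definition H :: "nat \<Rightarrow> complex \<Rightarrow> 'a fps" where "H i u = Abs_fps (\<lambda>k. HH i k u)"

lemma finite_others: "finite (others i)" by (simp add: others_def finite_roots)

text \<open>For product 1 the zero is u = 1 - 2 h and for product -1 it is u = 1 + 2 h, where h is
  the height. In the first case h is at least 2, because subtracting the simple root leaves a
  positive root. So the modulus is at least 3.\<close>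

lemma coline_nonzero:
  assumes i: "i \<in> {1..n}" and \<alpha>: "\<alpha> \<in> others i" and u: "u \<in> ball 0 3"
  shows "coline i u \<alpha> \<noteq> 0"
proof -
  have pos: "coline i u \<beta> \<noteq> 0" if \<beta>: "\<beta> \<in> pos" "\<beta> \<noteq> simple i" for \<beta>
  proof
    assume eq: "coline i u \<beta> = 0"
    have bil: "bil \<beta> (simple i) \<in> {-1, 0, 1}"
    proof -
      have "\<beta> \<noteq> - simple i" using not_both[OF \<beta>(1)] simple_pos[OF i] by (metis minus_minus)
      then show ?thesis using bil_roots[OF pos_root[OF \<beta>(1)] simple_root[OF i]] \<beta>(2) by auto
    qed
    have h: "real_of_int (ht \<beta>) \<ge> 1" using pos_ht[OF \<beta>(1)] by linarith
    have cu: "cmod u < 3" using u by simp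
    from bil consider "bil \<beta> (simple i) = 1" | "bil \<beta> (simple i) = 0" | "bil \<beta> (simple i) = -1" by auto
    then show False
    proof cases
      case 1
      have "ht (\<beta> - simple i) \<ge> 1" using pos_ht pos_sub_simple(1)[OF \<beta>(1) i 1] by blast
      then have "ht \<beta> \<ge> 2" using pos_sub_simple(3)[OF \<beta>(1) i 1] by simp
      then have h2: "real_of_int (ht \<beta>) \<ge> 2" by linarith
      have "u = of_real (1 - 2 * of_int (ht \<beta>))" using eq 1 by (simp add: coline_def field_simps)
      then have "cmod u = \<bar>1 - 2 * of_int (ht \<beta>)\<bar>" by (metis norm_of_real)
      then show False using h2 cu by linarith
    next
      case 2
      then show False using eq h by (simp add: coline_def)
    next
      case 3
      have "u = of_real (1 + 2 * of_int (ht \<beta>))" using eq 3 by (simp add: coline_def field_simps eq_neg_iff_add_eq_0)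
      then have "cmod u = \<bar>1 + 2 * of_int (ht \<beta>)\<bar>" by (metis norm_of_real)
      then show False using h cu by linarith
    qed
  qed
  show ?thesis
  proof (cases "\<alpha> \<in> pos")
    case True
    then show ?thesis using pos \<alpha> by (simp add: others_def)
  next
    case False
    then have "- \<alpha> \<in> pos" using pos_or_neg \<alpha> by (auto simp: others_def)
    moreover have "- \<alpha> \<noteq> simple i" using \<alpha> by (auto simp: others_def) (metis minus_minus)
    ultimately have "- \<alpha> \<in> pos" "- \<alpha> \<noteq> simple i" by auto
    then show ?thesis using pos[of "- \<alpha>"] by (simp add: coline_minus)
  qed
qed

lemma aa_holomorphic: "i \<in> {1..n} \<Longrightarrow> \<alpha> \<in> others i \<Longrightarrow> aa i \<alpha> holomorphic_on ball 0 3"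
  using coline_nonzero unfolding aa_def[abs_def] coline_def[abs_def]
  by (intro holomorphic_intros) auto

lemma JJ_holomorphic:
  "i \<in> {1..n} \<Longrightarrow> set w \<subseteq> insert None (Some ` others i) \<Longrightarrow> JJ i w holomorphic_on ball 0 3"
proof (induction i w rule: JJ.induct)
  case (2 i w)
  then show ?case by (auto intro!: prim quot_holomorphic)
next
  case (3 i \<alpha> w)
  then show ?case by (auto intro!: prim holomorphic_on_mult aa_holomorphic)
qed auto

lemma JJ_0:
  assumes "i \<in> {1..n}" "set w \<subseteq> insert None (Some ` others i)" "w \<noteq> []"
  shows "JJ i w 0 = 0"
proof (cases w)
  case (Cons x w')
  have "JJ i w' holomorphic_on ball 0 3" using JJ_holomorphic assms Cons by auto
  then show ?thesis using assms Cons
    by (cases x) (auto intro!: prim quot_holomorphic holomorphic_on_mult aa_holomorphic)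
qed (use assms in auto)

lemma JJ_deriv:
  assumes "i \<in> {1..n}" "set w \<subseteq> insert None (Some ` others i)" "u \<in> ball 0 3"
  shows "(JJ i (None # w) has_field_derivative quot (JJ i w) u) (at u)"
    "\<alpha> \<in> others i \<Longrightarrow> (JJ i (Some \<alpha> # w) has_field_derivative aa i \<alpha> u * JJ i w u) (at u)"
  using assms JJ_holomorphic[OF assms(1,2)]
  by (auto intro!: prim quot_holomorphic holomorphic_on_mult aa_holomorphic)

lemma sum_words_option:
  assumes "finite A"
  shows "(\<Sum>w\<in>words_of (insert None (Some ` A)) (Suc k). f w)
    = (\<Sum>w\<in>words_of (insert None (Some ` A)) k. f (None # w))
      + (\<Sum>a\<in>A. \<Sum>w\<in>words_of (insert None (Some ` A)) k. f (Some a # w))"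
  using assms by (subst sum_words_of_Suc) (auto simp: sum.reindex)

lemma words_sub: "w \<in> words_of A k \<Longrightarrow> set w \<subseteq> A" by (simp add: words_of_def)

lemma HH_0: "HH i 0 u = 1" by (simp add: HH_def scC_one)

lemma HH_at_0: "i \<in> {1..n} \<Longrightarrow> HH i (Suc k) 0 = 0"
  unfolding HH_def
proof (intro sum.neutral ballI)
  fix w assume "i \<in> {1..n}" and w: "w \<in> words_of (insert None (Some ` others i)) (Suc k)"
  moreover have "w \<noteq> []" using w by (auto simp: words_of_def)
  ultimately have "JJ i w 0 = 0" using JJ_0[of i w] words_sub[OF w] by blast
  then show "scC (JJ i w 0) (MM i w) = 0" by (simp add: scC.sm_zero_left)
qed

lemma HH_holomorphic:
  assumes "i \<in> {1..n}" "clin \<phi>"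
  shows "(\<lambda>u. \<phi> (HH i k u)) holomorphic_on ball 0 3"
  unfolding HH_def clin_sum[OF assms(2)] clin_scC[OF assms(2)]
  by (intro holomorphic_intros JJ_holomorphic assms(1) words_sub)

lemma HH_deriv:
  assumes i: "i \<in> {1..n}" and \<phi>: "clin \<phi>" and u: "u \<in> ball 0 3" "u \<noteq> 0"
  shows "((\<lambda>u. \<phi> (HH i (Suc k) u)) has_field_derivative
    \<phi> (bb i * HH i k u - HH i k u * bb i) / u + (\<Sum>\<alpha>\<in>others i. aa i \<alpha> u * \<phi> (tau \<alpha> * HH i k u))) (at u)"
proof -
  let ?W = "words_of (insert None (Some ` others i)) k"
  have "((\<lambda>u. \<phi> (HH i (Suc k) u)) has_field_derivative
     (\<Sum>w\<in>?W. quot (JJ i w) u * \<phi> (MM i (None # w))) +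
     (\<Sum>\<alpha>\<in>others i. \<Sum>w\<in>?W. aa i \<alpha> u * JJ i w u * \<phi> (MM i (Some \<alpha> # w)))) (at u)"
    unfolding HH_def sum_words_option[OF finite_others] clin_add[OF \<phi>] clin_sum[OF \<phi>] clin_scC[OF \<phi>]
    by (intro DERIV_add DERIV_sum DERIV_cmult_right JJ_deriv i u words_sub)
  moreover have "(\<Sum>w\<in>?W. quot (JJ i w) u * \<phi> (MM i (None # w)))
      = (\<Sum>w\<in>?W. JJ i w u / u * \<phi> (bb i * MM i w - MM i w * bb i))"
  proof (rule sum.cong[OF refl])
    fix w assume w: "w \<in> ?W"
    \<comment> \<open>For the empty word the quotient is 0 and not 1 / u, but the commutator with 1
      vanishes too.\<close>
    show "quot (JJ i w) u * \<phi> (MM i (None # w)) = JJ i w u / u * \<phi> (bb i * MM i w - MM i w * bb i)"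
      using JJ_0[OF i words_sub[OF w]] u by (cases "w = []") (simp_all add: quot_def clin_0[OF \<phi>])
  qed
  moreover have "\<dots> = \<phi> (bb i * HH i k u - HH i k u * bb i) / u"
    by (simp add: HH_def sum_distrib_left sum_distrib_right clin_diff[OF \<phi>] clin_sum[OF \<phi>] clin_scC[OF \<phi>]
        scC_mult_left scC_mult_right sum_subtractf[symmetric] sum_divide_distrib right_diff_distrib diff_divide_distrib)
  moreover have "(\<Sum>\<alpha>\<in>others i. \<Sum>w\<in>?W. aa i \<alpha> u * JJ i w u * \<phi> (MM i (Some \<alpha> # w)))
      = (\<Sum>\<alpha>\<in>others i. aa i \<alpha> u * \<phi> (tau \<alpha> * HH i k u))"
    by (simp add: HH_def sum_distrib_left clin_sum[OF \<phi>] clin_scC[OF \<phi>] scC_mult_right mult.assoc)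
  ultimately show ?thesis by simp
qed


lemma R_bb: "i \<in> {1..n} \<Longrightarrow> R (simple i) * bb i = bb i * R (simple i)"
  using R_tt[of "simple i" "simple i"] simple_root[of i]
  by (simp add: bb_def tau_def scC_mult_left scC_mult_right refl_self tt_minus[OF simple_root[of i]])

lemma R_tau: "i \<in> {1..n} \<Longrightarrow> \<alpha> \<in> roots \<Longrightarrow> R (simple i) * tau \<alpha> = tau (refl (simple i) \<alpha>) * R (simple i)"
  using R_tt[of "simple i" \<alpha>] simple_root[of i]
  by (simp add: tau_def scC_mult_left scC_mult_right)

lemma bij_others: "i \<in> {1..n} \<Longrightarrow> bij_betw (refl (simple i)) (others i) (others i)"
proof (rule bij_betw_byWitness[where f' = "refl (simple i)"])
  assume i: "i \<in> {1..n}"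
  note si = simple_root[OF i]
  have "refl (simple i) \<alpha> \<in> others i" if \<alpha>: "\<alpha> \<in> others i" for \<alpha>
  proof -
    have "refl (simple i) \<alpha> \<noteq> \<beta>" if "\<alpha> \<noteq> refl (simple i) \<beta>" for \<beta>
      using that refl_refl[OF si] by metis
    then show ?thesis using \<alpha> refl_root[OF si] by (auto simp: others_def refl_self[OF si] refl_add(2))
  qed
  then show "refl (simple i) ` others i \<subseteq> others i" by blast
  then show "refl (simple i) ` others i \<subseteq> others i" .
qed (simp_all add: refl_refl simple_root)

lemma aa_refl: "i \<in> {1..n} \<Longrightarrow> aa i (refl (simple i) \<alpha>) u = - aa i \<alpha> (- u)"
proof -
  assume i: "i \<in> {1..n}"
  have b: "bil (refl (simple i) \<alpha>) (simple i) = - bil \<alpha> (simple i)"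
    using bil_root[OF simple_root[OF i]] by (simp add: refl_def bil_simps)
  have h: "ht (refl (simple i) \<alpha>) = ht \<alpha> - bil \<alpha> (simple i)" using i by (simp add: refl_def ht_add ht_simple)
  have "coline i u (refl (simple i) \<alpha>) = coline i (- u) \<alpha>"
    unfolding coline_def b h by (simp add: field_simps)
  then show ?thesis by (simp add: aa_def b)
qed

text \<open>The reflection of node \<open>i\<close> takes u to -u and preserves the equation and the
  normalisation at u = 0, where its solution is unique. The derivative of the difference is 0 away
  from 0, and continuity takes care of 0.\<close>

lemma HH_symmetric:
  assumes i: "i \<in> {1..n}" and u: "u \<in> ball 0 3"
  shows "R (simple i) * HH i k (- u) * R (simple i) = HH i k u"
  using u
proof (induction k arbitrary: u)
  case 0
  then show ?case using R_sq[OF simple_root[OF i]] by (simp add: HH_0)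
next
  case (Suc k)
  let ?R = "R (simple i)" and ?S = "refl (simple i)"
  show ?case
  proof (rule clin_eqI)
    fix \<phi> :: "'a \<Rightarrow> complex" assume \<phi>: "clin \<phi>"
    define \<psi> where "\<psi> x = \<phi> (?R * x * ?R)" for x
    have \<psi>: "clin \<psi>" unfolding \<psi>_def[abs_def] using clin_left[OF clin_right[OF \<phi>], of ?R ?R] by simp
    define D where "D u = \<psi> (HH i (Suc k) (- u)) - \<phi> (HH i (Suc k) u)" for u
    have cont: "continuous_on (ball 0 3) D" unfolding D_def
    proof (intro continuous_on_diff)
      show "continuous_on (ball 0 3) (\<lambda>u. \<phi> (HH i (Suc k) u))"
        by (rule holomorphic_on_imp_continuous_on[OF HH_holomorphic[OF i \<phi>]])
      show "continuous_on (ball 0 3) (\<lambda>u. \<psi> (HH i (Suc k) (- u)))"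
        by (rule continuous_on_compose2[OF holomorphic_on_imp_continuous_on[OF HH_holomorphic[OF i \<psi>]], of _ uminus])
          (auto intro!: continuous_intros)
    qed
    have "(D has_field_derivative 0) (at u)" if u: "u \<in> ball 0 3 - {0}" for u
    proof -
      have mu: "- u \<in> ball 0 3" "- u \<noteq> 0" and pu: "u \<in> ball 0 3" "u \<noteq> 0" using u by auto
      have IH: "HH i k u = ?R * HH i k (- u) * ?R" using Suc.IH[OF pu(1)] by simp
      have e1: "\<psi> (bb i * HH i k (- u) - HH i k (- u) * bb i) = \<phi> (bb i * HH i k u - HH i k u * bb i)"
      proof -
        have "?R * (bb i * HH i k (- u) - HH i k (- u) * bb i) * ?R
            = (?R * bb i) * HH i k (- u) * ?R - ?R * HH i k (- u) * (bb i * ?R)"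
          by (simp add: algebra_simps)
        also have "\<dots> = bb i * HH i k u - HH i k u * bb i"
        proof -
          have "(?R * bb i) * X * ?R = bb i * (?R * X * ?R)" for X by (simp only: R_bb[OF i] mult.assoc)
          moreover have "?R * X * (bb i * ?R) = ?R * X * ?R * bb i" for X by (simp only: R_bb[OF i, symmetric] mult.assoc)
          ultimately show ?thesis unfolding IH by simp
        qed
        finally show ?thesis by (simp add: \<psi>_def)
      qed
      have "(\<Sum>\<alpha>\<in>others i. aa i \<alpha> u * \<phi> (tau \<alpha> * HH i k u))
          = (\<Sum>\<alpha>\<in>others i. aa i (?S \<alpha>) u * \<phi> (tau (?S \<alpha>) * HH i k u))"
        by (rule sum.reindex_bij_betw[OF bij_others[OF i], symmetric])
      also have "\<dots> = (\<Sum>\<alpha>\<in>others i. - (aa i \<alpha> (- u) * \<psi> (tau \<alpha> * HH i k (- u))))"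
      proof (rule sum.cong[OF refl])
        fix \<alpha> assume \<alpha>: "\<alpha> \<in> others i"
        have "tau (?S \<alpha>) * HH i k u = (tau (?S \<alpha>) * ?R) * HH i k (- u) * ?R"
          unfolding IH by (simp add: mult.assoc)
        also have "\<dots> = ?R * (tau \<alpha> * HH i k (- u)) * ?R"
          using R_tau[OF i, of \<alpha>] \<alpha> by (simp add: others_def flip: mult.assoc)
        finally show "aa i (?S \<alpha>) u * \<phi> (tau (?S \<alpha>) * HH i k u) = - (aa i \<alpha> (- u) * \<psi> (tau \<alpha> * HH i k (- u)))"
          by (simp add: aa_refl[OF i] \<psi>_def)
      qed
      finally have e2: "(\<Sum>\<alpha>\<in>others i. aa i \<alpha> u * \<phi> (tau \<alpha> * HH i k u))
          = - (\<Sum>\<alpha>\<in>others i. aa i \<alpha> (- u) * \<psi> (tau \<alpha> * HH i k (- u)))"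
        by (simp add: sum_negf)
      have d1: "((\<lambda>u. \<psi> (HH i (Suc k) (- u))) has_field_derivative
          (\<psi> (bb i * HH i k (- u) - HH i k (- u) * bb i) / (- u)
            + (\<Sum>\<alpha>\<in>others i. aa i \<alpha> (- u) * \<psi> (tau \<alpha> * HH i k (- u)))) * (- 1)) (at u)"
        by (rule DERIV_chain2[where g = uminus, OF HH_deriv[OF i \<psi> mu]]) (auto intro!: derivative_eq_intros)
      show ?thesis unfolding D_def
        by (rule DERIV_cong[OF DERIV_diff[OF d1 HH_deriv[OF i \<phi> pu]]]) (simp add: e1 e2)
    qed
    then obtain c where c: "\<And>u. u \<in> ball 0 3 \<Longrightarrow> D u = c"
      using DERIV_zero_connected_constant[of "ball 0 3" "{0}" D] cont by auto
    have "D 0 = 0" by (simp add: D_def HH_at_0[OF i] clin_0[OF \<phi>] clin_0[OF \<psi>])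
    then have "D u = 0" using c[of 0] c[OF Suc.prems] by simp
    then show "\<phi> (?R * HH i (Suc k) (- u) * ?R) = \<phi> (HH i (Suc k) u)" by (simp add: D_def \<psi>_def)
  qed
qed

lemma H_symmetric:
  assumes "i \<in> {1..n}"
  shows "fps_const (R (simple i)) * H i (- 1) = H i 1 * fps_const (R (simple i))"
proof (rule fps_ext)
  fix k
  have "R (simple i) * HH i k (- 1) * R (simple i) * R (simple i) = HH i k 1 * R (simple i)"
    using HH_symmetric[OF assms, of 1 k] by simp
  then show "(fps_const (R (simple i)) * H i (- 1)) $ k = (H i 1 * fps_const (R (simple i))) $ k"
    using R_sq[OF simple_root[OF assms]] by (simp add: H_def mult.assoc)
qed

definition vder :: "(real \<Rightarrow> 'a fps) \<Rightarrow> (real \<Rightarrow> 'a fps) \<Rightarrow> bool" where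
  "vder Y Y' \<longleftrightarrow> (\<forall>\<phi> k. clin \<phi> \<longrightarrow> (\<forall>t\<in>{0..pi}.
     ((\<lambda>t. \<phi> (Y t $ k)) has_vector_derivative \<phi> (Y' t $ k)) (at t within {0..pi})))"

lemma vder_mult_scalar:
  assumes F: "vder F F'" and s: "\<And>k t. t \<in> {0..pi} \<Longrightarrow> (s k has_vector_derivative s' k t) (at t within {0..pi})"
  shows "vder (\<lambda>t. F t * Abs_fps (\<lambda>k. scC (s k t) (c k)))
    (\<lambda>t. F' t * Abs_fps (\<lambda>k. scC (s k t) (c k)) + F t * Abs_fps (\<lambda>k. scC (s' k t) (c k)))"
  unfolding vder_def
proof (intro allI impI ballI)
  fix \<phi> k t assume \<phi>: "clin (\<phi> :: 'a \<Rightarrow> complex)" and t: "t \<in> {0..pi}"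
  have "((\<lambda>t. \<Sum>j=0..k. \<phi> (F t $ j * c (k - j)) * s (k - j) t) has_vector_derivative
      (\<Sum>j=0..k. \<phi> (F t $ j * c (k - j)) * s' (k - j) t + \<phi> (F' t $ j * c (k - j)) * s (k - j) t)) (at t within {0..pi})"
  proof (intro has_vector_derivative_sum has_vector_derivative_mult s t)
    show "((\<lambda>t. \<phi> (F t $ j * c (k - j))) has_vector_derivative \<phi> (F' t $ j * c (k - j))) (at t within {0..pi})" for j
      using F clin_right[OF \<phi>, of "c (k - j)"] t unfolding vder_def by blast
  qed
  then show "((\<lambda>t. \<phi> ((F t * Abs_fps (\<lambda>k. scC (s k t) (c k))) $ k)) has_vector_derivative
      \<phi> ((F' t * Abs_fps (\<lambda>k. scC (s k t) (c k)) + F t * Abs_fps (\<lambda>k. scC (s' k t) (c k))) $ k)) (at t within {0..pi})"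
    by (simp add: fps_mult_nth clin_add[OF \<phi>] clin_sum[OF \<phi>] scC_mult_right clin_scC[OF \<phi>] sum.distrib mult.commute add.commute)
qed

text \<open>The exponential of \<i> \<theta> times the residue times y, which is the power of u =
  exp (\<i> \<theta>) in the local solution.\<close>

definition Ex :: "nat \<Rightarrow> real \<Rightarrow> 'a fps" where
  "Ex i \<theta> = Abs_fps (\<lambda>k. scC ((\<i> * \<theta>) ^ k / fact k) (bb i ^ k))"

lemma Ex_deriv: "Abs_fps (\<lambda>k. scC (if k = 0 then 0 else \<i> * ((\<i> * complex_of_real \<theta>) ^ (k - 1) / fact (k - 1))) (bb i ^ k))
    = fps_X * (fps_const (scC \<i> (bb i)) * Ex i \<theta>)"
proof (rule fps_ext)
  fix k
  show "Abs_fps (\<lambda>k. scC (if k = 0 then 0 else \<i> * ((\<i> * complex_of_real \<theta>) ^ (k - 1) / fact (k - 1))) (bb i ^ k)) $ k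
    = (fps_X * (fps_const (scC \<i> (bb i)) * Ex i \<theta>)) $ k"
    by (cases k) (simp_all add: Ex_def scC.sm_zero_left scC.sm_zero_right scC_mult_left scC_mult_right scC_scC mult.commute)
qed

lemma exp_path_deriv:
  "((\<lambda>\<theta>. exp (\<i> * complex_of_real \<theta>)) has_vector_derivative \<i> * exp (\<i> * \<theta>)) (at \<theta> within {0..pi})"
proof -
  have "((\<lambda>z. exp (\<i> * z)) has_field_derivative \<i> * exp (\<i> * \<theta>)) (at (of_real \<theta>))"
    by (auto intro!: derivative_eq_intros)
  then show ?thesis by (rule has_vector_derivative_real_field[THEN has_vector_derivative_at_within])
qed

lemma vder_H:
  assumes i: "i \<in> {1..n}"
  shows "vder (\<lambda>\<theta>. H i (exp (\<i> * \<theta>)))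
    (\<lambda>\<theta>. fps_X * (fps_const (scC \<i> (bb i)) * H i (exp (\<i> * \<theta>)) - H i (exp (\<i> * \<theta>)) * fps_const (scC \<i> (bb i))
       + (\<Sum>\<alpha>\<in>others i. fps_const (scC (\<i> * exp (\<i> * \<theta>) * aa i \<alpha> (exp (\<i> * \<theta>))) (tau \<alpha>)) * H i (exp (\<i> * \<theta>)))))"
  unfolding vder_def
proof (intro allI impI ballI)
  fix \<phi> k \<theta> assume \<phi>: "clin (\<phi> :: 'a \<Rightarrow> complex)" and \<theta>: "\<theta> \<in> {0..pi}"
  let ?u = "exp (\<i> * complex_of_real \<theta>)"
  let ?Z = "fps_const (scC \<i> (bb i)) * H i ?u - H i ?u * fps_const (scC \<i> (bb i))
       + (\<Sum>\<alpha>\<in>others i. fps_const (scC (\<i> * ?u * aa i \<alpha> ?u) (tau \<alpha>)) * H i ?u)"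
  have u: "?u \<in> ball 0 3" "?u \<noteq> 0" by simp_all
  show "((\<lambda>\<theta>. \<phi> (H i (exp (\<i> * complex_of_real \<theta>)) $ k)) has_vector_derivative \<phi> ((fps_X * ?Z) $ k)) (at \<theta> within {0..pi})"
  proof (cases k)
    case 0
    then show ?thesis by (simp add: H_def HH_0 clin_0[OF \<phi>])
  next
    case (Suc j)
    have "((\<lambda>\<theta>. \<phi> (HH i (Suc j) (exp (\<i> * complex_of_real \<theta>)))) has_vector_derivative
       (\<i> * ?u) * (\<phi> (bb i * HH i j ?u - HH i j ?u * bb i) / ?u + (\<Sum>\<alpha>\<in>others i. aa i \<alpha> ?u * \<phi> (tau \<alpha> * HH i j ?u)))) (at \<theta> within {0..pi})"
      using field_vector_diff_chain_within[OF exp_path_deriv has_field_derivative_at_within[OF HH_deriv[OF i \<phi> u]]]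
      by (simp add: o_def)
    also have "(\<i> * ?u) * (\<phi> (bb i * HH i j ?u - HH i j ?u * bb i) / ?u + (\<Sum>\<alpha>\<in>others i. aa i \<alpha> ?u * \<phi> (tau \<alpha> * HH i j ?u)))
        = \<phi> (?Z $ j)"
    proof -
      have "(\<i> * v) * (z / v + S) = \<i> * z + \<i> * v * S" if "v \<noteq> 0" for v z S :: complex
        using that by (simp add: field_simps)
      from this[OF u(2)] show ?thesis
        by (simp only: H_def fps_sum_nth fps_add_nth fps_sub_nth fps_mult_left_const_nth fps_mult_right_const_nth
            Abs_fps_inverse fps_nth_Abs_fps clin_add[OF \<phi>] clin_diff[OF \<phi>] clin_sum[OF \<phi>] scC_mult_left scC_mult_right
            clin_scC[OF \<phi>] sum_distrib_left right_diff_distrib mult.assoc)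
    qed
    finally show ?thesis by (simp add: Suc H_def)
  qed
qed

lemma sum_roots_others:
  assumes "i \<in> {1..n}"
  shows "(\<Sum>\<alpha>\<in>roots. f \<alpha>) = f (simple i) + f (- simple i) + (\<Sum>\<alpha>\<in>others i. f \<alpha>)"
proof -
  note si = simple_root[OF assms]
  have ne: "- simple i \<noteq> simple i" using bil_roots(2)[OF minus_root[OF si] si] bil_root[OF si] by (auto simp: bil_minus)
  have "roots = insert (simple i) (insert (- simple i) (others i))"
    using si minus_root[OF si] by (auto simp: others_def)
  moreover have "simple i \<notin> others i" "- simple i \<notin> others i" by (auto simp: others_def)
  ultimately show ?thesis using finite_others[of i] ne by (simp add: add.assoc)
qed

lemma horizontal_H_Ex:
  assumes i: "i \<in> {1..n}"
  shows "horizontal 0 pi (\<Omega> i []) (\<lambda>\<theta>. H i (exp (\<i> * \<theta>)) * Ex i \<theta>)"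
proof -
  let ?H = "\<lambda>\<theta>. H i (exp (\<i> * complex_of_real \<theta>))"
  let ?b = "fps_const (scC \<i> (bb i))"
  let ?t = "\<lambda>\<theta> \<alpha>. fps_const (scC (\<i> * exp (\<i> * complex_of_real \<theta>) * aa i \<alpha> (exp (\<i> * \<theta>))) (tau \<alpha>))"
  have "(((\<lambda>\<theta>. (\<i> * complex_of_real \<theta>) ^ k / fact k)) has_vector_derivative
      (if k = 0 then 0 else \<i> * ((\<i> * complex_of_real \<theta>) ^ (k - 1) / fact (k - 1)))) (at \<theta> within {0..pi})" for k \<theta>
  proof -
    have "((\<lambda>z. (\<i> * z) ^ k / fact k) has_field_derivative
        (if k = 0 then 0 else \<i> * ((\<i> * of_real \<theta>) ^ (k - 1) / fact (k - 1)))) (at (of_real \<theta>))"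
    proof (cases k)
      case (Suc j)
      have "((\<lambda>z. (\<i> * z) ^ Suc j / fact (Suc j)) has_field_derivative
          ((1 + of_nat j) * (\<i> * (\<i> * of_real \<theta>) ^ j)) / fact (Suc j)) (at (of_real \<theta>))"
        by (intro DERIV_cdivide DERIV_power_Suc) (auto intro!: derivative_eq_intros)
      moreover have "((1 + of_nat j) * (\<i> * (\<i> * of_real \<theta>) ^ j)) / fact (Suc j) = \<i> * ((\<i> * complex_of_real \<theta>) ^ j / fact j)"
        unfolding fact_Suc of_nat_Suc using of_nat_neq_0[of j, where 'a = complex] by simp
      ultimately show ?thesis by (simp add: Suc)
    qed simp
    then show ?thesis by (rule has_vector_derivative_real_field[THEN has_vector_derivative_at_within])
  qed
  from vder_mult_scalar[where c = "\<lambda>k. bb i ^ k" and s = "\<lambda>k \<theta>. (\<i> * complex_of_real \<theta>) ^ k / fact k" and s' = "\<lambda>k \<theta>. if k = 0 then 0 else \<i> * ((\<i> * complex_of_real \<theta>) ^ (k - 1) / fact (k - 1))", OF vder_H[OF i] this]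
  have v: "vder (\<lambda>\<theta>. ?H \<theta> * Ex i \<theta>) (\<lambda>\<theta>. fps_X * (?b * ?H \<theta> - ?H \<theta> * ?b + (\<Sum>\<alpha>\<in>others i. ?t \<theta> \<alpha> * ?H \<theta>)) * Ex i \<theta>
      + ?H \<theta> * (fps_X * (?b * Ex i \<theta>)))"
    unfolding Ex_deriv unfolding Ex_def .
  have r: "fps_X * (?b * ?H \<theta> - ?H \<theta> * ?b + (\<Sum>\<alpha>\<in>others i. ?t \<theta> \<alpha> * ?H \<theta>)) * Ex i \<theta> + ?H \<theta> * (fps_X * (?b * Ex i \<theta>))
      = ?b * (fps_X * (?H \<theta> * Ex i \<theta>)) + (\<Sum>\<alpha>\<in>others i. ?t \<theta> \<alpha> * (fps_X * (?H \<theta> * Ex i \<theta>)))" for \<theta>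
  proof -
    have X: "x * (fps_X * y) = fps_X * (x * y)" for x y :: "'a fps"
      by (metis fps_mult_fps_X_commute mult.assoc)
    show ?thesis
      by (simp add: X sum_distrib_left[symmetric] distrib_left distrib_right left_diff_distrib right_diff_distrib
          sum_distrib_right mult.assoc)
  qed
  show ?thesis
    unfolding horizontal_def
  proof (intro allI impI ballI)
    fix \<phi> k \<theta> assume \<phi>: "clin (\<phi> :: 'a \<Rightarrow> complex)" and \<theta>: "\<theta> \<in> {0..pi}"
    let ?Y = "fps_X * (?H \<theta> * Ex i \<theta>)" and ?u = "exp (\<i> * complex_of_real \<theta>)"
    have \<Omega>o: "\<Omega> i [] \<theta> \<alpha> = \<i> * ?u * aa i \<alpha> ?u" for \<alpha> by (simp add: \<Omega>_def aa_def)
    have bs: "bil (simple i) (simple i) = 2" using bil_root[OF simple_root[OF i]] .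
    have \<Omega>s: "\<Omega> i [] \<theta> (simple i) = \<i>" "\<Omega> i [] \<theta> (- simple i) = \<i>"
      by (simp_all add: \<Omega>_def coline_simple[OF i] coline_minus bs bil_minus)
    have "(\<Sum>\<alpha>\<in>roots. \<Omega> i [] \<theta> \<alpha> * \<phi> (tau \<alpha> * ?Y $ k))
        = \<i> * \<phi> (tau (simple i) * ?Y $ k) + \<i> * \<phi> (tau (simple i) * ?Y $ k)
          + (\<Sum>\<alpha>\<in>others i. \<i> * ?u * aa i \<alpha> ?u * \<phi> (tau \<alpha> * ?Y $ k))"
      unfolding sum_roots_others[OF i] \<Omega>s
      by (simp only: \<Omega>o tau_def tt_minus[OF simple_root[OF i]])
    also have "\<dots> = \<phi> ((?b * ?Y + (\<Sum>\<alpha>\<in>others i. ?t \<theta> \<alpha> * ?Y)) $ k)"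
      by (simp add: fps_sum_nth clin_add[OF \<phi>] clin_sum[OF \<phi>] scC_mult_left clin_scC[OF \<phi>] bb_def)
    finally show "((\<lambda>\<theta>. \<phi> ((?H \<theta> * Ex i \<theta>) $ k)) has_vector_derivative
        (\<Sum>\<alpha>\<in>roots. \<Omega> i [] \<theta> \<alpha> * \<phi> (tau \<alpha> * ?Y $ k))) (at \<theta> within {0..pi})"
      using v \<phi> \<theta> unfolding vder_def r by simp
  qed
qed

text \<open>By uniqueness, the transport over the half circle equals that of the local solution.
  \<open>H_symmetric\<close> then moves the reflection past the value of \<open>H\<close> at -1, so
  that the generator becomes a conjugate of its local model.\<close>

lemma gg_local:
  assumes i: "i \<in> {1..n}"
  shows "gg i = H i 1 * (fps_const (R (simple i)) * Ex i pi) * finv (H i 1)"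
proof -
  let ?L = "\<lambda>\<theta>. (\<lambda>\<alpha>. coline i (exp (\<i> * complex_of_real \<theta>)) (act_inv [] \<alpha>))"
  have H0: "H i u $ 0 = 1" for u by (simp add: H_def HH_0)
  have Ex0: "Ex i 0 = 1"
    by (rule fps_ext) (simp add: Ex_def scC_one scC.sm_zero_left power_0_left)
  let ?Y = "\<lambda>\<theta>. P (?L \<theta>) * finv (P (point []))"
  let ?Z = "\<lambda>\<theta>. (H i (exp (\<i> * complex_of_real \<theta>)) * Ex i \<theta>) * finv (H i 1)"
  have L0: "?L 0 = point []" "?L pi = point [i]"
    using coline_ends[OF i, of "[]"] by (simp_all add: fun_eq_iff)
  have "horizontal 0 pi (\<Omega> i []) (\<lambda>\<theta>. P (?L \<theta>))"
    by (rule P_horizontal) (use i simple_pos in auto)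
  then have 1: "horizontal 0 pi (\<Omega> i []) ?Y" by (rule horizontal_mult_right)
  have 2: "horizontal 0 pi (\<Omega> i []) ?Z" by (rule horizontal_mult_right[OF horizontal_H_Ex[OF i]])
  have "?Y 0 = 1" "?Z 0 = 1" unfolding L0 by (simp_all add: finv P_0 Ex0 H0)
  then have init: "?Y 0 = ?Z 0" by (rule trans[OF _ sym])
  have "pi \<in> {0..pi}" by simp
  from horizontal_unique[OF 1 2 pi_ge_zero init this]
  have "P (point [i]) * finv (P (point [])) = H i (- 1) * Ex i pi * finv (H i 1)"
    unfolding L0 by simp
  then have "gg i = (fps_const (R (simple i)) * H i (- 1)) * Ex i pi * finv (H i 1)"
    by (simp add: gg_def mult.assoc)
  then show ?thesis unfolding H_symmetric[OF i] by (simp add: mult.assoc)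
qed

end

section \<open>Representations of the BMW algebra\<close>

text \<open>The values of \<open>l\<^sup>-\<^sup>1\<close>, \<open>l\<close>, \<open>m\<close> and \<open>\<delta>\<close>; the constant term of the last one is \<open>d\<close>.\<close>

definition par_c :: "complex \<Rightarrow> complex fps" where "par_c d = fps_exp (1 - d)"
definition par_l :: "complex \<Rightarrow> complex fps" where "par_l d = fps_exp (d - 1)"
definition par_m :: "complex fps" where "par_m = fps_exp (- 1) - fps_exp 1"
definition par_D :: "complex \<Rightarrow> complex fps" where
  "par_D d = fps_shift 1 (par_m - (par_l d - par_c d)) * inverse (fps_shift 1 par_m)"

lemma par_lc: "par_l d * par_c d = 1"
  using fps_exp_add_mult[of "d - 1" "1 - d"] by (simp add: par_l_def par_c_def)

lemma par_nth:
  "par_c d $ 0 = 1" "par_c d $ 1 = 1 - d" "par_m $ 0 = 0" "par_m $ 1 = - 2" "par_D d $ 0 = d"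
  by (simp_all add: par_c_def par_m_def par_D_def par_l_def field_simps)

text \<open>Numerator and denominator of \<open>par_D\<close> are shifted because both series vanish
  at y = 0; multiplication by the variable undoes the shift.\<close>

lemma par_mD: "par_m * par_D d = par_m - (par_l d - par_c d)"
proof -
  let ?s = "fps_shift 1 par_m"
  have s: "?s $ 0 \<noteq> 0" using par_nth(4) by simp
  have sh: "f = fps_X * fps_shift 1 f" if "f $ 0 = 0" for f :: "complex fps"
    using that by (intro fps_ext) simp
  have "par_m - (par_l d - par_c d) = fps_X * fps_shift 1 (par_m - (par_l d - par_c d))"
    by (rule sh) (simp add: par_nth par_l_def)
  also have "\<dots> = fps_X * ?s * par_D d"
    using inverse_mult_eq_1[OF s] by (simp add: par_D_def mult_ac)
  also have "fps_X * ?s = par_m" using sh[of par_m] par_nth(3) by simp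
  finally show ?thesis by simp
qed

lemma par_D_inverse: "d \<noteq> 0 \<Longrightarrow> par_D d * inverse (par_D d) = 1"
  using inverse_mult_eq_1[of "par_D d"] by (simp add: par_nth mult.commute)

lemma scF_par_m_cancel:
  fixes u :: "'a::calg fps"
  assumes "scF par_m u = 0"
  shows "u = 0"
proof (rule ccontr)
  assume "u \<noteq> 0"
  then have ex: "\<exists>k. u $ k \<noteq> 0" by (metis fps_ext fps_zero_nth)
  define k where "k = (LEAST k. u $ k \<noteq> 0)"
  have k: "u $ k \<noteq> 0" "\<And>j. j < k \<Longrightarrow> u $ j = 0"
    using LeastI_ex[OF ex] not_less_Least unfolding k_def by blast+
  have "scF par_m u $ (1 + k) = scC (par_m $ 1) (u $ k)"
    by (rule scF_leading) (use k(2) par_nth(3) in auto)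
  then have "scC (par_m $ 1) (u $ k) = 0" unfolding assms by simp
  then show False using k(1) scC_eq_0[of "par_m $ 1" "u $ k"] unfolding par_nth by simp
qed

lemma scF_const_nth: "scF s (fps_const a) $ k = scC (s $ k) a"
  by (simp add: scF_def scC.sm_mult_left)

section \<open>The relations of the BMW algebra\<close>

locale brauer_kz_2 = brauer_kz +
  assumes \<delta>_ge: "\<delta> \<ge> 2"
begin

abbreviation dd :: complex where "dd \<equiv> of_nat \<delta>"

lemma of_nat_mult_scC: "of_nat k * x = scC (of_nat k) (x :: 'a)"
  by (induction k) (simp_all add: scC.sm_simps distrib_right)

text \<open>The spectral projections at a node: \<open>ee0\<close> belongs to the image of
  \<open>E\<close>, while \<open>pp0\<close> and \<open>nn0\<close> belong to the rest of the
  eigenspaces of \<open>R\<close> for 1 and -1.\<close>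

definition ee0 :: "nat \<Rightarrow> 'a" where "ee0 i = scC (1 / dd) (E (simple i))"
definition pp0 :: "nat \<Rightarrow> 'a" where "pp0 i = scC (1 / 2) (1 + R (simple i)) - ee0 i"
definition nn0 :: "nat \<Rightarrow> 'a" where "nn0 i = scC (1 / 2) (1 - R (simple i))"

lemma scC_half: "scC (1 / 2) (x + x) = x"
  using scC_add_left[of "1/2" "1/2" x] by (simp add: scC.sm_simps)

lemma idempotents:
  assumes "i \<in> {1..n}"
  shows "pp0 i * pp0 i = pp0 i" "nn0 i * nn0 i = nn0 i" "ee0 i * ee0 i = ee0 i"
    "pp0 i * nn0 i = 0" "nn0 i * pp0 i = 0" "pp0 i * ee0 i = 0" "ee0 i * pp0 i = 0"
    "nn0 i * ee0 i = 0" "ee0 i * nn0 i = 0" "pp0 i + nn0 i + ee0 i = 1"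
    "R (simple i) = pp0 i - nn0 i + ee0 i"
proof -
  let ?R = "R (simple i)"
  let ?h = "scC (1 / 2) (1 + ?R)"
  note s = simple_root[OF assms]
  have d: "dd \<noteq> 0" using \<delta>_ge by simp
  have q: "scC (1 / 4) (x + x) = scC (1 / 2) x" for x :: 'a
    using scC_add_left[of "1/4" "1/4" x] by (simp add: scC.sm_simps)
  have Re: "?R * ee0 i = ee0 i" "ee0 i * ?R = ee0 i"
    using RE[OF s] ER[OF s] by (simp_all add: ee0_def scC_mult_left scC_mult_right)
  show ee: "ee0 i * ee0 i = ee0 i"
    using EE[OF s] d by (simp add: ee0_def scC_mult_left scC_mult_right scC_scC of_nat_mult_scC)
  have he: "?h * ee0 i = ee0 i" "ee0 i * ?h = ee0 i"
    using Re scC_half by (simp_all add: scC_mult_left scC_mult_right distrib_left distrib_right)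
  show ne: "nn0 i * ee0 i = 0" "ee0 i * nn0 i = 0"
    using Re by (simp_all add: nn0_def scC_mult_left scC_mult_right left_diff_distrib right_diff_distrib scC.sm_zero_right)
  have hh: "?h * ?h = ?h"
  proof -
    have "?h * ?h = scC (1 / 4) ((1 + ?R) + (1 + ?R))"
      using R_sq[OF s] by (simp add: scC.sm_simps algebra_simps)
    then show ?thesis unfolding q .
  qed
  show nn: "nn0 i * nn0 i = nn0 i"
  proof -
    have "nn0 i * nn0 i = scC (1 / 4) ((1 - ?R) + (1 - ?R))"
      using R_sq[OF s] scC_add_right[of "1 / 4" 1 "1 :: 'a"] by (simp add: nn0_def scC.sm_simps algebra_simps)
    then show ?thesis unfolding q nn0_def .
  qed
  have hn: "?h * nn0 i = 0" "nn0 i * ?h = 0"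
    using R_sq[OF s] by (simp_all add: nn0_def scC.sm_simps algebra_simps)
  show "pp0 i * pp0 i = pp0 i" "pp0 i * nn0 i = 0" "nn0 i * pp0 i = 0" "pp0 i * ee0 i = 0" "ee0 i * pp0 i = 0"
    unfolding pp0_def left_diff_distrib right_diff_distrib hh he hn ne ee by simp_all
  have hs: "?h + nn0 i = 1" "?h - nn0 i = ?R"
    using scC_half[of 1] scC_half[of ?R]
    by (simp_all add: nn0_def scC_add_right[symmetric] scC.sm_diff_right[symmetric])
  show "pp0 i + nn0 i + ee0 i = 1" "R (simple i) = pp0 i - nn0 i + ee0 i"
    using hs by (simp_all add: pp0_def)
qed

text \<open>An operator in the algebra of one node, given by its eigenvalues on the three
  eigenspaces. The relations of a single node thus become identities between power series.\<close>

definition lc :: "nat \<Rightarrow> complex fps \<Rightarrow> complex fps \<Rightarrow> complex fps \<Rightarrow> 'a fps" where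
  "lc i a b c = scF a (fps_const (pp0 i)) + scF b (fps_const (nn0 i)) + scF c (fps_const (ee0 i))"

lemma lc_mult: "i \<in> {1..n} \<Longrightarrow> lc i a b c * lc i a' b' c' = lc i (a * a') (b * b') (c * c')"
  unfolding lc_def using idempotents[of i]
  by (simp add: distrib_left distrib_right scF.sm_mult_left scF.sm_mult_right scF.sm_sm scF.sm_zero_right mult.commute)

lemma lc_diff: "lc i a b c - lc i a' b' c' = lc i (a - a') (b - b') (c - c')"
  unfolding lc_def by (simp add: scF.sm_diff_left)

lemma lc_one: "i \<in> {1..n} \<Longrightarrow> lc i a a a = scF a 1"
  unfolding lc_def using idempotents(10)[of i]
  by (simp only: scF.sm_add_right[symmetric] fps_const_add) simp

lemma lc_scF: "scF s (lc i a b c) = lc i (s * a) (s * b) (s * c)"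
  unfolding lc_def by (simp add: scF.sm_add_right scF.sm_sm)

text \<open>Since \<open>bb i\<close> is R - E divided by pi \<i>, the half turn is the exponential
  of y (R - E). The eigenvalues of R - E are 1, -1 and 1 - \<delta>, and R multiplies by 1, -1 and
  1.\<close>

lemma R_exp:
  assumes i: "i \<in> {1..n}"
  shows "fps_const (R (simple i)) * Ex i pi = lc i (fps_exp 1) (- fps_exp (- 1)) (par_c dd)"
proof (rule fps_ext)
  fix k
  note id = idempotents[OF i]
  have "E (simple i) = scC dd (ee0 i)" using \<delta>_ge by (simp add: ee0_def scC_scC scC_one)
  then have tt: "tt (simple i) = pp0 i - nn0 i + scC (1 - dd) (ee0 i)"
    unfolding tt_def id(11) by (simp add: scC.sm_simps)
  have b: "bb i = scC (1 / (pi * \<i>)) (tt (simple i))" by (simp add: bb_def tau_def scC_scC)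
  have pw: "bb i ^ k = scC ((1 / (pi * \<i>)) ^ k) (tt (simple i) ^ k)" for k
    unfolding b by (induction k) (simp_all add: scC_one scC_mult_left scC_mult_right scC_scC mult_ac)
  have tk: "tt (simple i) ^ k = pp0 i + scC ((- 1) ^ k) (nn0 i) + scC ((1 - dd) ^ k) (ee0 i)" for k
  proof (induction k)
    case 0
    then show ?case using id(10) by (simp add: scC_one)
  next
    case (Suc k)
    show ?case unfolding power_Suc Suc unfolding tt
      using id by (simp add: algebra_simps scC_mult_left scC_mult_right scC.sm_zero_right scC_scC scC.sm_simps)
  qed
  have c: "((\<i> * complex_of_real pi) ^ k / fact k) * (1 / (complex_of_real pi * \<i>)) ^ k = 1 / fact k"
  proof -
    have "((\<i> * complex_of_real pi)) ^ k * (1 / (complex_of_real pi * \<i>)) ^ k = 1"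
      by (simp flip: power_mult_distrib)
    then show ?thesis by (simp add: field_simps)
  qed
  have "(fps_const (R (simple i)) * Ex i pi) $ k = scC (1 / fact k) (R (simple i) * tt (simple i) ^ k)"
    by (simp add: Ex_def pw scC_mult_right scC_scC c[simplified])
  also have "R (simple i) * tt (simple i) ^ k = pp0 i - scC ((- 1) ^ k) (nn0 i) + scC ((1 - dd) ^ k) (ee0 i)"
    unfolding tk id(11) using id(1-9) by (simp add: algebra_simps scC_mult_right scC.sm_zero_right scC.sm_minus_right)
  finally show "(fps_const (R (simple i)) * Ex i pi) $ k = lc i (fps_exp 1) (- fps_exp (- 1)) (par_c dd) $ k"
    by (simp add: lc_def scF_const_nth par_c_def scC.sm_simps)
qed

definition cj :: "nat \<Rightarrow> 'a fps \<Rightarrow> 'a fps" where "cj i x = H i 1 * x * finv (H i 1)"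

lemma H_0: "H i u $ 0 = 1" by (simp add: H_def HH_0)

lemma cj:
  "cj i x * cj i y = cj i (x * y)" "cj i x - cj i y = cj i (x - y)" "scF s (cj i x) = cj i (scF s x)" "cj i 1 = 1"
  using finv[OF H_0, of i 1]
  by (simp_all add: cj_def mult.assoc left_diff_distrib right_diff_distrib scF.sm_mult_left scF.sm_mult_right)
     (simp flip: mult.assoc)

definition ggi :: "nat \<Rightarrow> 'a fps" where "ggi i = cj i (lc i (fps_exp (- 1)) (- fps_exp 1) (par_l dd))"
text \<open>The eigenvalues are forced by g - g^-1 = m (e - 1): on the first two eigenspaces g -
  g^-1 is -m, on the third it is l^-1 - l.\<close>

definition ee :: "nat \<Rightarrow> 'a fps" where "ee i = cj i (lc i 0 0 (par_D dd))"

lemma gg_cj: "i \<in> {1..n} \<Longrightarrow> gg i = cj i (lc i (fps_exp 1) (- fps_exp (- 1)) (par_c dd))"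
  using gg_local[of i] R_exp[of i] by (simp add: cj_def mult.assoc)

lemma ee_0: "ee i $ 0 = E (simple i)"
  using \<delta>_ge by (simp add: ee_def cj_def H_0 finv lc_def scF_const_nth par_nth scC.sm_simps ee0_def)

lemma exp_inv: "fps_exp 1 * fps_exp (- 1) = (1 :: complex fps)"
  using fps_exp_add_mult[of 1 "- 1 :: complex"] by simp

lemma node:
  assumes i: "i \<in> {1..n}"
  shows "gg i * ggi i = 1" "ggi i * gg i = 1" "gg i - ggi i = scF par_m (ee i - 1)"
    "gg i * ee i = scF (par_c dd) (ee i)" "ee i * gg i = scF (par_c dd) (ee i)"
    "ee i * ee i = scF (par_D dd) (ee i)"
proof -
  show "gg i * ggi i = 1" "ggi i * gg i = 1"
    unfolding gg_cj[OF i] ggi_def cj lc_mult[OF i]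
    using lc_one[OF i, of 1] par_lc[of dd] exp_inv
    by (simp_all add: mult.commute cj scF.sm_one)
  show "gg i * ee i = scF (par_c dd) (ee i)" "ee i * gg i = scF (par_c dd) (ee i)"
    "ee i * ee i = scF (par_D dd) (ee i)"
    unfolding gg_cj[OF i] ee_def cj lc_mult[OF i] lc_scF by (simp_all add: mult.commute)
  have "ee i - 1 = cj i (lc i (- 1) (- 1) (par_D dd - 1))"
    using lc_one[OF i, of 1] lc_diff[of i 0 0 "par_D dd" 1 1 1] cj(2)[of i _ 1]
    by (simp add: ee_def cj(4) scF.sm_one)
  then have "scF par_m (ee i - 1) = cj i (lc i (- par_m) (- par_m) (par_m * par_D dd - par_m))"
    by (simp add: cj lc_scF right_diff_distrib)
  then show "gg i - ggi i = scF par_m (ee i - 1)"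
    unfolding gg_cj[OF i] ggi_def cj lc_diff par_mD by (simp add: par_m_def)
qed

lemma node':
  assumes i: "i \<in> {1..n}"
  shows "gg i * gg i = 1 - scF par_m (gg i - scF (par_c dd) (ee i))"
proof -
  have "(gg i - ggi i) * gg i = scF par_m (ee i * gg i - gg i)"
    unfolding node(3)[OF i] by (simp add: scF.sm_mult_left left_diff_distrib)
  then have "gg i * gg i - 1 = - scF par_m (gg i - scF (par_c dd) (ee i))"
    unfolding left_diff_distrib node(2)[OF i] node(5)[OF i] scF.sm_minus_right[symmetric] by simp
  then show ?thesis by (simp add: algebra_simps)
qed

lemma ggi_comm:
  assumes "i \<in> {1..n}" "x * gg i = gg i * x"
  shows "x * ggi i = ggi i * x"
proof -
  have "x * ggi i = (ggi i * gg i) * x * ggi i" by (simp add: node(2)[OF assms(1)])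
  also have "\<dots> = ggi i * (gg i * x) * ggi i" by (simp only: mult.assoc)
  also have "\<dots> = ggi i * x * (gg i * ggi i)" by (simp only: assms(2)[symmetric] mult.assoc)
  finally show ?thesis by (simp add: node(1)[OF assms(1)])
qed

text \<open>Up to the cancellable factor m, the element \<open>ee i\<close> is a combination of 1,
  \<open>gg i\<close> and its inverse.\<close>

lemma ee_comm:
  assumes "i \<in> {1..n}" "x * gg i = gg i * x"
  shows "x * ee i = ee i * x"
proof -
  have "x * (gg i - ggi i) = (gg i - ggi i) * x"
    using assms(2) ggi_comm[OF assms] by (simp add: algebra_simps)
  then have "scF par_m (x * ee i - ee i * x) = 0"
    unfolding node(3)[OF assms(1)] by (simp add: scF.sm_mult_left scF.sm_mult_right algebra_simps scF.sm_diff_right)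
  then show ?thesis using scF_par_m_cancel by fastforce
qed

lemma nonadjacent:
  assumes "i \<in> {1..n}" "j \<in> {1..n}" "\<not> adj i j"
  shows "gg i * gg j = gg j * gg i" "ee i * gg j = gg j * ee i" "ee i * ee j = ee j * ee i"
proof -
  show g: "gg i * gg j = gg j * gg i" by (rule gg_comm[OF assms])
  show e: "ee i * gg j = gg j * ee i" using ee_comm[OF assms(1) g[symmetric]] by simp
  show "ee i * ee j = ee j * ee i" using ee_comm[OF assms(2) e] .
qed

text \<open>The deformation argument applies: the relations of the Brauer algebra give the required
  identities of constant terms, and \<delta> \<ge> 2 avoids the exceptional values 0, 1 and
  -2.\<close>

lemma adjacent:
  assumes ij: "i \<in> {1..n}" "j \<in> {1..n}" "adj i j"
  shows "gg i * gg j * ee i = ee j * ee i" "ee j * gg i * gg j = ee j * ee i" "ee i * ee j * ee i = ee i"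
    "ee i * gg j * ee i = scF (par_l dd) (ee i)"
    "gg i * ee j * ee i = gg j * ee i + scF par_m (ee i - ee j * ee i)"
    "ee j * ee i * gg j = ee j * gg i + scF par_m (ee j - ee j * ee i)"
    "gg i * ee j * gg i = gg j * ee i * gg j + scF par_m (ee i * gg j - ee j * gg i + gg j * ee i - gg i * ee j)
      + scF (par_m * par_m) (ee i - ee j)"
proof -
  note si = simple_root[OF ij(1)] and sj = simple_root[OF ij(2)]
  have ne: "i \<noteq> j" using ij adj_irrefl by auto
  have bil: "bil (simple i) (simple j) = -1" using ij ne by (simp add: bil_simple_simple cartan_def)
  have bil': "bil (simple j) (simple i) = -1" using bil bil_sym[of "simple i"] by simp
  have d: "dd \<noteq> 0" "dd \<noteq> 1" "dd \<noteq> - 2"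
  proof -
    show "dd \<noteq> 0" "dd \<noteq> 1" using \<delta>_ge by simp_all
    have "dd + 2 = of_nat (\<delta> + 2)" by simp
    then show "dd \<noteq> - 2" by (metis add.left_inverse add_is_0 of_nat_eq_0_iff zero_neq_numeral)
  qed
  have pair: "bmw_pair scF (gg i) (ggi i) (gg j) (ggi j) (ee i) (ee j) (par_c dd) (par_l dd) par_m (par_D dd) (inverse (par_D dd))"
    by unfold_locales
      (fact par_lc par_mD node[OF ij(1)] node[OF ij(2)] gg_braid[OF ij] par_D_inverse[OF d(1)] scF_par_m_cancel)+
  have x0: "gg i $ 0 * gg i $ 0 = 1" "gg j $ 0 * gg j $ 0 = 1"
    unfolding gg_0 by (rule R_sq[OF si] R_sq[OF sj])+
  have "bil (simple i) (refl (simple i) (simple j)) = 1"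
    using bil bil' bil_root[OF si] by (simp add: refl_def bil_diff bil_sc)
  then have "E (simple i) * R (simple j) * E (simple i) = E (simple i)"
    using E_R[OF si sj] EEE[OF si refl_root[OF si sj]] bil by simp
  then have pyp: "ee i $ 0 * gg j $ 0 * ee i $ 0 = ee i $ 0" unfolding gg_0 ee_0 .
  show "gg i * gg j * ee i = ee j * ee i" "ee j * gg i * gg j = ee j * ee i" "ee i * ee j * ee i = ee i"
    "ee i * gg j * ee i = scF (par_l dd) (ee i)"
    "gg i * ee j * ee i = gg j * ee i + scF par_m (ee i - ee j * ee i)"
    "ee j * ee i * gg j = ee j * gg i + scF par_m (ee j - ee j * ee i)"
    "gg i * ee j * gg i = gg j * ee i * gg j + scF par_m (ee i * gg j - ee j * gg i + gg j * ee i - gg i * ee j)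
      + scF (par_m * par_m) (ee i - ee j)"
    by (rule bmw_pair_deformation[OF pair par_nth d x0 pyp])+
qed

end

section \<open>Words in the Temperley--Lieb monoid\<close>

text \<open>Integer powers of a unit \<open>u\<close> with inverse \<open>v\<close>; they are needed
  in the coefficient ring and in all of its specialisations alike.\<close>

definition upow :: "'a::comm_ring_1 \<Rightarrow> 'a \<Rightarrow> int \<Rightarrow> 'a" where
  "upow u v k = (if 0 \<le> k then u ^ nat k else v ^ nat (- k))"

lemma upow_0 [simp]: "upow u v 0 = 1" and upow_1 [simp]: "upow u v 1 = u"
  and upow_minus_1 [simp]: "upow u v (- 1) = v"
  by (simp_all add: upow_def)

lemma upow_add:
  assumes uv: "u * v = 1"
  shows "upow u v (j + k) = upow u v j * upow u v k"
proof -
  have S: "upow u v (k + 1) = u * upow u v k" for k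
  proof (cases "0 \<le> k")
    case True
    then have "nat (k + 1) = Suc (nat k)" by simp
    then show ?thesis using True by (simp add: upow_def)
  next
    case False
    then have n: "nat (- k) = Suc (nat (- (k + 1)))" by simp
    have "u * upow u v k = (u * v) * v ^ nat (- (k + 1))" using False unfolding upow_def n by (simp add: mult.assoc)
    also have "\<dots> = upow u v (k + 1)"
      using False by (cases "k = -1") (simp_all add: uv upow_def)
    finally show ?thesis ..
  qed
  have P: "upow u v (k - 1) = v * upow u v k" for k
  proof -
    have "v * upow u v k = (u * v) * upow u v (k - 1)" using S[of "k - 1"] by (simp add: mult_ac)
    then show ?thesis by (simp add: uv)
  qed
  show ?thesis
  proof (induction j rule: int_induct[of _ 0])
    case (step1 i)
    then show ?case using S[of "i + k"] S[of i] by (simp add: add_ac mult_ac)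
  next
    case (step2 i)
    then show ?case using P[of "i + k"] P[of i] by (simp add: algebra_simps)
  qed simp
qed

lemma upow_minus: "u * v = 1 \<Longrightarrow> upow u v k * upow u v (- k) = 1"
  using upow_add[of u v k "- k"] by simp

context tits
begin

text \<open>\<open>tle k w w'\<close>: the relations of the Temperley--Lieb algebra imply \<open>w = \<delta>\<^sup>k w'\<close>.\<close>

inductive tle :: "int \<Rightarrow> nat list \<Rightarrow> nat list \<Rightarrow> bool" where
  tle_refl: "tle 0 w w"
| tle_sym: "tle k w w' \<Longrightarrow> tle (- k) w' w"
| tle_trans: "tle k w w' \<Longrightarrow> tle l w' w'' \<Longrightarrow> tle (k + l) w w''"
| tle_square: "i \<in> {1..n} \<Longrightarrow> tle 1 (u @ [i, i] @ v) (u @ [i] @ v)"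
| tle_comm: "i \<in> {1..n} \<Longrightarrow> j \<in> {1..n} \<Longrightarrow> \<not> adj i j \<Longrightarrow> tle 0 (u @ [i, j] @ v) (u @ [j, i] @ v)"
| tle_braid: "i \<in> {1..n} \<Longrightarrow> j \<in> {1..n} \<Longrightarrow> adj i j \<Longrightarrow> tle 0 (u @ [i, j, i] @ v) (u @ [i] @ v)"

lemma tle_append: "tle k w w' \<Longrightarrow> tle k (x @ w @ y) (x @ w' @ y)"
proof (induction rule: tle.induct)
  case (tle_square i u v)
  then show ?case using tle.tle_square[of i "x @ u" "v @ y"] by simp
next
  case (tle_comm i j u v)
  then show ?case using tle.tle_comm[of i j "x @ u" "v @ y"] by simp
next
  case (tle_braid i j u v)
  then show ?case using tle.tle_braid[of i j "x @ u" "v @ y"] by simp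
qed (auto intro: tle.intros(1-3))

end

lemma (in alg) prod_list_tle:
  fixes x :: "nat \<Rightarrow> 'A"
  assumes tits: "tits n adj" and D: "D * Di = 1"
    and sq: "\<And>i. i \<in> {1..n} \<Longrightarrow> x i * x i = D \<cdot> x i"
    and cm: "\<And>i j. i \<in> {1..n} \<Longrightarrow> j \<in> {1..n} \<Longrightarrow> \<not> adj i j \<Longrightarrow> x i * x j = x j * x i"
    and br: "\<And>i j. i \<in> {1..n} \<Longrightarrow> j \<in> {1..n} \<Longrightarrow> adj i j \<Longrightarrow> x i * x j * x i = x i"
  shows "tits.tle n adj k w w' \<Longrightarrow> prod_list (map x w) = upow D Di k \<cdot> prod_list (map x w')"
proof (induction rule: tits.tle.induct[OF tits, consumes 1, case_names refl sym trans square comm braid])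
  case (sym k w w')
  have "upow D Di (- k) \<cdot> prod_list (map x w) = (upow D Di k * upow D Di (- k)) \<cdot> prod_list (map x w')"
    unfolding sym.IH by (simp add: sm_sm mult.commute)
  then show ?case by (simp add: upow_minus[OF D] sm_one)
next
  case (trans k w w' l w'')
  then show ?case by (simp add: upow_add[OF D] sm_sm)
next
  case (square i u v)
  have "prod_list (map x u) * (x i * x i) * prod_list (map x v)
      = D \<cdot> (prod_list (map x u) * x i * prod_list (map x v))"
    unfolding sq[OF square] by (simp add: sm_mult_left sm_mult_right)
  then show ?case by (simp add: mult.assoc)
next
  case (comm i j u v)
  have "prod_list (map x u) * (x i * x j) * prod_list (map x v)
      = prod_list (map x u) * (x j * x i) * prod_list (map x v)"
    unfolding cm[OF comm] ..
  then show ?case by (simp add: mult.assoc sm_one)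
next
  case (braid i j u v)
  have "prod_list (map x u) * (x i * x j * x i) * prod_list (map x v)
      = prod_list (map x u) * x i * prod_list (map x v)"
    unfolding br[OF braid] ..
  then show ?case by (simp add: mult.assoc sm_one)
qed (simp add: sm_one)

section \<open>Linear operators on complex functions\<close>

typedef 'i endo = "{T :: ('i \<Rightarrow> complex) \<Rightarrow> 'i \<Rightarrow> complex.
    \<forall>c f g. T (\<lambda>\<sigma>. c * f \<sigma> + g \<sigma>) = (\<lambda>\<sigma>. c * T f \<sigma> + T g \<sigma>)}"
  morphisms apply_endo Endo
  by (rule exI[of _ "\<lambda>f. f"]) simp

setup_lifting type_definition_endo

instantiation endo :: (type) calg
begin

lift_definition zero_endo :: "'a endo" is "\<lambda>f \<sigma>. 0" by simp
lift_definition one_endo :: "'a endo" is "\<lambda>f. f" by simp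
lift_definition plus_endo :: "'a endo \<Rightarrow> 'a endo \<Rightarrow> 'a endo" is "\<lambda>S T f \<sigma>. S f \<sigma> + T f \<sigma>"
  by (simp add: algebra_simps)
lift_definition minus_endo :: "'a endo \<Rightarrow> 'a endo \<Rightarrow> 'a endo" is "\<lambda>S T f \<sigma>. S f \<sigma> - T f \<sigma>"
  by (simp add: algebra_simps)
lift_definition uminus_endo :: "'a endo \<Rightarrow> 'a endo" is "\<lambda>S f \<sigma>. - S f \<sigma>"
  by (simp add: algebra_simps)
lift_definition times_endo :: "'a endo \<Rightarrow> 'a endo \<Rightarrow> 'a endo" is "\<lambda>S T f. S (T f)" by simp
lift_definition scC_endo :: "complex \<Rightarrow> 'a endo \<Rightarrow> 'a endo" is "\<lambda>c T f \<sigma>. c * T f \<sigma>"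
  by (simp add: algebra_simps)

instance
proof
  have add: "T (\<lambda>\<sigma>. f \<sigma> + g \<sigma>) = (\<lambda>\<sigma>. T f \<sigma> + T g \<sigma>)" 
    if "\<forall>c f g. T (\<lambda>\<sigma>. c * f \<sigma> + g \<sigma>) = (\<lambda>\<sigma>. c * T f \<sigma> + T g \<sigma>)"
    for T :: "('a \<Rightarrow> complex) \<Rightarrow> 'a \<Rightarrow> complex" and f g
    using that[rule_format, of 1 f g] by simp
  have zero: "T (\<lambda>\<sigma>. 0) = (\<lambda>\<sigma>. 0)"
    if "\<forall>c f g. T (\<lambda>\<sigma>. c * f \<sigma> + g \<sigma>) = (\<lambda>\<sigma>. c * T f \<sigma> + T g \<sigma>)"
    for T :: "('a \<Rightarrow> complex) \<Rightarrow> 'a \<Rightarrow> complex"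
    using add[OF that, of "\<lambda>\<sigma>. 0" "\<lambda>\<sigma>. 0"] by (simp add: fun_eq_iff)
  have scale: "T (\<lambda>\<sigma>. c * f \<sigma>) = (\<lambda>\<sigma>. c * T f \<sigma>)" 
    if "\<forall>c f g. T (\<lambda>\<sigma>. c * f \<sigma> + g \<sigma>) = (\<lambda>\<sigma>. c * T f \<sigma> + T g \<sigma>)"
    for T :: "('a \<Rightarrow> complex) \<Rightarrow> 'a \<Rightarrow> complex" and c f
    using that[rule_format, of c f "\<lambda>\<sigma>. 0"] zero[OF that] by simp
  fix S T U :: "'a endo" and a b :: complex
  show "S * T * U = S * (T * U)" by transfer simp
  show "S + T + U = S + (T + U)" by transfer (simp add: add.assoc)
  show "S + T = T + S" by transfer (simp add: add.commute)
  show "0 + S = S" by transfer simp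
  show "- S + S = 0" by transfer simp
  show "S - T = S + - T" by transfer simp
  show "1 * S = S" "S * 1 = S" by (transfer; simp)+
  show "(S + T) * U = S * U + T * U" by transfer simp
  show "S * (T + U) = S * T + S * U" by transfer (simp add: add)
  show "(0 :: 'a endo) \<noteq> 1"
    by transfer (metis zero_neq_one)
  show "scC (a + b) S = scC a S + scC b S" "scC a (S + T) = scC a S + scC a T"
    "scC a (scC b S) = scC (a * b) S" "scC 1 S = S" "scC a S * T = scC a (S * T)"
    by (transfer; simp add: algebra_simps)+
  show "S * scC a T = scC a (S * T)" by transfer (simp add: scale)
  show "S = T" if *: "\<And>\<phi> :: 'a endo \<Rightarrow> complex. (\<And>u v. \<phi> (u + v) = \<phi> u + \<phi> v) \<Longrightarrow>
      (\<And>c u. \<phi> (scC c u) = c * \<phi> u) \<Longrightarrow> \<phi> S = \<phi> T"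
  proof -
    \<comment> \<open>Evaluating the image of a function at a point is a linear functional, and
      these functionals determine the operator.\<close>
    have "apply_endo S f \<sigma> = apply_endo T f \<sigma>" for f \<sigma>
      by (rule *[of "\<lambda>S. apply_endo S f \<sigma>"]) (simp_all add: plus_endo.rep_eq scC_endo.rep_eq)
    then show ?thesis by (simp add: apply_endo_inject[symmetric] fun_eq_iff)
  qed
qed

end

lift_definition weighted :: "('i \<Rightarrow> 'i) \<Rightarrow> ('i \<Rightarrow> complex) \<Rightarrow> 'i endo"
  is "\<lambda>s c f \<sigma>. c \<sigma> * f (s \<sigma>)" by (simp add: algebra_simps)

lemma weighted_mult: "weighted s c * weighted s' c' = weighted (\<lambda>\<sigma>. s' (s \<sigma>)) (\<lambda>\<sigma>. c \<sigma> * c' (s \<sigma>))"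
  by transfer (simp add: mult.assoc)

lemma weighted_scC: "scC z (weighted s c) = weighted s (\<lambda>\<sigma>. z * c \<sigma>)"
  by transfer (simp add: mult.assoc)

lemma weighted_one: "weighted (\<lambda>\<sigma>. \<sigma>) (\<lambda>\<sigma>. 1) = 1"
  by transfer simp

section \<open>A positive representation and the uniqueness of exponents\<close>

context tits
begin

definition flip :: "nat \<Rightarrow> nat set \<Rightarrow> nat set" where
  "flip i c = (if i \<in> c then c - {i} else insert i c)"
definition evn :: "nat \<Rightarrow> nat set \<Rightarrow> bool" where
  "evn i c \<longleftrightarrow> even (card {j \<in> {1..n}. j \<in> c \<and> adj i j})"

lemma flip_flip: "flip i (flip i c) = c" by (auto simp: flip_def)
lemma flip_commute: "flip i (flip j c) = flip j (flip i c)" by (auto simp: flip_def)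

lemma evn_flip:
  assumes "i \<in> {1..n}" "j \<in> {1..n}"
  shows "evn i (flip j c) \<longleftrightarrow> (if adj i j then \<not> evn i c else evn i c)"
proof -
  let ?S = "\<lambda>c. {k \<in> {1..n}. k \<in> c \<and> adj i k}"
  have e: "even (card (?S (insert j d))) \<longleftrightarrow> (if adj i j then odd (card (?S d)) else even (card (?S d)))"
    if "j \<notin> d" for d
  proof (cases "adj i j")
    case True
    have "?S (insert j d) = insert j (?S d)" using assms True by auto
    then show ?thesis using that True by simp
  next
    case False
    then have "?S (insert j d) = ?S d" by auto
    then show ?thesis using False by simp
  qed
  show ?thesis
  proof (cases "j \<in> c")
    case True
    then have "insert j (flip j c) = c" "j \<notin> flip j c" by (auto simp: flip_def)
    then show ?thesis using e[of "flip j c"] by (auto simp: evn_def)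
  next
    case False
    then have "flip j c = insert j c" by (auto simp: flip_def)
    then show ?thesis using e[of c] False by (auto simp: evn_def)
  qed
qed

text \<open>A representation with \<open>\<delta> = 2\<close> on functions of subsets of the diagram which preserves
  positivity: no word vanishes, and no word is a multiple of itself.\<close>

lift_definition pos_gen :: "nat \<Rightarrow> nat set endo"
  is "\<lambda>i f c. if evn i c then f c + f (flip i c) else 0" by (auto simp: algebra_simps fun_eq_iff)

text \<open>For adjacent nodes, exactly one of \<open>c\<close> and \<open>flip i c\<close> is even
  for \<open>j\<close>, and flipping \<open>j\<close> there makes it odd for \<open>i\<close>. So
  only the two terms of a single generator survive in the triple product. In the square each term
  occurs twice.\<close>

lemma pos_gen_relations:
  "i \<in> {1..n} \<Longrightarrow> pos_gen i * pos_gen i = scC 2 (pos_gen i)"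
  "i \<in> {1..n} \<Longrightarrow> j \<in> {1..n} \<Longrightarrow> \<not> adj i j \<Longrightarrow> pos_gen i * pos_gen j = pos_gen j * pos_gen i"
  "i \<in> {1..n} \<Longrightarrow> j \<in> {1..n} \<Longrightarrow> adj i j \<Longrightarrow> pos_gen i * pos_gen j * pos_gen i = pos_gen i"
proof -
  show "pos_gen i * pos_gen i = scC 2 (pos_gen i)" if "i \<in> {1..n}"
    using that by transfer (simp add: fun_eq_iff evn_flip adj_irrefl flip_flip)
  show "pos_gen i * pos_gen j = pos_gen j * pos_gen i" if *: "i \<in> {1..n}" "j \<in> {1..n}" "\<not> adj i j"
  proof -
    have "\<not> adj j i" using * adj_sym by blast
    then show ?thesis using * by transfer (auto simp: fun_eq_iff evn_flip flip_commute)
  qed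
  show "pos_gen i * pos_gen j * pos_gen i = pos_gen i" if *: "i \<in> {1..n}" "j \<in> {1..n}" "adj i j"
  proof -
    have "adj j i" using * adj_sym by blast
    then show ?thesis using * by transfer
      (auto simp: fun_eq_iff evn_flip adj_irrefl flip_flip flip_commute)
  qed
qed

lemma pos_word:
  "\<exists>g :: nat set \<Rightarrow> real. (\<forall>c. g c \<ge> 0) \<and> g {} \<ge> 1 \<and>
    apply_endo (prod_list (map pos_gen w)) (\<lambda>_. 1) = (\<lambda>c. of_real (g c))"
proof (induction w)
  case Nil
  show ?case by (rule exI[of _ "\<lambda>_. 1"]) (simp add: one_endo.rep_eq)
next
  case (Cons i w)
  then obtain g :: "nat set \<Rightarrow> real" where g: "\<forall>c. g c \<ge> 0" "g {} \<ge> 1"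
    "apply_endo (prod_list (map pos_gen w)) (\<lambda>_. 1) = (\<lambda>c. of_real (g c))" by blast
  have "evn i {}" by (simp add: evn_def)
  moreover have "g {} + g (flip i {}) \<ge> 1" using g(1)[rule_format, of "flip i {}"] g(2) by linarith
  ultimately show ?case
    using g(1)
    by (intro exI[of _ "\<lambda>c. if evn i c then g c + g (flip i c) else 0"])
      (auto simp: times_endo.rep_eq g(3) pos_gen.rep_eq fun_eq_iff)
qed

text \<open>In the positive representation, a word applied to the constant function 1 has a positive
  value at the empty set, so it cannot be a nontrivial power of 2 times itself.\<close>

lemma tle_self: "tle k w w \<Longrightarrow> k = 0"
proof -
  assume "tle k w w"
  then have *: "prod_list (map pos_gen w) = scC (upow 2 (1 / 2) k) (prod_list (map pos_gen w))"
    by (intro scC.prod_list_tle[OF tits_axioms _ pos_gen_relations]) simp_all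
  obtain g :: "nat set \<Rightarrow> real" where g: "g {} \<ge> 1"
    "apply_endo (prod_list (map pos_gen w)) (\<lambda>_. 1) = (\<lambda>c. of_real (g c))" using pos_word by blast
  have "complex_of_real (g {}) = upow 2 (1 / 2) k * complex_of_real (g {})"
    using arg_cong[OF *, of "\<lambda>S. apply_endo S (\<lambda>_. 1) {}"] by (simp add: scC_endo.rep_eq g(2))
  then have u: "upow 2 (1 / 2) k = (1 :: complex)" using g(1) by auto
  have pw: "m = 0" if "(2 :: complex) ^ m = 1" for m
  proof -
    have "(2 :: real) ^ m = 1" using that by (metis norm_numeral norm_one norm_power)
    moreover have "(1 :: real) < 2 ^ m" if "m \<noteq> 0" using that by simp
    ultimately show ?thesis by force
  qed
  show "k = 0"
  proof (cases "0 \<le> k")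
    case True
    then show ?thesis using u pw[of "nat k"] by (simp add: upow_def)
  next
    case False
    then have "2 ^ nat (- k) = (1 :: complex)" using u by (simp add: upow_def power_one_over)
    then show ?thesis using pw False by force
  qed
qed

text \<open>An arbitrary representative of each class of words that agree up to a power of \<delta>.
  By \<open>tle_self\<close> the exponent \<open>nexp\<close> is then determined by the
  word.\<close>

definition nform :: "nat list \<Rightarrow> nat list" where "nform w = (SOME w'. \<exists>k. tle k w w')"
definition nexp :: "nat list \<Rightarrow> int" where "nexp w = (SOME k. tle k w (nform w))"

lemma tle_nform: "tle (nexp w) w (nform w)"
proof -
  have "\<exists>w' k. tle k w w'" using tle_refl by blast
  then have "\<exists>k. tle k w (nform w)" unfolding nform_def by (rule someI_ex)
  then show ?thesis unfolding nexp_def by (rule someI_ex)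
qed

lemma tle_imp:
  assumes "tle k w w'"
  shows "nform w = nform w'" "nexp w = k + nexp w'"
proof -
  have "(\<exists>l. tle l w x) \<longleftrightarrow> (\<exists>l. tle l w' x)" for x
    using assms tle_sym tle_trans by blast
  then show *: "nform w = nform w'" by (simp add: nform_def)
  have "tle (k + nexp w' + - nexp w) w w"
    using tle_trans[OF tle_trans[OF assms tle_nform] tle_sym[OF tle_nform[of w], unfolded *]] .
  then show "nexp w = k + nexp w'" using tle_self by force
qed

lemma nform_nform: "nform (nform w) = nform w" "nexp (nform w) = 0"
  using tle_imp[OF tle_nform, of w] by simp_all

lemma nform_append:
  "nform (x @ nform w @ y) = nform (x @ w @ y)" "nexp (x @ w @ y) = nexp w + nexp (x @ nform w @ y)"
  using tle_imp[OF tle_append[OF tle_nform], of x w y] by simp_all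

abbreviation two_pow :: "int \<Rightarrow> complex" where "two_pow \<equiv> upow 2 (1 / 2)"

lemma two_pow_add: "two_pow (j + k) = two_pow j * two_pow k" by (rule upow_add) simp

lemma two_pow_nz: "two_pow k \<noteq> 0" by (simp add: upow_def)

text \<open>Right multiplication by \<open>x\<close> on the word in position \<open>a\<close>, with \<open>\<delta> = 2\<close>.\<close>

definition slot :: "nat \<Rightarrow> nat list \<Rightarrow> (nat \<Rightarrow> nat list) endo" where
  "slot a x = weighted (\<lambda>\<sigma>. \<sigma>(a := nform (\<sigma> a @ x))) (\<lambda>\<sigma>. two_pow (nexp (\<sigma> a @ x)))"

lemma nform_append_right: "nform (nform w @ y) = nform (w @ y)" "nexp (w @ y) = nexp w + nexp (nform w @ y)"
  using nform_append[of "[]" w y] unfolding append_Nil .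

lemma slot_mult: "slot a x * slot a y = slot a (x @ y)"
proof -
  have "nform (nform (w @ x) @ y) = nform (w @ x @ y)"
    "two_pow (nexp (w @ x)) * two_pow (nexp (nform (w @ x) @ y)) = two_pow (nexp (w @ x @ y))" for w
    using nform_append_right[of "w @ x" y] by (simp_all add: two_pow_add)
  then show ?thesis unfolding slot_def weighted_mult by simp
qed

lemma slot_comm: "a \<noteq> b \<Longrightarrow> slot a x * slot b y = slot b y * slot a x"
  unfolding slot_def weighted_mult by (intro arg_cong2[where f = weighted] ext) (auto simp: mult.commute)

lemma slot_tle: "tle k x y \<Longrightarrow> slot a x = scC (two_pow k) (slot a y)"
proof -
  assume k: "tle k x y"
  have "nform (w @ x) = nform (w @ y)" "two_pow (nexp (w @ x)) = two_pow k * two_pow (nexp (w @ y))" for w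
    using tle_imp[OF tle_append[OF k, of w "[]"]] by (simp_all add: two_pow_add)
  then show ?thesis unfolding slot_def weighted_scC by simp
qed

lemma tl_rep_slot: "tl_rep n adj (\<lambda>i. 1 - slot a [i])"
proof -
  have sq: "slot a [i] * slot a [i] = slot a [i] + slot a [i]" if "i \<in> {1..n}" for i
  proof -
    have "slot a [i] * slot a [i] = scC 2 (slot a [i])"
      using slot_tle[OF tle_square[OF that, of "[]" "[]"], of a] by (simp add: slot_mult)
    then show ?thesis using scC_add_left[of 1 1 "slot a [i]"] by (simp add: scC_one)
  qed
  have cm: "slot a [i] * slot a [j] = slot a [j] * slot a [i]" if "i \<in> {1..n}" "j \<in> {1..n}" "\<not> adj i j" for i j
    using slot_tle[OF tle_comm[OF that, of "[]" "[]"], of a] by (simp add: slot_mult scC_one)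
  have br: "slot a [i] * slot a [j] * slot a [i] = slot a [i]" if "i \<in> {1..n}" "j \<in> {1..n}" "adj i j" for i j
    using slot_tle[OF tle_braid[OF that, of "[]" "[]"], of a] by (simp add: slot_mult scC_one)
  show ?thesis
  proof
    show "(1 - slot a [i]) * (1 - slot a [i]) = 1" if "i \<in> {1..n}" for i
      unfolding left_diff_distrib right_diff_distrib using sq[OF that] by simp
    show "(1 - slot a [i]) * (1 - slot a [j]) = (1 - slot a [j]) * (1 - slot a [i])"
      if "i \<in> {1..n}" "j \<in> {1..n}" "\<not> adj i j" for i j
      unfolding left_diff_distrib right_diff_distrib using cm[OF that] by simp
    have X: "(1 - slot a [i]) * (1 - slot a [j]) * (1 - slot a [i])
        = 1 - slot a [i] - slot a [j] + slot a [i] * slot a [j] + slot a [j] * slot a [i]"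
      if "i \<in> {1..n}" "j \<in> {1..n}" "adj i j" for i j
    proof -
      have "(1 - slot a [i]) * (1 - slot a [j]) * (1 - slot a [i]) = 1 - slot a [i] - slot a [j] + slot a [i] * slot a [j]
          + slot a [j] * slot a [i] + (slot a [i] * slot a [i] - slot a [i]) - slot a [i] * slot a [j] * slot a [i]"
        by (simp add: algebra_simps)
      then show ?thesis unfolding sq[OF that(1)] br[OF that] by simp
    qed
    show "(1 - slot a [i]) * (1 - slot a [j]) * (1 - slot a [i])
        = (1 - slot a [j]) * (1 - slot a [i]) * (1 - slot a [j])"
      if "i \<in> {1..n}" "j \<in> {1..n}" "adj i j" for i j
      unfolding X[OF that] X[OF that(2,1) adj_sym[OF that]] by (simp add: algebra_simps)
    show "(1 - (1 - slot a [i])) * (1 - (1 - slot a [j])) * (1 - (1 - slot a [i])) = 1 - (1 - slot a [i])"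
      if "i \<in> {1..n}" "j \<in> {1..n}" "adj i j" for i j
      using br[OF that] by simp
  qed
qed

definition slots :: "nat \<Rightarrow> nat list \<Rightarrow> (nat \<Rightarrow> nat list) endo" where
  "slots N x = prod_list (map (\<lambda>a. slot a x) [0..<N])"

lemma slots_weighted:
  "slots N x = weighted (\<lambda>\<sigma> a. if a < N then nform (\<sigma> a @ x) else \<sigma> a) (\<lambda>\<sigma>. \<Prod>a<N. two_pow (nexp (\<sigma> a @ x)))"
proof (induction N)
  case 0
  then show ?case by (simp add: slots_def weighted_one)
next
  case (Suc N)
  have "slots (Suc N) x = slots N x * slot N x" by (simp add: slots_def)
  also have "\<dots> = weighted (\<lambda>\<sigma> a. if a < Suc N then nform (\<sigma> a @ x) else \<sigma> a)
      (\<lambda>\<sigma>. \<Prod>a<Suc N. two_pow (nexp (\<sigma> a @ x)))"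
    unfolding Suc slot_def weighted_mult by (intro arg_cong2[where f = weighted] ext) (auto simp: less_Suc_eq)
  finally show ?case .
qed

lemma slots_mult: "slots N x * slots N y = slots N (x @ y)"
proof -
  have "(\<Prod>a<N. two_pow (nexp (\<sigma> a @ x))) * (\<Prod>a<N. two_pow (nexp ((if a < N then nform (\<sigma> a @ x) else \<sigma> a) @ y)))
      = (\<Prod>a<N. two_pow (nexp (\<sigma> a @ x @ y)))" for \<sigma> :: "nat \<Rightarrow> nat list"
    unfolding prod.distrib[symmetric] two_pow_add[symmetric]
  proof (rule prod.cong[OF refl])
    fix a assume "a \<in> {..<N}"
    then show "two_pow (nexp (\<sigma> a @ x) + nexp ((if a < N then nform (\<sigma> a @ x) else \<sigma> a) @ y)) = two_pow (nexp (\<sigma> a @ x @ y))"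
      using nform_append_right(2)[of "\<sigma> a @ x" y] by simp
  qed
  moreover have "nform (nform (w @ x) @ y) = nform (w @ x @ y)" for w
    using nform_append_right(1)[of "w @ x" y] by simp
  ultimately show ?thesis unfolding slots_weighted weighted_mult
    by (intro arg_cong2[where f = weighted] ext) simp_all
qed

lemma slots_word: "w \<noteq> [] \<Longrightarrow> prod_list (map (\<lambda>i. slots N [i]) w) = slots N w"
proof (induction w)
  case (Cons i w)
  then show ?case by (cases "w = []") (simp_all add: slots_mult)
qed simp

lemma slots_word_apply:
  "\<exists>z. z \<noteq> 0 \<and> (\<forall>f. apply_endo (prod_list (map (\<lambda>i. slots N [i]) w)) f (\<lambda>_. nform [])
    = z * f (\<lambda>a. if a < N then nform w else nform []))"
\<comment> \<open>For the empty word the product is the identity, whereas \<open>slots N []\<close>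
  replaces the entries below \<open>N\<close> by their normal forms.\<close>
proof (cases "w = []")
  case True
  then show ?thesis unfolding True by (intro exI[of _ 1]) (simp add: one_endo.rep_eq)
next
  case False
  show ?thesis unfolding slots_word[OF False] unfolding slots_weighted weighted.rep_eq
    using nform_append_right(1)[of "[]" w]
    by (intro exI[of _ "\<Prod>a<N. two_pow (nexp (nform [] @ w))"]) (simp add: two_pow_nz cong: if_cong)
qed

text \<open>Evaluated at the tuple of empty words in normal form, the operator of a word sees a
  function at a single tuple. Since \<open>0 < N\<close>, distinct normal forms lead to distinct
  tuples, and the indicator function of one of these isolates one coefficient.\<close>

lemma slots_independent:
  assumes N: "0 < N" and V: "finite V" "\<And>v. v \<in> V \<Longrightarrow> nform v = v"
    and sum: "(\<Sum>v\<in>V. scC (c v) (prod_list (map (\<lambda>i. slots N [i]) v))) = 0" and v: "v \<in> V"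
  shows "c v = 0"
proof -
  define \<sigma> where "\<sigma> w = (\<lambda>a. if a < N then nform w else nform [])" for w
  define f where "f x = (if x = \<sigma> v then 1 else 0 :: complex)" for x
  have "\<forall>w. \<exists>z. z \<noteq> 0 \<and> (\<forall>f. apply_endo (prod_list (map (\<lambda>i. slots N [i]) w)) f (\<lambda>_. nform []) = z * f (\<sigma> w))"
    unfolding \<sigma>_def using slots_word_apply[of N] by blast
  from choice[OF this] obtain z where z: "\<And>w. z w \<noteq> 0"
    "\<And>w f. apply_endo (prod_list (map (\<lambda>i. slots N [i]) w)) f (\<lambda>_. nform []) = z w * f (\<sigma> w)" by blast
  have \<sigma>: "\<sigma> w = \<sigma> v \<longleftrightarrow> w = v" if "w \<in> V" for w
  proof
    assume "\<sigma> w = \<sigma> v"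
    then have "\<sigma> w 0 = \<sigma> v 0" by simp
    then show "w = v" using N V(2)[OF that] V(2)[OF v] by (simp add: \<sigma>_def)
  qed simp
  have ap: "apply_endo (\<Sum>v\<in>V. T v) f x = (\<Sum>v\<in>V. apply_endo (T v) f x)" for T and x :: "nat \<Rightarrow> nat list"
    by (induction V rule: infinite_finite_induct) (simp_all add: zero_endo.rep_eq plus_endo.rep_eq)
  have "0 = (\<Sum>w\<in>V. c w * (z w * f (\<sigma> w)))"
    using arg_cong[OF sum, of "\<lambda>T. apply_endo T f (\<lambda>_. nform [])"]
    by (simp add: ap z(2) scC_endo.rep_eq zero_endo.rep_eq)
  also have "\<dots> = (\<Sum>w\<in>V. if w = v then c v * z v else 0)"
    by (intro sum.cong refl) (auto simp: f_def \<sigma>)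
  also have "\<dots> = c v * z v" using V(1) v by simp
  finally show ?thesis using z(1)[of v] by simp
qed

end

section \<open>Points of the coefficient ring\<close>

lemma poly_mapping_induct [case_names zero single add]:
  fixes p :: "'k \<Rightarrow>\<^sub>0 'r::comm_monoid_add"
  assumes "P 0" "\<And>k a. P (Poly_Mapping.single k a)" "\<And>p q. P p \<Longrightarrow> P q \<Longrightarrow> P (p + q)"
  shows "P p"
proof (induction p rule: update_induct)
  case (update f a b)
  have "Poly_Mapping.update a b f = Poly_Mapping.single a b + f"
    using update(1) by (intro poly_mapping_eqI) (auto simp: lookup_update lookup_add lookup_single in_keys_iff when_def)
  then show ?case using assms(2)[of a b] assms(3) update(3) by simp
qed (rule assms(1))

definition pm_eval :: "('r::zero \<Rightarrow> 'b::ring_1) \<Rightarrow> ('k \<Rightarrow> 'b) \<Rightarrow> ('k \<Rightarrow>\<^sub>0 'r) \<Rightarrow> 'b" where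
  "pm_eval h \<chi> p = (\<Sum>k\<in>Poly_Mapping.keys p. h (Poly_Mapping.lookup p k) * \<chi> k)"

text \<open>Serves both the Laurent ring, with exponents as keys, and free algebras, with words as
  keys. In the second case the target is not commutative, which is why the images of scalars have to
  be central.\<close>

locale pm_hom =
  fixes h :: "'r::comm_ring_1 \<Rightarrow> 'b::ring_1" and \<chi> :: "'k::monoid_add \<Rightarrow> 'b"
  assumes h_add: "h (a + b) = h a + h b" and h_mult: "h (a * b) = h a * h b" and h_one: "h 1 = 1"
    and h_central: "h a * x = x * h a"
    and \<chi>_0: "\<chi> 0 = 1" and \<chi>_add: "\<chi> (j + k) = \<chi> j * \<chi> k"
begin

lemma h_0: "h 0 = 0" using h_add[of 0 0] by simp

lemma eval_superset:
  assumes "finite A" "Poly_Mapping.keys p \<subseteq> A"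
  shows "pm_eval h \<chi> p = (\<Sum>k\<in>A. h (Poly_Mapping.lookup p k) * \<chi> k)"
  unfolding pm_eval_def
  by (rule sum.mono_neutral_left[OF assms]) (auto simp: in_keys_iff h_0)

lemma eval_0: "pm_eval h \<chi> 0 = 0" by (simp add: pm_eval_def)

lemma eval_add: "pm_eval h \<chi> (p + q) = pm_eval h \<chi> p + pm_eval h \<chi> q"
proof -
  let ?A = "Poly_Mapping.keys p \<union> Poly_Mapping.keys q"
  have "Poly_Mapping.keys (p + q) \<subseteq> ?A" by (rule Poly_Mapping.keys_add)
  then have "pm_eval h \<chi> (p + q) = (\<Sum>k\<in>?A. h (Poly_Mapping.lookup (p + q) k) * \<chi> k)"
    by (intro eval_superset) auto
  also have "\<dots> = (\<Sum>k\<in>?A. h (Poly_Mapping.lookup p k) * \<chi> k) + (\<Sum>k\<in>?A. h (Poly_Mapping.lookup q k) * \<chi> k)"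
    by (simp add: lookup_add h_add distrib_right sum.distrib)
  also have "\<dots> = pm_eval h \<chi> p + pm_eval h \<chi> q"
    by (intro arg_cong2[where f = "(+)"] eval_superset[symmetric]) auto
  finally show ?thesis .
qed

lemma eval_diff: "pm_eval h \<chi> (p - q) = pm_eval h \<chi> p - pm_eval h \<chi> q"
  using eval_add[of "p - q" q] by (simp add: algebra_simps)

lemma eval_single: "pm_eval h \<chi> (Poly_Mapping.single k a) = h a * \<chi> k"
  using eval_superset[of "{k}" "Poly_Mapping.single k a"] by (simp add: lookup_single)

lemma eval_one: "pm_eval h \<chi> 1 = 1"
  using eval_single[of 0 1] by (simp add: h_one \<chi>_0)

lemma eval_mult: "pm_eval h \<chi> (p * q) = pm_eval h \<chi> p * pm_eval h \<chi> q"
proof (induction p rule: poly_mapping_induct)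
  case (single k a)
  show ?case
  proof (induction q rule: poly_mapping_induct)
    case (single l b)
    have "h (a * b) * \<chi> (k + l) = h a * (h b * \<chi> k) * \<chi> l" by (simp add: h_mult \<chi>_add mult.assoc)
    also have "\<dots> = h a * \<chi> k * (h b * \<chi> l)" unfolding h_central[of b "\<chi> k"] by (simp add: mult.assoc)
    finally show ?case by (simp add: mult_single eval_single)
  qed (simp_all add: eval_0 eval_add distrib_left)
qed (simp_all add: eval_0 eval_add distrib_right)

lemma eval_sum: "pm_eval h \<chi> (\<Sum>x\<in>A. f x) = (\<Sum>x\<in>A. pm_eval h \<chi> (f x))"
  by (induction A rule: infinite_finite_induct) (simp_all add: eval_0 eval_add)

end

section \<open>Specialisations of the coefficient ring\<close>

definition laur_val :: "'b \<Rightarrow> 'b \<Rightarrow> 'b \<Rightarrow> 'b \<Rightarrow> 'b \<Rightarrow> int \<times> int \<times> nat \<Rightarrow> 'b::comm_ring_1" where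
  "laur_val D D' l l' m = (\<lambda>(a, b, k). upow D D' a * upow l l' b * m ^ k)"

abbreviation laur_eval :: "'b::comm_ring_1 \<Rightarrow> 'b \<Rightarrow> 'b \<Rightarrow> 'b \<Rightarrow> 'b \<Rightarrow> laurent \<Rightarrow> 'b" where
  "laur_eval D D' l l' m \<equiv> pm_eval of_int (laur_val D D' l l' m)"

lemma laur_hom:
  assumes "D * D' = 1" "l * l' = 1"
  shows "pm_hom of_int (laur_val D D' l l' m)"
proof
  show "laur_val D D' l l' m 0 = 1" by (simp add: laur_val_def zero_prod_def)
  show "laur_val D D' l l' m (j + k) = laur_val D D' l l' m j * laur_val D D' l l' m k" for j k
    by (cases j; cases k) (simp add: laur_val_def upow_add[OF assms(1)] upow_add[OF assms(2)] power_add mult_ac)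
qed (simp_all add: mult.commute)

lemma laur_eval_monom:
  assumes "D * D' = 1" "l * l' = 1"
  shows "laur_eval D D' l l' m (laurent_monom a b k) = upow D D' a * upow l l' b * m ^ k"
  using pm_hom.eval_single[OF laur_hom[OF assms], of m "(a, b, k)" 1] by (simp add: laurent_monom_def laur_val_def)

locale coeff_point =
  fixes D D' l l' m :: "'b::comm_ring_1"
  assumes DD': "D * D' = 1" and ll': "l * l' = 1" and rel: "m * (1 - D) = l - l'"
begin

lemma laur_eval_rel: "laur_eval D D' l l' m laurent_rel = 0"
proof -
  interpret pm_hom of_int "laur_val D D' l l' m" by (rule laur_hom[OF DD' ll'])
  show ?thesis unfolding laurent_rel_def eval_diff eval_mult eval_one laur_eval_monom[OF DD' ll']
    using rel by simp
qed

lemma laur_eval_dvd: "laurent_rel dvd p - q \<Longrightarrow> laur_eval D D' l l' m p = laur_eval D D' l l' m q"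
proof -
  interpret pm_hom of_int "laur_val D D' l l' m" by (rule laur_hom[OF DD' ll'])
  assume "laurent_rel dvd p - q"
  then obtain r where "p - q = laurent_rel * r" ..
  then have "laur_eval D D' l l' m (p - q) = 0" by (simp add: eval_mult laur_eval_rel)
  then show ?thesis by (simp add: eval_diff)
qed

definition cev :: "coeff \<Rightarrow> 'b" where "cev x = laur_eval D D' l l' m (rep_coeff x)"

lemma cev_abs: "cev (abs_coeff p) = laur_eval D D' l l' m p"
  unfolding cev_def using Quotient_rep_abs[OF Quotient_coeff, of p]
  by (intro laur_eval_dvd) simp

lemma coeff_cases: obtains p where "x = abs_coeff p"
  using Quotient_abs_rep[OF Quotient_coeff, of x] by metis

lemma cev_hom: "cev (x + y) = cev x + cev y" "cev (x * y) = cev x * cev y" "cev 1 = 1"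
proof -
  interpret pm_hom of_int "laur_val D D' l l' m" by (rule laur_hom[OF DD' ll'])
  obtain p q where x: "x = abs_coeff p" and y: "y = abs_coeff q" using coeff_cases by metis
  show "cev (x + y) = cev x + cev y" "cev (x * y) = cev x * cev y"
    unfolding x y plus_coeff.abs_eq times_coeff.abs_eq cev_abs eval_add eval_mult by simp_all
  show "cev 1 = 1" unfolding one_coeff.abs_eq cev_abs eval_one by simp
qed

lemma cev_params: "cev dlt = D" "cev ell = l" "cev ell_inv = l'" "cev emm = m"
  unfolding dlt_def ell_def ell_inv_def emm_def cev_abs laur_eval_monom[OF DD' ll'] by simp_all

lemma cev_0: "cev 0 = 0" using cev_hom(1)[of 0 0] by simp
lemma cev_sum: "cev (\<Sum>x\<in>A. f x) = (\<Sum>x\<in>A. cev (f x))"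
  by (induction A rule: infinite_finite_induct) (simp_all add: cev_0 cev_hom)

end

section \<open>Rational functions at real points\<close>

definition rational_on :: "real set \<Rightarrow> (real \<Rightarrow> real) \<Rightarrow> bool" where
  "rational_on S f \<longleftrightarrow> (\<exists>P Q :: real poly. \<forall>x\<in>S. poly Q x \<noteq> 0 \<and> f x = poly P x / poly Q x)"

lemma rational_on_zero:
  assumes "rational_on S f" "infinite {x \<in> S. f x = 0}" "x \<in> S"
  shows "f x = 0"
proof -
  obtain P Q :: "real poly" where PQ: "\<forall>x\<in>S. poly Q x \<noteq> 0 \<and> f x = poly P x / poly Q x"
    using assms(1) by (auto simp: rational_on_def)
  have "{x \<in> S. f x = 0} \<subseteq> {x. poly P x = 0}" using PQ by auto
  then have "P = 0" using assms(2) poly_roots_finite[of P] infinite_super by blast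
  then show ?thesis using PQ assms(3) by simp
qed

lemma rational_on_const: "rational_on S (\<lambda>x. c)"
  unfolding rational_on_def by (intro exI[of _ "[:c:]"] exI[of _ 1]) simp

lemma rational_on_id: "rational_on S (\<lambda>x. x)"
  unfolding rational_on_def by (intro exI[of _ "[:0, 1:]"] exI[of _ 1]) simp

lemma rational_on_add:
  assumes "rational_on S f" "rational_on S h"
  shows "rational_on S (\<lambda>x. f x + h x)"
proof -
  obtain P Q P' Q' :: "real poly" where "\<forall>x\<in>S. poly Q x \<noteq> 0 \<and> f x = poly P x / poly Q x"
    "\<forall>x\<in>S. poly Q' x \<noteq> 0 \<and> h x = poly P' x / poly Q' x"
    using assms unfolding rational_on_def by blast
  then show ?thesis unfolding rational_on_def
    by (intro exI[of _ "P * Q' + P' * Q"] exI[of _ "Q * Q'"]) (simp add: field_simps)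
qed

lemma rational_on_mult:
  assumes "rational_on S f" "rational_on S h"
  shows "rational_on S (\<lambda>x. f x * h x)"
proof -
  obtain P Q P' Q' :: "real poly" where "\<forall>x\<in>S. poly Q x \<noteq> 0 \<and> f x = poly P x / poly Q x"
    "\<forall>x\<in>S. poly Q' x \<noteq> 0 \<and> h x = poly P' x / poly Q' x"
    using assms unfolding rational_on_def by blast
  then show ?thesis unfolding rational_on_def
    by (intro exI[of _ "P * P'"] exI[of _ "Q * Q'"]) (simp add: field_simps)
qed

lemma rational_on_diff:
  assumes "rational_on S f" "rational_on S h"
  shows "rational_on S (\<lambda>x. f x - h x)"
  using rational_on_add[OF assms(1) rational_on_mult[OF rational_on_const[of S "- 1"] assms(2)]] by simp

lemma rational_on_inverse:
  assumes "rational_on S f" "\<And>x. x \<in> S \<Longrightarrow> f x \<noteq> 0"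
  shows "rational_on S (\<lambda>x. 1 / f x)"
proof -
  obtain P Q :: "real poly" where "\<forall>x\<in>S. poly Q x \<noteq> 0 \<and> f x = poly P x / poly Q x"
    using assms(1) unfolding rational_on_def by blast
  then show ?thesis unfolding rational_on_def using assms(2)
    by (intro exI[of _ Q] exI[of _ P]) (auto simp: field_simps)
qed

lemma rational_on_power: "rational_on S f \<Longrightarrow> rational_on S (\<lambda>x. f x ^ k)"
  by (induction k) (simp_all add: rational_on_const rational_on_mult)

lemma rational_on_upow: "rational_on S f \<Longrightarrow> rational_on S h \<Longrightarrow> rational_on S (\<lambda>x. upow (f x) (h x) k)"
  by (cases "0 \<le> k") (simp_all add: upow_def rational_on_power)

lemma rational_on_sum: "(\<And>i. i \<in> I \<Longrightarrow> rational_on S (f i)) \<Longrightarrow> rational_on S (\<lambda>x. \<Sum>i\<in>I. f i x)"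
  by (induction I rule: infinite_finite_induct) (simp_all add: rational_on_const rational_on_add)

lemma rational_on_laur_eval:
  assumes "rational_on S D" "\<And>x. x \<in> S \<Longrightarrow> D x \<noteq> 0" "rational_on S l" "\<And>x. x \<in> S \<Longrightarrow> l x \<noteq> 0" "rational_on S m"
  shows "rational_on S (\<lambda>x. laur_eval (D x) (1 / D x) (l x) (1 / l x) (m x) p)"
  unfolding pm_eval_def laur_val_def case_prod_beta
  by (intro rational_on_sum rational_on_mult rational_on_const rational_on_upow rational_on_power rational_on_inverse assms)

text \<open>The value of \<delta> obtained by solving the relation of the coefficient ring; l and m
  serve as coordinates.\<close>

definition del :: "real \<Rightarrow> real \<Rightarrow> real" where "del l m = 1 - (l - 1 / l) / m"

definition laur_at :: "laurent \<Rightarrow> real \<Rightarrow> real \<Rightarrow> real" where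
  "laur_at p l m = laur_eval (del l m) (1 / del l m) l (1 / l) m p"

lemma del_pos:
  assumes "l > 1" "m < 0"
  shows "del l m > 0"
proof -
  have "1 / l < l" using assms(1) by (simp add: field_simps) (smt (verit) mult_less_cancel_right2)
  then have "(l - 1 / l) / m < 0" using assms(2) by (simp add: divide_pos_neg)
  then show ?thesis by (simp add: del_def)
qed

lemma rational_on_del:
  assumes "rational_on S l" "\<And>x. x \<in> S \<Longrightarrow> l x \<noteq> 0" "rational_on S m" "\<And>x. x \<in> S \<Longrightarrow> m x \<noteq> 0"
  shows "rational_on S (\<lambda>x. del (l x) (m x))"
proof -
  have "rational_on S (\<lambda>x. 1 - (l x - 1 / l x) * (1 / m x))"
    by (intro rational_on_diff rational_on_mult rational_on_inverse rational_on_const assms)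
  then show ?thesis by (simp add: del_def)
qed

lemma rational_on_laur_at:
  assumes "rational_on S l" "\<And>x. x \<in> S \<Longrightarrow> l x \<noteq> 0" "rational_on S m" "\<And>x. x \<in> S \<Longrightarrow> m x \<noteq> 0"
    "\<And>x. x \<in> S \<Longrightarrow> del (l x) (m x) \<noteq> 0"
  shows "rational_on S (\<lambda>x. laur_at p (l x) (m x))"
  unfolding laur_at_def by (intro rational_on_laur_eval rational_on_del assms)

lemma inverse_minus_self_inj:
  assumes "1 / z - z = 1 / w - w" "z > 1" "w > (1 :: real)"
  shows "z = w"
proof -
  have "(z - w) * (1 + 1 / (z * w)) = (z - 1 / z) - (w - 1 / w)"
    using assms(2,3) by (simp add: field_simps)
  also have "\<dots> = 0" using assms(1) by linarith
  finally have "z - w = 0 \<or> 1 + 1 / (z * w) = 0" unfolding mult_eq_0_iff .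
  moreover have "1 + 1 / (z * w) > 0" using assms(2,3) by (simp add: add_pos_pos)
  ultimately show ?thesis by simp
qed

text \<open>The curves \<open>l = z\<^bsup>2^N - 1\<^esup>\<close>, \<open>m = 1/z - z\<close> meet every line \<open>l = const > 1\<close> in infinitely many points.\<close>

lemma laur_at_zero:
  assumes curve: "\<And>N z. even N \<Longrightarrow> N > 0 \<Longrightarrow> z > 1 \<Longrightarrow> laur_at p (z ^ (2 ^ N - 1)) (1 / z - z) = 0"
    and m: "m < 0" and l: "l \<noteq> 0" and d: "del l m \<noteq> 0"
  shows "laur_at p l m = 0"
proof -
  have big: "laur_at p l m = 0" if l: "l > 1" and m: "m < 0" for l m
  proof (rule rational_on_zero[of "{..<0}" "\<lambda>m. laur_at p l m"])
    show "rational_on {..<0} (\<lambda>m. laur_at p l m)"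
      using l del_pos[OF l] by (intro rational_on_laur_at rational_on_const rational_on_id) (auto simp: less_imp_neq[THEN not_sym])
    \<comment> \<open>The curve for N = 2 (k + 1) meets the line at the point where z is the root of
      l of order 2^N - 1. Different k give different points.\<close>
    define M :: "nat \<Rightarrow> nat" where "M k = 2 ^ (2 * Suc k) - 1" for k
    let ?z = "\<lambda>k. l powr (1 / real (M k))"
    have M: "M k > 0" for k
    proof -
      have "(2 :: nat) ^ (2 * Suc k) > 2 ^ 0" by (rule power_strict_increasing) auto
      then show ?thesis unfolding M_def by simp
    qed
    have z: "?z k > 1" for k by (rule gr_one_powr[OF l]) (use M[of k] in simp)
    have zM: "?z k ^ M k = l" for k
      using l M[of k] by (simp only: powr_realpow[symmetric, OF powr_gt_zero[THEN iffD2]]) (simp add: powr_powr)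
    have sub: "range (\<lambda>k. 1 / ?z k - ?z k) \<subseteq> {x \<in> {..<0}. laur_at p l x = 0}"
    proof (rule image_subsetI)
      fix k
      have "1 / x < 1" if "x > 1" for x :: real using that by simp
      from this[OF z[of k]] have "1 / ?z k - ?z k < 0" using z[of k] by linarith
      then show "1 / ?z k - ?z k \<in> {x \<in> {..<0}. laur_at p l x = 0}"
        using curve[of "2 * Suc k" "?z k"] z[of k] zM[of k] unfolding M_def by simp
    qed
    have "inj (\<lambda>k. 1 / ?z k - ?z k)"
    proof (rule injI)
      fix j k assume "1 / ?z j - ?z j = 1 / ?z k - ?z k"
      then have "?z j = ?z k" using z inverse_minus_self_inj by blast
      then have "1 / real (M j) = 1 / real (M k)" using l powr_inj[of l] by auto
      then have "M j = M k" using M[of j] M[of k] by simp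
      then have "(2 :: nat) ^ (2 * Suc j) = 2 ^ (2 * Suc k)" using M[of j] M[of k] unfolding M_def by linarith
      then show "j = k" by (simp del: power_Suc mult_Suc_right)
    qed
    then have "infinite (range (\<lambda>k. 1 / ?z k - ?z k))" by (rule range_inj_infinite)
    with sub show "infinite {x \<in> {..<0}. laur_at p l x = 0}" by (rule infinite_super)
  qed (use m in simp)
  \<comment> \<open>Now \<open>m\<close> is fixed: the zeros with l > 1 spread to all admissible
    l.\<close>
  show ?thesis
  proof (rule rational_on_zero[of "{l. l \<noteq> 0 \<and> del l m \<noteq> 0}" "\<lambda>l. laur_at p l m"])
    show "rational_on {l. l \<noteq> 0 \<and> del l m \<noteq> 0} (\<lambda>l. laur_at p l m)"
      using m by (intro rational_on_laur_at rational_on_const rational_on_id) auto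
    have "{1<..} \<subseteq> {x \<in> {l. l \<noteq> 0 \<and> del l m \<noteq> 0}. laur_at p x m = 0}"
      using big[OF _ m] del_pos[OF _ m] by (auto simp: less_imp_neq[THEN not_sym])
    then show "infinite {x \<in> {l. l \<noteq> 0 \<and> del l m \<noteq> 0}. laur_at p x m = 0}"
      by (rule infinite_super) (rule infinite_Ioi)
  qed (use l d in simp)
qed

section \<open>Separation of the coefficients\<close>

lemma has_fps_expansion_power':
  "f has_fps_expansion F \<Longrightarrow> (\<lambda>x. f x ^ k) has_fps_expansion (F ^ k :: complex fps)"
  by (induction k) (auto intro!: has_fps_expansion_mult)

lemma has_fps_expansion_laur_eval:
  fixes F F' G G' K :: "complex fps"
  assumes "D has_fps_expansion F" "D' has_fps_expansion F'" "l has_fps_expansion G" "l' has_fps_expansion G'"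
    "m has_fps_expansion K"
  shows "(\<lambda>x. laur_eval (D x) (D' x) (l x) (l' x) (m x) p) has_fps_expansion laur_eval F F' G G' K p"
proof -
  have c: "(\<lambda>x. of_int c) has_fps_expansion (of_int c :: complex fps)" for c
    using has_fps_expansion_const[of "of_int c :: complex"] by (simp add: fps_of_int)
  have u: "(\<lambda>x. upow (f x) (f' x) k) has_fps_expansion upow H H' k"
    if "f has_fps_expansion H" "f' has_fps_expansion H'" for f f' and H H' :: "complex fps" and k
    using that by (cases "0 \<le> k") (simp_all add: upow_def has_fps_expansion_power')
  show ?thesis unfolding pm_eval_def laur_val_def case_prod_beta
    by (intro has_fps_expansion_sum has_fps_expansion_mult c u has_fps_expansion_power' assms)
qed

lemma of_real_upow: "upow (complex_of_real x) (of_real y) k = of_real (upow x y k)"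
  by (simp add: upow_def)

lemma of_real_laur_eval:
  "laur_eval (complex_of_real D) (of_real D') (of_real l) (of_real l') (of_real m) p = of_real (laur_eval D D' l l' m p)"
  by (simp add: pm_eval_def laur_val_def case_prod_beta of_real_upow)

text \<open>The vanishing series is the expansion at 0 of an analytic function of x, which therefore
  vanishes for small x > 0. With z = exp x it is a rational function of z, so that it vanishes for
  all z > 1.\<close>

lemma laur_at_curve:
  assumes M: "M > 0" and zero: "laur_eval (par_D (of_nat (Suc M))) (inverse (par_D (of_nat (Suc M)))) (par_l (of_nat (Suc M)))
      (par_c (of_nat (Suc M))) par_m p = 0" and z: "z > 1"
  shows "laur_at p (z ^ M) (1 / z - z) = 0"
proof -
  let ?d = "of_nat (Suc M) :: complex"
  define nm where "nm x = exp (- 1 * x) - exp (1 * x)" for x :: complex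
  define nl where "nl x = exp ((?d - 1) * x)" for x
  define nc where "nc x = exp ((1 - ?d) * x)" for x
  \<comment> \<open>The quotient has a removable singularity at x = 0, filled here with the quotient
    of the linear coefficients.\<close>
  define nD where "nD x = (if x = 0 then (par_m - (par_l ?d - par_c ?d)) $ 1 else (nm x - (nl x - nc x)) / x ^ 1)
      * inverse (if x = 0 then par_m $ 1 else nm x / x ^ 1)" for x
  have em: "nm has_fps_expansion par_m" unfolding nm_def par_m_def by (intro has_fps_expansion_diff has_fps_expansion_exp)
  have el: "nl has_fps_expansion par_l ?d" unfolding nl_def par_l_def by (rule has_fps_expansion_exp)
  have ec: "nc has_fps_expansion par_c ?d" unfolding nc_def par_c_def by (rule has_fps_expansion_exp)
  have sd: "1 \<le> subdegree f" if "f $ 0 = 0" "f $ 1 \<noteq> 0" for f :: "complex fps"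
    using that by (intro subdegree_geI) (auto simp: fps_eq_iff)
  have A1: "(par_m - (par_l ?d - par_c ?d)) $ 1 \<noteq> 0" "(par_m - (par_l ?d - par_c ?d)) $ 0 = 0"
  proof -
    have "(par_m - (par_l ?d - par_c ?d)) $ 1 = - 2 * ?d" by (simp add: par_m_def par_l_def par_c_def)
    moreover have "?d \<noteq> 0" by (rule of_nat_neq_0)
    ultimately show "(par_m - (par_l ?d - par_c ?d)) $ 1 \<noteq> 0" by (simp only: mult_eq_0_iff) simp
  qed (simp add: par_m_def par_l_def par_c_def)
  have eD: "nD has_fps_expansion par_D ?d"
    unfolding nD_def par_D_def
  proof (intro has_fps_expansion_mult has_fps_expansion_shift has_fps_expansion_inverse has_fps_expansion_diff em el ec refl sd)
    show "fps_shift 1 par_m $ 0 \<noteq> 0" using par_nth(4) by simp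
  qed (use A1 par_nth in auto)
  have eDi: "(\<lambda>x. inverse (nD x)) has_fps_expansion inverse (par_D ?d)"
    by (rule has_fps_expansion_inverse[OF eD]) (simp add: par_nth del: of_nat_Suc)
  have "(\<lambda>x. laur_eval (nD x) (inverse (nD x)) (nl x) (nc x) (nm x) p) has_fps_expansion 0"
    using has_fps_expansion_laur_eval[OF eD eDi el ec em, of p] unfolding zero .
  then have "\<forall>\<^sub>F x in nhds 0. laur_eval (nD x) (inverse (nD x)) (nl x) (nc x) (nm x) p = 0"
    unfolding has_fps_expansion_def by (auto elim: eventually_mono)
  then obtain r where r: "r > 0" "\<And>x. dist x 0 < r \<Longrightarrow> laur_eval (nD x) (inverse (nD x)) (nl x) (nc x) (nm x) p = 0"
    unfolding eventually_nhds_metric by blast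
  have small: "laur_at p (exp x ^ M) (1 / exp x - exp x) = 0" if x: "0 < x" "x < r" for x :: real
  proof -
    let ?m = "1 / exp x - exp x" and ?l = "exp x ^ M"
    have x0: "complex_of_real x \<noteq> 0" using x by simp
    have m: "nm (of_real x) = of_real ?m" by (simp add: nm_def exp_minus field_simps exp_of_real)
    have l: "nl (of_real x) = of_real ?l" by (simp add: nl_def exp_of_nat_mult exp_of_real)
    have c: "nc (of_real x) = of_real (1 / ?l)"
      by (simp add: nc_def exp_of_nat_mult exp_of_real exp_minus field_simps)
    have m0: "?m \<noteq> 0"
    proof -
      have "1 < exp x" using x by simp
      then have "1 / exp x < 1" by simp
      then show ?thesis using \<open>1 < exp x\<close> by linarith
    qed
    have mc: "nm (of_real x) \<noteq> 0" unfolding m using m0 by (metis of_real_eq_0_iff)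
    have D: "nD (of_real x) = of_real (del ?l ?m)"
    proof -
      have "nD (of_real x) = 1 - (nl (of_real x) - nc (of_real x)) / nm (of_real x)"
        using x0 mc by (simp add: nD_def field_simps)
      then show ?thesis unfolding m l c del_def by (simp only: of_real_diff of_real_divide of_real_1)
    qed
    have "laur_eval (nD (of_real x)) (inverse (nD (of_real x))) (nl (of_real x)) (nc (of_real x)) (nm (of_real x)) p = 0"
      by (rule r(2)) (use x in simp)
    then have "complex_of_real (laur_eval (del ?l ?m) (inverse (del ?l ?m)) ?l (1 / ?l) ?m p) = 0"
      unfolding m l c D of_real_inverse[symmetric] of_real_laur_eval .
    then show ?thesis by (simp add: laur_at_def inverse_eq_divide)
  qed
  show ?thesis
  proof (rule rational_on_zero[of "{1<..}" "\<lambda>z. laur_at p (z ^ M) (1 / z - z)"])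
    have neg: "1 / z - z < 0" if "z > 1" for z :: real
    proof -
      have "1 / z < 1" using that by simp
      then show ?thesis using that by linarith
    qed
    have "z ^ M > 1" if "z > 1" for z :: real using that M by (simp add: one_less_power)
    then have "del (z ^ M) (1 / z - z) \<noteq> 0" if "z > 1" for z
      using that del_pos[of "z ^ M" "1 / z - z"] neg[OF that] by (simp add: less_imp_neq[THEN not_sym])
    then show "rational_on {1<..} (\<lambda>z. laur_at p (z ^ M) (1 / z - z))"
      using neg by (intro rational_on_laur_at rational_on_power rational_on_diff rational_on_inverse rational_on_id)
        (auto simp: less_imp_neq)
    have "exp ` {0<..<r} \<subseteq> {z \<in> {1<..}. laur_at p (z ^ M) (1 / z - z) = 0}" using small by auto
    moreover have "infinite (exp ` {0<..<r})"
      using r(1) by (subst finite_image_iff) (auto simp: inj_on_def infinite_Ioo)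
    ultimately show "infinite {z \<in> {1<..}. laur_at p (z ^ M) (1 / z - z) = 0}" by (rule infinite_super)
  qed (use z in simp)
qed

section \<open>The coefficient ring as spanned by 1 and l over Laurent polynomials without l\<close>

definition ell_free :: "laurent set" where
  "ell_free = {a. \<forall>k\<in>Poly_Mapping.keys a. fst (snd k) = 0}"

lemma ell_free_add: "a \<in> ell_free \<Longrightarrow> b \<in> ell_free \<Longrightarrow> a + b \<in> ell_free"
  unfolding ell_free_def using Poly_Mapping.keys_add[of a b] by blast

lemma ell_free_uminus: "a \<in> ell_free \<Longrightarrow> - a \<in> ell_free"
  by (simp add: ell_free_def)

lemma ell_free_mult:
  assumes "a \<in> ell_free" "b \<in> ell_free"
  shows "a * b \<in> ell_free"
  unfolding ell_free_def
proof safe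
  fix i j k assume "(i, j, k) \<in> Poly_Mapping.keys (a * b)"
  then obtain u v where "(i, j, k) = u + v" "u \<in> Poly_Mapping.keys a" "v \<in> Poly_Mapping.keys b"
    using keys_mult[of a b] by blast
  then show "fst (snd (i, j, k)) = 0" using assms by (simp add: ell_free_def)
qed

lemma ell_free_single: "Poly_Mapping.single (i, 0, k) c \<in> ell_free"
  by (simp add: ell_free_def)

lemma ell_free_0: "0 \<in> ell_free" by (simp add: ell_free_def)

abbreviation lau_l :: laurent where "lau_l \<equiv> laurent_monom 0 1 0"
abbreviation lau_s :: laurent where "lau_s \<equiv> laurent_monom 0 0 1 * (1 - laurent_monom 1 0 0)"

lemma lau_s_free: "lau_s \<in> ell_free"
proof -
  have "lau_s = Poly_Mapping.single (0, 0, 1) 1 + - Poly_Mapping.single (1, 0, 1) 1"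
    by (simp add: laurent_monom_def right_diff_distrib mult_single)
  then show ?thesis by (simp only: ell_free_add ell_free_uminus ell_free_single)
qed

definition reducible_l :: "laurent \<Rightarrow> bool" where
  "reducible_l p \<longleftrightarrow> (\<exists>a\<in>ell_free. \<exists>b\<in>ell_free. laurent_rel dvd p - (a + b * lau_l))"

lemma lau_inverse: "laurent_monom 0 (- 1) 0 * lau_l = 1"
  by (simp add: laurent_monom_def mult_single) (simp flip: zero_prod_def)

lemma reducible_l_add: "reducible_l p \<Longrightarrow> reducible_l q \<Longrightarrow> reducible_l (p + q)"
  unfolding reducible_l_def
proof (elim bexE)
  fix a b a' b' assume *: "a \<in> ell_free" "b \<in> ell_free" "a' \<in> ell_free" "b' \<in> ell_free"
    and d: "laurent_rel dvd p - (a + b * lau_l)" "laurent_rel dvd q - (a' + b' * lau_l)"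
  have "p + q - ((a + a') + (b + b') * lau_l) = (p - (a + b * lau_l)) + (q - (a' + b' * lau_l))"
    by (simp add: algebra_simps)
  then have "laurent_rel dvd p + q - ((a + a') + (b + b') * lau_l)" using d by (simp only: dvd_add)
  then show "\<exists>a\<in>ell_free. \<exists>b\<in>ell_free. laurent_rel dvd p + q - (a + b * lau_l)"
    using * ell_free_add by blast
qed

text \<open>Write s for \<open>lau_s\<close>. Modulo the relation, the square of l is s l + 1 and
  the inverse of l is l - s, so multiplication by l and by its inverse preserves the form a + b
  l.\<close>

lemma reducible_l_mult:
  assumes "reducible_l p"
  shows "reducible_l (lau_l * p)" "reducible_l (laurent_monom 0 (- 1) 0 * p)"
proof -
  let ?L' = "laurent_monom 0 (- 1) 0"
  obtain a b r where ab: "a \<in> ell_free" "b \<in> ell_free" and r: "p = a + b * lau_l + laurent_rel * r"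
    using assms unfolding reducible_l_def dvd_def by (metis diff_eq_eq add.commute)
  have rel: "laurent_rel = lau_s - (lau_l - ?L')" by (simp add: laurent_rel_def)
  have ll: "lau_l * lau_l = lau_s * lau_l + 1 - laurent_rel * lau_l"
    unfolding rel using lau_inverse by (simp only: left_diff_distrib) simp
  have "lau_l * p = a * lau_l + b * (lau_l * lau_l) + laurent_rel * (lau_l * r)" unfolding r by (simp only: ring_distribs mult_ac)
  also have "\<dots> = b + (a + b * lau_s) * lau_l + laurent_rel * (lau_l * r - b * lau_l)"
    unfolding ll by (simp only: ring_distribs mult_ac) simp
  finally have "laurent_rel dvd lau_l * p - (b + (a + b * lau_s) * lau_l)" by simp
  moreover have "a + b * lau_s \<in> ell_free" by (intro ell_free_add ell_free_mult ab lau_s_free)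
  ultimately show "reducible_l (lau_l * p)" unfolding reducible_l_def using ab by blast
  have l': "?L' = lau_l - lau_s + laurent_rel" unfolding rel by simp
  have "?L' * p = a * ?L' + b * (?L' * lau_l) + laurent_rel * (?L' * r)" unfolding r by (simp only: ring_distribs mult_ac)
  also have "\<dots> = a * (lau_l - lau_s + laurent_rel) + b + laurent_rel * (?L' * r)"
    unfolding lau_inverse by (simp only: l'[symmetric] mult_1_right)
  also have "\<dots> = (b + - (a * lau_s)) + a * lau_l + laurent_rel * (a + ?L' * r)"
    by (simp only: ring_distribs mult_ac) simp
  finally have "laurent_rel dvd ?L' * p - ((b + - (a * lau_s)) + a * lau_l)" by simp
  moreover have "b + - (a * lau_s) \<in> ell_free"
    by (intro ell_free_add ell_free_uminus ell_free_mult ab lau_s_free)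
  ultimately show "reducible_l (?L' * p)" unfolding reducible_l_def using ab by blast
qed

lemma reducible_l: "reducible_l p"
proof (induction p rule: poly_mapping_induct)
  case zero
  show ?case unfolding reducible_l_def using ell_free_0 by (intro bexI[of _ 0]) auto
next
  case (single k c)
  obtain i j r where k: "k = (i, j, r)" by (cases k)
  show ?case unfolding k
  proof (induction j rule: int_induct[of _ 0])
    case base
    show ?case unfolding reducible_l_def
      by (intro bexI[of _ 0] bexI[of _ "Poly_Mapping.single (i, 0, r) c"] ell_free_0 ell_free_single) simp
  next
    case (step1 j)
    have "Poly_Mapping.single (i, j + 1, r) c = lau_l * Poly_Mapping.single (i, j, r) c"
      by (simp add: laurent_monom_def mult_single add.commute)
    then show ?case using reducible_l_mult(1)[OF step1.IH] by simp
  next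
    case (step2 j)
    have "Poly_Mapping.single (i, j - 1, r) c = laurent_monom 0 (- 1) 0 * Poly_Mapping.single (i, j, r) c"
      by (simp add: laurent_monom_def mult_single)
    then show ?case using reducible_l_mult(2)[OF step2.IH] by simp
  qed
qed (rule reducible_l_add)

text \<open>After multiplication by a power \<open>d ^ B\<close> that clears the denominators, the
  value is a polynomial in d with infinitely many zeros. Each of its coefficients is in turn a
  polynomial in m with infinitely many zeros.\<close>

lemma ell_free_eq_0:
  assumes a: "a \<in> ell_free"
    and zero: "\<And>d m :: real. d \<noteq> 0 \<Longrightarrow> m < 0 \<Longrightarrow> laur_eval d (1 / d) 1 1 m a = 0"
  shows "a = 0"
proof (rule poly_mapping_eqI)
  fix k0 :: "int \<times> int \<times> nat"
  let ?K = "Poly_Mapping.keys a" and ?c = "Poly_Mapping.lookup a"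
  obtain i0 j0 r0 where k0: "k0 = (i0, j0, r0)" by (cases k0)
  show "?c k0 = Poly_Mapping.lookup 0 k0"
  proof (rule ccontr)
    assume "?c k0 \<noteq> Poly_Mapping.lookup 0 k0"
    then have mem: "k0 \<in> ?K" by (simp add: in_keys_iff)
    obtain B where B: "\<And>k. k \<in> ?K \<Longrightarrow> - fst k \<le> int B"
    proof -
      have "finite ((\<lambda>k. - fst k) ` ?K)" by simp
      then obtain b where "\<forall>x\<in>(\<lambda>k. - fst k) ` ?K. x \<le> b" using bdd_above_finite unfolding bdd_above_def by blast
      then show ?thesis by (intro that[of "nat b"]) force
    qed
    have inner: "(\<Sum>k\<in>{k \<in> ?K. fst k = i0}. of_int (?c k) * m ^ snd (snd k)) = 0" if m: "m < 0" for m :: real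
    proof -
      define P where "P = (\<Sum>k\<in>?K. monom (of_int (?c k) * m ^ snd (snd k)) (nat (fst k + int B)))"
      have "poly P d = 0" if d: "d \<noteq> 0" for d
      proof -
        have "poly P d = (\<Sum>k\<in>?K. d ^ B * (of_int (?c k) * laur_val d (1 / d) 1 1 m k))"
          unfolding P_def poly_sum
        proof (rule sum.cong[OF refl])
          fix k assume k: "k \<in> ?K"
          obtain i j r where kk: "k = (i, j, r)" by (cases k)
          have "d ^ nat (i + int B) = upow d (1 / d) (int B + i)" using B[OF k] by (simp add: kk upow_def add.commute)
          also have "\<dots> = d ^ B * upow d (1 / d) i" using d by (simp add: upow_add) (simp add: upow_def)
          finally show "poly (monom (of_int (?c k) * m ^ snd (snd k)) (nat (fst k + int B))) d
              = d ^ B * (of_int (?c k) * laur_val d (1 / d) 1 1 m k)"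
            by (simp add: kk poly_monom laur_val_def) (simp add: upow_def)
        qed
        also have "\<dots> = d ^ B * laur_eval d (1 / d) 1 1 m a" by (simp add: pm_eval_def sum_distrib_left)
        finally show ?thesis using zero[OF d m] by simp
      qed
      then have "UNIV - {0} \<subseteq> {d. poly P d = 0}" by auto
      moreover have "infinite (UNIV - {0 :: real})" using infinite_UNIV_char_0 by (rule Diff_infinite_finite[rotated]) simp
      ultimately have "P = 0" using poly_roots_finite[of P] infinite_super by blast
      then have "0 = coeff P (nat (i0 + int B))" by simp
      also have "\<dots> = (\<Sum>k\<in>?K. if fst k = i0 then of_int (?c k) * m ^ snd (snd k) else 0)"
        unfolding P_def coeff_sum
      proof (rule sum.cong[OF refl])
        fix k assume "k \<in> ?K"
        then have "nat (fst k + int B) = nat (i0 + int B) \<longleftrightarrow> fst k = i0" using B[of k] B[OF mem] by (simp add: k0 nat_eq_iff)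
        then show "coeff (monom (of_int (?c k) * m ^ snd (snd k)) (nat (fst k + int B))) (nat (i0 + int B))
            = (if fst k = i0 then of_int (?c k) * m ^ snd (snd k) else 0)" by simp
      qed
      finally show ?thesis by (simp add: sum.inter_filter)
    qed
    define Q :: "real poly" where "Q = (\<Sum>k\<in>{k \<in> ?K. fst k = i0}. monom (of_int (?c k)) (snd (snd k)))"
    have "{..<0} \<subseteq> {m. poly Q m = 0}" using inner by (auto simp: Q_def poly_sum poly_monom)
    then have "Q = 0" using poly_roots_finite[of Q] infinite_Iio infinite_super by blast
    then have "0 = coeff Q r0" by simp
    also have "\<dots> = (\<Sum>k\<in>{k \<in> ?K. fst k = i0}. if k = k0 then of_int (?c k0) else 0)"
      unfolding Q_def coeff_sum
    proof (rule sum.cong[OF refl])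
      fix k assume "k \<in> {k \<in> ?K. fst k = i0}"
      then have "fst k = i0" "fst (snd k) = 0" "fst (snd k0) = 0" using a mem by (auto simp: ell_free_def)
      then have "snd (snd k) = r0 \<longleftrightarrow> k = k0" by (cases k) (auto simp: k0)
      then show "coeff (monom (of_int (?c k)) (snd (snd k))) r0 = (if k = k0 then of_int (?c k0) else 0 :: real)" by simp
    qed
    also have "\<dots> = of_int (?c k0)" using mem k0 by (simp add: sum.delta)
    finally show False using mem by (simp add: in_keys_iff)
  qed
qed

lemma laur_eval_ell_free: "a \<in> ell_free \<Longrightarrow> laur_eval D D' l l' m a = laur_eval D D' 1 1 m a"
  unfolding pm_eval_def ell_free_def by (intro sum.cong refl) (auto simp: laur_val_def upow_def)

text \<open>Modulo the relation every element has the form \<open>a + b l\<close> without \<open>l\<close> in \<open>a\<close> and \<open>b\<close>; the points with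
  coordinates \<open>l\<close> and \<open>-1/l\<close> share \<open>\<delta>\<close> and \<open>m\<close>, which separates \<open>a\<close> from \<open>b\<close>.\<close>

lemma laurent_rel_dvdI:
  assumes zero: "\<And>l m. m < 0 \<Longrightarrow> l \<noteq> 0 \<Longrightarrow> del l m \<noteq> 0 \<Longrightarrow> laur_at p l m = 0"
  shows "laurent_rel dvd p"
proof -
  obtain a b where ab: "a \<in> ell_free" "b \<in> ell_free" and p: "laurent_rel dvd p - (a + b * lau_l)"
    using reducible_l[of p] unfolding reducible_l_def by blast
  have *: "laur_eval d (1 / d) 1 1 m a = 0 \<and> laur_eval d (1 / d) 1 1 m b = 0" if d: "d \<noteq> 0" and m: "m < 0" for d m :: real
  proof -
    define s where "s = m * (1 - d)"
    \<comment> \<open>The positive root of the quadratic equation L - 1 / L = s; the other root is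
      -1 / L.\<close>
    define L where "L = (s + sqrt (s\<^sup>2 + 4)) / 2"
    have "sqrt (s\<^sup>2 + 4) > \<bar>s\<bar>" by (rule real_less_rsqrt) simp
    then have "- s < sqrt (s\<^sup>2 + 4)" by linarith
    then have L: "L > 0" unfolding L_def by simp
    have "2 * L - s = sqrt (s\<^sup>2 + 4)" unfolding L_def by (simp add: field_simps)
    then have "(2 * L - s)\<^sup>2 = s\<^sup>2 + 4" by simp
    then have "L * L - s * L = 1" by (simp add: power2_eq_square algebra_simps)
    then have Ls: "L - 1 / L = s" using L by (simp add: field_simps)
    have lin: "laur_eval d (1 / d) 1 1 m a + laur_eval d (1 / d) 1 1 m b * l = 0" if l: "l \<noteq> 0" "l - 1 / l = s" for l
    proof -
      have dl: "del l m = d" using m unfolding del_def l(2) s_def by simp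
      interpret coeff_point d "1 / d" l "1 / l" m
        by unfold_locales (use d l in \<open>simp_all add: s_def\<close>)
      interpret pm_hom of_int "laur_val d (1 / d) l (1 / l) m" by (rule laur_hom[OF DD' ll'])
      have "0 = laur_eval d (1 / d) l (1 / l) m p" using zero[OF m l(1)] d by (simp add: laur_at_def dl)
      also have "\<dots> = laur_eval d (1 / d) l (1 / l) m a + laur_eval d (1 / d) l (1 / l) m b * l"
        unfolding laur_eval_dvd[OF p] eval_add eval_mult laur_eval_monom[OF DD' ll'] by simp
      finally show ?thesis using laur_eval_ell_free ab by metis
    qed
    from lin[of L] lin[of "- 1 / L"] have
      eqs: "laur_eval d (1 / d) 1 1 m a + laur_eval d (1 / d) 1 1 m b * L = 0"
        "laur_eval d (1 / d) 1 1 m a + laur_eval d (1 / d) 1 1 m b * (- 1 / L) = 0"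
      using L Ls by simp_all
    then have "laur_eval d (1 / d) 1 1 m b * (L + 1 / L) = 0" by (simp add: algebra_simps)
    moreover have "L + 1 / L > 0" using L by (simp add: add_pos_pos)
    ultimately have "laur_eval d (1 / d) 1 1 m b = 0" by simp
    then show ?thesis using eqs(1) by simp
  qed
  have "a = 0" by (rule ell_free_eq_0[OF ab(1)]) (use * in blast)
  moreover have "b = 0" by (rule ell_free_eq_0[OF ab(2)]) (use * in blast)
  ultimately show ?thesis using p by simp
qed

theorem laurent_kernel:
  assumes "\<And>N. even N \<Longrightarrow> N > 0 \<Longrightarrow>
    laur_eval (par_D (of_nat (2 ^ N))) (inverse (par_D (of_nat (2 ^ N)))) (par_l (of_nat (2 ^ N))) (par_c (of_nat (2 ^ N))) par_m p = 0"
  shows "laurent_rel dvd p"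
proof (rule laurent_rel_dvdI)
  fix l m :: real assume lm: "m < 0" "l \<noteq> 0" "del l m \<noteq> 0"
  show "laur_at p l m = 0"
  proof (rule laur_at_zero[OF _ lm])
    fix N :: nat and z :: real assume N: "even N" "N > 0" and z: "z > 1"
    have "(2 :: nat) ^ N > 1" using N(2) by (rule one_less_power[rotated]) simp
    then have M: "Suc (2 ^ N - 1) = 2 ^ N" "2 ^ N - 1 > (0 :: nat)" by simp_all
    show "laur_at p (z ^ (2 ^ N - 1)) (1 / z - z) = 0"
      by (rule laur_at_curve[OF M(2) _ z]) (unfold M(1), rule assms[OF N])
  qed
qed

section \<open>Positivity of the Dynkin diagrams\<close>

definition ade_form :: "ade \<Rightarrow> (nat \<Rightarrow> real) \<Rightarrow> real" where
  "ade_form X u = (\<Sum>i=1..ade_rank X. \<Sum>j=1..ade_rank X.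
     (if i = j then 2 else if ade_adj X i j then - 1 else 0) * u i * u j)"

lemma ade_edge_neq: "ade_admissible X \<Longrightarrow> ade_edge X i j \<Longrightarrow> i < j"
  by (cases X) auto

lemma ade_form_edges:
  assumes "ade_admissible X"
  shows "ade_form X u = 2 * (\<Sum>i=1..ade_rank X. (u i)\<^sup>2)
    - 2 * (\<Sum>i=1..ade_rank X. \<Sum>j=1..ade_rank X. if ade_edge X i j then u i * u j else 0)"
proof -
  let ?I = "{1..ade_rank X}"
  have "(if i = j then 2 else if ade_adj X i j then - 1 else 0) * u i * u j
      = (if i = j then 2 * (u i)\<^sup>2 else 0) - (if ade_edge X i j then u i * u j else 0)
        - (if ade_edge X j i then u j * u i else 0)" for i j
    using ade_edge_neq[OF assms, of i j] ade_edge_neq[OF assms, of j i]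
    by (auto simp: ade_adj_def power2_eq_square)
  then have "ade_form X u = (\<Sum>i\<in>?I. \<Sum>j\<in>?I. if i = j then 2 * (u i)\<^sup>2 else 0)
      - (\<Sum>i\<in>?I. \<Sum>j\<in>?I. if ade_edge X i j then u i * u j else 0)
      - (\<Sum>i\<in>?I. \<Sum>j\<in>?I. if ade_edge X j i then u j * u i else 0)"
    unfolding ade_form_def by (simp only: sum_subtractf)
  also have "(\<Sum>i\<in>?I. \<Sum>j\<in>?I. if ade_edge X j i then u j * u i else 0)
      = (\<Sum>i\<in>?I. \<Sum>j\<in>?I. if ade_edge X i j then u i * u j else 0)" by (rule sum.swap)
  also have "(\<Sum>i\<in>?I. \<Sum>j\<in>?I. if i = j then 2 * (u i)\<^sup>2 else 0) = 2 * (\<Sum>i\<in>?I. (u i)\<^sup>2)"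
    by (simp add: sum_distrib_left)
  finally show ?thesis by simp
qed

definition path_form :: "nat \<Rightarrow> (nat \<Rightarrow> real) \<Rightarrow> real" where
  "path_form k u = 2 * (\<Sum>i=1..k. (u i)\<^sup>2) - 2 * (\<Sum>i=1..<k. u i * u (i + 1))"

lemma path_form_Suc: "k \<ge> 1 \<Longrightarrow> path_form (Suc k) u = path_form k u + 2 * (u (Suc k))\<^sup>2 - 2 * (u k * u (Suc k))"
  by (simp add: path_form_def algebra_simps)

text \<open>Squares are completed from one end of the path. The constants satisfy a(1) = 2 and a(k +
  1) = 2 - 1 / a(k), hence a(k) = (k + 1) / k.\<close>

lemma path_form_ge: "k \<ge> 1 \<Longrightarrow> path_form k u \<ge> (real k + 1) / real k * (u k)\<^sup>2"
proof (induction k rule: dec_induct)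
  case base
  show ?case by (simp add: path_form_def)
next
  case (step k)
  let ?a = "(real k + 1) / real k" and ?b = "real k / (real k + 1)"
  have k: "real k > 0" using step.hyps by simp
  have ab: "?a * ?b = 1" using k by simp
  have c: "(real (Suc k) + 1) / real (Suc k) = 2 - ?b" using k by (simp add: field_simps)
  have "0 \<le> ?a * (u k - ?b * u (Suc k))\<^sup>2" using k by simp
  also have "\<dots> = ?a * (u k)\<^sup>2 - 2 * (?a * ?b) * (u k * u (Suc k)) + (?a * ?b) * ?b * (u (Suc k))\<^sup>2"
  proof -
    have "a * (x - b * y)\<^sup>2 = a * x\<^sup>2 - 2 * (a * b) * (x * y) + (a * b) * b * y\<^sup>2" for a b x y :: real
      by (simp add: power2_eq_square algebra_simps)
    then show ?thesis .
  qed
  finally have "?a * (u k)\<^sup>2 - 2 * (u k * u (Suc k)) + ?b * (u (Suc k))\<^sup>2 \<ge> 0" unfolding ab by simp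
  then show ?case unfolding path_form_Suc[OF step.hyps(1)] c left_diff_distrib using step.IH by linarith
qed

lemma path_form_nonneg: "k \<ge> 1 \<Longrightarrow> path_form k u \<ge> 0"
  using path_form_ge[of k u] by (rule order_trans[rotated]) auto

lemma path_form_zero: "k \<ge> 1 \<Longrightarrow> path_form k u = 0 \<Longrightarrow> i \<in> {1..k} \<Longrightarrow> u i = 0"
proof (induction k rule: dec_induct)
  case base
  then show ?case by (auto simp: path_form_def)
next
  case (step k)
  have "(real (Suc k) + 1) / real (Suc k) * (u (Suc k))\<^sup>2 \<le> 0"
    using path_form_ge[of "Suc k" u] step.prems by simp
  moreover have "(real (Suc k) + 1) / real (Suc k) > 0" by simp
  ultimately have z: "u (Suc k) = 0" by (metis mult_le_0_iff not_less power2_less_eq_zero_iff)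
  then have "path_form k u = 0" using step path_form_Suc[of k u] by simp
  then show ?case using step z by (cases "i = Suc k") auto
qed

lemma sum_path_edges:
  fixes u :: "nat \<Rightarrow> real"
  shows "(\<Sum>i=1..k. \<Sum>j=1..k. if j = i + 1 then u i * u j else 0) = (\<Sum>i=1..<k. u i * u (i + 1))"
proof -
  have "(\<Sum>i=1..k. \<Sum>j=1..k. if j = i + 1 then u i * u j else 0) = (\<Sum>i=1..k. if i < k then u i * u (i + 1) else 0)"
    by (intro sum.cong refl) (simp add: sum.delta)
  also have "\<dots> = (\<Sum>i\<in>{i \<in> {1..k}. i < k}. u i * u (i + 1))" by (rule sum.inter_filter[symmetric]) simp
  also have "{i \<in> {1..k}. i < k} = {1..<k}" by auto
  finally show ?thesis .
qed

lemma arm_1: "2 * b\<^sup>2 - 2 * (x * b) = 2 * (b - x / 2)\<^sup>2 - x\<^sup>2 / 2" for b x :: real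
  by (simp add: power2_eq_square field_simps)

definition pos_def_on :: "nat \<Rightarrow> ((nat \<Rightarrow> real) \<Rightarrow> real) \<Rightarrow> bool" where
  "pos_def_on k Q \<longleftrightarrow> (\<forall>u. Q u \<ge> 0 \<and> (Q u = 0 \<longrightarrow> (\<forall>i\<in>{1..k}. u i = 0)))"

lemma pos_def_A: "1 \<le> k \<Longrightarrow> pos_def_on k (ade_form (Type_A k))"
proof -
  assume k: "1 \<le> k"
  then have "ade_form (Type_A k) u = path_form k u" for u
    using sum_path_edges[of u k] by (simp add: ade_form_edges path_form_def)
  then show ?thesis unfolding pos_def_on_def using path_form_nonneg[OF k] path_form_zero[OF k] by simp
qed

lemma pos_def_D:
  assumes "4 \<le> k"
  shows "pos_def_on k (ade_form (Type_D k))"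
proof -
  \<comment> \<open>The branch node. Each of the two arms of length 1 costs half the square of its
    coordinate, and the bound (r + 1) / r > 1 for the path that ends in it pays for both.\<close>
  define r where "r = k - 2"
  have k: "k = Suc (Suc r)" and r: "r \<ge> 1" using assms by (simp_all add: r_def)
  have form: "ade_form (Type_D k) u = path_form r u - (u r)\<^sup>2 + 2 * (u (Suc r) - u r / 2)\<^sup>2 + 2 * (u k - u r / 2)\<^sup>2" for u
  proof -
    \<comment> \<open>The diagram is the path on k nodes with its last edge replaced by an edge from
      k - 2 to k.\<close>
    have "(\<Sum>i=1..k. \<Sum>j=1..k. if ade_edge (Type_D k) i j then u i * u j else 0)
        = (\<Sum>i=1..k. \<Sum>j=1..k. (if j = i + 1 then u i * u j else 0)
          + (if i = r then (if j = k then u i * u j else 0) else 0)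
          - (if i = Suc r then (if j = k then u i * u j else 0) else 0))"
      by (intro sum.cong refl) (auto simp: k)
    also have "\<dots> = (\<Sum>i=1..<k. u i * u (i + 1)) + u r * u k - u (Suc r) * u k"
      unfolding sum_subtractf sum.distrib sum_path_edges using r by (simp add: k if_distrib sum.delta cong: if_cong)
    also have "\<dots> = (\<Sum>i=1..<r. u i * u (i + 1)) + u r * u (Suc r) + u r * u k"
      using r by (simp add: k)
    finally have "ade_form (Type_D k) u = path_form r u + (2 * (u (Suc r))\<^sup>2 - 2 * (u r * u (Suc r))) + (2 * (u k)\<^sup>2 - 2 * (u r * u k))"
      using assms r by (simp add: ade_form_edges path_form_def k algebra_simps)
    then show ?thesis unfolding arm_1 by simp
  qed
  have ge: "path_form r u - (u r)\<^sup>2 \<ge> (u r)\<^sup>2 / real r" for u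
    using path_form_ge[OF r, of u] r by (simp add: field_simps)
  show ?thesis unfolding pos_def_on_def
  proof (intro allI conjI impI ballI)
    fix u
    have p: "(u r)\<^sup>2 / real r \<ge> 0" by simp
    have s: "(u (Suc r) - u r / 2)\<^sup>2 \<ge> 0" "(u k - u r / 2)\<^sup>2 \<ge> 0" by simp_all
    show "ade_form (Type_D k) u \<ge> 0" unfolding form using ge[of u] p s by linarith
    fix i assume z: "ade_form (Type_D k) u = 0" and i: "i \<in> {1..k}"
    have "(u r)\<^sup>2 / real r = 0" and s0: "(u (Suc r) - u r / 2)\<^sup>2 = 0" "(u k - u r / 2)\<^sup>2 = 0" 
      and pz: "path_form r u - (u r)\<^sup>2 = 0"
      using z ge[of u] p s unfolding form by linarith+
    then have ur: "u r = 0" using r by simp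
    then have "path_form r u = 0" "u (Suc r) = 0" "u k = 0" using s0 pz by simp_all
    then show "u i = 0" using path_form_zero[OF r, of u i] i by (cases "i \<le> r") (auto simp: k le_Suc_eq)
  qed
qed

lemma sum_1_8: "(\<Sum>i=1..(8::nat). f i) = f 1 + f 2 + f 3 + f 4 + f 5 + f 6 + f 7 + f (8 :: nat)" for f :: "nat \<Rightarrow> real"
  by (simp add: eval_nat_numeral)

text \<open>Squares are completed along the three arms, of lengths 1, 2 and 4, towards the branch
  node 4. What is left there is 2 - 1/2 - 2/3 - 4/5 = 1/30, whence the factor 30.\<close>

lemma pos_def_E8: "pos_def_on 8 (ade_form (Type_E 8))"
proof -
  have form: "30 * ade_form (Type_E 8) u = (u 4)\<^sup>2 + 60 * (u 2 - u 4 / 2)\<^sup>2 + 60 * (u 1 - u 3 / 2)\<^sup>2 + 45 * (u 3 - 2 * u 4 / 3)\<^sup>2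
      + 60 * (u 8 - u 7 / 2)\<^sup>2 + 45 * (u 7 - 2 * u 6 / 3)\<^sup>2 + 40 * (u 6 - 3 * u 5 / 4)\<^sup>2 + 75 / 2 * (u 5 - 4 * u 4 / 5)\<^sup>2" for u
    by (simp add: ade_form_edges sum_1_8[unfolded One_nat_def] power2_eq_square field_simps)
  show ?thesis unfolding pos_def_on_def
  proof (intro allI conjI impI ballI)
    fix u :: "nat \<Rightarrow> real"
    have s: "(u 4)\<^sup>2 \<ge> 0" "(u 2 - u 4 / 2)\<^sup>2 \<ge> 0" "(u 1 - u 3 / 2)\<^sup>2 \<ge> 0" "(u 3 - 2 * u 4 / 3)\<^sup>2 \<ge> 0"
      "(u 8 - u 7 / 2)\<^sup>2 \<ge> 0" "(u 7 - 2 * u 6 / 3)\<^sup>2 \<ge> 0" "(u 6 - 3 * u 5 / 4)\<^sup>2 \<ge> 0" "(u 5 - 4 * u 4 / 5)\<^sup>2 \<ge> 0"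
      by simp_all
    show "ade_form (Type_E 8) u \<ge> 0" using form[of u] s by linarith
    fix i :: nat assume z: "ade_form (Type_E 8) u = 0" and i: "i \<in> {1..8}"
    have "(u 4)\<^sup>2 = 0" "(u 2 - u 4 / 2)\<^sup>2 = 0" "(u 1 - u 3 / 2)\<^sup>2 = 0" "(u 3 - 2 * u 4 / 3)\<^sup>2 = 0"
      "(u 8 - u 7 / 2)\<^sup>2 = 0" "(u 7 - 2 * u 6 / 3)\<^sup>2 = 0" "(u 6 - 3 * u 5 / 4)\<^sup>2 = 0" "(u 5 - 4 * u 4 / 5)\<^sup>2 = 0"
      using form[of u] s z by linarith+
    then have "u 1 = 0" "u 2 = 0" "u 3 = 0" "u 4 = 0" "u 5 = 0" "u 6 = 0" "u 7 = 0" "u 8 = 0" by simp_all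
    moreover have "i \<in> {1, 2, 3, 4, 5, 6, 7, 8}" using i by auto
    ultimately show "u i = 0" by auto
  qed
qed

text \<open>The nodes up to k of the largest diagram carry the diagram of rank k, so extension by
  zero reduces everything to rank 8.\<close>

lemma pos_def_E:
  assumes "k \<in> {6, 7, 8}"
  shows "pos_def_on k (ade_form (Type_E k))"
proof -
  define c where "c u i = (if i \<le> k then u i else 0)" for u :: "nat \<Rightarrow> real" and i
  have form: "ade_form (Type_E 8) (c u) = ade_form (Type_E k) u" for u
  proof -
    have sub: "{1..k} \<subseteq> {1..8}" using assms by auto
    have 1: "(\<Sum>i=1..8. (c u i)\<^sup>2) = (\<Sum>i=1..k. (u i)\<^sup>2)"
      by (rule sum.mono_neutral_cong_right) (use sub in \<open>auto simp: c_def\<close>)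
    have 2: "(\<Sum>i=1..8. \<Sum>j=1..8. if ade_edge (Type_E 8) i j then c u i * c u j else 0)
       = (\<Sum>i=1..k. \<Sum>j=1..k. if ade_edge (Type_E k) i j then u i * u j else 0)"
    proof (rule sum.mono_neutral_cong_right)
      show "\<forall>i\<in>{1..8} - {1..k}. (\<Sum>j=1..8. if ade_edge (Type_E 8) i j then c u i * c u j else 0) = 0"
        by (auto simp: c_def intro!: sum.neutral)
      show "(\<Sum>j=1..8. if ade_edge (Type_E 8) i j then c u i * c u j else 0)
          = (\<Sum>j=1..k. if ade_edge (Type_E k) i j then u i * u j else 0)" if "i \<in> {1..k}" for i
        by (rule sum.mono_neutral_cong_right) (use sub that in \<open>auto simp: c_def\<close>)
    qed (use sub in auto)
    have "ade_admissible (Type_E k)" "ade_admissible (Type_E 8)" using assms by auto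
    from this[THEN ade_form_edges] show ?thesis using 1 2 by simp
  qed
  show ?thesis unfolding pos_def_on_def
  proof (intro allI conjI impI ballI)
    fix u
    show "ade_form (Type_E k) u \<ge> 0" using pos_def_E8 unfolding pos_def_on_def form[symmetric] by blast
    fix i assume "ade_form (Type_E k) u = 0" and i: "i \<in> {1..k}"
    then have "c u i = 0" using pos_def_E8 assms unfolding pos_def_on_def form[symmetric] by auto
    then show "u i = 0" using i by (simp add: c_def)
  qed
qed

lemma pos_def_ade: "ade_admissible X \<Longrightarrow> pos_def_on (ade_rank X) (ade_form X)"
  using pos_def_A pos_def_D pos_def_E by (cases X) simp_all

text \<open>The Tits form is the orthogonal sum of the forms of the components, each of which is
  positive definite.\<close>

theorem tits_simply_laced_spherical:
  assumes "simply_laced_spherical n adj"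
  shows "tits n adj"
proof -
  from assms obtain Xs f where adm: "\<And>X. X \<in> set Xs \<Longrightarrow> ade_admissible X"
    and bij: "bij_betw f (SIGMA c:{..<length Xs}. {1..ade_rank (Xs ! c)}) {1..n}"
    and adj: "\<And>x y. x \<in> (SIGMA c:{..<length Xs}. {1..ade_rank (Xs ! c)}) \<Longrightarrow>
        y \<in> (SIGMA c:{..<length Xs}. {1..ade_rank (Xs ! c)}) \<Longrightarrow>
        adj (f x) (f y) \<longleftrightarrow> fst x = fst y \<and> ade_adj (Xs ! fst x) (snd x) (snd y)"
    unfolding simply_laced_spherical_def by blast
  let ?I = "{..<length Xs}" and ?J = "\<lambda>c. {1..ade_rank (Xs ! c)}"
  let ?S = "Sigma ?I ?J"
  have surj: "\<exists>x\<in>?S. i = f x" if "i \<in> {1..n}" for i using bij that unfolding bij_betw_def by blast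
  show ?thesis
  proof
    show "adj j i" if ij: "i \<in> {1..n}" "j \<in> {1..n}" "adj i j" for i j
    proof -
      obtain x y where "x \<in> ?S" "y \<in> ?S" "i = f x" "j = f y" using surj ij by metis
      then show ?thesis using adj[of x y] adj[of y x] ij(3) by (auto simp: ade_adj_def)
    qed
    show "\<not> adj i i" if i: "i \<in> {1..n}" for i
    proof -
      obtain x where x: "x \<in> ?S" "i = f x" using surj i by metis
      then have "ade_admissible (Xs ! fst x)" using adm by auto
      then show ?thesis using adj[of x x] x ade_edge_neq[of "Xs ! fst x" "snd x" "snd x"] by (auto simp: ade_adj_def)
    qed
    fix v :: "nat \<Rightarrow> int"
    assume v: "\<And>i. i \<notin> {1..n} \<Longrightarrow> v i = 0" "v \<noteq> (\<lambda>_. 0)"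
    define w where "w i j = (if i = j then 2 else if adj i j then - 1 else 0) * real_of_int (v i) * of_int (v j)" for i j
    define u where "u c k = real_of_int (v (f (c, k)))" for c k
    have inj: "f x = f y \<longleftrightarrow> x = y" if "x \<in> ?S" "y \<in> ?S" for x y
      using inj_on_eq_iff[OF bij_betw_imp_inj_on[OF bij] that] .
    have w_eq: "w (f (c, k)) (f (d, m)) = (if c = d then (if k = m then 2 else if ade_adj (Xs ! c) k m then - 1 else 0) * u c k * u c m else 0)"
      if "(c, k) \<in> ?S" "(d, m) \<in> ?S" for c k d m
      using inj[OF that] adj[OF that] by (auto simp: w_def u_def)
    have "(\<Sum>i=1..n. \<Sum>j=1..n. w i j) = (\<Sum>x\<in>?S. \<Sum>y\<in>?S. w (f x) (f y))"
    proof -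
      have re: "(\<Sum>i=1..n. G i) = (\<Sum>x\<in>?S. G (f x))" for G :: "nat \<Rightarrow> real"
        by (rule sum.reindex_bij_betw[OF bij, symmetric])
      show ?thesis unfolding re ..
    qed
    also have "\<dots> = (\<Sum>c\<in>?I. \<Sum>k\<in>?J c. \<Sum>d\<in>?I. \<Sum>m\<in>?J d. w (f (c, k)) (f (d, m)))"
    proof -
      have "(\<Sum>x\<in>?S. G x) = (\<Sum>c\<in>?I. \<Sum>k\<in>?J c. G (c, k))" for G :: "nat \<times> nat \<Rightarrow> real"
        by (simp add: sum.Sigma)
      then show ?thesis by (simp only:)
    qed
    also have "\<dots> = (\<Sum>c\<in>?I. \<Sum>k\<in>?J c. \<Sum>d\<in>?I. if c = d then \<Sum>m\<in>?J c. (if k = m then 2 else if ade_adj (Xs ! c) k m then - 1 else 0) * u c k * u c m else 0)"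
      by (intro sum.cong refl) (auto simp: w_eq)
    also have "\<dots> = (\<Sum>c\<in>?I. ade_form (Xs ! c) (u c))" by (simp add: ade_form_def)
    finally have eq: "(\<Sum>i=1..n. \<Sum>j=1..n. w i j) = (\<Sum>c\<in>?I. ade_form (Xs ! c) (u c))" .
    have pd: "pos_def_on (ade_rank (Xs ! c)) (ade_form (Xs ! c))" if "c \<in> ?I" for c using pos_def_ade adm that by simp
    have nn: "ade_form (Xs ! c) (u c) \<ge> 0" if "c \<in> ?I" for c using pd[OF that] by (simp add: pos_def_on_def)
    have "(\<Sum>c\<in>?I. ade_form (Xs ! c) (u c)) \<noteq> 0"
    proof
      assume "(\<Sum>c\<in>?I. ade_form (Xs ! c) (u c)) = 0"
      then have z: "ade_form (Xs ! c) (u c) = 0" if "c \<in> ?I" for c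
        using sum_nonneg_eq_0_iff[of ?I "\<lambda>c. ade_form (Xs ! c) (u c)"] nn that by blast
      have "v i = 0" for i
      proof (cases "i \<in> {1..n}")
        case True
        then obtain c k where x: "c \<in> ?I" "k \<in> ?J c" "i = f (c, k)" using surj by fast
        then have "u c k = 0" using pd[OF x(1)] z[OF x(1)] unfolding pos_def_on_def by blast
        then show ?thesis by (simp add: u_def x(3))
      qed (use v(1) in blast)
      then show False using v(2) by (simp add: fun_eq_iff)
    qed
    then have "(\<Sum>i=1..n. \<Sum>j=1..n. w i j) > 0" unfolding eq using sum_nonneg[of ?I "\<lambda>c. ade_form (Xs ! c) (u c)"] nn by force
    moreover have "(\<Sum>i=1..n. \<Sum>j=1..n. w i j)
        = real_of_int (\<Sum>i=1..n. \<Sum>j=1..n. (if i = j then 2 else if adj i j then - 1 else 0) * v i * v j)"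
      unfolding w_def of_int_sum by (intro sum.cong refl) auto
    ultimately show "(\<Sum>i=1..n. \<Sum>j=1..n. (if i = j then 2 else if adj i j then - 1 else 0) * v i * v j) > 0" by linarith
  qed
qed

section \<open>Presented algebras\<close>

lemma free_algebra_simps:
  "carrier (free_algebra X) = {p. \<forall>w\<in>Poly_Mapping.keys p. set (letters w) \<subseteq> X}"
  "monoid.mult (free_algebra X) = (*)" "monoid.one (free_algebra X) = 1"
  "ring.zero (free_algebra X) = 0" "ring.add (free_algebra X) = (+)"
  by (simp_all add: free_algebra_def)

lemma free_carrier_add:
  "p \<in> carrier (free_algebra X) \<Longrightarrow> q \<in> carrier (free_algebra X) \<Longrightarrow> p + q \<in> carrier (free_algebra X)"
  using Poly_Mapping.keys_add[of p q] by (auto simp: free_algebra_simps)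

lemma free_carrier_uminus: "p \<in> carrier (free_algebra X) \<Longrightarrow> - p \<in> carrier (free_algebra X)"
  by (simp add: free_algebra_simps)

lemma free_carrier_diff:
  "p \<in> carrier (free_algebra X) \<Longrightarrow> q \<in> carrier (free_algebra X) \<Longrightarrow> p - q \<in> carrier (free_algebra X)"
  using free_carrier_add[of p X "- q"] free_carrier_uminus[of q X] by simp

lemma free_carrier_mult:
  assumes "p \<in> carrier (free_algebra X)" "q \<in> carrier (free_algebra X)"
  shows "p * q \<in> carrier (free_algebra X)"
  unfolding free_algebra_simps
proof safe
  fix w x assume w: "w \<in> Poly_Mapping.keys (p * q)" and x: "x \<in> set (letters w)"
  obtain u v where "w = u + v" "u \<in> Poly_Mapping.keys p" "v \<in> Poly_Mapping.keys q"
    using keys_mult[of p q] w by blast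
  then show "x \<in> X" using assms x by (auto simp: free_algebra_simps plus_word_def)
qed

lemma free_carrier_single: "set (letters w) \<subseteq> X \<Longrightarrow> Poly_Mapping.single w a \<in> carrier (free_algebra X)"
  by (simp add: free_algebra_simps)

lemma free_carrier_scal: "scal r \<in> carrier (free_algebra X)"
  unfolding scal_def by (rule free_carrier_single) (simp add: zero_word_def)

lemma free_carrier_gen: "x \<in> X \<Longrightarrow> gen x \<in> carrier (free_algebra X)"
  unfolding gen_def by (rule free_carrier_single) simp

lemma free_carrier_one: "1 \<in> carrier (free_algebra X)"
  using free_carrier_scal[of 1 X] by (simp add: scal_def)

lemma free_carrier_0: "0 \<in> carrier (free_algebra X)"
  by (simp add: free_algebra_simps)

lemma free_carrier_power: "p \<in> carrier (free_algebra X) \<Longrightarrow> p ^ k \<in> carrier (free_algebra X)"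
  by (induction k) (simp_all add: free_carrier_one free_carrier_mult)

lemmas free_carrier = free_carrier_add free_carrier_diff free_carrier_uminus free_carrier_mult free_carrier_scal free_carrier_gen
  free_carrier_one free_carrier_0 free_carrier_power

lemma ring_free_algebra: "ring (free_algebra X)"
proof (intro ringI abelian_groupI monoidI)
  show "\<exists>q\<in>carrier (free_algebra X). q \<oplus>\<^bsub>free_algebra X\<^esub> p = \<zero>\<^bsub>free_algebra X\<^esub>" if "p \<in> carrier (free_algebra X)" for p
    using free_carrier_uminus[OF that] by (intro bexI[of _ "- p"]) (simp_all add: free_algebra_simps)
qed (use free_carrier in \<open>simp_all add: free_algebra_simps(2-) algebra_simps\<close>)

lemma scal_simps:
  "scal (a + b) = scal a + scal b" "scal (a * b) = scal a * scal b" "scal 1 = 1" "scal 0 = 0"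
  by (simp_all add: scal_def single_add mult_single)

lemma scal_central: "scal r * p = p * scal (r :: 'r::comm_ring_1)"
  by (induction p rule: poly_mapping_induct) (simp_all add: scal_def mult_single mult.commute distrib_left distrib_right)

lemma minus_free: "q \<in> carrier (free_algebra X) \<Longrightarrow> \<ominus>\<^bsub>free_algebra X\<^esub> q = - q"
proof -
  interpret ring "free_algebra X" by (rule ring_free_algebra)
  assume q: "q \<in> carrier (free_algebra X)"
  then show ?thesis
    using free_carrier_uminus[OF q] by (intro minus_equality) (simp_all add: free_algebra_simps(4,5))
qed

locale presentation =
  fixes X :: "'x set" and rels :: "(('r::comm_ring_1, 'x) ncpoly \<times> ('r, 'x) ncpoly) set"
  assumes rels_carrier: "(p, q) \<in> rels \<Longrightarrow> p \<in> carrier (free_algebra X) \<and> q \<in> carrier (free_algebra X)"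
begin

abbreviation A :: "('r, 'x) ncpoly set" where "A \<equiv> carrier (free_algebra X)"
abbreviation I :: "('r, 'x) ncpoly set" where "I \<equiv> rel_ideal X rels"
abbreviation cls :: "('r, 'x) ncpoly \<Rightarrow> ('r, 'x) ncpoly set" where "cls \<equiv> presented_class X rels"

lemma rels_sub: "{p - q | p q. (p, q) \<in> rels} \<subseteq> A"
  using rels_carrier free_carrier_diff by blast

lemma ideal_I: "ideal I (free_algebra X)"
  unfolding rel_ideal_def by (rule ring.genideal_ideal[OF ring_free_algebra rels_sub])

lemma rel_ideal_rel: "(p, q) \<in> rels \<Longrightarrow> p - q \<in> I"
  using ring.genideal_self[OF ring_free_algebra rels_sub] unfolding rel_ideal_def by blast

lemma rel_ideal_carrier: "p \<in> I \<Longrightarrow> p \<in> A"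
  using ideal.Icarr[OF ideal_I] .

lemma rel_ideal_closed:
  "0 \<in> I" "p \<in> I \<Longrightarrow> q \<in> I \<Longrightarrow> p + q \<in> I" "p \<in> I \<Longrightarrow> q \<in> A \<Longrightarrow> p * q \<in> I" "p \<in> I \<Longrightarrow> q \<in> A \<Longrightarrow> q * p \<in> I"
  "p \<in> I \<Longrightarrow> - p \<in> I" "p \<in> I \<Longrightarrow> q \<in> I \<Longrightarrow> p - q \<in> I"
proof -
  interpret ideal I "free_algebra X" by (rule ideal_I)
  show "0 \<in> I" using additive_subgroup.zero_closed[OF is_additive_subgroup] by (simp add: free_algebra_simps)
  show a: "p \<in> I \<Longrightarrow> q \<in> I \<Longrightarrow> p + q \<in> I" for p q using additive_subgroup.a_closed[OF is_additive_subgroup, of p q] by (simp add: free_algebra_simps)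
  show "p \<in> I \<Longrightarrow> q \<in> A \<Longrightarrow> p * q \<in> I" "p \<in> I \<Longrightarrow> q \<in> A \<Longrightarrow> q * p \<in> I"
    using I_r_closed[of p q] I_l_closed[of p q] by (simp_all add: free_algebra_simps)
  show m: "p \<in> I \<Longrightarrow> - p \<in> I" for p using additive_subgroup.a_inv_closed[OF is_additive_subgroup, of p] minus_free[OF rel_ideal_carrier] by simp
  show "p \<in> I \<Longrightarrow> q \<in> I \<Longrightarrow> p - q \<in> I" using a[of p "- q"] m by simp
qed

lemma rel_ideal_sum: "(\<And>i. i \<in> S \<Longrightarrow> f i \<in> I) \<Longrightarrow> (\<Sum>i\<in>S. f i) \<in> I"
  by (induction S rule: infinite_finite_induct) (simp_all add: rel_ideal_closed)

text \<open>The universal property in the form used below, where \<open>K\<close> is a set of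
  elements with trivial image.\<close>

lemma rel_ideal_minimal:
  assumes K: "K \<subseteq> A" "0 \<in> K" "\<And>p q. p \<in> K \<Longrightarrow> q \<in> K \<Longrightarrow> p - q \<in> K"
    "\<And>p q. p \<in> K \<Longrightarrow> q \<in> A \<Longrightarrow> p * q \<in> K" "\<And>p q. p \<in> K \<Longrightarrow> q \<in> A \<Longrightarrow> q * p \<in> K"
    and rels: "\<And>p q. (p, q) \<in> rels \<Longrightarrow> p - q \<in> K"
  shows "I \<subseteq> K"
proof -
  interpret ring "free_algebra X" by (rule ring_free_algebra)
  have "ideal K (free_algebra X)"
  proof (rule idealI[OF ring_free_algebra])
    have neg: "- p \<in> K" if "p \<in> K" for p using K(3)[OF K(2) that] by simp
    have plus: "p + q \<in> K" if "p \<in> K" "q \<in> K" for p q using K(3)[OF that(1) neg[OF that(2)]] by simp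
    show "subgroup K (add_monoid (free_algebra X))"
    proof (rule add.subgroupI)
      show "\<ominus>\<^bsub>free_algebra X\<^esub> p \<in> K" if "p \<in> K" for p
        using neg[OF that] minus_free[of p X] that K(1) by auto
    qed (use K plus in \<open>auto simp: free_algebra_simps\<close>)
  qed (use K in \<open>simp_all add: free_algebra_simps(2)\<close>)
  then show ?thesis unfolding rel_ideal_def using rels by (intro genideal_minimal) auto
qed

lemma cls_eq: "p \<in> A \<Longrightarrow> q \<in> A \<Longrightarrow> cls p = cls q \<longleftrightarrow> p - q \<in> I"
  unfolding presented_class_def using ring.quotient_eq_iff_same_a_r_cos[OF ring_free_algebra ideal_I, of p q] minus_free[of q X]
  by (simp add: a_minus_def free_algebra_simps(5))

lemma presented_algebra_simps:
  "carrier (presented_algebra X rels) = cls ` A"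
  "monoid.one (presented_algebra X rels) = cls 1"
  "p \<in> A \<Longrightarrow> q \<in> A \<Longrightarrow> cls p \<otimes>\<^bsub>presented_algebra X rels\<^esub> cls q = cls (p * q)"
  "p \<in> A \<Longrightarrow> q \<in> A \<Longrightarrow> cls p \<oplus>\<^bsub>presented_algebra X rels\<^esub> cls q = cls (p + q)"
  "p \<in> A \<Longrightarrow> r \<odot>\<^bsub>presented_algebra X rels\<^esub> cls p = cls (scal r * p)"
proof -
  interpret ideal I "free_algebra X" by (rule ideal_I)
  note d = presented_algebra_def Let_def ring.extend_def module.fields_def
  show "carrier (presented_algebra X rels) = cls ` A"
    by (auto simp: d FactRing_def A_RCOSETS_def' presented_class_def)
  show "monoid.one (presented_algebra X rels) = cls 1"
    by (simp add: d FactRing_def presented_class_def free_algebra_simps(3))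
  show m: "cls p \<otimes>\<^bsub>presented_algebra X rels\<^esub> cls q = cls (p * q)" if "p \<in> A" "q \<in> A" for p q
    using rcoset_mult_add[OF that] by (simp add: d FactRing_def presented_class_def free_algebra_simps(2))
  show "cls p \<oplus>\<^bsub>presented_algebra X rels\<^esub> cls q = cls (p + q)" if "p \<in> A" "q \<in> A"
    using a_rcos_sum[OF that] by (simp add: d FactRing_def presented_class_def free_algebra_simps(5))
  show "r \<odot>\<^bsub>presented_algebra X rels\<^esub> cls p = cls (scal r * p)" if "p \<in> A"
    using m[OF free_carrier_scal that, of r] by (simp add: d)
qed

end

section \<open>Injectivity\<close>

lemma bmw_rels_cases:
  assumes "(p, q) \<in> bmw_rels n adj"
  obtains i where "i \<in> {1..n}" "(p, q) \<in> bmw_rels_node i"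
  | i j where "i \<in> {1..n}" "j \<in> {1..n}" "\<not> adj i j" "(p, q) \<in> bmw_rels_nonadj i j"
  | i j where "i \<in> {1..n}" "j \<in> {1..n}" "adj i j" "(p, q) \<in> bmw_rels_adj i j"
  using assms unfolding bmw_rels_def
  by (elim UnE UN_E CollectE conjE) (rule that; assumption)+

lemma bmw_gen_carrier:
  "i \<in> {1..n} \<Longrightarrow> gen (bmw_gen.GG i) \<in> carrier (free_algebra (bmw_gens n))"
  "i \<in> {1..n} \<Longrightarrow> gen (EE i) \<in> carrier (free_algebra (bmw_gens n))"
  by (rule free_carrier_gen; simp add: bmw_gens_def)+

lemmas free_ops = free_carrier_add free_carrier_diff free_carrier_mult free_carrier_power free_carrier_scal free_carrier_one

interpretation bmw: presentation "bmw_gens n" "bmw_rels n adj" for n adj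
proof
  fix p q assume "(p, q) \<in> bmw_rels n adj"
  then show "p \<in> carrier (free_algebra (bmw_gens n)) \<and> q \<in> carrier (free_algebra (bmw_gens n))"
  proof (cases rule: bmw_rels_cases)
    case (1 i)
    show ?thesis using 1(2) unfolding bmw_rels_node_def insert_iff empty_iff prod.inject
      by (elim disjE conjE; simp only:) (intro conjI free_ops bmw_gen_carrier 1(1))+
  next
    case (2 i j)
    show ?thesis using 2(4) unfolding bmw_rels_nonadj_def insert_iff empty_iff prod.inject
      by (elim disjE conjE; simp only:) (intro conjI free_ops bmw_gen_carrier 2(1,2))+
  next
    case (3 i j)
    show ?thesis using 3(4) unfolding bmw_rels_adj_def insert_iff empty_iff prod.inject
      by (elim disjE conjE; simp only:) (intro conjI free_ops bmw_gen_carrier 3(1,2))+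
  qed
qed

interpretation tl: presentation "{1..n}" "tl_rels n adj" for n adj
proof
  fix p q :: "(coeff, nat) ncpoly" assume "(p, q) \<in> tl_rels n adj"
  then consider i where "i \<in> {1..n}" "(p, q) = (gen i ^ 2, scal dlt * gen i)"
    | i j where "i \<in> {1..n}" "j \<in> {1..n}" "(p, q) = (gen i * gen j, gen j * gen i)"
    | i j where "i \<in> {1..n}" "j \<in> {1..n}" "(p, q) = (gen i * gen j * gen i, gen i)"
    unfolding tl_rels_def by (elim UnE CollectE exE conjE) (rule that; assumption)+
  then show "p \<in> carrier (free_algebra {1..n}) \<and> q \<in> carrier (free_algebra {1..n})"
    unfolding prod.inject
    by cases (elim conjE; simp only:; intro conjI free_ops free_carrier_gen; assumption)+
qed

text \<open>The homomorphism of free algebras that sends e_i to e_i. It induces the map whose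
  injectivity is at stake.\<close>

definition theta :: "(coeff, nat) ncpoly \<Rightarrow> (coeff, bmw_gen) ncpoly" where
  "theta = pm_eval scal (\<lambda>w. prod_list (map (\<lambda>i. gen (EE i)) (letters w)))"

interpretation theta: pm_hom "scal :: coeff \<Rightarrow> (coeff, bmw_gen) ncpoly" "\<lambda>w. prod_list (map (\<lambda>i. gen (EE i)) (letters w))"
proof
  show "scal a * x = x * scal a" for a :: coeff and x :: "(coeff, bmw_gen) ncpoly" by (rule scal_central)
qed (simp_all add: scal_simps zero_word_def plus_word_def)

lemmas theta_simps = theta.eval_add[folded theta_def] theta.eval_diff[folded theta_def] theta.eval_mult[folded theta_def]
  theta.eval_one[folded theta_def] theta.eval_0[folded theta_def]

lemma theta_gen: "theta (gen i) = gen (EE i)" and theta_scal: "theta (scal r) = scal r"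
  unfolding gen_def[of i] scal_def[of r, where 'x = nat] theta_def
  by (simp_all add: theta.eval_single scal_simps zero_word_def)

context brauer_kz_2
begin

lemma dd_nz: "dd \<noteq> 0" using \<delta>_ge by simp

sublocale cp: coeff_point "par_D dd" "inverse (par_D dd)" "par_l dd" "par_c dd" par_m
  by standard (simp_all add: par_D_inverse[OF dd_nz] par_lc right_diff_distrib par_mD)

definition img :: "bmw_gen \<Rightarrow> 'a fps" where "img x = (case x of bmw_gen.GG i \<Rightarrow> gg i | EE i \<Rightarrow> ee i)"

sublocale ev: pm_hom "\<lambda>r. kap (cp.cev r)" "\<lambda>w. prod_list (map img (letters w))"
proof
  show "kap (cp.cev r) * x = x * kap (cp.cev r)" for r and x :: "'a fps" by (rule kap_central[symmetric])
qed (simp_all add: cp.cev_hom kap_add kap_mult kap_one zero_word_def plus_word_def)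

abbreviation ev :: "(coeff, bmw_gen) ncpoly \<Rightarrow> 'a fps" where
  "ev \<equiv> pm_eval (\<lambda>r. kap (cp.cev r)) (\<lambda>w. prod_list (map img (letters w)))"

lemma ev_gen: "ev (gen x) = img x" and ev_scal: "ev (scal r) = kap (cp.cev r)"
  unfolding gen_def scal_def by (simp_all add: ev.eval_single cp.cev_hom kap_one zero_word_def)

lemma img_simps: "img (bmw_gen.GG i) = gg i" "img (EE i) = ee i"
  by (simp_all add: img_def)

lemmas ev_simps = ev.eval_add ev.eval_diff ev.eval_mult ev.eval_one ev_gen ev_scal cp.cev_params img_simps power2_eq_square

lemma ev_bmw_rels:
  assumes "(p, q) \<in> bmw_rels n adj"
  shows "ev p = ev q"
  using assms
proof (cases rule: bmw_rels_cases)
  case (1 i)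
  note a = node(4,5,6)[OF 1(1), unfolded scF_def] node'[OF 1(1), unfolded scF_def]
  show ?thesis using 1(2) unfolding bmw_rels_node_def insert_iff empty_iff prod.inject
    by (elim disjE conjE FalseE; simp only: ev_simps) (rule a)+
next
  case (2 i j)
  show ?thesis using 2(4) unfolding bmw_rels_nonadj_def insert_iff empty_iff prod.inject
    by (elim disjE conjE FalseE; simp only: ev_simps) (rule nonadjacent[OF 2(1-3)])+
next
  case (3 i j)
  have ji: "adj j i" by (rule adj_sym[OF 3(1-3)])
  note a = adjacent[OF 3(1-3), unfolded scF_def kap_mult] adjacent[OF 3(2,1) ji, unfolded scF_def kap_mult] gg_braid[OF 3(1-3)]
  show ?thesis using 3(4) unfolding bmw_rels_adj_def insert_iff empty_iff prod.inject
    by (elim disjE conjE FalseE; simp only: ev_simps) (rule a)+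
qed

lemma ev_ideal:
  assumes "p \<in> rel_ideal (bmw_gens n) (bmw_rels n adj)"
  shows "ev p = 0"
proof -
  have "rel_ideal (bmw_gens n) (bmw_rels n adj) \<subseteq> {p \<in> carrier (free_algebra (bmw_gens n)). ev p = 0}"
  proof (rule bmw.rel_ideal_minimal)
    show "p - q \<in> {p \<in> carrier (free_algebra (bmw_gens n)). ev p = 0}" if "(p, q) \<in> bmw_rels n adj" for p q
      using ev_bmw_rels[OF that] bmw.rels_carrier[OF that] by (simp add: ev.eval_diff free_carrier)
  qed (auto simp: ev.eval_0 ev.eval_diff ev.eval_mult free_carrier)
  then show ?thesis using assms by blast
qed

lemma ev_theta: "ev (theta p) = (\<Sum>w\<in>Poly_Mapping.keys p. scF (cp.cev (Poly_Mapping.lookup p w)) (prod_list (map ee (letters w))))"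
proof -
  have "ev (prod_list (map (\<lambda>i. gen (EE i)) w)) = prod_list (map ee w)" for w
    by (induction w) (simp_all only: list.map prod_list.Nil prod_list.Cons ev_simps)
  then show ?thesis unfolding theta_def pm_eval_def[of scal] by (simp add: ev.eval_sum ev.eval_mult ev_scal scF_def)
qed

lemma ee_word: "tle k w w' \<Longrightarrow> prod_list (map ee w) = scF (upow (par_D dd) (inverse (par_D dd)) k) (prod_list (map ee w'))"
  by (rule scF.prod_list_tle[OF tits_axioms cp.DD' node(6) nonadjacent(3) adjacent(3)])

lemma ee_word_0: "prod_list (map ee w) $ 0 = prod_list (map (\<lambda>i. E (simple i)) w)"
  by (induction w) (simp_all add: ee_0)

text \<open>Independence at y = 0 is enough: in a vanishing combination, the coefficients of the
  lowest order that occurs form a vanishing combination of the constant terms.\<close>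

lemma ee_words_independent:
  assumes V: "finite V" and v: "v \<in> V"
    and indep: "\<And>c v. (\<Sum>v\<in>V. scC (c v) (prod_list (map (\<lambda>i. E (simple i)) v))) = 0 \<Longrightarrow> v \<in> V \<Longrightarrow> c v = 0"
    and sum: "(\<Sum>v\<in>V. scF (s v) (prod_list (map ee v))) = 0"
  shows "s v = 0"
proof (rule ccontr)
  assume "s v \<noteq> 0"
  then have ex: "\<exists>k. \<exists>v\<in>V. s v $ k \<noteq> 0" using v by (metis fps_ext fps_zero_nth)
  define k where "k = (LEAST k. \<exists>v\<in>V. s v $ k \<noteq> 0)"
  have k: "\<exists>v\<in>V. s v $ k \<noteq> 0" using LeastI_ex[OF ex] unfolding k_def .
  have j: "s v $ j = 0" if "v \<in> V" "j < k" for v j using not_less_Least[of j] that unfolding k_def by blast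
  have "scF (s v) (prod_list (map ee v)) $ k = scC (s v $ k) (prod_list (map (\<lambda>i. E (simple i)) v))" if "v \<in> V" for v
    using scF_leading(1)[of k "s v" 0 "prod_list (map ee v)"] j[OF that] by (simp add: ee_word_0)
  then have "(\<Sum>v\<in>V. scC (s v $ k) (prod_list (map (\<lambda>i. E (simple i)) v))) = (\<Sum>v\<in>V. scF (s v) (prod_list (map ee v))) $ k"
    by (simp add: fps_sum_nth)
  then have "s v $ k = 0" if "v \<in> V" for v using indep[of "\<lambda>v. s v $ k", OF _ that] unfolding sum by simp
  then show False using k by blast
qed

end

section \<open>Normal forms in the presented Temperley--Lieb algebra\<close>

definition dlt_inv :: coeff where "dlt_inv = abs_coeff (laurent_monom (- 1) 0 0)"

lemma dlt_dlt_inv: "dlt * dlt_inv = 1"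
  unfolding dlt_def dlt_inv_def times_coeff.abs_eq one_coeff.abs_eq
  by (simp add: laurent_monom_def mult_single) (simp flip: zero_prod_def)

abbreviation dpow :: "int \<Rightarrow> coeff" where "dpow \<equiv> upow dlt dlt_inv"

context coeff_point
begin

lemma cev_dpow: "cev (dpow k) = upow D D' k"
proof -
  have p: "cev (x ^ j) = cev x ^ j" for x j by (induction j) (simp_all add: cev_hom)
  have "cev dlt_inv = D'" unfolding dlt_inv_def cev_abs laur_eval_monom[OF DD' ll'] by simp
  then show ?thesis by (simp add: upow_def p cev_params)
qed

end

definition word_monom :: "nat list \<Rightarrow> (coeff, nat) ncpoly" where "word_monom w = Poly_Mapping.single (Word w) 1"

lemma word_monom_append: "word_monom (u @ v) = word_monom u * word_monom v"
  by (simp add: word_monom_def mult_single plus_word_def)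

lemma word_monom_Nil: "word_monom [] = 1"
  by (simp add: word_monom_def flip: zero_word_def)

lemma word_monom_Cons: "word_monom (i # w) = gen i * word_monom w"
  using word_monom_append[of "[i]" w] by (simp add: word_monom_def gen_def)

lemma word_monom_carrier: "set w \<subseteq> X \<Longrightarrow> word_monom w \<in> carrier (free_algebra X)"
  unfolding word_monom_def by (rule free_carrier_single) simp

context tits
begin

abbreviation I_TL :: "(coeff, nat) ncpoly set" where "I_TL \<equiv> rel_ideal {1..n} (tl_rels n adj)"

text \<open>A rewriting step may be surrounded by letters outside the diagram, but it neither
  creates nor removes them; so derivations that start in the presented algebra stay in it.\<close>

lemma tle_set: "tle k w w' \<Longrightarrow> set w \<subseteq> {1..n} \<longleftrightarrow> set w' \<subseteq> {1..n}"
  by (induction rule: tle.induct) auto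

lemma tle_context_ideal:
  assumes "x - scal r * y \<in> I_TL" "set u \<subseteq> {1..n}" "set v \<subseteq> {1..n}"
  shows "word_monom u * x * word_monom v - scal r * (word_monom u * y * word_monom v) \<in> I_TL"
proof -
  have "word_monom u * (x - scal r * y) * word_monom v \<in> I_TL"
    by (intro tl.rel_ideal_closed(3,4) word_monom_carrier assms)
  moreover have "word_monom u * (scal r * y) = scal r * (word_monom u * y)"
    by (metis mult.assoc scal_central)
  ultimately show ?thesis by (simp add: left_diff_distrib right_diff_distrib mult.assoc)
qed

lemma tle_ideal: "tle k w w' \<Longrightarrow> set w \<subseteq> {1..n} \<Longrightarrow> word_monom w - scal (dpow k) * word_monom w' \<in> I_TL"
proof (induction rule: tle.induct)
  case (tle_refl w)
  show ?case using tl.rel_ideal_closed(1)[of n adj] by (simp add: scal_simps)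
next
  case (tle_sym k w w')
  have "- (scal (dpow (- k)) * (word_monom w - scal (dpow k) * word_monom w')) \<in> I_TL"
    using tle_sym.IH tle_set[OF tle_sym.hyps] tle_sym.prems by (intro tl.rel_ideal_closed(4,5) free_carrier_scal) simp
  moreover have "scal (dpow (- k)) * (scal (dpow k) * word_monom w') = word_monom w'"
    using upow_minus[OF dlt_dlt_inv, of k]
    by (simp only: mult.assoc[symmetric] scal_simps(2)[symmetric]) (simp add: mult.commute scal_simps)
  ultimately show ?case by (simp add: right_diff_distrib)
next
  case (tle_trans k w w' l w'')
  have "(word_monom w - scal (dpow k) * word_monom w') + scal (dpow k) * (word_monom w' - scal (dpow l) * word_monom w'') \<in> I_TL"
    using tle_trans.IH tle_set[OF tle_trans.hyps(1)] tle_trans.prems by (intro tl.rel_ideal_closed(2,4) free_carrier_scal) simp_all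
  then show ?case by (simp add: right_diff_distrib upow_add[OF dlt_dlt_inv] scal_simps mult.assoc)
next
  case (tle_square i u v)
  have "gen i ^ 2 - scal dlt * gen i \<in> I_TL"
    using tle_square(1) by (intro tl.rel_ideal_rel) (auto simp: tl_rels_def)
  then show ?case using tle_context_ideal[of "gen i * gen i" dlt "gen i" u v] tle_square(2)
    by (simp add: power2_eq_square word_monom_append word_monom_Cons word_monom_Nil mult.assoc)
next
  case (tle_comm i j u v)
  have "gen i * gen j - gen j * gen i \<in> I_TL"
    using tle_comm(1-3) by (intro tl.rel_ideal_rel) (auto simp: tl_rels_def)
  then show ?case using tle_context_ideal[of "gen i * gen j" 1 "gen j * gen i" u v] tle_comm(4)
    by (simp add: scal_simps word_monom_append word_monom_Cons word_monom_Nil mult.assoc)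
next
  case (tle_braid i j u v)
  have "gen i * gen j * gen i - gen i \<in> I_TL"
    using tle_braid(1-3) by (intro tl.rel_ideal_rel) (auto simp: tl_rels_def)
  then show ?case using tle_context_ideal[of "gen i * gen j * gen i" 1 "gen i" u v] tle_braid(4)
    by (simp add: scal_simps word_monom_append word_monom_Cons word_monom_Nil mult.assoc)
qed

text \<open>The coefficient of \<open>v\<close> after each word of \<open>p\<close> has been
  replaced by a power of \<delta> times its normal form.\<close>

definition nf_coeff :: "(coeff, nat) ncpoly \<Rightarrow> nat list \<Rightarrow> coeff" where
  "nf_coeff p v = (\<Sum>w\<in>{w \<in> Poly_Mapping.keys p. nform (letters w) = v}. Poly_Mapping.lookup p w * dpow (nexp (letters w)))"

definition nf_words :: "(coeff, nat) ncpoly \<Rightarrow> nat list set" where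
  "nf_words p = (\<lambda>w. nform (letters w)) ` Poly_Mapping.keys p"

lemma ncpoly_expand: "p = (\<Sum>w\<in>Poly_Mapping.keys p. scal (Poly_Mapping.lookup p w) * word_monom (letters w))"
proof -
  have "(\<Sum>w\<in>Poly_Mapping.keys p. scal (Poly_Mapping.lookup p w) * word_monom (letters w))
      = (\<Sum>w\<in>Poly_Mapping.keys p. Poly_Mapping.single w (Poly_Mapping.lookup p w))"
    by (simp add: scal_def word_monom_def mult_single)
  also have "\<dots> = p"
    by (rule poly_mapping_eqI) (simp add: lookup_sum lookup_single when_def in_keys_iff sum.delta)
  finally show ?thesis ..
qed

text \<open>Word by word, \<open>p\<close> differs from the combination of normal forms with these
  coefficients by elements of the ideal.\<close>

lemma nf_coeff_ideal:
  assumes p: "p \<in> carrier (free_algebra {1..n})" and zero: "\<And>v. v \<in> nf_words p \<Longrightarrow> nf_coeff p v = 0"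
  shows "p \<in> I_TL"
proof -
  let ?K = "Poly_Mapping.keys p"
  let ?t = "\<lambda>w. scal (Poly_Mapping.lookup p w * dpow (nexp (letters w))) * word_monom (nform (letters w))"
  have "(\<Sum>w\<in>?K. ?t w) = (\<Sum>v\<in>nf_words p. \<Sum>w\<in>{w \<in> ?K. nform (letters w) = v}. ?t w)"
    by (rule sum.group[symmetric]) (auto simp: nf_words_def)
  also have "\<dots> = (\<Sum>v\<in>nf_words p. scal (nf_coeff p v) * word_monom v)"
  proof (rule sum.cong[OF refl])
    fix v
    have s: "scal (\<Sum>x\<in>S. f x) = (\<Sum>x\<in>S. scal (f x))" for S and f :: "nat word \<Rightarrow> coeff"
      by (induction S rule: infinite_finite_induct) (simp_all add: scal_simps)
    show "(\<Sum>w\<in>{w \<in> ?K. nform (letters w) = v}. ?t w) = scal (nf_coeff p v) * word_monom v"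
      unfolding nf_coeff_def s sum_distrib_right by (intro sum.cong) auto
  qed
  also have "\<dots> = 0" using zero by (simp add: scal_simps)
  finally have z: "(\<Sum>w\<in>?K. ?t w) = 0" .
  have "(\<Sum>w\<in>?K. scal (Poly_Mapping.lookup p w) * (word_monom (letters w) - scal (dpow (nexp (letters w))) * word_monom (nform (letters w)))) \<in> I_TL"
  proof (intro tl.rel_ideal_sum tl.rel_ideal_closed(4) free_carrier_scal)
    fix w assume "w \<in> ?K"
    then have "set (letters w) \<subseteq> {1..n}" using p by (simp add: free_algebra_simps)
    then show "word_monom (letters w) - scal (dpow (nexp (letters w))) * word_monom (nform (letters w)) \<in> I_TL"
      by (rule tle_ideal[OF tle_nform])
  qed
  also have "(\<Sum>w\<in>?K. scal (Poly_Mapping.lookup p w) * (word_monom (letters w) - scal (dpow (nexp (letters w))) * word_monom (nform (letters w))))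
     = (\<Sum>w\<in>?K. scal (Poly_Mapping.lookup p w) * word_monom (letters w)) - (\<Sum>w\<in>?K. ?t w)"
    by (simp only: right_diff_distrib sum_subtractf scal_simps(2) mult.assoc)
  finally show ?thesis unfolding z using ncpoly_expand[of p] by simp
qed

text \<open>The specialisation turns \<open>theta p\<close> into a vanishing combination of the
  operators of normal forms. At y = 0 these operators are independent by
  \<open>slots_independent\<close>, hence they are so over power series.\<close>

lemma cev_nf_coeff:
  assumes rep: "brauer_kz_2 n adj R E (2 ^ N)" and N: "N > 0"
    and E: "\<And>i. i \<in> {1..n} \<Longrightarrow> E (simple i) = slots N [i]"
    and p: "p \<in> carrier (free_algebra {1..n})" and I: "theta p \<in> rel_ideal (bmw_gens n) (bmw_rels n adj)"
    and v: "v \<in> nf_words p"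
  shows "coeff_point.cev (par_D (of_nat (2 ^ N))) (inverse (par_D (of_nat (2 ^ N)))) (par_l (of_nat (2 ^ N)))
    (par_c (of_nat (2 ^ N))) par_m (nf_coeff p v) = 0"
proof -
  interpret B: brauer_kz_2 n adj R E "2 ^ N" by (rule rep)
  let ?K = "Poly_Mapping.keys p"
  have sub: "set (letters w) \<subseteq> {1..n}" if "w \<in> ?K" for w using that p by (simp add: free_algebra_simps)
  have Vset: "set v \<subseteq> {1..n}" "nform v = v" if "v \<in> nf_words p" for v
  proof -
    obtain w where w: "w \<in> ?K" "v = nform (letters w)" using \<open>v \<in> nf_words p\<close> unfolding nf_words_def by blast
    show "set v \<subseteq> {1..n}" using sub[OF w(1)] tle_set[OF tle_nform[of "letters w"]] unfolding w(2) by simp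
    show "nform v = v" unfolding w(2) by (rule nform_nform(1))
  qed
  have fin: "finite (nf_words p)" by (simp add: nf_words_def)
  let ?t = "\<lambda>w. scF (B.cp.cev (Poly_Mapping.lookup p w * dpow (nexp (letters w)))) (prod_list (map B.ee (nform (letters w))))"
  have "0 = B.ev (theta p)" using B.ev_ideal[OF I] by simp
  also have "\<dots> = (\<Sum>w\<in>?K. ?t w)"
    unfolding B.ev_theta
    by (intro sum.cong refl, subst B.ee_word[OF tle_nform]) (simp only: scF.sm_sm B.cp.cev_hom B.cp.cev_dpow)
  also have "\<dots> = (\<Sum>v\<in>nf_words p. \<Sum>w\<in>{w \<in> ?K. nform (letters w) = v}. ?t w)"
    by (rule sum.group[symmetric]) (auto simp: nf_words_def)
  also have "\<dots> = (\<Sum>v\<in>nf_words p. scF (B.cp.cev (nf_coeff p v)) (prod_list (map B.ee v)))"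
    unfolding nf_coeff_def B.cp.cev_sum scF.sm_sum_left by (intro sum.cong refl) auto
  finally have sum: "(\<Sum>v\<in>nf_words p. scF (B.cp.cev (nf_coeff p v)) (prod_list (map B.ee v))) = 0" by simp
  show ?thesis
  proof (rule B.ee_words_independent[OF fin v _ sum])
    fix c u assume c: "(\<Sum>v\<in>nf_words p. scC (c v) (prod_list (map (\<lambda>i. E (simple i)) v))) = 0" and u: "u \<in> nf_words p"
    have "prod_list (map (\<lambda>i. E (simple i)) v) = prod_list (map (\<lambda>i. slots N [i]) v)" if "v \<in> nf_words p" for v
      using E Vset(1)[OF that] by (intro arg_cong[where f = prod_list] map_cong) auto
    then have "(\<Sum>v\<in>nf_words p. scC (c v) (prod_list (map (\<lambda>i. slots N [i]) v))) = 0" using c by simp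
    then show "c u = 0" using slots_independent[OF N fin Vset(2)] u by blast
  qed
qed

text \<open>Each coefficient at a normal form dies in the specialisations for all even N > 0, and
  \<open>laurent_kernel\<close> shows that only 0 does.\<close>

theorem theta_injective:
  assumes p: "p \<in> carrier (free_algebra {1..n})" and I: "theta p \<in> rel_ideal (bmw_gens n) (bmw_rels n adj)"
  shows "p \<in> I_TL"
proof (rule nf_coeff_ideal[OF p])
  fix v assume v: "v \<in> nf_words p"
  obtain q where q: "nf_coeff p v = abs_coeff q" using Quotient_abs_rep[OF Quotient_coeff] by metis
  have "laurent_rel dvd q"
  proof (rule laurent_kernel)
    fix N :: nat assume N: "even N" "N > 0"
    have "\<exists>R E. brauer_rep n adj R E (2 ^ N) \<and>
      (\<forall>i\<in>{1..n}. R (tits.simple i) = prod_list (map (\<lambda>a. 1 - slot a [i]) [0..<N]) \<and>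
        E (tits.simple i) = prod_list (map (\<lambda>a. 1 - (1 - slot a [i])) [0..<N]))"
    proof (rule brauer_rep_tensor[where r = "\<lambda>a i. 1 - slot a [i]", OF _ tits_axioms _ N(1)])
      show "tl_rep n adj (\<lambda>i. 1 - slot a [i])" for a by (rule tl_rep_slot)
      show "(1 - slot a [i]) * (1 - slot b [j]) = (1 - slot b [j]) * (1 - slot a [i])" if "a \<noteq> b" for a b i j
        unfolding left_diff_distrib right_diff_distrib slot_comm[OF that] by simp
    qed
    then obtain R E :: "(nat \<Rightarrow> int) \<Rightarrow> (nat \<Rightarrow> nat list) endo" where rep: "brauer_rep n adj R E (2 ^ N)"
      and E: "\<And>i. i \<in> {1..n} \<Longrightarrow> E (simple i) = slots N [i]"
      by (auto simp: slots_def)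
    have two: "(2 :: nat) \<le> 2 ^ N" using N(2) by (cases N) auto
    have rep2: "brauer_kz_2 n adj R E (2 ^ N)"
      unfolding brauer_kz_2_def brauer_kz_2_axioms_def brauer_kz_def using rep two by simp
    interpret B: brauer_kz_2 n adj R E "2 ^ N" by (rule rep2)
    have "B.cp.cev (abs_coeff q) = 0"
      using cev_nf_coeff[OF rep2 N(2) E p I v] unfolding q .
    then show "laur_eval (par_D (of_nat (2 ^ N))) (inverse (par_D (of_nat (2 ^ N)))) (par_l (of_nat (2 ^ N))) (par_c (of_nat (2 ^ N))) par_m q = 0"
      unfolding B.cp.cev_abs .
  qed
  then show "nf_coeff p v = 0" unfolding q zero_coeff.abs_eq
    using Quotient_rel_abs2[OF Quotient_coeff] coeff.abs_eq_iff by simp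
qed

end

section \<open>The isomorphism\<close>

lemma free_carrier_sum: "(\<And>i. i \<in> S \<Longrightarrow> f i \<in> carrier (free_algebra X)) \<Longrightarrow> (\<Sum>i\<in>S. f i) \<in> carrier (free_algebra X)"
  by (induction S rule: infinite_finite_induct) (simp_all add: free_carrier_0 free_carrier_add)

lemma theta_carrier:
  assumes "p \<in> carrier (free_algebra {1..n})"
  shows "theta p \<in> carrier (free_algebra (bmw_gens n))"
  unfolding theta_def pm_eval_def
proof (intro free_carrier_sum free_carrier_mult free_carrier_scal)
  fix w assume "w \<in> Poly_Mapping.keys p"
  then have "set (letters w) \<subseteq> {1..n}" using assms by (simp add: free_algebra_simps)
  then have "set u \<subseteq> {1..n} \<Longrightarrow> prod_list (map e u) \<in> carrier (free_algebra (bmw_gens n))" for u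
    by (induction u) (auto intro!: free_carrier_one free_carrier_mult bmw_gen_carrier)
  then show "prod_list (map e (letters w)) \<in> carrier (free_algebra (bmw_gens n))"
    using \<open>set (letters w) \<subseteq> {1..n}\<close> .
qed

lemma theta_rel_ideal:
  assumes "p \<in> rel_ideal {1..n} (tl_rels n adj)"
  shows "theta p \<in> rel_ideal (bmw_gens n) (bmw_rels n adj)"
proof -
  let ?K = "{p \<in> carrier (free_algebra {1..n}). theta p \<in> rel_ideal (bmw_gens n) (bmw_rels n adj)}"
  have "rel_ideal {1..n} (tl_rels n adj) \<subseteq> ?K"
  proof (rule tl.rel_ideal_minimal)
    fix p q assume pq: "(p, q) \<in> tl_rels n adj"
    then consider i where "i \<in> {1..n}" "(p, q) = (gen i ^ 2, scal dlt * gen i)"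
      | i j where "i \<in> {1..n}" "j \<in> {1..n}" "\<not> adj i j" "(p, q) = (gen i * gen j, gen j * gen i)"
      | i j where "i \<in> {1..n}" "j \<in> {1..n}" "adj i j" "(p, q) = (gen i * gen j * gen i, gen i)"
      unfolding tl_rels_def by (elim UnE CollectE exE conjE) (rule that; assumption)+
    then have "(theta p, theta q) \<in> bmw_rels n adj"
    proof cases
      case (1 i)
      then have "(theta p, theta q) \<in> bmw_rels_node i"
        by (simp add: bmw_rels_node_def theta_simps theta_gen theta_scal power2_eq_square)
      then show ?thesis unfolding bmw_rels_def using 1(1) by blast
    next
      case (2 i j)
      then have "(theta p, theta q) \<in> bmw_rels_nonadj i j"
        by (simp add: bmw_rels_nonadj_def theta_simps theta_gen)
      then show ?thesis unfolding bmw_rels_def using 2(1-3) by blast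
    next
      case (3 i j)
      then have "(theta p, theta q) \<in> bmw_rels_adj i j"
        by (simp add: bmw_rels_adj_def theta_simps theta_gen)
      then show ?thesis unfolding bmw_rels_def using 3(1-3) by blast
    qed
    then show "p - q \<in> ?K"
      using bmw.rel_ideal_rel tl.rels_carrier[OF pq] by (simp add: theta_simps free_carrier_diff)
  qed (auto simp: theta_simps bmw.rel_ideal_closed free_carrier theta_carrier)
  then show ?thesis using assms by blast
qed

lemma bmw_e_subalgebra:
  "generated_subalgebra (BMW n adj) (BMW_e n adj ` {1..n})
    = (\<lambda>p. presented_class (bmw_gens n) (bmw_rels n adj) (theta p)) ` carrier (free_algebra {1..n})"
  (is "?G = ?c ` ?A")
proof
  note s = bmw.presented_algebra_simps[where n = n and adj = adj, folded BMW_def]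
  have ops: "?c p \<oplus>\<^bsub>BMW n adj\<^esub> ?c q = ?c (p + q)" "?c p \<otimes>\<^bsub>BMW n adj\<^esub> ?c q = ?c (p * q)"
    if "p \<in> ?A" "q \<in> ?A" for p q
    using s(3,4)[OF theta_carrier[OF that(1)] theta_carrier[OF that(2)]] by (simp_all add: theta_simps)
  have sm: "r \<odot>\<^bsub>BMW n adj\<^esub> ?c p = ?c (scal r * p)" if "p \<in> ?A" for r p
    using s(5)[OF theta_carrier[OF that]] by (simp add: theta_simps theta_scal)
  have gen: "BMW_e n adj i = ?c (gen i)" for i by (simp add: BMW_e_def theta_gen)
  have one: "\<one>\<^bsub>BMW n adj\<^esub> = ?c 1" by (simp add: s(2) theta_simps)
  show "?G \<subseteq> ?c ` ?A"
  proof
    fix x assume "x \<in> ?G"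
    then show "x \<in> ?c ` ?A"
    proof induction
      case one
      show ?case unfolding \<open>\<one>\<^bsub>BMW n adj\<^esub> = ?c 1\<close> using free_carrier_one by (rule imageI)
    next
      case (incl s)
      then show ?case unfolding gen by (auto intro!: free_carrier_gen)
    next
      case (add a b)
      then obtain p q where p: "p \<in> ?A" "a = ?c p" and q: "q \<in> ?A" "b = ?c q" by (elim imageE)
      show ?case unfolding p(2) q(2) ops(1)[OF p(1) q(1)] by (intro imageI free_carrier_add p(1) q(1))
    next
      case (mult a b)
      then obtain p q where p: "p \<in> ?A" "a = ?c p" and q: "q \<in> ?A" "b = ?c q" by (elim imageE)
      show ?case unfolding p(2) q(2) ops(2)[OF p(1) q(1)] by (intro imageI free_carrier_mult p(1) q(1))
    next
      case (smult a r)
      then obtain p where p: "p \<in> ?A" "a = ?c p" by (elim imageE)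
      show ?case unfolding p(2) sm[OF p(1)] by (intro imageI free_carrier_mult free_carrier_scal p(1))
    qed
  qed
  have word: "?c (word_monom w) \<in> ?G" if "set w \<subseteq> {1..n}" for w
    using that
  proof (induction w)
    case Nil
    show ?case unfolding word_monom_Nil one[symmetric] by (rule generated_subalgebra.one)
  next
    case (Cons i w)
    have i: "i \<in> {1..n}" and w: "set w \<subseteq> {1..n}" using Cons.prems by auto
    have "?c (gen i) \<in> ?G" unfolding gen[symmetric] by (intro generated_subalgebra.incl imageI i)
    then have "?c (gen i) \<otimes>\<^bsub>BMW n adj\<^esub> ?c (word_monom w) \<in> ?G"
      by (rule generated_subalgebra.mult[OF _ Cons.IH[OF w]])
    then show ?case unfolding ops(2)[OF free_carrier_gen[OF i] word_monom_carrier[OF w]] word_monom_Cons .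
  qed
  have "?c p \<in> ?G" if "p \<in> ?A" for p
    using that
  proof (induction p rule: update_induct)
    case const
    \<comment> \<open>The zero element is obtained as a scalar multiple of 1, since the generation
      rules do not list it.\<close>
    have "0 \<odot>\<^bsub>BMW n adj\<^esub> \<one>\<^bsub>BMW n adj\<^esub> \<in> ?G" by (intro generated_subalgebra.smult generated_subalgebra.one)
    then show ?case unfolding one sm[OF free_carrier_one] by (simp add: scal_simps)
  next
    case (update f w b)
    have keys: "Poly_Mapping.keys (Poly_Mapping.update w b f) = insert w (Poly_Mapping.keys f)"
      using update.hyps by (auto simp: in_keys_iff lookup_update split: if_splits)
    have f: "f \<in> ?A" and w: "set (letters w) \<subseteq> {1..n}"
      using update.prems keys by (simp_all add: free_algebra_simps(1))
    have "Poly_Mapping.update w b f = scal b * word_monom (letters w) + f"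
      using update.hyps(1)
      by (intro poly_mapping_eqI) (auto simp: scal_def word_monom_def mult_single lookup_update lookup_add lookup_single in_keys_iff when_def)
    then have "?c (Poly_Mapping.update w b f) = (b \<odot>\<^bsub>BMW n adj\<^esub> ?c (word_monom (letters w))) \<oplus>\<^bsub>BMW n adj\<^esub> ?c f"
      using sm[OF word_monom_carrier[OF w]] ops(1)[OF free_carrier_mult[OF free_carrier_scal word_monom_carrier[OF w]] f] by simp
    moreover have "\<dots> \<in> ?G"
      by (rule generated_subalgebra.add[OF generated_subalgebra.smult[OF word[OF w]] update.IH[OF f]])
    ultimately show ?case by simp
  qed
  then show "?c ` ?A \<subseteq> ?G" by blast
qed

theorem proposition1p2:
  fixes n :: nat and adj :: "nat \<Rightarrow> nat \<Rightarrow> bool"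
  assumes "simply_laced_spherical n adj"
  shows "algebra_isomorphic (BMW_e_subalgebra n adj) (Temperley_Lieb n adj)"
proof -
  interpret tits n adj by (rule tits_simply_laced_spherical[OF assms])
  let ?A = "carrier (free_algebra {1..n})" and ?S = "BMW_e_subalgebra n adj" and ?T = "Temperley_Lieb n adj"
  let ?c = "\<lambda>p. presented_class (bmw_gens n) (bmw_rels n adj) (theta p)" and ?d = "presented_class {1..n} (tl_rels n adj)"
  note sB = bmw.presented_algebra_simps[where n = n and adj = adj, folded BMW_def]
  note sT = tl.presented_algebra_simps[where n = n and adj = adj, folded Temperley_Lieb_def]
  have eq: "?c p = ?c q \<longleftrightarrow> ?d p = ?d q" if "p \<in> ?A" "q \<in> ?A" for p q
  proof -
    have "?c p = ?c q \<longleftrightarrow> theta (p - q) \<in> rel_ideal (bmw_gens n) (bmw_rels n adj)"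
      using bmw.cls_eq[OF theta_carrier[OF that(1)] theta_carrier[OF that(2)]] by (simp add: theta_simps)
    also have "\<dots> \<longleftrightarrow> p - q \<in> I_TL"
      using theta_injective theta_rel_ideal free_carrier_diff[OF that] by blast
    also have "\<dots> \<longleftrightarrow> ?d p = ?d q" using tl.cls_eq[OF that] by simp
    finally show ?thesis .
  qed
  \<comment> \<open>By \<open>eq\<close>, the maps \<open>?c\<close> and \<open>?d\<close> have the
    same fibres, so the choice of the representative does not matter.\<close>
  define h where "h x = ?d (SOME p. p \<in> ?A \<and> ?c p = x)" for x
  have h: "h (?c p) = ?d p" if "p \<in> ?A" for p
  proof -
    have "\<exists>q. q \<in> ?A \<and> ?c q = ?c p" using that by blast
    then have "(SOME q. q \<in> ?A \<and> ?c q = ?c p) \<in> ?A \<and> ?c (SOME q. q \<in> ?A \<and> ?c q = ?c p) = ?c p" by (rule someI_ex)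
    then show ?thesis unfolding h_def using eq[OF _ that] by blast
  qed
  have car: "carrier ?S = ?c ` ?A" using bmw_e_subalgebra[of n adj] by (simp add: BMW_e_subalgebra_def)
  have ops: "?c p \<oplus>\<^bsub>?S\<^esub> ?c q = ?c (p + q)" "?c p \<otimes>\<^bsub>?S\<^esub> ?c q = ?c (p * q)" if "p \<in> ?A" "q \<in> ?A" for p q
    using sB(3,4)[OF theta_carrier[OF that(1)] theta_carrier[OF that(2)]] by (simp_all add: BMW_e_subalgebra_def theta_simps)
  have sm: "r \<odot>\<^bsub>?S\<^esub> ?c p = ?c (scal r * p)" if "p \<in> ?A" for r p
    using sB(5)[OF theta_carrier[OF that]] by (simp add: BMW_e_subalgebra_def theta_simps theta_scal)
  have one: "\<one>\<^bsub>?S\<^esub> = ?c 1" by (simp add: BMW_e_subalgebra_def sB(2) theta_simps)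
  have "h \<in> ring_iso ?S ?T"
    unfolding ring_iso_def
  proof (intro CollectI conjI ring_hom_memI)
    show "h x \<in> carrier ?T" if "x \<in> carrier ?S" for x 
    proof -
      obtain p where p: "p \<in> ?A" "x = ?c p" using \<open>x \<in> carrier ?S\<close> unfolding car by (elim imageE)
      show ?thesis unfolding p(2) h[OF p(1)] sT(1) by (intro imageI p(1))
    qed
    show "h (x \<otimes>\<^bsub>?S\<^esub> y) = h x \<otimes>\<^bsub>?T\<^esub> h y" "h (x \<oplus>\<^bsub>?S\<^esub> y) = h x \<oplus>\<^bsub>?T\<^esub> h y"
      if "x \<in> carrier ?S" "y \<in> carrier ?S" for x y
    proof -
      obtain p q where pq: "p \<in> ?A" "q \<in> ?A" and xy: "x = ?c p" "y = ?c q" using \<open>x \<in> carrier ?S\<close> \<open>y \<in> carrier ?S\<close> unfolding car by (elim imageE)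
      show "h (x \<otimes>\<^bsub>?S\<^esub> y) = h x \<otimes>\<^bsub>?T\<^esub> h y" "h (x \<oplus>\<^bsub>?S\<^esub> y) = h x \<oplus>\<^bsub>?T\<^esub> h y"
        unfolding xy ops[OF pq] h[OF pq(1)] h[OF pq(2)] sT(3,4)[OF pq]
        by (rule h[OF free_carrier_mult[OF pq]] h[OF free_carrier_add[OF pq]])+
    qed
    show "h \<one>\<^bsub>?S\<^esub> = \<one>\<^bsub>?T\<^esub>" unfolding one h[OF free_carrier_one] sT(2) ..
    show "bij_betw h (carrier ?S) (carrier ?T)"
      unfolding bij_betw_def car sT(1)
    proof
      show "inj_on h (?c ` ?A)"
      proof (rule inj_onI, elim imageE)
        fix x y p q assume "h x = h y" and p: "p \<in> ?A" "x = ?c p" and q: "q \<in> ?A" "y = ?c q"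
        then have "?d p = ?d q" using h[OF p(1)] h[OF q(1)] by simp
        then show "x = y" unfolding p(2) q(2) eq[OF p(1) q(1)] .
      qed
      show "h ` ?c ` ?A = ?d ` ?A" unfolding image_image by (rule image_cong[OF refl h])
    qed
  qed
  moreover have "h (r \<odot>\<^bsub>?S\<^esub> x) = r \<odot>\<^bsub>?T\<^esub> h x" if "x \<in> carrier ?S" for r x
  proof -
    obtain p where p: "p \<in> ?A" "x = ?c p" using \<open>x \<in> carrier ?S\<close> unfolding car by (elim imageE)
    show ?thesis unfolding p(2) sm[OF p(1)] h[OF p(1)] sT(5)[OF p(1)]
      by (rule h[OF free_carrier_mult[OF free_carrier_scal p(1)]])
  qed
  ultimately show ?thesis unfolding algebra_isomorphic_def by blast
qed

end
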